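(* Let $\Delta$ be a $(d-1)$-dimensional simplicial sphere satisfying the link condition, and let $1\le k\le \frac d2-1$. Then $$\frac{1}{f_1(\Delta)}\frac{\mathcal C_k}{g_{k+1}(\Delta)}\ \ge\ \left(1-\omega_k^{\frac{k}{k+1}}\left(1-\frac{1}{f_1(\Delta)}\frac{\mathcal C_{k-1}}{g_k(\Delta)}\right)\right)^{\frac{k+1}{k}} = \left(\omega_k^{\frac{k}{k+1}}\left(\frac{1}{f_1(\Delta)}\frac{\mathcal C_{k-1}}{g_k(\Delta)}\right)+\left(1-\omega_k^{\frac{k}{k+1}}\right)\right)^{\frac{k+1}{k}},$$ where $$\omega_k = f_1(\Delta)^{\frac1k}\,\frac{g_k(\Delta)^{\frac{k+1}{k}}}{g_{k+1}(\Delta)}.$$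
   Context: For a $(d-1)$-dimensional simplicial complex $\Delta$, $f_i(\Delta)$ is the number of $i$-dimensional faces ($f_{-1}=1$), so $f_1(\Delta)$ is the number of edges. The $h$-vector is $h_j(\Delta)=\sum_{i=0}^j(-1)^{j-i}\binom{d-i}{j-i}f_{i-1}(\Delta)$, $0\le j\le d$, and the $g$-vector is $g_0=1$, $g_i=h_i-h_{i-1}$ for $1\le i\le\lfloor d/2\rfloor$ (the link of an edge is $(d-3)$-dimensional, and its $g$-vector is formed with $d-2$ in place of $d$). The link of a face $F$ is $\mathrm{lk}_\Delta(F)=\{G\in\Delta: G\cup F\in\Delta,\ G\cap F=\emptyset\}$. "Simplicial sphere" means piecewise linear (PL) simplicial sphere. $\Delta$ satisfies the link condition if $\mathrm{lk}_\Delta(a)\cap \mathrm{lk}_\Delta(b)=\mathrm{lk}_\Delta(\{a,b\})$ for every edge $\{a,b\}\in\Delta$. Further $$\mathcal C_k=\sum_{e\in\Delta,\ |e|=2} g_k(\mathrm{lk}_\Delta(e))=\tfrac12\left[(k+1)(k+2)g_{k+2}(\Delta)+2(k+1)(d-k)g_{k+1}(\Delta)+(d-k)(d-k+1)g_k(\Delta)\right],$$ with the convention $g_m(\Delta)=0$ for $m\ge\frac d2+1$. In this setting $g_\ell(\Delta)\neq0$ for $0\le\ell\le\frac d2$.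
   Formalization: A negative base of the outer power with exponent (k+1)/k is replaced by 0; as written the inequality fails for the boundary of the 4-dimensional cross-polytope with k=1 (left side 1/2, base 1−2√12, square above 35), and for even k the power of a negative base is undefined. *)

theory Defs
  imports "HOL-Analysis.Analysis" "HOL-Analysis.Finite_Function_Topology"
begin

section \<open>Abstract simplicial complexes\<close>

text \<open>The vertices are those \<open>v\<close> with \<open>{v} \<in> \<Delta>\<close>; the empty set is always a face.\<close>

definition abstract_complex :: "'a set set \<Rightarrow> bool" where
  "abstract_complex \<Delta> \<longleftrightarrow>
     finite \<Delta> \<and> {} \<in> \<Delta> \<and> (\<forall>F\<in>\<Delta>. finite F) \<and> (\<forall>F\<in>\<Delta>. \<forall>G. G \<subseteq> F \<longrightarrow> G \<in> \<Delta>)"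

definition complex_dim :: "'a set set \<Rightarrow> int" where
  "complex_dim \<Delta> = int (Max (card ` \<Delta>)) - 1"

definition lk :: "'a set set \<Rightarrow> 'a set \<Rightarrow> 'a set set" where
  "lk \<Delta> F = {G \<in> \<Delta>. G \<union> F \<in> \<Delta> \<and> G \<inter> F = {}}"

definition edges :: "'a set set \<Rightarrow> 'a set set" where
  "edges \<Delta> = {e \<in> \<Delta>. card e = 2}"

definition link_condition :: "'a set set \<Rightarrow> bool" where
  "link_condition \<Delta> \<longleftrightarrow>
     (\<forall>a b. a \<noteq> b \<and> {a, b} \<in> \<Delta> \<longrightarrow> lk \<Delta> {a} \<inter> lk \<Delta> {b} = lk \<Delta> {a, b})"

section \<open>Piecewise linear spheres\<close>

text \<open>The realization lives in the real vector space with basis the type of vertices,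
  each vertex being placed at its basis vector.\<close>

definition realization :: "'a set set \<Rightarrow> ('a \<Rightarrow>\<^sub>0 real) set" where
  "realization \<Delta> = (\<Union>F\<in>\<Delta>. convex hull ((\<lambda>v. Poly_Mapping.single v 1) ` F))"

definition PL_on :: "'a::real_vector set \<Rightarrow> ('a \<Rightarrow> 'b::real_vector) \<Rightarrow> bool" where
  "PL_on X f \<longleftrightarrow>
     (\<exists>\<P>. finite \<P> \<and> (\<forall>P\<in>\<P>. polytope P) \<and> \<Union>\<P> = X \<and>
          (\<forall>P\<in>\<P>. \<exists>L c. linear L \<and> (\<forall>x\<in>P. f x = L x + c)))"

definition PL_homeomorphic :: "'a::real_normed_vector set \<Rightarrow> 'b::real_normed_vector set \<Rightarrow> bool" where
  "PL_homeomorphic X Y \<longleftrightarrow> (\<exists>f g. homeomorphism X Y f g \<and> PL_on X f \<and> PL_on Y g)"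

definition simplex_boundary :: "nat \<Rightarrow> nat set set" where
  "simplex_boundary m = {F. F \<subset> {0..m}}"

text \<open>The boundary of the \<open>m\<close>-simplex has dimension \<open>m - 1\<close>.\<close>

definition PL_sphere :: "'a set set \<Rightarrow> bool" where
  "PL_sphere \<Delta> \<longleftrightarrow>
     abstract_complex \<Delta> \<and>
     (\<exists>m. int m = complex_dim \<Delta> + 1 \<and>
          PL_homeomorphic (realization \<Delta>) (realization (simplex_boundary m)))"

section \<open>Face numbers\<close>

text \<open>Throughout, \<open>d\<close> is one more than the dimension of the complex in question. The argument of
  \<open>f_num\<close> is an integer so that \<open>f_num \<Delta> (-1)\<close> counts the empty face.\<close>

definition f_num :: "'a set set \<Rightarrow> int \<Rightarrow> nat" where
  "f_num \<Delta> i = card {F \<in> \<Delta>. int (card F) = i + 1}"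

definition h_num :: "nat \<Rightarrow> 'a set set \<Rightarrow> nat \<Rightarrow> int" where
  "h_num d \<Delta> j =
     (\<Sum>i=0..j. (-1) ^ (j - i) * int ((d - i) choose (j - i)) * int (f_num \<Delta> (int i - 1)))"

definition g_num :: "nat \<Rightarrow> 'a set set \<Rightarrow> nat \<Rightarrow> int" where
  "g_num d \<Delta> i =
     (if i = 0 then 1
      else if i \<le> d div 2 then h_num d \<Delta> i - h_num d \<Delta> (i - 1)
      else 0)"

text \<open>The link of an edge has dimension \<open>d - 3\<close>, hence the parameter \<open>d - 2\<close>.\<close>

definition C_num :: "nat \<Rightarrow> 'a set set \<Rightarrow> nat \<Rightarrow> int" where
  "C_num d \<Delta> k = (\<Sum>e\<in>edges \<Delta>. g_num (d - 2) (lk \<Delta> e) k)"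

definition omega :: "nat \<Rightarrow> 'a set set \<Rightarrow> nat \<Rightarrow> real" where
  "omega d \<Delta> k =
     real (f_num \<Delta> 1) powr (1 / real k) *
     (real_of_int (g_num d \<Delta> k) powr (real (k + 1) / real k) / real_of_int (g_num d \<Delta> (k + 1)))"

text \<open>Powers \<open>t\<^sup>a\<close> with a positive, in general non-integral exponent are monotone on
  \<open>t \<ge> 0\<close>; they are extended by \<open>0\<close> to negative bases. The built-in \<open>powr\<close> would
  give \<open>\<bar>t\<bar>\<^sup>a\<close> there, which is not what an inequality \<open>x \<ge> t\<^sup>a\<close> derived from
  \<open>x powr (1/a) \<ge> t\<close> means for \<open>t < 0\<close>; with it the main inequality would fail
  already for the boundary of the 4-dimensional cross-polytope and \<open>k = 1\<close>.\<close>

definition pos_powr :: "real \<Rightarrow> real \<Rightarrow> real" where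
  "pos_powr t a = max 0 t powr a"

end

theory Submission
 imports Defs "HOL-Library.Z2" "HOL-Computational_Algebra.Fraction_Field" "HOL-Library.Nat_Bijection"
  "HOL-Library.Function_Algebras" "HOL-Library.Multiset_Order"
begin

text \<open>By the link condition, contracting an edge \<open>e\<close> of \<open>\<Delta>\<close> yields a complex that is again a homology
 sphere with coefficients in characteristic two, and its g-numbers are
 \<open>g\<^sub>i(\<Delta>) - g\<^sub>i\<^sub>-\<^sub>1(lk e)\<close>. For such a homology sphere of dimension \<open>d - 1\<close>, the numbers
 \<open>g\<^sub>0, g\<^sub>1, ...\<close> up to \<open>d/2\<close> count the monomials, by degree, of an order ideal: they are the leading
 monomials of the kernel of the Lefschetz map \<open>ell\<close> on the dual of the Stanley--Reisner ring modulo a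
 generic linear system of parameters. That \<open>ell\<close> is onto in low degrees is the anisotropy argument
 of Papadakis--Petrotou and Karu--Xiao, in which differentiating the volume form \<open>\<Omega>\<close> with respect to the
 generic coefficients produces the squares of its values. The Loomis--Whitney inequality for the order
 ideal gives \<open>g\<^sub>k\<^sub>+\<^sub>1\<^sup>k \<le> g\<^sub>k\<^sup>k\<^sup>+\<^sup>1\<close>. Applied to all
 contractions and summed over the edges, this bounds \<open>f\<^sub>1 g\<^sub>k\<^sub>+\<^sub>1 - C\<^sub>k\<close> by the power with exponent
 \<open>(k + 1)/k\<close> of \<open>f\<^sub>1 g\<^sub>k - C\<^sub>k\<^sub>-\<^sub>1\<close>, and \<open>x\<^sup>t + (1 - x)\<^sup>t \<ge> 1\<close> for
 \<open>0 \<le> x, t \<le> 1\<close> turns this into the claim. The topological input, that a PL sphere is a homology sphere,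
 is obtained by comparing simplicial chains of \<open>\<Delta>\<close> with chains of small subsets of its realization.\<close>


subsection \<open>Simplicial chains and acyclic carriers\<close>

text \<open>Characteristic two is forced by the derivation argument; it also makes every boundary
  and determinant sign-free, so one field carries both the homology and the algebra. Contraction has
  to stay inside the class treated, so the class is defined by the homology of all links: a link of
  the contraction is a contracted link of \<open>\<Delta>\<close>, a link of
  \<open>\<Delta>\<close>, or two balls glued along a link through the contracted edge. A
  homeomorphism does not respect faces, so it can only transport local homology at points; a point
  inside a face recovers the link of that face. In the algebra everything is a functional on
  monomials: multiplication by a form becomes its transpose, quotients become kernels, and regular
  sequences become coregular ones, so dimensions are counted without quotient spaces. The volume
  form is a sum over the facets of explicit quotients of minors of a matrix with one extra generic
  column \<open>None\<close>. That column belongs to a cone point and cancels in the sum, but it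
  makes each summand depend on a matrix with one more column than rows, where the derivations can be
  computed.\<close>

abbreviation "lookup \<equiv> Poly_Mapping.lookup"
abbreviation "single \<equiv> Poly_Mapping.single"
abbreviation "keys \<equiv> Poly_Mapping.keys"

text \<open>A class rather than the two-element field, since the coefficients finally used are
  rational functions in the entries of a generic matrix.\<close>

class char_two = field +
 assumes one_plus_one: "1 + 1 = 0"

lemma add_self [simp]: "x + x = (0::'k::char_two)"
proof -
 have "x + x = x * (1 + 1)" by (simp only: distrib_left mult_1_right)
 thus ?thesis by (simp only: one_plus_one mult_zero_right)
qed

lemma char_two_minus [simp]: "- x = (x::'k::char_two)"
 by (rule minus_unique) (rule add_self)

lemma char_two_diff [simp]: "x - y = (x + y::'k::char_two)"
 by (simp only: diff_conv_add_uminus char_two_minus)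

lemma char_two_eq_iff: "x + y = 0 \<longleftrightarrow> x = (y::'k::char_two)"
 by (simp only: eq_neg_iff_add_eq_0[symmetric] char_two_minus)

lemma numeral_two_char_two [simp]: "(2::'k::char_two) = 0"
 by (simp only: one_add_one[symmetric] one_plus_one)

type_synonym ('p, 'k) chain = "'p set \<Rightarrow>\<^sub>0 'k"

lemma pm_add_self [simp]: "c + c = (0::'b \<Rightarrow>\<^sub>0 'k::char_two)"
 by (rule poly_mapping_eqI) (simp add: lookup_add)

lemma pm_add_self_left [simp]: "c + (c + d) = (d::'b \<Rightarrow>\<^sub>0 'k::char_two)"
 by (simp flip: add.assoc)

lemma pm_eq_iff: "c + d = 0 \<longleftrightarrow> c = (d::'b \<Rightarrow>\<^sub>0 'k::char_two)"
 by (metis pm_add_self pm_add_self_left add_0_right)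

definition sc :: "'k::char_two => ('b \<Rightarrow>\<^sub>0 'k) => ('b \<Rightarrow>\<^sub>0 'k)" where
 "sc a c = Poly_Mapping.map ((*) a) c"

lemma lookup_sc [simp]: "lookup (sc a c) x = a * lookup c x"
 by (simp add: sc_def map.rep_eq when_def)

lemma sc_simps [simp]: "sc 0 c = 0" "sc 1 c = c" "sc a 0 = 0"
 by (auto intro!: poly_mapping_eqI)

lemma sc_add: "sc a (c + d) = sc a c + sc a d" "sc (a + b) c = sc a c + sc b c"
 by (auto intro!: poly_mapping_eqI simp: lookup_add algebra_simps)

lemma sc_sc: "sc a (sc b c) = sc (a * b) c"
 by (auto intro!: poly_mapping_eqI)

lemma sc_sum: "sc a (sum f S) = (\<Sum>x\<in>S. sc a (f x))"
 by (induction S rule: infinite_finite_induct) (auto simp: sc_add)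

lemma keys_sc: "keys (sc a c) \<subseteq> keys c"
 by (auto simp: in_keys_iff)

definition lin :: "('b => ('c \<Rightarrow>\<^sub>0 'k::char_two)) => ('b \<Rightarrow>\<^sub>0 'k) => ('c \<Rightarrow>\<^sub>0 'k)" where
 "lin f c = (\<Sum>X\<in>keys c. sc (lookup c X) (f X))"

lemma lin_superset:
 "finite S ==> keys c \<subseteq> S ==> lin f c = (\<Sum>X\<in>S. sc (lookup c X) (f X))"
 unfolding lin_def by (rule sum.mono_neutral_left) (auto simp: in_keys_iff)

lemma lin_add: "lin f (c + d) = lin f c + lin f d"
proof -
 let ?S = "keys c \<union> keys d"
 have "keys (c + d) \<subseteq> ?S" by (rule Poly_Mapping.keys_add)
 thus ?thesis
  by (simp add: lin_superset[of ?S] lookup_add sc_add sum.distrib)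
qed

lemma lin_0 [simp]: "lin f 0 = 0"
 by (simp add: lin_def)

lemma lin_sc: "lin f (sc a c) = sc a (lin f c)"
 by (simp add: lin_superset[OF finite_keys keys_sc] lin_def[of f c] sc_sum sc_sc)

lemma lin_sum: "lin f (sum g S) = (\<Sum>x\<in>S. lin f (g x))"
 by (induction S rule: infinite_finite_induct) (auto simp: lin_add)

lemma lin_single [simp]: "lin f (single X a) = sc a (f X)"
 by (cases "a = 0") (auto simp: lin_def)

lemma lin_lin: "lin f (lin g c) = lin (\<lambda>X. lin f (g X)) c"
 by (simp add: lin_def[of g] lin_def[of "\<lambda>X. lin f (g X)"] lin_sum lin_sc)

lemma lin_cong: "(\<And>X. X \<in> keys c ==> f X = g X) ==> lin f c = lin g c"
 by (simp add: lin_def)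

lemma lin_fun_add: "lin (\<lambda>X. f X + g X) c = lin f c + lin g c"
 by (simp add: lin_def sc_add sum.distrib)

lemma lin_fun_0 [simp]: "lin (\<lambda>X. 0) c = 0"
 by (simp add: lin_def)

lemma lin_ident: "lin (\<lambda>X. single X 1) c = c"
proof (rule poly_mapping_eqI)
 fix X
 have "lookup (lin (\<lambda>X. single X 1) c) X =
  (\<Sum>Y\<in>keys c. if X = Y then lookup c Y else 0)"
  unfolding lin_def lookup_sum by (rule sum.cong) (auto simp: lookup_single when_def)
 also have "... = lookup c X"
  by (simp add: sum.delta in_keys_iff)
 finally show "lookup (lin (\<lambda>X. single X 1) c) X = lookup c X" .
qed

definition bd1 :: "'p set => ('p, 'k::char_two) chain" where
 "bd1 X = (\<Sum>x\<in>X. single (X - {x}) 1)"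

definition bd :: "('p, 'k::char_two) chain => ('p, 'k) chain" where
 "bd = lin bd1"

lemma bd_linear: "bd (c + d) = bd c + bd d" "bd 0 = 0" "bd (sc a c) = sc a (bd c)"
  "bd (sum g S) = (\<Sum>x\<in>S. bd (g x))" "bd (single X a) = sc a (bd1 X)"
 by (simp_all add: bd_def lin_add lin_sc lin_sum)

text \<open>Each unordered pair is counted twice. The cancellation is a hypothesis on
  \<open>f\<close> instead of a class constraint, so that chains are covered as well as
  scalars.\<close>

lemma sum_symmetric_offdiag:
 fixes f :: "'b => 'b => 'c::comm_monoid_add"
 assumes "finite X" "\<And>x y. f x y = f y x" "\<And>x y. x \<in> X ==> f x y + f x y = 0"
 shows "(\<Sum>x\<in>X. \<Sum>y\<in>X - {x}. f x y) = 0"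
 using assms(1,3)
proof (induction X)
 case (insert a X)
 have "(\<Sum>x\<in>X. \<Sum>y\<in>insert a X - {x}. f x y) = (\<Sum>x\<in>X. f x a + (\<Sum>y\<in>X - {x}. f x y))"
 proof (rule sum.cong)
  fix x assume "x \<in> X"
  hence "insert a X - {x} = insert a (X - {x})" using insert.hyps by auto
  thus "(\<Sum>y\<in>insert a X - {x}. f x y) = f x a + (\<Sum>y\<in>X - {x}. f x y)"
   using insert.hyps by simp
 qed simp
 also have "... = (\<Sum>x\<in>X. f a x)"
  using insert by (simp add: sum.distrib assms(2)[of _ a])
 finally have *: "(\<Sum>x\<in>X. \<Sum>y\<in>insert a X - {x}. f x y) = (\<Sum>x\<in>X. f a x)" .
 have "insert a X - {a} = X" using insert.hyps by auto
 hence "(\<Sum>x\<in>insert a X. \<Sum>y\<in>insert a X - {x}. f x y) = (\<Sum>y\<in>X. f a y) + (\<Sum>y\<in>X. f a y)"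
  using insert.hyps by (simp add: * )
 also have "... = (\<Sum>y\<in>X. f a y + f a y)" by (simp add: sum.distrib)
 also have "... = 0" using insert.prems by simp
 finally show ?case .
qed simp

lemma bd_bd1: "bd (bd1 X) = (0::('p, 'k::char_two) chain)"
proof (cases "finite X")
 case True
 have "bd (bd1 X) = (\<Sum>x\<in>X. \<Sum>y\<in>X - {x}. single (X - {x} - {y}) (1::'k))"
  by (simp add: bd1_def[of X] bd_linear) (simp add: bd1_def)
 also have "... = 0"
  using True
 proof (rule sum_symmetric_offdiag)
  show "single (X - {x} - {y}) (1::'k) = single (X - {y} - {x}) 1" for x y
   by (rule arg_cong[of _ _ "\<lambda>Z. single Z 1"]) auto
 qed simp
 finally show ?thesis .
qed (simp add: bd1_def bd_def)

lemma bd_bd [simp]: "bd (bd c) = 0"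
proof -
 have "bd (bd c) = lin (\<lambda>X. bd (bd1 X)) c" unfolding bd_def by (rule lin_lin)
 also have "... = 0" by (simp add: bd_bd1)
 finally show ?thesis .
qed

text \<open>The index is the cardinality of the simplices, one more than their dimension. Index 0
  belongs to the empty simplex, so the chains are the augmented ones.\<close>

definition chains :: "'p set set => nat => ('p, 'k::char_two) chain set" where
 "chains \<K> i = {c. \<forall>X\<in>keys c. X \<in> \<K> \<and> finite X \<and> card X = i}"

lemma chains_0 [simp]: "0 \<in> chains \<K> i"
 by (simp add: chains_def)

lemma chains_add: "c \<in> chains \<K> i ==> d \<in> chains \<K> i ==> c + d \<in> chains \<K> i"
 unfolding chains_def using Poly_Mapping.keys_add by fastforce

lemma chains_sc: "c \<in> chains \<K> i ==> sc a c \<in> chains \<K> i"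
 unfolding chains_def using keys_sc by fastforce

lemma chains_sum: "(\<And>x. x \<in> S ==> g x \<in> chains \<K> i) ==> sum g S \<in> chains \<K> i"
 by (induction S rule: infinite_finite_induct) (auto simp: chains_add)

lemma chains_single: "X \<in> \<K> ==> finite X ==> card X = i ==> single X a \<in> chains \<K> i"
 by (cases "a = 0") (auto simp: chains_def)

lemma chains_mono: "c \<in> chains \<K> i ==> \<K> \<subseteq> \<L> ==> c \<in> chains \<L> i"
 by (auto simp: chains_def)

lemma chains_lin:
 "c \<in> chains \<K> i ==> (\<And>X. X \<in> \<K> ==> finite X ==> card X = i ==> f X \<in> chains \<L> j) ==> lin f c \<in> chains \<L> j"
 unfolding lin_def by (rule chains_sum, rule chains_sc) (auto simp: chains_def)

definition down :: "'p set set => bool" where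
 "down \<K> \<longleftrightarrow> (\<forall>X\<in>\<K>. \<forall>Y. Y \<subseteq> X --> Y \<in> \<K>)"

lemma downD: "down \<K> ==> X \<in> \<K> ==> Y \<subseteq> X ==> Y \<in> \<K>"
 by (auto simp: down_def)

lemma chains_bd1: "down \<K> ==> X \<in> \<K> ==> finite X ==> bd1 X \<in> chains \<K> (card X - 1)"
 unfolding bd1_def by (intro chains_sum chains_single) (auto intro: downD)

lemma chains_bd: "down \<K> ==> c \<in> chains \<K> i ==> bd c \<in> chains \<K> (i - 1)"
 unfolding bd_def by (erule chains_lin) (auto dest: chains_bd1)

lemma bd_chains_0: "c \<in> chains \<K> 0 ==> bd c = 0"
proof -
 assume c: "c \<in> chains \<K> 0"
 have "bd c = lin (\<lambda>X. 0) c"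
  unfolding bd_def by (rule lin_cong) (use c in \<open>auto simp: chains_def bd1_def\<close>)
 thus ?thesis by simp
qed

text \<open>The type argument fixes the coefficient field, which \<open>\<K>\<close> does not
  determine. Index 0 is included, so the empty simplex has to bound if it is present.\<close>

definition acyclic_cx :: "'p set set => 'k::char_two itself => bool" where
 "acyclic_cx \<K> (_::'k itself) \<longleftrightarrow>
  (\<forall>i. \<forall>z \<in> chains \<K> i. bd z = (0::('p,'k) chain) --> (\<exists>b \<in> chains \<K> (Suc i). bd b = z))"

lemma acyclic_cxD:
 assumes "acyclic_cx \<K> TYPE('k::char_two)" "z \<in> chains \<K> i" "bd z = 0"
 obtains b :: "('p,'k::char_two) chain" where "b \<in> chains \<K> (Suc i)" "bd b = z"
 using assms unfolding acyclic_cx_def by blast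

definition cone :: "'p => ('p, 'k::char_two) chain => ('p, 'k) chain" where
 "cone p = lin (\<lambda>X. if p \<in> X then 0 else single (insert p X) 1)"

text \<open>If \<open>p\<close> lies in \<open>X\<close>, coning kills \<open>X\<close> and all its
  faces except \<open>X - {p}\<close>, which it turns back into \<open>X\<close>.\<close>

lemma bd_cone_single:
 assumes "finite X"
 shows "bd (cone p (single X (1::'k::char_two))) + cone p (bd1 X) = single X 1"
proof (cases "p \<in> X")
 case False
 have eq: "insert p X - {x} = insert p (X - {x})" if "x \<in> X" for x using that False by auto
 have "bd (cone p (single X (1::'k))) = single X 1 + (\<Sum>x\<in>X. single (insert p (X - {x})) 1)"
  using False assms by (simp add: cone_def bd_linear bd1_def eq)
 moreover have "cone p (bd1 X) = (\<Sum>x\<in>X. single (insert p (X - {x})) (1::'k))"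
  using False by (simp add: bd1_def cone_def lin_sum)
 ultimately show ?thesis by (simp add: add.assoc)
next
 case True
 have "cone p (bd1 X) = (\<Sum>x\<in>X. if x = p then single X (1::'k) else 0)"
  unfolding bd1_def cone_def lin_sum using True by (intro sum.cong) (auto simp: insert_absorb)
 also have "... = single X 1" using True assms by simp
 finally show ?thesis using True by (simp add: cone_def bd_linear)
qed

lemma bd_cone:
 assumes "c \<in> chains \<K> i"
 shows "bd (cone p c) = c + cone p (bd c)"
proof -
 have "bd (cone p c) + cone p (bd c) =
  lin (\<lambda>X. bd (cone p (single X 1)) + cone p (bd1 X)) c"
  by (simp add: lin_fun_add cone_def bd_def lin_lin)
 also have "... = lin (\<lambda>X. single X 1) c"
  by (rule lin_cong, rule bd_cone_single) (use assms in \<open>auto simp: chains_def\<close>)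
 also have "... = c" by (rule lin_ident)
 finally show ?thesis by (metis add.assoc add.commute pm_add_self_left)
qed

lemma chains_cone:
 assumes "c \<in> chains \<K> i" "\<And>X. X \<in> \<K> ==> finite X ==> card X = i ==> p \<notin> X ==> insert p X \<in> \<L>"
 shows "cone p c \<in> chains \<L> (Suc i)"
 unfolding cone_def by (rule chains_lin[OF assms(1)]) (auto intro!: chains_single assms(2))

lemma cone_acyclic:
 assumes "\<And>X. X \<in> \<K> ==> insert p X \<in> \<K>"
 shows "acyclic_cx \<K> TYPE('k::char_two)"
 unfolding acyclic_cx_def
proof (intro allI ballI impI)
 fix i and z :: "('a,'k) chain" assume z: "z \<in> chains \<K> i" "bd z = 0"
 show "\<exists>b\<in>chains \<K> (Suc i). bd b = z"
 proof
  show "bd (cone p z) = z" by (simp add: bd_cone[OF z(1)] z(2)) (simp add: cone_def)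
  show "cone p z \<in> chains \<K> (Suc i)" using z(1) assms by (rule chains_cone)
 qed
qed

text \<open>The acyclic carrier argument: \<open>r\<close> is the prescribed defect, \<open>n\<close> the degree shift and \<open>d0\<close> the value on the
 empty simplex. The choice \<open>r = 0, n = 0\<close> produces chain maps, \<open>r = \<phi> + \<psi>, n = 1, d0 = 0\<close> chain homotopies.\<close>

lemma acyclic_carrier:
 fixes Car :: "'p set => 'q set set" and r :: "'p set => ('q, 'k::char_two) chain"
 assumes \<K>: "down \<K>" "\<And>X. X \<in> \<K> ==> finite X"
  and mono: "\<And>X Y. X \<in> \<K> ==> Y \<subseteq> X ==> Car Y \<subseteq> Car X"
  and down: "\<And>X. X \<in> \<K> ==> down (Car X)"
  and acyc: "\<And>X. X \<in> \<K> ==> X \<noteq> {} ==> acyclic_cx (Car X) TYPE('k)"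
  and r: "\<And>X. X \<in> \<K> ==> X \<noteq> {} ==> r X \<in> chains (Car X) (card X + n - 1)"
  and bdr: "\<And>X. X \<in> \<K> ==> X \<noteq> {} ==> bd (r X) = lin r (bd1 X)"
  and d0: "{} \<in> \<K> ==> d0 \<in> chains (Car {}) n" "bd d0 = r {}"
 obtains D where "D {} = d0" "\<And>X. X \<in> \<K> ==> D X \<in> chains (Car X) (card X + n)"
  "\<And>X. X \<in> \<K> ==> bd (D X) = r X + lin D (bd1 X)"
proof -
 define P where "P m D \<longleftrightarrow> D {} = d0 \<and> (\<forall>X\<in>\<K>. card X \<le> m --> D X \<in> chains (Car X) (card X + n) \<and> bd (D X) = r X + lin D (bd1 X))"
  for m and D :: "'p set => ('q,'k) chain"
 \<comment> \<open>Values on smaller simplices are never changed again, so the sequence of partial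
   solutions stabilises at each simplex and its diagonal is a solution.\<close>
 have step: "\<exists>D'. P (Suc m) D' \<and> (\<forall>X\<in>\<K>. card X \<le> m --> D' X = D X)" if D: "P m D" for m D
 proof -
  have ex: "\<exists>b. b \<in> chains (Car X) (card X + n) \<and> bd b = r X + lin D (bd1 X)"
   if X: "X \<in> \<K>" "card X = Suc m" for X
  proof -
   have fin: "finite X" and ne: "X \<noteq> {}" using X \<K>(2) by auto
   have sub: "X - {x} \<in> \<K> \<and> card (X - {x}) = m" if "x \<in> X" for x
    using that X fin downD[OF \<K>(1)] by (auto simp: card_Diff_singleton_if)
   have DX: "D (X - {x}) \<in> chains (Car X) (m + n)" "bd (D (X - {x})) = r (X - {x}) + lin D (bd1 (X - {x}))"
    if "x \<in> X" for x
   proof -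
    have "D (X - {x}) \<in> chains (Car (X - {x})) (m + n)"
     using D sub[OF that] unfolding P_def by fastforce
    thus "D (X - {x}) \<in> chains (Car X) (m + n)"
     by (rule chains_mono) (use X mono in blast)
    show "bd (D (X - {x})) = r (X - {x}) + lin D (bd1 (X - {x}))"
     using D sub[OF that] unfolding P_def by fastforce
   qed
   let ?z = "r X + lin D (bd1 X)"
   have lD: "lin D (bd1 X) = (\<Sum>x\<in>X. D (X - {x}))" for D :: "'p set => ('q,'k) chain"
    by (simp add: bd1_def lin_sum)
   have "?z \<in> chains (Car X) (m + n)"
    using r[OF X(1) ne] X(2) DX(1) by (auto intro!: chains_add chains_sum simp: lD)
   \<comment> \<open>The boundary of \<open>r X\<close> cancels against the defects inherited from
     the faces; what remains is \<open>lin D\<close> of a double boundary.\<close>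
   moreover have "bd ?z = 0"
   proof -
    have "bd (lin D (bd1 X)) = (\<Sum>x\<in>X. r (X - {x})) + (\<Sum>x\<in>X. lin D (bd1 (X - {x})))"
     by (simp add: lD[of D] bd_linear DX(2) sum.distrib)
    also have "(\<Sum>x\<in>X. lin D (bd1 (X - {x}))) = lin D (bd (bd1 X))"
     by (simp add: bd1_def[of X] bd_linear lin_sum)
    also have "... = 0" by (simp add: bd_bd1)
    finally show ?thesis using bdr[OF X(1) ne] by (simp add: bd_linear lD[of r])
   qed
   ultimately show ?thesis
    using acyclic_cxD[OF acyc[OF X(1) ne]] X(2) by (metis add_Suc)
  qed
  define D' where "D' X = (if card X = Suc m \<and> X \<in> \<K> then SOME b. b \<in> chains (Car X) (card X + n) \<and> bd b = r X + lin D (bd1 X) else D X)" for X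
  have new: "D' X \<in> chains (Car X) (card X + n) \<and> bd (D' X) = r X + lin D (bd1 X)" if "X \<in> \<K>" "card X = Suc m" for X
   using someI_ex[OF ex[OF that]] that by (simp add: D'_def)
  have old: "D' X = D X" if "card X \<noteq> Suc m" for X using that by (simp add: D'_def)
  have linD': "lin D' (bd1 X) = lin D (bd1 X)" if "X \<in> \<K>" "card X \<le> Suc m" for X
   using that \<K>(2)[of X] by (auto simp: bd1_def lin_sum card_Diff_singleton_if intro!: sum.cong old)
  have "P (Suc m) D'"
   unfolding P_def
  proof (intro conjI ballI impI)
   show "D' {} = d0" using D by (simp add: D'_def P_def)
   fix X assume X: "X \<in> \<K>" "card X \<le> Suc m"
   show "D' X \<in> chains (Car X) (card X + n)" "bd (D' X) = r X + lin D' (bd1 X)"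
    using D X new[of X] old[of X] linD'[OF X] unfolding P_def by (cases "card X = Suc m"; force)+
  qed
  thus ?thesis using old by (intro exI[of _ D']) auto
 qed
 have base: "P 0 (\<lambda>X. d0)"
  using d0 \<K>(2) by (auto simp: P_def bd1_def)
 obtain Ds where Ds: "\<And>m. P m (Ds m)" "\<And>m X. X \<in> \<K> ==> card X \<le> m ==> Ds (Suc m) X = Ds m X"
  using dependent_nat_choice[of P "\<lambda>m D D'. \<forall>X\<in>\<K>. card X \<le> m --> D' X = D X"] base step
  by (metis (no_types, lifting))
 have stable: "Ds m X = Ds (card X) X" if "X \<in> \<K>" "card X \<le> m" for m X
  using that(2) by (induction m rule: dec_induct) (use Ds(2) that in auto)
 define D where "D X = Ds (card X) X" for X
 show thesis
 proof
  show "D {} = d0" using Ds(1)[of 0] by (simp add: D_def P_def)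
  fix X assume X: "X \<in> \<K>"
  have "lin (Ds (card X)) (bd1 X) = lin D (bd1 X)"
   unfolding bd1_def lin_sum lin_single sc_simps D_def
   by (intro sum.cong refl stable downD[OF \<K>(1) X] card_mono \<K>(2)[OF X]) auto
  thus "D X \<in> chains (Car X) (card X + n)" "bd (D X) = r X + lin D (bd1 X)"
   using Ds(1)[of "card X"] X by (auto simp: P_def D_def)
 qed
qed

section \<open>Simplicial maps on chains and contiguity\<close>

definition push :: "('p => 'q) => ('p, 'k::char_two) chain => ('q, 'k) chain" where
 "push h = lin (\<lambda>X. if inj_on h X then single (h ` X) 1 else 0)"

text \<open>If \<open>h\<close> identifies \<open>x\<close> and \<open>y\<close> in
  \<open>X\<close>, a face that keeps both is degenerate, and the two faces that omit one of them
  have the same image and cancel.\<close>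

lemma push_bd1:
 assumes "finite X"
 shows "push h (bd1 X) = bd (push h (single X (1::'k::char_two)))"
proof (cases "inj_on h X")
 case True
 have "push h (bd1 X) = (\<Sum>x\<in>X. single (h ` X - {h x}) (1::'k))"
  unfolding push_def bd1_def lin_sum
  by (intro sum.cong) (use True in \<open>auto simp: inj_on_diff inj_on_image_set_diff[OF True]\<close>)
 also have "... = bd1 (h ` X)"
  unfolding bd1_def by (simp add: sum.reindex[OF True])
 finally show ?thesis using True by (simp add: push_def bd_linear)
next
 case False
 then obtain x y where xy: "x \<in> X" "y \<in> X" "x \<noteq> y" "h x = h y" by (auto simp: inj_on_def)
 let ?t = "\<lambda>w. if inj_on h (X - {w}) then single (h ` (X - {w})) (1::'k) else 0"
 have "push h (bd1 X) = (\<Sum>w\<in>X. ?t w)"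
  unfolding push_def bd1_def lin_sum by (intro sum.cong) auto
 also have "... = (\<Sum>w\<in>{x, y}. ?t w)"
 proof (rule sum.mono_neutral_right)
  show "\<forall>w\<in>X - {x, y}. ?t w = 0"
   using xy by (auto simp: inj_on_def)
 qed (use xy assms in auto)
 also have "... = ?t x + ?t y" using xy by simp
 also have "?t x = ?t y"
 proof -
  have "h ` (X - {x}) = h ` (X - {y})"
  proof -
   have "h ` (X - {x}) = h ` X" "h ` (X - {y}) = h ` X"
    using xy by (auto simp: image_iff Bex_def) (metis xy)+
   thus ?thesis by simp
  qed
  moreover have "inj_on h (X - {x}) \<longleftrightarrow> inj_on h (X - {y})"
   using xy assms calculation
   by (simp add: inj_on_iff_eq_card card_Diff_singleton_if)
  ultimately show ?thesis by simp
 qed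
 finally show ?thesis using False by (simp add: push_def bd_linear)
qed

lemma push_bd:
 assumes "c \<in> chains \<K> i"
 shows "push h (bd c) = bd (push h c)"
proof -
 have "push h (bd c) = lin (\<lambda>X. push h (bd1 X)) c"
  by (simp add: push_def bd_def lin_lin)
 also have "... = lin (\<lambda>X. bd (push h (single X 1))) c"
  by (rule lin_cong, rule push_bd1) (use assms in \<open>auto simp: chains_def\<close>)
 also have "... = bd (push h c)"
  by (simp add: push_def bd_def lin_lin)
 finally show ?thesis .
qed

lemma push_linear: "push h (c + d) = push h c + push h d" "push h (sc a c) = sc a (push h c)" "push h 0 = 0"
 by (simp_all add: push_def lin_add lin_sc)

lemma chains_push:
 assumes "c \<in> chains \<K> i" "\<And>X. X \<in> \<K> ==> finite X ==> card X = i ==> h ` X \<in> \<L>"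
 shows "push h c \<in> chains \<L> i"
 unfolding push_def by (rule chains_lin[OF assms(1)]) (auto intro!: chains_single assms(2) simp: card_image)

lemma push_push_inv:
 assumes "c \<in> chains \<K> i" "\<And>X x. X \<in> \<K> ==> x \<in> X ==> g (f x) = x"
 shows "push g (push f c) = c"
proof -
 have "push g (push f c) = lin (\<lambda>X. single X 1) c"
  unfolding push_def lin_lin
 proof (rule lin_cong)
  fix X assume "X \<in> keys c"
  hence X: "X \<in> \<K>" using assms by (auto simp: chains_def)
  hence "inj_on f X" "g ` f ` X = X" "inj_on g (f ` X)"
   using assms(2)[OF X] by (auto simp: image_image intro: inj_on_inverseI[of _ g] inj_on_inverseI[of _ f])
  thus "lin (\<lambda>X. if inj_on g X then single (g ` X) 1 else 0)
      (if inj_on f X then single (f ` X) 1 else 0) = single X (1::'b)"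
   by simp
 qed
 thus ?thesis by (simp add: lin_ident)
qed

lemma pm_cancel_mid: "(a + b) + (b + c) = a + (c::'b \<Rightarrow>\<^sub>0 'k::char_two)"
 by (metis add.assoc pm_add_self_left)

lemma homotopy_chain:
 assumes "\<And>X. X \<in> \<K> ==> bd (D X) = r X + lin D (bd1 X)" "z \<in> chains \<K> i"
 shows "bd (lin D z) = lin r z + lin D (bd z)"
proof -
 have "bd (lin D z) = lin (\<lambda>X. bd (D X)) z" by (simp add: bd_def lin_lin)
 also have "... = lin (\<lambda>X. r X + lin D (bd1 X)) z"
  by (rule lin_cong) (use assms in \<open>auto simp: chains_def\<close>)
 also have "... = lin r z + lin D (bd z)" by (simp add: lin_fun_add bd_def lin_lin)
 finally show ?thesis .
qed

lemma push_single: "finite X ==> h ` X \<subseteq> Y ==> push h (single X a) \<in> chains (Pow Y) (card X)"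
 by (auto simp: push_def card_image intro!: chains_sc chains_single)

lemma lin_push: "lin (\<lambda>X. push h (single X 1)) z = push h z"
 by (simp add: push_def)

text \<open>Both maps are carried by the full simplex on the union of the two images of
  \<open>X\<close>. This is a cone, so an acyclic carrier joins them.\<close>

lemma contiguous_push:
 fixes z :: "('p, 'k::char_two) chain"
 assumes \<K>: "down \<K>" "\<And>X. X \<in> \<K> ==> finite X"
  and h: "\<And>X. X \<in> \<K> ==> h ` X \<union> h' ` X \<in> \<L>" and \<L>: "down \<L>"
  and z: "z \<in> chains \<K> i" "bd z = 0"
 shows "\<exists>b \<in> chains \<L> (Suc i). push h z + push h' z = bd b"
proof -
 let ?Car = "\<lambda>X. Pow (h ` X \<union> h' ` X)"
 let ?r = "\<lambda>X. push h (single X (1::'k)) + push h' (single X 1)"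
 obtain D where D: "\<And>X. X \<in> \<K> ==> D X \<in> chains (?Car X) (card X + 1)"
   "\<And>X. X \<in> \<K> ==> bd (D X) = ?r X + lin D (bd1 X)"
 proof (rule acyclic_carrier[of \<K> ?Car ?r 1 0])
  show "bd 0 = ?r {}" by (simp add: push_def bd_linear)
  show "?Car Y \<subseteq> ?Car X" if "Y \<subseteq> X" for X Y using that by blast
  fix X assume X: "X \<in> \<K>" and ne: "X \<noteq> {}"
  then obtain x where "x \<in> X" by auto
  thus "acyclic_cx (?Car X) TYPE('k)" by (intro cone_acyclic[of _ "h x"]) auto
  show "?r X \<in> chains (?Car X) (card X + 1 - 1)"
   using \<K>(2)[OF X] by (auto intro!: chains_add push_single)
  have "lin ?r (bd1 X) = push h (bd1 X) + push h' (bd1 X)"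
   by (simp add: lin_fun_add lin_push)
  also have "... = bd (?r X)" using \<K>(2)[OF X] by (simp add: push_bd1 bd_linear)
  finally show "bd (?r X) = lin ?r (bd1 X)" by simp
 qed (use \<K> in \<open>auto simp: down_def intro: image_mono\<close>)
 show ?thesis
 proof
  show "lin D z \<in> chains \<L> (Suc i)"
  proof (rule chains_lin[OF z(1)])
   fix X assume X: "X \<in> \<K>" "card X = i"
   have "?Car X \<subseteq> \<L>" using h[OF X(1)] \<L> by (auto simp: down_def)
   thus "D X \<in> chains \<L> (Suc i)" using D(1)[OF X(1)] X(2) chains_mono by fastforce
  qed
  show "push h z + push h' z = bd (lin D z)"
   using homotopy_chain[OF D(2) z(1)] z(2) by (simp add: lin_fun_add lin_push)
 qed
qed

section \<open>Chains of small finite sets (Vietoris-Rips complexes)\<close>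

definition rips :: "real => 'e::metric_space set => 'e set set" where
 "rips E Z = {X. finite X \<and> X \<subseteq> Z \<and> (\<forall>x\<in>X. \<forall>y\<in>X. dist x y < E)}"

lemma down_rips [simp]: "down (rips E Z)"
 by (auto simp: down_def rips_def intro: finite_subset)

lemma rips_finite: "X \<in> rips E Z ==> finite X"
 by (simp add: rips_def)

lemma rips_mono: "Z \<subseteq> Z' ==> E \<le> E' ==> rips E Z \<subseteq> rips E' Z'"
 by (fastforce simp: rips_def)

lemma push_id: "push (\<lambda>x. x) c = c"
 by (simp add: push_def lin_ident)

text \<open>The cycle is moved towards \<open>p\<close> in \<open>N\<close> steps so short that
  consecutive positions are contiguous. After the last step it lives on the single point
  \<open>p\<close> and bounds there.\<close>

lemma rips_star_acyclic:
 fixes Z :: "'e::real_normed_vector set"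
 assumes p: "p \<in> Z" and star: "\<And>x t. x \<in> Z ==> 0 \<le> t ==> t \<le> 1 ==> (1 - t) *\<^sub>R x + t *\<^sub>R p \<in> Z"
  and E: "0 < E"
 shows "acyclic_cx (rips E Z) TYPE('k::char_two)"
 unfolding acyclic_cx_def
proof (intro allI ballI impI)
 fix i and z :: "('e,'k) chain" assume z: "z \<in> chains (rips E Z) i" "bd z = 0"
 let ?S = "keys z"
 \<comment> \<open>Only the finitely many simplices of the cycle and their faces are moved, so their
   diameters stay below a bound \<open>\<delta>\<close> strictly less than \<open>E\<close> and
   their distances to \<open>p\<close> are bounded by \<open>R\<close>.\<close>
 define \<K> where "\<K> = {Y. \<exists>X\<in>?S. Y \<subseteq> X}"
 have S: "X \<in> rips E Z" "card X = i" "finite X" if "X \<in> ?S" for X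
  using z that by (auto simp: chains_def)
 have \<K>: "down \<K>" "\<And>X. X \<in> \<K> ==> finite X" "z \<in> chains \<K> i"
  using z(1) by (auto simp: \<K>_def down_def chains_def intro: finite_subset)
 let ?P = "(\<Union>X\<in>?S. X \<times> X)"
 have finP: "finite ?P" using S(3) by auto
 define \<delta> where "\<delta> = Max (insert 0 ((\<lambda>(x, y). dist x y) ` ?P))"
 have "\<delta> < E" unfolding \<delta>_def using finP E S(1) by (subst Max_less_iff) (auto simp: rips_def)
 have \<delta>: "dist x y \<le> \<delta>" if "X \<in> ?S" "x \<in> X" "y \<in> X" for X x y
  unfolding \<delta>_def using finP that by (intro Max_ge) force+
 define R where "R = Max (insert 0 ((\<lambda>x. norm (p - x)) ` \<Union>?S))"
 have R: "norm (p - x) \<le> R" if "X \<in> ?S" "x \<in> X" for X x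
  unfolding R_def using S(3) that by (intro Max_ge) auto
 \<comment> \<open>With steps of length at most \<open>R / N\<close>, the slack
   \<open>E - \<delta>\<close> absorbs one step.\<close>
 obtain N :: nat where N: "R / (E - \<delta>) < N" "0 < N"
  using reals_Archimedean2[of "max 1 (R / (E - \<delta>))"] by (metis max_less_iff_conj of_nat_0_less_iff zero_less_one order_less_trans)
 hence RN: "R / N < E - \<delta>" using \<open>\<delta> < E\<close> by (simp add: field_simps)
 define h where "h k x = (1 - real k / N) *\<^sub>R x + (real k / N) *\<^sub>R p" for k x
 have step: "\<exists>b \<in> chains (rips E Z) (Suc i). push (h k) z + push (h (Suc k)) z = bd b" if k: "k < N" for k
 proof (rule contiguous_push[OF \<K>(1,2) _ down_rips \<K>(3) z(2)])
  fix Y assume "Y \<in> \<K>"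
  then obtain X where X: "X \<in> ?S" "Y \<subseteq> X" by (auto simp: \<K>_def)
  have hZ: "h j x \<in> Z" if "j \<le> N" "x \<in> X" for j x
   unfolding h_def by (rule star) (use S(1)[OF X(1)] that N in \<open>auto simp: rips_def\<close>)
  have same: "dist (h j x) (h j y) \<le> \<delta>" if "j \<le> N" "x \<in> X" "y \<in> X" for j x y
  proof -
   have "dist (h j x) (h j y) = norm ((1 - real j / N) *\<^sub>R (x - y))"
    unfolding dist_norm h_def by (simp add: algebra_simps)
   also have "... = (1 - real j / N) * dist x y" using that N by (simp add: dist_norm)
   also have "... \<le> 1 * dist x y" using that N by (intro mult_right_mono) auto
   finally show ?thesis using \<delta>[OF X(1) that(2,3)] by simp
  qed
  have next': "dist (h k x) (h (Suc k) x) \<le> R / N" if "x \<in> X" for x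
  proof -
   have "h (Suc k) x - h k x = (1 / N) *\<^sub>R (p - x)"
    using N by (simp add: h_def algebra_simps add_divide_distrib)
   hence "dist (h k x) (h (Suc k) x) = norm (p - x) / N"
    using N by (simp add: dist_norm norm_minus_commute[of "h k x"])
   thus ?thesis using R[OF X(1) that] N by (simp add: divide_right_mono)
  qed
  have cross: "dist (h k x) (h (Suc k) y) < E" if "x \<in> X" "y \<in> X" for x y
   using dist_triangle[of "h k x" "h (Suc k) y" "h k y"] same[of k x y] next'[OF that(2)] that k RN by linarith
  show "h k ` Y \<union> h (Suc k) ` Y \<in> rips E Z"
   unfolding rips_def
  proof (intro CollectI conjI ballI)
   show "finite (h k ` Y \<union> h (Suc k) ` Y)" using S(3)[OF X(1)] X(2) by (auto intro: finite_subset)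
   show "h k ` Y \<union> h (Suc k) ` Y \<subseteq> Z" using hZ X(2) k by auto
   fix a b assume "a \<in> h k ` Y \<union> h (Suc k) ` Y" "b \<in> h k ` Y \<union> h (Suc k) ` Y"
   then obtain x y where xy: "x \<in> X" "y \<in> X" "a = h k x \<or> a = h (Suc k) x" "b = h k y \<or> b = h (Suc k) y"
    using X(2) by auto
   thus "dist a b < E"
    using same[of k x y] same[of "Suc k" x y] cross[of x y] cross[of y x] k \<open>\<delta> < E\<close>
    by (auto simp: dist_commute)
  qed
 qed
 have "\<exists>b \<in> chains (rips E Z) (Suc i). push (h 0) z + push (h k) z = bd b" if "k \<le> N" for k
  using that
 proof (induction k)
  case 0
  show ?case by (intro bexI[of _ 0]) (auto simp: bd_linear)
 next
  case (Suc k)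
  then obtain b where b: "b \<in> chains (rips E Z) (Suc i)" "push (h 0) z + push (h k) z = bd b" by auto
  obtain b' where b': "b' \<in> chains (rips E Z) (Suc i)" "push (h k) z + push (h (Suc k)) z = bd b'"
   using step[of k] Suc.prems by auto
  have "bd (b + b') = push (h 0) z + push (h (Suc k)) z"
   by (simp only: bd_linear b(2)[symmetric] b'(2)[symmetric] pm_cancel_mid)
  thus ?case using b b' by (intro bexI[of _ "b + b'"]) (auto intro: chains_add)
 qed
 from this[of N] obtain b where b: "b \<in> chains (rips E Z) (Suc i)" "push (h 0) z + push (h N) z = bd b" by auto
 have h0: "push (h 0) z = z" by (simp add: h_def[abs_def] push_id)
 have hN: "h N = (\<lambda>x. p)" using N by (auto simp: h_def)
 have "push (h N) z \<in> chains (Pow {p}) i" using \<K>(3) by (rule chains_push) (auto simp: hN)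
 moreover have "bd (push (h N) z) = 0" using push_bd[OF z(1), of "h N"] z(2) by (simp add: push_linear)
 moreover have "acyclic_cx (Pow {p}) TYPE('k)" by (rule cone_acyclic[of _ p]) auto
 ultimately obtain b' where b': "b' \<in> chains (Pow {p}) (Suc i)" "bd b' = push (h N) z"
  using acyclic_cxD by metis
 have "b' \<in> chains (rips E Z) (Suc i)"
  using b'(1) by (rule chains_mono) (use p E in \<open>auto simp: rips_def subset_singleton_iff\<close>)
 moreover have "bd (b + b') = z"
  using h0 by (simp only: bd_linear b'(2) b(2)[symmetric] add.assoc pm_add_self add_0_right)
 ultimately show "\<exists>b\<in>chains (rips E Z) (Suc i). bd b = z"
  using b(1) by (intro bexI[of _ "b + b'"]) (auto intro: chains_add)
qed

subsection \<open>Polyhedra\<close>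

lemma lookup_scaleR [simp]: "lookup (r *\<^sub>R x) v = r *\<^sub>R lookup x v"
proof -
 have "finite {i. r *\<^sub>R lookup x i \<noteq> 0}"
  by (rule finite_subset[of _ "keys x"]) (auto simp: in_keys_iff)
 thus ?thesis by (simp add: scaleR_poly_mapping_def)
qed

lemma abs_lookup_le_dist:
 fixes x y :: "'a \<Rightarrow>\<^sub>0 real"
 shows "\<bar>lookup x v - lookup y v\<bar> \<le> dist x y"
proof (cases "v \<in> keys x \<union> keys y")
 case True
 thus ?thesis
  unfolding dist_poly_mapping_def by (subst dist_real_def[symmetric], intro member_le_sum) auto
qed (auto simp: in_keys_iff)

text \<open>Barycentric coordinates: the vertices are basis vectors, so a point determines its
  coordinates, and their support is the smallest face that contains it.\<close>

lemma realization_iff: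
 assumes "abstract_complex \<Delta>"
 shows "x \<in> realization \<Delta> \<longleftrightarrow> keys x \<in> \<Delta> \<and> (\<forall>v. 0 \<le> lookup x v) \<and>
     (\<Sum>v\<in>keys x. lookup x v) = 1"
proof -
 let ?e = "\<lambda>v::'a. single v (1::real)"
 have inj: "inj_on ?e F" for F by (auto simp: inj_on_def dest: arg_cong[of _ _ keys])
 have look: "lookup (\<Sum>v\<in>F. u v *\<^sub>R ?e v) w = (if w \<in> F then u w else 0)" if "finite F" for F u w
 proof -
  have "lookup (\<Sum>v\<in>F. u v *\<^sub>R ?e v) w = (\<Sum>v\<in>F. if w = v then u v else 0)"
   unfolding lookup_sum by (intro sum.cong) (auto simp: lookup_single when_def)
  thus ?thesis using that by (simp add: sum.delta)
 qed
 have hull: "convex hull (?e ` F) = {\<Sum>v\<in>F. u v *\<^sub>R ?e v |u. (\<forall>v\<in>F. 0 \<le> u v) \<and> sum u F = 1}" if finF: "finite F" for F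
 proof (intro equalityI subsetI)
  fix y assume "y \<in> convex hull (?e ` F)"
  then obtain u where "\<forall>x\<in>?e ` F. 0 \<le> u x" "sum u (?e ` F) = 1" "(\<Sum>x\<in>?e ` F. u x *\<^sub>R x) = y"
   unfolding convex_hull_finite[OF finite_imageI[OF finF]] by blast
  thus "y \<in> {\<Sum>v\<in>F. u v *\<^sub>R ?e v |u. (\<forall>v\<in>F. 0 \<le> u v) \<and> sum u F = 1}"
   using finF by (intro CollectI exI[of _ "\<lambda>v. u (?e v)"]) (simp add: sum.reindex[OF inj])
 next
  fix y assume "y \<in> {\<Sum>v\<in>F. u v *\<^sub>R ?e v |u. (\<forall>v\<in>F. 0 \<le> u v) \<and> sum u F = 1}"
  then obtain u where u: "\<forall>v\<in>F. 0 \<le> u v" "sum u F = 1" "y = (\<Sum>v\<in>F. u v *\<^sub>R ?e v)" by auto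
  show "y \<in> convex hull (?e ` F)"
   unfolding u(3) by (rule convex_sum) (use u finF in \<open>auto intro: hull_inc convex_convex_hull\<close>)
 qed
 have fin: "finite F" if "F \<in> \<Delta>" for F using assms that by (auto simp: abstract_complex_def)
 show ?thesis
 proof
  assume "x \<in> realization \<Delta>"
  then obtain F u where F: "F \<in> \<Delta>" "\<forall>v\<in>F. 0 \<le> u v" "sum u F = 1" "x = (\<Sum>v\<in>F. u v *\<^sub>R ?e v)"
   using hull[OF fin] by (auto simp: realization_def)
  note l = look[OF fin[OF F(1)], of u, folded F(4)]
  have k: "keys x \<subseteq> F" by (auto simp: in_keys_iff l split: if_splits)
  hence "keys x \<in> \<Delta>" using assms F(1) unfolding abstract_complex_def by blast
  moreover have "(\<Sum>v\<in>keys x. lookup x v) = (\<Sum>v\<in>F. lookup x v)"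
   by (rule sum.mono_neutral_left) (use k fin[OF F(1)] in \<open>auto simp: in_keys_iff\<close>)
  moreover have "... = 1" using F(3) by (simp add: l)
  ultimately show "keys x \<in> \<Delta> \<and> (\<forall>v. 0 \<le> lookup x v) \<and>
     (\<Sum>v\<in>keys x. lookup x v) = 1"
   using F(2) by (auto simp: l)
 next
  assume x: "keys x \<in> \<Delta> \<and> (\<forall>v. 0 \<le> lookup x v) \<and>
     (\<Sum>v\<in>keys x. lookup x v) = 1"
  have "x = (\<Sum>v\<in>keys x. lookup x v *\<^sub>R ?e v)"
   by (rule poly_mapping_eqI) (simp add: look in_keys_iff)
  hence "x \<in> convex hull (?e ` keys x)"
   using x unfolding hull[OF finite_keys] by blast
  thus "x \<in> realization \<Delta>" using x by (auto simp: realization_def)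
 qed
qed

lemma compact_realization:
 assumes "abstract_complex \<Delta>"
 shows "compact (realization \<Delta>)"
 unfolding realization_def
 by (rule compact_UN) (use assms in \<open>auto simp: abstract_complex_def intro!: finite_imp_compact_convex_hull\<close>)

section \<open>Comparison of a complex with the small subsets of its realization\<close>

abbreviation coord :: "('a \<Rightarrow>\<^sub>0 real) => 'a => real" where
 "coord \<equiv> lookup"

abbreviation carrier :: "('a \<Rightarrow>\<^sub>0 real) => 'a set" where
 "carrier \<equiv> keys"

lemma abstract_complexD:
 assumes "abstract_complex \<Delta>"
 shows "finite \<Delta>" "{} \<in> \<Delta>" "F \<in> \<Delta> ==> finite F" "F \<in> \<Delta> ==> G \<subseteq> F ==> G \<in> \<Delta>" "down \<Delta>" "finite (\<Union>\<Delta>)"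
 using assms unfolding abstract_complex_def down_def by blast+

text \<open>The complement of the open star of \<open>J\<close>. Chains modulo it compute the local
  homology at an interior point of \<open>J\<close>.\<close>

definition avoid :: "'a set set => 'a set => 'a set set" where
 "avoid \<Delta> J = {G \<in> \<Delta>. \<not> J \<subseteq> G}"

lemma down_avoid: "down \<Delta> ==> down (avoid \<Delta> J)"
 by (fastforce simp: down_def avoid_def)

definition face_points :: "'a set set => 'a set => ('a \<Rightarrow>\<^sub>0 real) set" where
 "face_points \<Delta> F = {x \<in> realization \<Delta>. carrier x \<subseteq> F}"

lemma vertex_point:
 assumes "abstract_complex \<Delta>" "{v} \<in> \<Delta>"
 shows "single v 1 \<in> realization \<Delta>"
 using assms by (auto simp: realization_iff lookup_single when_def)

lemma segment_to_vertex:
 assumes \<Delta>: "abstract_complex \<Delta>" and y: "y \<in> realization \<Delta>" and t: "0 \<le> t" "t \<le> 1"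
  and v: "insert v (carrier y) \<in> \<Delta>"
 shows "(1 - t) *\<^sub>R y + t *\<^sub>R single v 1 \<in> realization \<Delta>" (is "?z \<in> _")
proof -
 have k: "carrier ?z \<subseteq> insert v (carrier y)"
  by (auto simp: in_keys_iff lookup_add lookup_single when_def split: if_splits)
 have fin: "finite (insert v (carrier y))" by simp
 have "(\<Sum>u\<in>carrier ?z. coord ?z u) = (\<Sum>u\<in>insert v (carrier y). coord ?z u)"
  by (rule sum.mono_neutral_left) (use k in \<open>auto simp: in_keys_iff\<close>)
 also have "... = (1 - t) * (\<Sum>u\<in>insert v (carrier y). coord y u) + t * (\<Sum>u\<in>insert v (carrier y). if u = v then 1 else 0)"
  by (simp add: lookup_add sum.distrib sum_distrib_left lookup_single when_def eq_commute[of v]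
    if_distrib[of "(*) t"] cong: if_cong)
 also have "(\<Sum>u\<in>insert v (carrier y). coord y u) = (\<Sum>u\<in>carrier y. coord y u)"
  by (rule sum.mono_neutral_right) (auto simp: in_keys_iff)
 also have "... = 1" using y by (simp add: realization_iff[OF \<Delta>])
 finally have "(\<Sum>u\<in>carrier ?z. coord ?z u) = 1" by (simp add: sum.delta[OF fin])
 moreover have "carrier ?z \<in> \<Delta>" using abstract_complexD(4)[OF \<Delta> v k] .
 ultimately show ?thesis
  using y t by (auto simp: realization_iff[OF \<Delta>] lookup_add lookup_single when_def)
qed

text \<open>Stands in for iterated barycentric subdivision: a chain map that fills each face with
  simplices of diameter below \<open>E\<close> inside that face.\<close>

definition subdiv :: "real => 'a set set => ('a set => ('a \<Rightarrow>\<^sub>0 real, 'k::char_two) chain) => bool" where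
 "subdiv E \<Delta> s \<longleftrightarrow> s {} = single {} 1 \<and>
  (\<forall>F\<in>\<Delta>. s F \<in> chains (rips E (face_points \<Delta> F)) (card F) \<and> bd (s F) = lin s (bd1 F))"

text \<open>The points of a closed face are star-shaped about each of its vertices, so they give
  acyclic carriers.\<close>

lemma subdiv_exists:
 assumes \<Delta>: "abstract_complex \<Delta>" and E: "0 < E"
 obtains s :: "'a set => ('a \<Rightarrow>\<^sub>0 real, 'k::char_two) chain" where "subdiv E \<Delta> s"
proof -
 let ?Car = "\<lambda>F. rips E (face_points \<Delta> F)"
 obtain D :: "'a set => ('a \<Rightarrow>\<^sub>0 real, 'k) chain" where D: "D {} = single {} 1"
  "\<And>X. X \<in> \<Delta> ==> D X \<in> chains (?Car X) (card X + 0)"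
  "\<And>X. X \<in> \<Delta> ==> bd (D X) = (\<lambda>X. 0) X + lin D (bd1 X)"
 proof (rule acyclic_carrier[of \<Delta> ?Car "\<lambda>X. 0" 0 "single {} (1::'k)"])
  show "down \<Delta>" by (rule abstract_complexD[OF \<Delta>])
  show "?Car Y \<subseteq> ?Car X" if "Y \<subseteq> X" for X Y
   by (rule rips_mono) (use that in \<open>auto simp: face_points_def\<close>)
  show "bd (single {} (1::'k)) = (\<lambda>X. 0) {}" by (simp add: bd_linear bd1_def)
  show "single {} (1::'k) \<in> chains (?Car {}) 0" by (auto intro!: chains_single simp: rips_def)
  fix X assume X: "X \<in> \<Delta>"
  show "finite X" using abstract_complexD[OF \<Delta>] X by auto
  assume "X \<noteq> {}"
  then obtain v where v: "v \<in> X" by auto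
  hence vD: "{v} \<in> \<Delta>" using abstract_complexD(4)[OF \<Delta> X] by auto
  show "acyclic_cx (?Car X) TYPE('k)"
  proof (rule rips_star_acyclic[OF _ _ E, of "single v 1"])
   show "single v 1 \<in> face_points \<Delta> X"
    using vertex_point[OF \<Delta> vD] v by (simp add: face_points_def)
   fix x and t :: real assume x: "x \<in> face_points \<Delta> X" and t: "0 \<le> t" "t \<le> 1"
   have "insert v (carrier x) \<in> \<Delta>"
    by (rule abstract_complexD(4)[OF \<Delta> X]) (use x v in \<open>auto simp: face_points_def\<close>)
   hence "(1 - t) *\<^sub>R x + t *\<^sub>R single v 1 \<in> realization \<Delta>"
    using x t by (intro segment_to_vertex[OF \<Delta>]) (auto simp: face_points_def)
   thus "(1 - t) *\<^sub>R x + t *\<^sub>R single v 1 \<in> face_points \<Delta> X"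
    using x v by (auto simp: face_points_def in_keys_iff lookup_add lookup_single when_def split: if_splits)
  qed
 qed (auto simp: bd_linear)
 thus thesis by (intro that[of D]) (auto simp: subdiv_def)
qed

lemma subdiv_bd:
 assumes "subdiv E \<Delta> s" "c \<in> chains \<Delta> i"
 shows "bd (lin s c) = lin s (bd c)"
 using homotopy_chain[of \<Delta> s "\<lambda>X. 0" c i] assms by (simp add: subdiv_def)

text \<open>The points outside the neighbourhood on which all coordinates of \<open>J\<close> exceed
  the threshold \<open>w\<close>. In the realization and for the zero threshold, these are the
  points of the subcomplex \<open>avoid \<Delta> J\<close>.\<close>

definition bad :: "'a set => ('a => real) => ('a \<Rightarrow>\<^sub>0 real) => bool" where
 "bad J w x \<longleftrightarrow> (\<exists>v\<in>J. coord x v \<le> w v)"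

text \<open>The relative complex of a face \<open>J\<close>; for \<open>J = {}\<close> it is void, so that it does not even contain the
 empty simplex and the relative chains are the augmented chains.\<close>

definition bad_rips :: "real => 'a set set => 'a set => ('a => real) => ('a \<Rightarrow>\<^sub>0 real) set set" where
 "bad_rips E \<Delta> J w = {X \<in> rips E (realization \<Delta>). J \<noteq> {} \<and> (\<forall>x\<in>X. bad J w x)}"

lemma subdiv_chains:
 assumes "subdiv E \<Delta> s"
 shows "c \<in> chains \<Delta> i ==> lin s c \<in> chains (rips E (realization \<Delta>)) i"
  and "c \<in> chains (avoid \<Delta> J) i ==> (\<And>v. 0 \<le> w v) ==> lin s c \<in> chains (bad_rips E \<Delta> J w) i"
proof -
 have r: "rips E (face_points \<Delta> F) \<subseteq> rips E (realization \<Delta>)" for F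
  by (rule rips_mono) (auto simp: face_points_def)
 show "lin s c \<in> chains (rips E (realization \<Delta>)) i" if "c \<in> chains \<Delta> i"
  using that by (rule chains_lin) (use assms r in \<open>auto simp: subdiv_def intro: chains_mono\<close>)
 show "lin s c \<in> chains (bad_rips E \<Delta> J w) i" if c: "c \<in> chains (avoid \<Delta> J) i" and w: "\<And>v. 0 \<le> w v"
  using c
 proof (rule chains_lin)
  fix F assume F: "F \<in> avoid \<Delta> J" "card F = i"
  have "rips E (face_points \<Delta> F) \<subseteq> bad_rips E \<Delta> J w"
  proof
   fix X assume X: "X \<in> rips E (face_points \<Delta> F)"
   obtain v where v: "v \<in> J" "v \<notin> F" using F by (auto simp: avoid_def)
   have "coord x v \<le> w v" if "x \<in> X" for x
   proof -
    have "v \<notin> carrier x" using X that v by (auto simp: rips_def face_points_def)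
    thus ?thesis using w by (simp add: in_keys_iff)
   qed
   thus "X \<in> bad_rips E \<Delta> J w"
    using X r v by (auto simp: bad_rips_def bad_def)
  qed
  thus "s F \<in> chains (bad_rips E \<Delta> J w) i"
   using assms F by (auto simp: subdiv_def avoid_def intro: chains_mono)
 qed
qed

text \<open>A simplicial approximation: the vertex chosen at \<open>x\<close> is above its threshold
  at all points near \<open>x\<close>. Hence the vertices chosen on a small set lie in the carrier
  of each of its points and span a face, and no vertex is chosen at which some point of the set is
  below the threshold.\<close>

definition vertex_map :: "real => 'a set set => ('a => real) => (('a \<Rightarrow>\<^sub>0 real) => 'a) => bool" where
 "vertex_map E \<Delta> w \<Phi> \<longleftrightarrow>
  (\<forall>x\<in>realization \<Delta>. \<forall>y\<in>realization \<Delta>. dist x y < E --> w (\<Phi> x) < coord y (\<Phi> x))"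

lemma realization_sum:
 assumes "abstract_complex \<Delta>" "x \<in> realization \<Delta>"
 shows "(\<Sum>v\<in>\<Union>\<Delta>. coord x v) = 1"
proof -
 have "(\<Sum>v\<in>\<Union>\<Delta>. coord x v) = (\<Sum>v\<in>carrier x. coord x v)"
  by (rule sum.mono_neutral_right) (use assms abstract_complexD[OF assms(1)] in \<open>auto simp: in_keys_iff realization_iff\<close>)
 thus ?thesis using assms by (simp add: realization_iff)
qed

text \<open>Pigeonhole: the coordinates sum to 1, so they cannot all stay below
  \<open>w v + E\<close> if these bounds sum to at most 1. Coordinates are 1-Lipschitz, which turns
  the margin \<open>E\<close> into stability over distances less than \<open>E\<close>.\<close>

lemma vertex_map_exists:
 fixes w :: "'a => real" and E :: real
 assumes \<Delta>: "abstract_complex \<Delta>" and E: "E * card (\<Union>\<Delta>) \<le> 1 - (\<Sum>v\<in>\<Union>\<Delta>. w v)"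
 obtains \<Phi> where "vertex_map E \<Delta> w \<Phi>"
proof -
 have "\<exists>v\<in>\<Union>\<Delta>. E \<le> coord x v - w v" if x: "x \<in> realization \<Delta>" for x
 proof (rule ccontr)
  assume neg: "\<not> (\<exists>v\<in>\<Union>\<Delta>. E \<le> coord x v - w v)"
  have ne: "\<Union>\<Delta> \<noteq> {}" using realization_sum[OF \<Delta> x] by (metis sum.empty zero_neq_one)
  have "(\<Sum>v\<in>\<Union>\<Delta>. coord x v - w v) < (\<Sum>v\<in>\<Union>\<Delta>. E)"
   using abstract_complexD(6)[OF \<Delta>] ne by (rule sum_strict_mono) (metis neg not_le)
  also have "... \<le> 1 - (\<Sum>v\<in>\<Union>\<Delta>. w v)" using E by (simp add: mult.commute)
  finally show False by (simp add: sum_subtractf realization_sum[OF \<Delta> x])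
 qed
 then obtain \<Phi> where \<Phi>: "\<And>x. x \<in> realization \<Delta> ==> E \<le> coord x (\<Phi> x) - w (\<Phi> x)" by metis
 have "vertex_map E \<Delta> w \<Phi>"
  unfolding vertex_map_def
 proof (intro ballI impI)
  fix x y assume "x \<in> realization \<Delta>" "y \<in> realization \<Delta>" "dist x y < E"
  thus "w (\<Phi> x) < coord y (\<Phi> x)"
   using \<Phi>[of x] abs_lookup_le_dist[of x "\<Phi> x" y] by linarith
 qed
 thus thesis by (rule that)
qed

context
 fixes E :: real and \<Delta> :: "'a set set" and w :: "'a => real" and \<Phi> :: "('a \<Rightarrow>\<^sub>0 real) => 'a"
 assumes \<Delta>: "abstract_complex \<Delta>" and E: "0 < E" and w: "\<And>v. 0 \<le> w v"
  and \<Phi>: "vertex_map E \<Delta> w \<Phi>"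
begin

lemma vertex_map_large:
 assumes "X \<in> rips E (realization \<Delta>)" "x \<in> X" "y \<in> X"
 shows "w (\<Phi> x) < coord y (\<Phi> x)" "\<Phi> x \<in> carrier y"
proof -
 show *: "w (\<Phi> x) < coord y (\<Phi> x)"
  using assms \<Phi> by (auto simp: vertex_map_def rips_def subset_iff)
 show "\<Phi> x \<in> carrier y" using * w[of "\<Phi> x"] by (auto simp: in_keys_iff)
qed

lemma vertex_map_carrier: "x \<in> realization \<Delta> ==> \<Phi> x \<in> carrier x"
 using vertex_map_large[of "{x}" x x] E by (simp add: rips_def)

lemma vertex_map_face:
 assumes "X \<in> rips E (realization \<Delta>)"
 shows "\<Phi> ` X \<in> \<Delta>"
proof (cases "X = {}")
 case False
 then obtain y where y: "y \<in> X" by auto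
 hence "carrier y \<in> \<Delta>" using assms realization_iff[OF \<Delta>] by (auto simp: rips_def)
 moreover have "\<Phi> ` X \<subseteq> carrier y" using vertex_map_large(2)[OF assms _ y] by auto
 ultimately show ?thesis using abstract_complexD(4)[OF \<Delta>] by auto
qed (use abstract_complexD[OF \<Delta>] in auto)

lemma vertex_map_avoid:
 assumes "X \<in> bad_rips E \<Delta> J w"
 shows "\<Phi> ` X \<in> avoid \<Delta> J"
proof -
 have X: "X \<in> rips E (realization \<Delta>)" "J \<noteq> {}" using assms by (auto simp: bad_rips_def)
 have "\<not> J \<subseteq> \<Phi> ` X"
 proof (cases "X = {}")
  case False
  then obtain y where y: "y \<in> X" by auto
  then obtain v where v: "v \<in> J" "coord y v \<le> w v" using assms by (auto simp: bad_rips_def bad_def)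
  hence "v \<notin> \<Phi> ` X" using vertex_map_large(1)[OF X(1) _ y] by force
  thus ?thesis using v by auto
 qed (use X in auto)
 thus ?thesis using vertex_map_face[OF X(1)] by (simp add: avoid_def)
qed

text \<open>The round trip and the identity both send a face to chains on its own vertices, and a
  full simplex is an acyclic carrier.\<close>

lemma vertex_map_subdiv_homotopy:
 assumes s: "subdiv E' \<Delta> (s :: 'a set => ('a \<Rightarrow>\<^sub>0 real, 'k::char_two) chain)"
 obtains D where "\<And>\<L> c i. down \<L> ==> \<L> \<subseteq> \<Delta> ==> c \<in> chains \<L> i ==> lin D c \<in> chains \<L> (Suc i)"
  "\<And>c i. c \<in> chains \<Delta> i ==> bd (lin D c) = push \<Phi> (lin s c) + c + lin D (bd c)"
proof -
 let ?r = "\<lambda>F. push \<Phi> (s F) + single F (1::'k)"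
 obtain D where D: "D {} = 0" "\<And>X. X \<in> \<Delta> ==> D X \<in> chains (Pow X) (card X + 1)"
  "\<And>X. X \<in> \<Delta> ==> bd (D X) = ?r X + lin D (bd1 X)"
 proof (rule acyclic_carrier[of \<Delta> Pow ?r 1 0])
  show "bd 0 = ?r {}" using s by (simp add: subdiv_def push_def bd_linear)
  show "Pow Y \<subseteq> Pow X" if "Y \<subseteq> X" for X Y :: "'a set" using that by auto
  fix X assume X: "X \<in> \<Delta>"
  show fin: "finite X" using abstract_complexD[OF \<Delta>] X by auto
  have sX: "s X \<in> chains (rips E' (face_points \<Delta> X)) (card X)" "bd (s X) = lin s (bd1 X)"
   using s X by (auto simp: subdiv_def)
  have "push \<Phi> (s X) \<in> chains (Pow X) (card X)"
   using sX(1) by (rule chains_push) (use vertex_map_carrier in \<open>auto simp: rips_def face_points_def\<close>)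
  thus "?r X \<in> chains (Pow X) (card X + 1 - 1)"
   using fin by (auto intro!: chains_add chains_single)
  have "bd (?r X) = push \<Phi> (bd (s X)) + bd1 X"
   by (simp add: bd_linear push_bd[OF sX(1)])
  also have "... = lin ?r (bd1 X)"
   by (simp add: sX(2) lin_fun_add lin_ident) (simp add: push_def lin_lin)
  finally show "bd (?r X) = lin ?r (bd1 X)" .
  assume "X \<noteq> {}"
  then obtain v where "v \<in> X" by auto
  thus "acyclic_cx (Pow X) TYPE('k)" by (intro cone_acyclic[of _ v]) auto
 qed (use abstract_complexD[OF \<Delta>] in \<open>auto simp: down_def\<close>)
 show thesis
 proof
  show "lin D c \<in> chains \<L> (Suc i)" if "down \<L>" "\<L> \<subseteq> \<Delta>" "c \<in> chains \<L> i" for \<L> c i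
   using that(3)
  proof (rule chains_lin)
   fix X assume X: "X \<in> \<L>" "card X = i"
   have "Pow X \<subseteq> \<L>" using X that by (auto simp: down_def)
   thus "D X \<in> chains \<L> (Suc i)" using D(2)[of X] X that by (auto intro: chains_mono)
  qed
  show "bd (lin D c) = push \<Phi> (lin s c) + c + lin D (bd c)" if "c \<in> chains \<Delta> i" for c i
   using homotopy_chain[OF D(3) that] by (simp add: lin_fun_add lin_ident) (simp add: push_def lin_lin)
 qed
qed

text \<open>The other round trip. Its homotopy must keep bad sets bad, so the carrier consists of
  points of the face of \<open>x\<close> that inherit every threshold in \<open>J\<close> which
  \<open>x\<close> fails to exceed.\<close>

lemma subdiv_vertex_map_homotopy:
 assumes s: "subdiv E \<Delta> (s :: 'a set => ('a \<Rightarrow>\<^sub>0 real, 'k::char_two) chain)"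
 obtains D where "\<And>c i. c \<in> chains (rips E (realization \<Delta>)) i ==> lin D c \<in> chains (rips E (realization \<Delta>)) (Suc i)"
  "\<And>c i. c \<in> chains (bad_rips E \<Delta> J w) i ==> lin D c \<in> chains (bad_rips E \<Delta> J w) (Suc i)"
  "\<And>c i. c \<in> chains (rips E (realization \<Delta>)) i ==> bd (lin D c) = lin s (push \<Phi> c) + c + lin D (bd c)"
proof -
 let ?R = "rips E (realization \<Delta>)"
 define C where "C x = {y \<in> realization \<Delta>. carrier y \<subseteq> carrier x \<and> (\<forall>v\<in>J. coord x v \<le> w v --> coord y v \<le> w v)}" for x
 let ?Car = "\<lambda>X. rips E (\<Union>x\<in>X. C x)"
 let ?r = "\<lambda>X. lin s (push \<Phi> (single X (1::'k))) + single X 1"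
 have finR: "finite X" if "X \<in> ?R" for X using that by (rule rips_finite)
 have CarR: "?Car X \<subseteq> ?R" for X by (rule rips_mono) (auto simp: C_def)
 have self: "x \<in> C x" if "x \<in> realization \<Delta>" for x using that by (auto simp: C_def)
 obtain D where D: "D {} = 0" "\<And>X. X \<in> ?R ==> D X \<in> chains (?Car X) (card X + 1)"
  "\<And>X. X \<in> ?R ==> bd (D X) = ?r X + lin D (bd1 X)"
 proof (rule acyclic_carrier[of ?R ?Car ?r 1 0])
  show "bd 0 = ?r {}" using s by (simp add: subdiv_def push_def bd_linear)
  show "?Car Y \<subseteq> ?Car X" if "Y \<subseteq> X" for X Y by (rule rips_mono) (use that in auto)
  fix X assume X: "X \<in> ?R"
  have fX: "\<Phi> ` X \<in> \<Delta>" using vertex_map_face[OF X] .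
  have sX: "s (\<Phi> ` X) \<in> chains (rips E (face_points \<Delta> (\<Phi> ` X))) (card (\<Phi> ` X))"
   using s fX by (auto simp: subdiv_def)
  have pX: "push \<Phi> (single X (1::'k)) \<in> chains \<Delta> (card X)"
   by (rule chains_push[of _ ?R]) (use X finR vertex_map_face in \<open>auto intro!: chains_single\<close>)
  have "bd (?r X) = lin s (push \<Phi> (bd1 X)) + bd1 X"
   using subdiv_bd[OF s pX] by (simp add: bd_linear push_bd1[OF finR[OF X]])
  also have "... = lin ?r (bd1 X)"
   by (simp add: lin_fun_add lin_ident) (simp add: push_def lin_lin)
  finally show "bd (?r X) = lin ?r (bd1 X)" .
  assume ne: "X \<noteq> {}"
  then obtain x0 where x0: "x0 \<in> X" by auto
  have "face_points \<Delta> (\<Phi> ` X) \<subseteq> C x0"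
  proof
   fix y assume y: "y \<in> face_points \<Delta> (\<Phi> ` X)"
   have "coord y v \<le> w v" if v: "coord x0 v \<le> w v" for v
   proof -
    have "v \<notin> \<Phi> ` X" using v vertex_map_large(1)[OF X _ x0] by force
    hence "v \<notin> carrier y" using y by (auto simp: face_points_def)
    thus ?thesis using w by (simp add: in_keys_iff)
   qed
   moreover have "carrier y \<subseteq> carrier x0" using y vertex_map_large(2)[OF X _ x0] by (auto simp: face_points_def)
   ultimately show "y \<in> C x0" using y by (auto simp: C_def face_points_def)
  qed
  hence "rips E (face_points \<Delta> (\<Phi> ` X)) \<subseteq> ?Car X"
   using x0 by (intro rips_mono) auto
  hence 1: "lin s (push \<Phi> (single X (1::'k))) \<in> chains (?Car X) (card X)"
   using sX by (auto simp: push_def card_image intro: chains_mono)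
  have "X \<subseteq> (\<Union>x\<in>X. C x)" using self X by (auto simp: rips_def)
  hence "X \<in> ?Car X" using X by (auto simp: rips_def)
  thus "?r X \<in> chains (?Car X) (card X + 1 - 1)"
   using 1 finR[OF X] by (auto intro!: chains_add chains_single)
  \<comment> \<open>The vertex \<open>\<Phi> x0\<close> is above its threshold at every point of
    \<open>X\<close>. Moving towards it shrinks all other coordinates, so the inherited bounds
    survive and the union of the sets \<open>C x\<close> is star-shaped about it.\<close>
  let ?p = "single (\<Phi> x0) (1::real)"
  have "{\<Phi> x0} \<in> \<Delta>" using abstract_complexD(4)[OF \<Delta> fX] x0 by auto
  hence pR: "?p \<in> realization \<Delta>" by (rule vertex_point[OF \<Delta>])
  show "acyclic_cx (?Car X) TYPE('k)"
  proof (rule rips_star_acyclic[OF _ _ E, of ?p])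
   have "?p \<in> C x0"
    using pR vertex_map_large[OF X x0 x0] w by (fastforce simp: C_def lookup_single when_def)
   thus "?p \<in> (\<Union>x\<in>X. C x)" using x0 by auto
   fix y and t :: real assume "y \<in> (\<Union>x\<in>X. C x)" and t: "0 \<le> t" "t \<le> 1"
   then obtain x where x: "x \<in> X" "y \<in> C x" by auto
   let ?z = "(1 - t) *\<^sub>R y + t *\<^sub>R ?p"
   have px: "\<Phi> x0 \<in> carrier x" "w (\<Phi> x0) < coord x (\<Phi> x0)" using vertex_map_large[OF X x0 x(1)] by auto
   have "carrier x \<in> \<Delta>" using x(1) X realization_iff[OF \<Delta>] by (auto simp: rips_def)
   hence "?z \<in> realization \<Delta>"
    using x px t by (intro segment_to_vertex[OF \<Delta>]) (auto simp: C_def intro: abstract_complexD(4)[OF \<Delta>])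
   moreover have "carrier ?z \<subseteq> carrier x"
    using x px by (auto simp: C_def in_keys_iff lookup_add lookup_single when_def split: if_splits)
   moreover have "coord ?z v \<le> w v" if "v \<in> J" "coord x v \<le> w v" for v
   proof -
    have "v \<noteq> \<Phi> x0" using that px by auto
    hence "coord ?z v = (1 - t) * coord y v" by (simp add: lookup_add lookup_single when_def)
    also have "... \<le> 1 * w v"
     by (rule mult_mono) (use t x that w realization_iff[OF \<Delta>, of y] in \<open>auto simp: C_def\<close>)
    finally show ?thesis by simp
   qed
   ultimately have "?z \<in> C x" by (auto simp: C_def)
   thus "?z \<in> (\<Union>x\<in>X. C x)" using x(1) by auto
  qed
 qed (use finR in auto)
 show thesis
 proof
  show "lin D c \<in> chains ?R (Suc i)" if "c \<in> chains ?R i" for c i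
   using that by (rule chains_lin) (use D(2) CarR in \<open>fastforce intro: chains_mono\<close>)
  show "lin D c \<in> chains (bad_rips E \<Delta> J w) (Suc i)" if "c \<in> chains (bad_rips E \<Delta> J w) i" for c i
   using that
  proof (rule chains_lin)
   fix X assume X: "X \<in> bad_rips E \<Delta> J w" "card X = i"
   have "?Car X \<subseteq> bad_rips E \<Delta> J w"
   proof
    fix Y assume Y: "Y \<in> ?Car X"
    have "bad J w y" if "y \<in> Y" for y
    proof -
     have "y \<in> (\<Union>x\<in>X. C x)" using Y that unfolding rips_def by blast
     then obtain x where "x \<in> X" "y \<in> C x" by blast
     thus ?thesis using X(1) by (auto simp: bad_rips_def bad_def C_def)
    qed
    thus "Y \<in> bad_rips E \<Delta> J w" using Y X(1) CarR[of X] by (auto simp: bad_rips_def)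
   qed
   thus "D X \<in> chains (bad_rips E \<Delta> J w) (Suc i)"
    using D(2)[of X] X by (auto simp: bad_rips_def intro: chains_mono)
  qed
  show "bd (lin D c) = lin s (push \<Phi> c) + c + lin D (bd c)" if "c \<in> chains ?R i" for c i
   using homotopy_chain[OF D(3) that] by (simp add: lin_fun_add lin_ident) (simp add: push_def lin_lin)
 qed
qed

end

section \<open>Relative homology under homeomorphisms\<close>

definition rel_cycle :: "'a set set => 'a set => nat => ('a, 'k::char_two) chain => bool" where
 "rel_cycle \<Delta> J i z \<longleftrightarrow> z \<in> chains \<Delta> i \<and> bd z \<in> chains (avoid \<Delta> J) (i - 1)"

definition rel_bounds :: "'a set set => 'a set => nat => ('a, 'k::char_two) chain => bool" where
 "rel_bounds \<Delta> J i z \<longleftrightarrow> (\<exists>b\<in>chains \<Delta> (Suc i). \<exists>l\<in>chains (avoid \<Delta> J) i. z = bd b + l)"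

text \<open>A linear map that is injective on relative homology in all degrees. Such maps in both
  directions carry over vanishing and one-dimensionality without quotient spaces.\<close>

definition rel_inj :: "'k::char_two itself => 'a set set => 'a set => 'b set set => 'b set => bool" where
 "rel_inj (_::'k itself) \<Delta> J C t \<longleftrightarrow> (\<exists>T :: ('a,'k) chain => ('b,'k) chain.
  (\<forall>a b c d. T (sc a c + sc b d) = sc a (T c) + sc b (T d)) \<and>
  (\<forall>i z. rel_cycle \<Delta> J i z --> rel_cycle C t i (T z) \<and>
    (rel_bounds C t i (T z) --> rel_bounds \<Delta> J i z)))"

lemma pm_move_mid:
 assumes "a = b + c + (d::'b \<Rightarrow>\<^sub>0 'k::char_two)"
 shows "c = a + b + d"
proof -
 have "a + b + d = c + ((b + d) + (b + d))" unfolding assms by (simp only: ac_simps)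
 thus ?thesis by (simp only: pm_add_self add_0_right)
qed

lemma mesh_exists:
 assumes "s < (1::real)"
 obtains E where "E > 0" "E * real n \<le> 1 - s"
proof
 show "(1 - s) / (real n + 1) > 0" using assms by simp
 show "(1 - s) / (real n + 1) * real n \<le> 1 - s" using assms by (simp add: field_simps)
qed

text \<open>The map subdivides, applies \<open>f\<close> and approximates by vertices. Conversely, a
  bounding chain in \<open>C\<close> is subdivided, corrected by a homotopy, pulled back by
  \<open>g\<close> and approximated in \<open>\<Delta>\<close>, where the round trip is homotopic to
  the identity. \<open>A1\<close> and \<open>A2\<close> interleave the thresholds 0,
  \<open>w'\<close> and \<open>w\<close>, so that the relative parts stay bad at every
  stage.\<close>

lemma rel_inj_homeo:
 fixes \<Delta> :: "'a set set" and C :: "'b set set"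
 assumes \<Delta>: "abstract_complex \<Delta>" and C: "abstract_complex C"
  and hom: "homeomorphism (realization \<Delta>) (realization C) f g"
  and w: "\<And>v. 0 \<le> w v" "(\<Sum>v\<in>\<Union>\<Delta>. w v) < 1"
  and w': "\<And>v. 0 \<le> w' v" "(\<Sum>v\<in>\<Union>C. w' v) < 1"
  and st: "J = {} \<longleftrightarrow> t = {}"
  and A1: "\<And>x. x \<in> realization \<Delta> ==> bad J (\<lambda>_. 0) x ==> bad t w' (f x)"
  and A2: "\<And>y. y \<in> realization C ==> bad t w' y ==> bad J w (g y)"
 shows "rel_inj TYPE('k::char_two) \<Delta> J C t"
proof -
 note pos = mesh_exists
 obtain E :: real where E: "E > 0" "E * card (\<Union>\<Delta>) \<le> 1 - (\<Sum>v\<in>\<Union>\<Delta>. w v)" using pos[OF w(2)] .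
 have uf: "uniformly_continuous_on (realization \<Delta>) f" and ug: "uniformly_continuous_on (realization C) g"
  using compact_uniformly_continuous[OF homeomorphism_cont1[OF hom] compact_realization[OF \<Delta>]]
   compact_uniformly_continuous[OF homeomorphism_cont2[OF hom] compact_realization[OF C]] .
 obtain \<delta> where \<delta>: "\<delta> > 0" "\<And>x y. x \<in> realization C ==> y \<in> realization C ==> dist y x < \<delta> ==> dist (g y) (g x) < E"
  using ug[unfolded uniformly_continuous_on_def, rule_format, OF E(1)] by blast
 obtain E0 :: real where E0: "E0 > 0" "E0 * card (\<Union>C) \<le> 1 - (\<Sum>v\<in>\<Union>C. w' v)" using pos[OF w'(2)] .
 \<comment> \<open>The mesh sizes are chosen backwards: \<open>E\<close> suits the approximation in
   \<open>\<Delta>\<close>, \<open>E'\<close> suits that in \<open>C\<close> and is carried below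
   \<open>E\<close> by \<open>g\<close>, and \<open>E1\<close> is carried below \<open>E'\<close> by
   \<open>f\<close>.\<close>
 define E' where "E' = min \<delta> E0"
 have E': "E' > 0" "E' \<le> \<delta>" using \<delta> E0 by (auto simp: E'_def)
 have "E' * card (\<Union>C) \<le> E0 * card (\<Union>C)" unfolding E'_def by (intro mult_right_mono) auto
 hence E'2: "E' * card (\<Union>C) \<le> 1 - (\<Sum>v\<in>\<Union>C. w' v)" using E0 by linarith
 obtain \<delta>' where \<delta>': "\<delta>' > 0" "\<And>x y. x \<in> realization \<Delta> ==> y \<in> realization \<Delta> ==> dist y x < \<delta>' ==> dist (f y) (f x) < E'"
  using uf[unfolded uniformly_continuous_on_def, rule_format, OF E'(1)] by blast
 define E1 where "E1 = min \<delta>' E"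
 have E1: "E1 > 0" "E1 \<le> E" "E1 \<le> \<delta>'" using \<delta>' E by (auto simp: E1_def)
 let ?X = "realization \<Delta>" and ?Y = "realization C"
 obtain \<Phi> where \<Phi>: "vertex_map E \<Delta> w \<Phi>" using vertex_map_exists[OF \<Delta> E(2)] .
 obtain \<Psi> where \<Psi>: "vertex_map E' C w' \<Psi>" using vertex_map_exists[OF C E'2] .
 obtain s :: "'a set => ('a \<Rightarrow>\<^sub>0 real, 'k) chain" where s: "subdiv E1 \<Delta> s" using subdiv_exists[OF \<Delta> E1(1)] .
 obtain s' :: "'b set => ('b \<Rightarrow>\<^sub>0 real, 'k) chain" where s': "subdiv E' C s'" using subdiv_exists[OF C E'(1)] .
 obtain D1 where D1: "\<And>\<L> c i. down \<L> ==> \<L> \<subseteq> \<Delta> ==> c \<in> chains \<L> i ==> lin D1 c \<in> chains \<L> (Suc i)"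
  "\<And>c i. c \<in> chains \<Delta> i ==> bd (lin D1 c) = push \<Phi> (lin s c) + c + lin D1 (bd c)"
 proof (rule vertex_map_subdiv_homotopy[OF \<Delta> E(1) w(1) \<Phi> s], goal_cases)
  case (1 D)
  show thesis by (rule that[of D]) (use 1 in simp_all)
 qed
 obtain D2 where D2: "\<And>c i. c \<in> chains (rips E' ?Y) i ==> lin D2 c \<in> chains (rips E' ?Y) (Suc i)"
  "\<And>c i. c \<in> chains (bad_rips E' C t w') i ==> lin D2 c \<in> chains (bad_rips E' C t w') (Suc i)"
  "\<And>c i. c \<in> chains (rips E' ?Y) i ==> bd (lin D2 c) = lin s' (push \<Psi> c) + c + lin D2 (bd c)"
 proof (rule subdiv_vertex_map_homotopy[OF C E'(1) w'(1) \<Psi> s', where J = t], goal_cases)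
  case (1 D)
  show thesis by (rule that[of D]) (use 1 in simp_all)
 qed
 have fX: "f x \<in> ?Y" if "x \<in> ?X" for x using that hom by (auto simp: homeomorphism_def)
 have gY: "g x \<in> ?X" if "x \<in> ?Y" for x using that hom by (auto simp: homeomorphism_def)
 have gf: "g (f x) = x" if "x \<in> ?X" for x using that hom by (auto simp: homeomorphism_def)
 have f_rips: "f ` X \<in> rips E' ?Y" if X: "X \<in> rips E1 ?X" for X
 proof -
  have "dist (f x) (f y) < E'" if "x \<in> X" "y \<in> X" for x y
  proof -
   have "x \<in> ?X" "y \<in> ?X" "dist x y < E1" using X that unfolding rips_def by blast+
   thus ?thesis using \<delta>'(2)[of y x] E1(3) by linarith
  qed
  moreover have "f ` X \<subseteq> ?Y" using X fX unfolding rips_def by blast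
  ultimately show ?thesis using X unfolding rips_def by blast
 qed
 have g_rips: "g ` X \<in> rips E ?X" if X: "X \<in> rips E' ?Y" for X
 proof -
  have "dist (g x) (g y) < E" if "x \<in> X" "y \<in> X" for x y
  proof -
   have "x \<in> ?Y" "y \<in> ?Y" "dist x y < E'" using X that unfolding rips_def by blast+
   thus ?thesis using \<delta>(2)[of y x] E'(2) by linarith
  qed
  moreover have "g ` X \<subseteq> ?X" using X gY unfolding rips_def by blast
  ultimately show ?thesis using X unfolding rips_def by blast
 qed
 have f_bad: "f ` X \<in> bad_rips E' C t w'" if "X \<in> bad_rips E1 \<Delta> J (\<lambda>_. 0)" for X
 proof -
  have X: "X \<in> rips E1 ?X" "J \<noteq> {}" "\<And>x. x \<in> X ==> bad J (\<lambda>_. 0) x" "X \<subseteq> ?X"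
   using that unfolding bad_rips_def rips_def by blast+
  thus ?thesis using f_rips[OF X(1)] A1 st unfolding bad_rips_def by blast
 qed
 have g_bad: "g ` X \<in> bad_rips E \<Delta> J w" if "X \<in> bad_rips E' C t w'" for X
 proof -
  have X: "X \<in> rips E' ?Y" "t \<noteq> {}" "\<And>x. x \<in> X ==> bad t w' x" "X \<subseteq> ?Y"
   using that unfolding bad_rips_def rips_def by blast+
  thus ?thesis using g_rips[OF X(1)] A2 st unfolding bad_rips_def by blast
 qed
 note face\<Phi> = vertex_map_face[OF \<Delta> E(1) w(1) \<Phi>] vertex_map_avoid[OF \<Delta> E(1) w(1) \<Phi>]
 note face\<Psi> = vertex_map_face[OF C E'(1) w'(1) \<Psi>] vertex_map_avoid[OF C E'(1) w'(1) \<Psi>]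
 define Y where "Y z = push f (lin s z)" for z :: "('a,'k) chain"
 define T where "T z = push \<Psi> (Y z)" for z
 have Yc: "Y z \<in> chains (rips E' ?Y) i" if "z \<in> chains \<Delta> i" for z i
  unfolding Y_def using subdiv_chains(1)[OF s that] f_rips by (rule chains_push)
 have Yb: "Y z \<in> chains (bad_rips E' C t w') i" if "z \<in> chains (avoid \<Delta> J) i" for z i
 proof -
  have "lin s z \<in> chains (bad_rips E1 \<Delta> J (\<lambda>_. 0)) i" by (rule subdiv_chains(2)[OF s that]) simp
  thus ?thesis unfolding Y_def by (rule chains_push) (rule f_bad)
 qed
 have bdY: "bd (Y z) = Y (bd z)" if "z \<in> chains \<Delta> i" for z i
  unfolding Y_def using push_bd[OF subdiv_chains(1)[OF s that], of f] subdiv_bd[OF s that] by simp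
 have bdT: "bd (T z) = T (bd z)" if "z \<in> chains \<Delta> i" for z i
  unfolding T_def using push_bd[OF Yc[OF that], of \<Psi>] bdY[OF that] by simp
 have bad_sub: "bad_rips E' C t w' \<subseteq> rips E' ?Y" by (auto simp: bad_rips_def)
 have "rel_cycle C t i (T z) \<and> (rel_bounds C t i (T z) --> rel_bounds \<Delta> J i z)" if z: "rel_cycle \<Delta> J i z" for i z
 proof (intro conjI impI)
  have z1: "z \<in> chains \<Delta> i" "bd z \<in> chains (avoid \<Delta> J) (i - 1)" using z by (auto simp: rel_cycle_def)
  have "T z \<in> chains C i" unfolding T_def using Yc[OF z1(1)] face\<Psi>(1) by (rule chains_push)
  moreover have "T (bd z) \<in> chains (avoid C t) (i - 1)" unfolding T_def using Yb[OF z1(2)] face\<Psi>(2) by (rule chains_push)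
  ultimately show "rel_cycle C t i (T z)" by (simp add: rel_cycle_def bdT[OF z1(1)])
  assume "rel_bounds C t i (T z)"
  then obtain b l where bl: "b \<in> chains C (Suc i)" "l \<in> chains (avoid C t) i" "T z = bd b + l"
   by (auto simp: rel_bounds_def)
  \<comment> \<open>These express \<open>Y z\<close> as a boundary plus a bad chain among the small
    sets of \<open>C\<close>; \<open>D2\<close> accounts for the difference between
    \<open>Y z\<close> and the subdivision of \<open>T z\<close>.\<close>
  let ?B = "lin s' b + lin D2 (Y z)" and ?L = "lin s' l + lin D2 (bd (Y z))"
  have "bd (lin D2 (Y z)) = lin s' (bd b + l) + Y z + lin D2 (bd (Y z))"
   using D2(3)[OF Yc[OF z1(1)]] bl(3) by (simp add: T_def)
  hence "Y z = bd (lin D2 (Y z)) + lin s' (bd b + l) + lin D2 (bd (Y z))"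
   by (rule pm_move_mid)
  hence YBL: "Y z = bd ?B + ?L"
   by (simp add: lin_add bd_linear subdiv_bd[OF s' bl(1)] ac_simps)
  have B: "?B \<in> chains (rips E' ?Y) (Suc i)"
   using subdiv_chains(1)[OF s' bl(1)] D2(1)[OF Yc[OF z1(1)]] by (rule chains_add)
  have L: "?L \<in> chains (bad_rips E' C t w') i"
  proof (rule chains_add)
   show "lin s' l \<in> chains (bad_rips E' C t w') i" using subdiv_chains(2)[OF s' bl(2) w'(1)] .
   show "lin D2 (bd (Y z)) \<in> chains (bad_rips E' C t w') i"
   \<comment> \<open>For \<open>i = 0\<close> the truncated \<open>i - 1\<close> would put the
     homotopy into the wrong index; there the boundary is zero.\<close>
   proof (cases "i = 0")
    case True
    hence "bd z = 0" using bd_chains_0 z1(1) by blast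
    thus ?thesis by (simp add: bdY[OF z1(1)]) (simp add: Y_def push_linear)
   next
    case False
    thus ?thesis using D2(2)[OF Yb[OF z1(2)]] by (simp add: bdY[OF z1(1)])
   qed
  qed
  have "lin s z = push g (Y z)"
   unfolding Y_def using push_push_inv[OF subdiv_chains(1)[OF s z1(1)], of g f] gf by (auto simp: rips_def subset_iff)
  also have "... = bd (push g ?B) + push g ?L"
   unfolding push_bd[OF B, symmetric] push_linear(1)[symmetric] YBL[symmetric] ..
  finally have "push \<Phi> (lin s z) = push \<Phi> (bd (push g ?B)) + push \<Phi> (push g ?L)" by (simp only: push_linear)
  moreover have gB: "push g ?B \<in> chains (rips E ?X) (Suc i)" using B g_rips by (rule chains_push)
  ultimately have eq: "push \<Phi> (lin s z) = bd (push \<Phi> (push g ?B)) + push \<Phi> (push g ?L)"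
   using push_bd[OF gB, of \<Phi>] by simp
  have "push g ?L \<in> chains (bad_rips E \<Delta> J w) i" using L g_bad by (rule chains_push)
  hence l1: "push \<Phi> (push g ?L) \<in> chains (avoid \<Delta> J) i" using face\<Phi>(2) by (rule chains_push)
  have b1: "push \<Phi> (push g ?B) \<in> chains \<Delta> (Suc i)" using gB face\<Phi>(1) by (rule chains_push)
  have "z = bd (lin D1 z) + push \<Phi> (lin s z) + lin D1 (bd z)"
   using D1(2)[OF z1(1)] by (rule pm_move_mid)
  hence zeq: "z = bd (lin D1 z + push \<Phi> (push g ?B)) + (push \<Phi> (push g ?L) + lin D1 (bd z))"
   by (simp add: eq bd_linear ac_simps)
  have l2: "lin D1 (bd z) \<in> chains (avoid \<Delta> J) i"
  proof (cases "i = 0")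
   case True
   hence "bd z = 0" using bd_chains_0 z1(1) by blast
   thus ?thesis by simp
  next
   case False
   have "lin D1 (bd z) \<in> chains (avoid \<Delta> J) (Suc (i - 1))"
    by (rule D1(1)[OF _ _ z1(2)]) (use abstract_complexD[OF \<Delta>] in \<open>auto simp: avoid_def intro!: down_avoid[unfolded avoid_def]\<close>)
   thus ?thesis using False by simp
  qed
  have b2: "lin D1 z \<in> chains \<Delta> (Suc i)" by (rule D1(1)[OF _ _ z1(1)]) (use abstract_complexD[OF \<Delta>] in auto)
  show "rel_bounds \<Delta> J i z"
   unfolding rel_bounds_def using zeq chains_add[OF b2 b1] chains_add[OF l1 l2] by blast
 qed
 moreover have "T (sc a c + sc b d) = sc a (T c) + sc b (T d)" for a b c d
  by (simp add: T_def Y_def lin_add lin_sc push_linear)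
 ultimately show ?thesis unfolding rel_inj_def by blast
qed

text \<open>The coordinates of \<open>b\<close> may shrink only by a small proportion. Both
  coordinate vectors sum to 1, so the total growth equals the total loss, and the l1 distance is at
  most twice the loss. Together with \<open>not_bad_nbhd\<close> this makes the sets of points that
  are not bad a neighbourhood basis at \<open>b\<close>.\<close>

lemma near_if_not_bad:
 assumes \<Delta>: "abstract_complex \<Delta>" and b: "b \<in> realization \<Delta>" and e: "0 < e"
 obtains \<eta> where "0 \<le> \<eta>" "\<eta> < 1"
  "\<And>x. x \<in> realization \<Delta> ==> \<not> bad (carrier b) (\<lambda>v. \<eta> * coord b v) x ==> dist x b < e"
proof
 \<comment> \<open>The relative loss is at most a quarter of \<open>min e 1\<close>; doubled, it is
   half of that and still below \<open>e\<close>.\<close>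
 let ?\<eta> = "1 - min e 1 / 4" and ?V = "\<Union>\<Delta>"
 show "0 \<le> ?\<eta>" "?\<eta> < 1" using e by auto
 fix x assume x: "x \<in> realization \<Delta>" and nb: "\<not> bad (carrier b) (\<lambda>v. ?\<eta> * coord b v) x"
 have sub: "carrier x \<union> carrier b \<subseteq> ?V" using x b by (auto simp: realization_iff[OF \<Delta>])
 have "dist x b = (\<Sum>v\<in>?V. \<bar>coord x v - coord b v\<bar>)"
  unfolding dist_poly_mapping_def
  by (rule sum.mono_neutral_cong_left) (use sub abstract_complexD[OF \<Delta>] in \<open>auto simp: in_keys_iff dist_real_def\<close>)
 also have "... \<le> (\<Sum>v\<in>?V. (coord x v - coord b v) + min e 1 / 2 * coord b v)"
 proof (rule sum_mono)
  fix v
  show "\<bar>coord x v - coord b v\<bar> \<le> (coord x v - coord b v) + min e 1 / 2 * coord b v"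
  proof (cases "v \<in> carrier b")
   case True
   hence "?\<eta> * coord b v < coord x v" using nb by (auto simp: bad_def not_le)
   hence "coord b v - coord x v \<le> min e 1 / 4 * coord b v" by (simp add: algebra_simps)
   moreover have "0 \<le> min e 1 * coord b v" using b e by (auto simp: realization_iff[OF \<Delta>])
   ultimately show ?thesis by linarith
  next
   case False
   thus ?thesis using x by (auto simp: realization_iff[OF \<Delta>] in_keys_iff)
  qed
 qed
 also have "... = min e 1 / 2"
  by (simp only: sum.distrib sum_subtractf sum_distrib_left[symmetric] realization_sum[OF \<Delta> x] realization_sum[OF \<Delta> b] diff_self add_0 mult_1_right)
 also have "... < e" using e by auto
 finally show "dist x b < e" .
qed

lemma not_bad_nbhd:
 assumes \<Delta>: "abstract_complex \<Delta>" and b: "b \<in> realization \<Delta>" and \<eta>: "\<eta> < 1"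
 obtains e where "0 < e" "\<And>x. dist x b < e ==> \<not> bad (carrier b) (\<lambda>v. \<eta> * coord b v) x"
proof -
 define e where "e = Min (insert 1 ((\<lambda>v. (1 - \<eta>) * coord b v) ` carrier b))"
 have pos: "0 < coord b v" if "v \<in> carrier b" for v
  using b that realization_iff[OF \<Delta>] by (metis in_keys_iff less_eq_real_def)
 show thesis
 proof
  show "0 < e" unfolding e_def using \<eta> pos by (subst Min_gr_iff) auto
  fix x assume d: "dist x b < e"
  show "\<not> bad (carrier b) (\<lambda>v. \<eta> * coord b v) x"
  proof
   assume "bad (carrier b) (\<lambda>v. \<eta> * coord b v) x"
   then obtain v where v: "v \<in> carrier b" "coord x v \<le> \<eta> * coord b v" by (auto simp: bad_def)
   have "e \<le> (1 - \<eta>) * coord b v" unfolding e_def using v by (intro Min_le) auto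
   moreover have "\<bar>coord x v - coord b v\<bar> < e" using d abs_lookup_le_dist[of x v b] by linarith
   ultimately show False using v by (auto simp: algebra_simps)
  qed
 qed
qed

text \<open>The thresholds come from nested neighbourhoods: the open star of
  \<open>carrier b\<close> contains the image under \<open>g\<close> of the neighbourhood of
  \<open>f b\<close> given by \<open>\<eta>'\<close>, which in turn contains the image under
  \<open>f\<close> of the neighbourhood of \<open>b\<close> given by \<open>\<eta>\<close>.\<close>

lemma rel_inj_homeo_point:
 assumes \<Delta>: "abstract_complex \<Delta>" and C: "abstract_complex C"
  and hom: "homeomorphism (realization \<Delta>) (realization C) f g" and b: "b \<in> realization \<Delta>"
 shows "rel_inj TYPE('k::char_two) \<Delta> (carrier b) C (carrier (f b))"
proof -
 have q: "f b \<in> realization C" and gq: "g (f b) = b" using hom b by (auto simp: homeomorphism_def)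
 have cf: "continuous_on (realization \<Delta>) f" and cg: "continuous_on (realization C) g"
  using hom by (auto simp: homeomorphism_def)
 obtain e where e: "0 < e" "\<And>x. dist x b < e ==> \<not> bad (carrier b) (\<lambda>v. 0 * coord b v) x"
 proof (rule not_bad_nbhd[OF \<Delta> b zero_less_one], goal_cases)
  case (1 u)
  show thesis by (rule that[of u]) (use 1 in simp_all)
 qed
 obtain e0 where e0: "0 < e0" "\<And>y. y \<in> realization C ==> dist y (f b) < e0 ==> dist (g y) b < e"
  using cg q gq e(1) unfolding continuous_on_iff by metis
 obtain \<eta>' where \<eta>': "0 \<le> \<eta>'" "\<eta>' < 1"
  "\<And>y. y \<in> realization C ==> \<not> bad (carrier (f b)) (\<lambda>v. \<eta>' * coord (f b) v) y ==> dist y (f b) < e0"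
 proof (rule near_if_not_bad[OF C q e0(1)], goal_cases)
  case (1 u)
  show thesis by (rule that[of u]) (use 1 in simp_all)
 qed
 obtain e1 where e1: "0 < e1" "\<And>y. dist y (f b) < e1 ==> \<not> bad (carrier (f b)) (\<lambda>v. \<eta>' * coord (f b) v) y"
 proof (rule not_bad_nbhd[OF C q \<eta>'(2)], goal_cases)
  case (1 u)
  show thesis by (rule that[of u]) (use 1 in simp_all)
 qed
 obtain e2 where e2: "0 < e2" "\<And>x. x \<in> realization \<Delta> ==> dist x b < e2 ==> dist (f x) (f b) < e1"
  using cf b e1(1) unfolding continuous_on_iff by metis
 obtain \<eta> where \<eta>: "0 \<le> \<eta>" "\<eta> < 1"
  "\<And>x. x \<in> realization \<Delta> ==> \<not> bad (carrier b) (\<lambda>v. \<eta> * coord b v) x ==> dist x b < e2"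
 proof (rule near_if_not_bad[OF \<Delta> b e2(1)], goal_cases)
  case (1 u)
  show thesis by (rule that[of u]) (use 1 in simp_all)
 qed
 have ne: "carrier x \<noteq> {}" if "abstract_complex \<Lambda>" "x \<in> realization \<Lambda>" for x :: "'c \<Rightarrow>\<^sub>0 real" and \<Lambda>
  using that realization_iff by fastforce
 show ?thesis
 proof (rule rel_inj_homeo[OF \<Delta> C hom])
  show "0 \<le> \<eta> * coord b v" "0 \<le> \<eta>' * coord (f b) v'" for v v'
   using \<eta> \<eta>' b q by (auto simp: realization_iff[OF \<Delta>] realization_iff[OF C])
  show "(\<Sum>v\<in>\<Union>\<Delta>. \<eta> * coord b v) < 1" "(\<Sum>v\<in>\<Union>C. \<eta>' * coord (f b) v) < 1"
   using \<eta> \<eta>' by (simp_all add: realization_sum[OF \<Delta> b] realization_sum[OF C q] flip: sum_distrib_left)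
  show "carrier b = {} \<longleftrightarrow> carrier (f b) = {}" using ne[OF \<Delta> b] ne[OF C q] by simp
  show "bad (carrier (f b)) (\<lambda>v. \<eta>' * coord (f b) v) (f x)" if "x \<in> realization \<Delta>" "bad (carrier b) (\<lambda>_. 0) x" for x
  proof (rule ccontr)
   assume n: "\<not> bad (carrier (f b)) (\<lambda>v. \<eta>' * coord (f b) v) (f x)"
   have "f x \<in> realization C" "g (f x) = x" using hom that by (auto simp: homeomorphism_def)
   thus False using \<eta>'(3)[OF _ n] e0(2)[of "f x"] e(2)[of x] that by simp
  qed
  show "bad (carrier b) (\<lambda>v. \<eta> * coord b v) (g y)"
   if "y \<in> realization C" "bad (carrier (f b)) (\<lambda>v. \<eta>' * coord (f b) v) y" for y
  proof (rule ccontr)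
   assume n: "\<not> bad (carrier b) (\<lambda>v. \<eta> * coord b v) (g y)"
   have "g y \<in> realization \<Delta>" "f (g y) = y" using hom that by (auto simp: homeomorphism_def)
   thus False using \<eta>(3)[OF _ n] e2(2)[of "g y"] e1(2)[of y] that by simp
  qed
 qed
qed

lemma rel_inj_homeo_empty:
 assumes \<Delta>: "abstract_complex \<Delta>" and C: "abstract_complex C"
  and hom: "homeomorphism (realization \<Delta>) (realization C) f g"
 shows "rel_inj TYPE('k::char_two) \<Delta> {} C {}"
 by (rule rel_inj_homeo[OF \<Delta> C hom, of "\<lambda>_. 0" "\<lambda>_. 0"]) (auto simp: bad_def)

subsection \<open>Homology spheres\<close>

text \<open>The relative homology of a ball modulo its boundary. One-dimensionality in the top index
  is split into a cycle that does not bound and the dependence of any two cycles; an injective map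
  transports each of these in one direction.\<close>

definition local_sphere :: "'k::char_two itself => nat => 'a set set => 'a set => bool" where
 "local_sphere (_::'k itself) d \<Delta> J \<longleftrightarrow>
  (\<forall>i<d. \<forall>z::('a,'k) chain. rel_cycle \<Delta> J i z --> rel_bounds \<Delta> J i z) \<and>
  (\<exists>z::('a,'k) chain. rel_cycle \<Delta> J d z \<and> \<not> rel_bounds \<Delta> J d z) \<and>
  (\<forall>z z'::('a,'k) chain. rel_cycle \<Delta> J d z --> rel_cycle \<Delta> J d z' -->
    (\<exists>a b. (a \<noteq> 0 \<or> b \<noteq> 0) \<and> rel_bounds \<Delta> J d (sc a z + sc b z')))"

definition homology_sphere :: "'k::char_two itself => nat => 'a set set => bool" where
 "homology_sphere K d \<Delta> \<longleftrightarrow> abstract_complex \<Delta> \<and> (\<forall>F\<in>\<Delta>. card F \<le> d) \<and> (\<forall>J\<in>\<Delta>. local_sphere K d \<Delta> J)"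

lemma rel_cycle_sc_add:
 "rel_cycle \<Delta> J i z ==> rel_cycle \<Delta> J i z' ==> rel_cycle \<Delta> J i (sc a z + sc b z')"
 by (auto simp: rel_cycle_def bd_linear intro!: chains_add chains_sc)

lemma local_sphereD:
 assumes "local_sphere TYPE('k::char_two) d \<Delta> J"
 shows "i < d ==> rel_cycle \<Delta> J i (z::('a,'k) chain) ==> rel_bounds \<Delta> J i z"
  and "\<exists>z::('a,'k) chain. rel_cycle \<Delta> J d z \<and> \<not> rel_bounds \<Delta> J d z"
  and "rel_cycle \<Delta> J d (z::('a,'k) chain) ==> rel_cycle \<Delta> J d z' ==>
   \<exists>a b. (a \<noteq> 0 \<or> b \<noteq> 0) \<and> rel_bounds \<Delta> J d (sc a z + sc b z')"
 using assms unfolding local_sphere_def by simp_all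

text \<open>Vanishing and dependence are pulled back along the map out of \<open>\<Delta>\<close>;
  the nonzero class comes from the map into it.\<close>

lemma local_sphere_transfer:
 fixes \<Delta> :: "'a set set" and C :: "'b set set"
 assumes G: "local_sphere TYPE('k::char_two) d C t"
  and i: "rel_inj TYPE('k) \<Delta> J C t" "rel_inj TYPE('k) C t \<Delta> J"
 shows "local_sphere TYPE('k) d \<Delta> J"
proof -
 obtain T :: "('a,'k) chain => ('b,'k) chain" where
  T0: "\<forall>a b c d. T (sc a c + sc b d) = sc a (T c) + sc b (T d)"
   "\<forall>i z. rel_cycle \<Delta> J i z --> rel_cycle C t i (T z) \<and> (rel_bounds C t i (T z) --> rel_bounds \<Delta> J i z)"
  using i(1) unfolding rel_inj_def by (elim exE conjE)
 note T = T0(1)[rule_format] T0(2)[rule_format, THEN conjunct1] T0(2)[rule_format, THEN conjunct2, rule_format]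
 obtain U :: "('b,'k) chain => ('a,'k) chain" where
  U0: "\<forall>i z. rel_cycle C t i z --> rel_cycle \<Delta> J i (U z) \<and> (rel_bounds \<Delta> J i (U z) --> rel_bounds C t i z)"
  using i(2) unfolding rel_inj_def by (elim exE conjE)
 note U = U0[rule_format, THEN conjunct1] U0[rule_format, THEN conjunct2, rule_format]
 note G' = local_sphereD[OF G]
 show ?thesis
  unfolding local_sphere_def
 proof (intro conjI allI impI)
  fix i z assume i: "i < d" and z: "rel_cycle \<Delta> J i (z::('a,'k) chain)"
  show "rel_bounds \<Delta> J i z" by (rule T(3)[OF z G'(1)[OF i T(2)[OF z]]])
 next
  obtain z :: "('b,'k) chain" where z: "rel_cycle C t d z" "\<not> rel_bounds C t d z" using G'(2) by (elim exE conjE)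
  have "\<not> rel_bounds \<Delta> J d (U z)" using U(2)[OF z(1)] z(2) by (rule contrapos_nn[rotated])
  with U(1)[OF z(1)] show "\<exists>z::('a,'k) chain. rel_cycle \<Delta> J d z \<and> \<not> rel_bounds \<Delta> J d z" by (intro exI conjI)
 next
  fix z z' :: "('a,'k) chain" assume z: "rel_cycle \<Delta> J d z" "rel_cycle \<Delta> J d z'"
  obtain a b where ab: "a \<noteq> 0 \<or> b \<noteq> 0" "rel_bounds C t d (sc a (T z) + sc b (T z'))"
   using G'(3)[OF T(2)[OF z(1)] T(2)[OF z(2)]] by (elim exE conjE)
  have "rel_bounds \<Delta> J d (sc a z + sc b z')"
   by (rule T(3)[OF rel_cycle_sc_add[OF z]]) (use ab(2) in \<open>simp only: T(1)\<close>)
  with ab(1) show "\<exists>a b. (a \<noteq> 0 \<or> b \<noteq> 0) \<and> rel_bounds \<Delta> J d (sc a z + sc b z')" by (intro exI conjI)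
 qed
qed

lemma lookup_lin: "lookup (lin f c) Y = (\<Sum>X\<in>keys c. lookup c X * lookup (f X) Y)"
 by (simp add: lin_def lookup_sum)

lemma lookup_bd:
 fixes c :: "('a, 'k::char_two) chain"
 assumes V: "finite V" "\<And>X. X \<in> keys c ==> X \<subseteq> V"
 shows "lookup (bd c) Y = (\<Sum>v\<in>V - Y. lookup c (insert v Y))"
proof -
 let ?l = lookup
 have "?l (bd1 X :: ('a,'k) chain) Y = (\<Sum>v\<in>V - Y. if insert v Y = X then 1 else 0)" if X: "X \<subseteq> V" for X
 proof -
  have fin: "finite X" using X V(1) finite_subset by auto
  have "?l (bd1 X :: ('a,'k) chain) Y = (\<Sum>x\<in>X. if X - {x} = Y then 1 else 0)"
   by (simp add: bd1_def lookup_sum lookup_single when_def)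
  also have "... = (\<Sum>x\<in>V - Y. if insert x Y = X then 1 else 0)"
   by (rule sum.mono_neutral_cong) (use X V fin in auto)
  finally show ?thesis .
 qed
 hence "?l (bd c) Y = (\<Sum>X\<in>keys c. \<Sum>v\<in>V - Y. if insert v Y = X then ?l c X else 0)"
  unfolding bd_def lookup_lin
  by (intro sum.cong) (use V in \<open>auto simp: sum_distrib_left if_distrib cong: if_cong\<close>)
 also have "... = (\<Sum>v\<in>V - Y. \<Sum>X\<in>keys c. if insert v Y = X then ?l c X else 0)"
  by (rule sum.swap)
 also have "... = (\<Sum>v\<in>V - Y. ?l c (insert v Y))"
  by (rule sum.cong) (auto simp: in_keys_iff)
 finally show ?thesis .
qed

lemma abstract_simplex_boundary: "abstract_complex (simplex_boundary d)"
proof -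
 have "finite (simplex_boundary d)"
  by (rule finite_subset[of _ "Pow {0..d}"]) (auto simp: simplex_boundary_def)
 thus ?thesis by (auto simp: abstract_complex_def simplex_boundary_def intro: finite_subset)
qed

text \<open>Coning from a vertex \<open>w\<close> outside \<open>t\<close> keeps chains of
  \<open>avoid\<close> inside \<open>avoid\<close>, which settles the indices below
  \<open>d\<close>. In index \<open>d\<close> nothing bounds, and modulo \<open>avoid\<close> a
  relative cycle is determined by its coefficient at the facet opposite to \<open>w\<close>.\<close>

lemma local_sphere_simplex_boundary:
 assumes t: "t \<in> simplex_boundary d"
 shows "local_sphere TYPE('k::char_two) d (simplex_boundary d) t"
proof -
 let ?C = "simplex_boundary d" and ?l = "lookup" and ?T = "{0..d}"
 obtain w where w: "w \<in> ?T" "w \<notin> t" using t unfolding simplex_boundary_def by blast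
 have C: "X \<in> ?C \<longleftrightarrow> X \<subseteq> ?T \<and> card X \<le> d" for X
 proof -
  have "card X \<le> d \<longleftrightarrow> X \<noteq> ?T" if "X \<subseteq> ?T"
  proof
   show "X \<noteq> ?T" if "card X \<le> d" using that by auto
   assume "X \<noteq> ?T"
   hence "card X < card ?T" using that by (intro psubset_card_mono) auto
   thus "card X \<le> d" by simp
  qed
  thus ?thesis by (auto simp: simplex_boundary_def)
 qed
 have big: "c = 0" if "c \<in> chains ?C (Suc d)" for c :: "(nat,'k) chain"
  using that by (auto simp: chains_def C intro!: poly_mapping_eqI) (metis in_keys_iff not_less_eq_eq order_refl)
 have facet: "F = ?T - {v} \<and> v \<in> ?T" if "F \<subseteq> ?T" "card F = d" "v \<notin> F" "v \<in> ?T" for F v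
  using that card_subset_eq[of "?T - {v}" F] by auto
 \<comment> \<open>If the facet without \<open>v\<close> contains \<open>t\<close>, so does the
   ridge without \<open>v\<close> and \<open>w\<close>. The boundary coefficient there is the sum of
   the coefficients at the facets opposite to \<open>v\<close> and to \<open>w\<close>, and it has
   to vanish.\<close>
 have const: "y \<in> chains (avoid ?C t) d" if y: "rel_cycle ?C t d y" "?l y (?T - {w}) = 0" for y :: "(nat,'k) chain"
  unfolding chains_def
 proof (intro CollectI ballI)
  fix X assume X: "X \<in> keys y"
  hence X1: "X \<in> ?C" "finite X" "card X = d" using y(1) by (auto simp: rel_cycle_def chains_def)
  hence XT: "X \<subseteq> ?T" by (simp add: C)
  have "\<not> t \<subseteq> X"
  proof
   assume tX: "t \<subseteq> X"
   have "X \<noteq> ?T"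
   proof
    assume "X = ?T"
    hence "card X = Suc d" by (simp only: card_atLeastAtMost diff_zero)
    thus False using X1(3) by simp
   qed
   then obtain v where v: "v \<in> ?T" "v \<notin> X" using XT by blast
   hence Xv: "X = ?T - {v}" using facet X1 XT by blast
   have vw: "v \<noteq> w" using X y(2) by (auto simp: Xv in_keys_iff)
   let ?Y = "?T - {v, w}"
   have "?l (bd y) ?Y = (\<Sum>u\<in>?T - ?Y. ?l y (insert u ?Y))"
    by (rule lookup_bd) (use y(1) in \<open>auto simp: rel_cycle_def chains_def C\<close>)
   also have "?T - ?Y = {v, w}" using v w by auto
   also have "insert w ?Y = X" "insert v ?Y = ?T - {w}" using v w vw Xv by auto
   hence "(\<Sum>u\<in>{v, w}. ?l y (insert u ?Y)) = ?l y X" using vw y(2) by simp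
   finally have "?Y \<in> keys (bd y)" using X by (auto simp: in_keys_iff)
   hence "\<not> t \<subseteq> ?Y" using y(1) by (auto simp: rel_cycle_def chains_def avoid_def)
   thus False using tX w v Xv by auto
  qed
  thus "X \<in> avoid ?C t \<and> finite X \<and> card X = d" using X1 by (simp add: avoid_def)
 qed
 show ?thesis
  unfolding local_sphere_def
 proof (intro conjI allI impI)
  fix i and z :: "(nat,'k) chain" assume i: "i < d" and "rel_cycle ?C t i z"
  hence z: "z \<in> chains ?C i" "bd z \<in> chains (avoid ?C t) (i - 1)" by (auto simp: rel_cycle_def)
  have b: "cone w z \<in> chains ?C (Suc i)"
   by (rule chains_cone[OF z(1)]) (use w i in \<open>auto simp: C\<close>)
  have l: "cone w (bd z) \<in> chains (avoid ?C t) i"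
  proof (cases "i = 0")
   case True
   hence "bd z = 0" using bd_chains_0[of z] z(1) by simp
   thus ?thesis by (simp add: cone_def)
  next
   case False
   have "cone w (bd z) \<in> chains (avoid ?C t) (Suc (i - 1))"
    by (rule chains_cone[OF z(2)]) (use w i False in \<open>auto simp: C avoid_def\<close>)
   thus ?thesis using False by simp
  qed
  have "z = bd (cone w z) + cone w (bd z)"
   by (simp add: bd_cone[OF z(1)] add.assoc)
  thus "rel_bounds ?C t i z" using b l unfolding rel_bounds_def by blast
 next
  have "(bd1 ?T :: (nat,'k) chain) \<in> chains ?C d"
   unfolding bd1_def
  proof (rule chains_sum, rule chains_single)
   fix x assume "x \<in> ?T"
   hence "card (?T - {x}) = d" by simp
   thus "card (?T - {x}) = d" "?T - {x} \<in> ?C" using C[of "?T - {x}"] by simp_all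
  qed simp
  hence r: "rel_cycle ?C t d (bd1 ?T :: (nat,'k) chain)"
   by (simp add: rel_cycle_def bd_bd1)
  have "?l (bd1 ?T :: (nat,'k) chain) (?T - {w}) = (\<Sum>x\<in>?T. if x = w then 1 else 0)"
   unfolding bd1_def lookup_sum
  proof (rule sum.cong)
   fix x assume "x \<in> ?T"
   hence "?T - {x} = ?T - {w} \<longleftrightarrow> x = w" using w(1) by blast
   thus "?l (single (?T - {x}) (1::'k)) (?T - {w}) = (if x = w then 1 else 0)"
    by (simp only: lookup_single when_def)
  qed simp
  hence "?l (bd1 ?T :: (nat,'k) chain) (?T - {w}) = 1" using w by simp
  hence k: "?T - {w} \<in> keys (bd1 ?T :: (nat,'k) chain)" by (simp add: in_keys_iff)
  have sub: "t \<subseteq> ?T - {w}" using w t unfolding simplex_boundary_def by blast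
  have "\<not> rel_bounds ?C t d (bd1 ?T :: (nat,'k) chain)"
  proof
   assume "rel_bounds ?C t d (bd1 ?T :: (nat,'k) chain)"
   then obtain b l where bl: "b \<in> chains ?C (Suc d)" "l \<in> chains (avoid ?C t) d" "(bd1 ?T :: (nat,'k) chain) = bd b + l"
    unfolding rel_bounds_def by (elim bexE)
   have "bd1 ?T = l" using bl(3) big[OF bl(1)] by (simp add: bd_linear)
   hence "?T - {w} \<in> avoid ?C t" using bl(2) k unfolding chains_def by blast
   thus False using sub unfolding avoid_def by blast
  qed
  with r show "\<exists>z::(nat,'k) chain. rel_cycle ?C t d z \<and> \<not> rel_bounds ?C t d z" by (intro exI conjI)
 next
  fix z z' :: "(nat,'k) chain" assume z: "rel_cycle ?C t d z" "rel_cycle ?C t d z'"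
  have triv: "rel_bounds ?C t d y" if "rel_cycle ?C t d y" "?l y (?T - {w}) = 0" for y :: "(nat,'k) chain"
   unfolding rel_bounds_def
  proof (intro bexI)
   show "y = bd 0 + y" by (simp add: bd_linear)
  qed (use const[OF that] in simp_all)
  let ?p = "?l z (?T - {w})" and ?q = "?l z' (?T - {w})"
  show "\<exists>a b. (a \<noteq> 0 \<or> b \<noteq> 0) \<and> rel_bounds ?C t d (sc a z + sc b z')"
  proof (cases "?p = 0")
   case True
   have "rel_bounds ?C t d (sc 1 z + sc 0 z')"
    by (rule triv[OF rel_cycle_sc_add[OF z]]) (simp add: lookup_add True)
   thus ?thesis using zero_neq_one[symmetric] by (intro exI conjI disjI1)
  next
   case False
   have "rel_bounds ?C t d (sc ?q z + sc ?p z')"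
    by (rule triv[OF rel_cycle_sc_add[OF z]]) (simp add: lookup_add mult.commute)
   with False show ?thesis by (intro exI conjI disjI2)
  qed
 qed
qed

lemma point_with_carrier:
 assumes "abstract_complex \<Delta>" "J \<in> \<Delta>" "J \<noteq> {}"
 obtains b where "b \<in> realization \<Delta>" "carrier b = J"
proof -
 have fin: "finite J" using abstract_complexD[OF assms(1)] assms(2) by auto
 define b where "b = (\<Sum>v\<in>J. single v (1 / real (card J)))"
 have l: "coord b u = (if u \<in> J then 1 / card J else 0)" for u
  unfolding b_def lookup_sum using fin by (simp add: lookup_single when_def)
 have k: "carrier b = J" using fin assms(3) by (auto simp: in_keys_iff l split: if_splits)
 hence "b \<in> realization \<Delta>"
  using assms fin by (auto simp: realization_iff l)
 thus thesis using k that by blast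
qed

text \<open>A nonempty face is the carrier of a point, and its condition is moved to the carrier of
  the image point in the simplex boundary. The empty face stands for the global homology.\<close>

theorem PL_sphere_homology_sphere:
 assumes S: "PL_sphere \<Delta>" and d: "complex_dim \<Delta> = int d - 1"
 shows "homology_sphere TYPE('k::char_two) d \<Delta>"
proof -
 have \<Delta>: "abstract_complex \<Delta>" using S by (simp add: PL_sphere_def)
 let ?C = "simplex_boundary d"
 note C = abstract_simplex_boundary[of d]
 obtain f g where hom: "homeomorphism (realization \<Delta>) (realization ?C) f g"
  using S d by (auto simp: PL_sphere_def PL_homeomorphic_def)
 have hom': "homeomorphism (realization ?C) (realization \<Delta>) g f"
  using hom by (rule homeomorphism_symD)
 have "card F \<le> d" if "F \<in> \<Delta>" for F
  using d that abstract_complexD(1)[OF \<Delta>] by (auto simp: complex_dim_def)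
 moreover have "local_sphere TYPE('k) d \<Delta> J" if J: "J \<in> \<Delta>" for J
 proof (cases "J = {}")
  case True
  have "{} \<in> ?C" using abstract_complexD(2)[OF C] .
  thus ?thesis
   using local_sphere_transfer[OF local_sphere_simplex_boundary rel_inj_homeo_empty[OF \<Delta> C hom] rel_inj_homeo_empty[OF C \<Delta> hom']]
   by (simp add: True)
 next
  case False
  then obtain b where b: "b \<in> realization \<Delta>" "carrier b = J" using point_with_carrier[OF \<Delta> J] by auto
  have fb: "f b \<in> realization ?C" "g (f b) = b" using hom b by (auto simp: homeomorphism_def)
  have "carrier (f b) \<in> ?C" using fb realization_iff[OF C] by auto
  thus ?thesis
   using local_sphere_transfer[OF local_sphere_simplex_boundary rel_inj_homeo_point[OF \<Delta> C hom b(1)]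
     rel_inj_homeo_point[OF C \<Delta> hom' fb(1), unfolded fb(2)]]
   by (simp add: b(2))
 qed
 ultimately show ?thesis using \<Delta> by (auto simp: homology_sphere_def)
qed

subsection \<open>Links and fundamental cycles\<close>

text \<open>Identifies chains modulo \<open>avoid \<Delta> J\<close> with chains of the link of
  \<open>J\<close>, lowering the index by \<open>card J\<close>; \<open>join\<close> is a
  section.\<close>

definition strip :: "'a set => ('a, 'k::char_two) chain => ('a, 'k) chain" where
 "strip J = lin (\<lambda>G. if J \<subseteq> G then single (G - J) 1 else 0)"

definition join :: "'a set => ('a, 'k::char_two) chain => ('a, 'k) chain" where
 "join J = lin (\<lambda>H. single (H \<union> J) 1)"

lemma strip_linear: "strip J (c + d) = strip J c + strip J d" "strip J (sc a c) = sc a (strip J c)" "strip J 0 = 0"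
 by (simp_all add: strip_def lin_add lin_sc)

lemma strip_bd1:
 assumes "finite G"
 shows "strip J (bd1 G) = bd (strip J (single G (1::'k::char_two)))"
proof (cases "J \<subseteq> G")
 case True
 have "strip J (bd1 G) = (\<Sum>x\<in>G. if J \<subseteq> G - {x} then single (G - {x} - J) (1::'k) else 0)"
  unfolding bd1_def strip_def lin_sum by (rule sum.cong) simp_all
 also have "... = (\<Sum>x\<in>G - J. single (G - J - {x}) (1::'k))"
 proof (rule sum.mono_neutral_cong_right)
  fix x assume "x \<in> G - J"
  hence "J \<subseteq> G - {x}" "G - {x} - J = G - J - {x}" using True by blast+
  thus "(if J \<subseteq> G - {x} then single (G - {x} - J) (1::'k) else 0) = single (G - J - {x}) 1"
   by simp
 qed (use assms in auto)
 also have "... = bd1 (G - J)" by (simp add: bd1_def)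
 finally show ?thesis using True by (simp add: strip_def bd_linear)
next
 case False
 hence "\<not> J \<subseteq> G - {x}" for x by blast
 thus ?thesis using False by (simp add: strip_def bd1_def lin_sum bd_linear)
qed

lemma strip_bd:
 assumes "c \<in> chains \<K> i"
 shows "strip J (bd c) = bd (strip J c)"
proof -
 have "strip J (bd c) = lin (\<lambda>X. strip J (bd1 X)) c"
  by (simp add: strip_def bd_def lin_lin)
 also have "... = lin (\<lambda>X. bd (strip J (single X 1))) c"
  by (rule lin_cong, rule strip_bd1) (use assms in \<open>auto simp: chains_def\<close>)
 also have "... = bd (strip J c)"
  by (simp add: strip_def bd_def lin_lin)
 finally show ?thesis .
qed

lemma lookup_strip:
 assumes "H \<inter> J = {}"
 shows "lookup (strip J c) H = lookup c (H \<union> J)"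
proof -
 have eq: "J \<subseteq> G \<and> G - J = H \<longleftrightarrow> G = H \<union> J" for G using assms by blast
 have "lookup (strip J c) H = (\<Sum>X\<in>keys c. if X = H \<union> J then lookup c X else 0)"
  unfolding strip_def lookup_lin
 proof (rule sum.cong)
  fix X
  show "lookup c X * lookup (if J \<subseteq> X then single (X - J) 1 else 0) H
   = (if X = H \<union> J then lookup c X else 0)"
  proof (cases "X = H \<union> J")
   case True
   hence "J \<subseteq> X" "X - J = H" using eq by blast+
   thus ?thesis using True by (simp add: lookup_single)
  next
   case False
   hence "\<not> (J \<subseteq> X \<and> X - J = H)" using eq by blast
   thus ?thesis using False by (auto simp: lookup_single when_def)
  qed
 qed simp
 thus ?thesis by (simp add: in_keys_iff)
qed

lemma strip_eq_0_avoid: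
 assumes "c \<in> chains \<Delta> i" "strip J c = 0"
 shows "c \<in> chains (avoid \<Delta> J) i"
 unfolding chains_def
proof (intro CollectI ballI)
 fix X assume X: "X \<in> keys c"
 have "\<not> J \<subseteq> X"
 proof
  assume "J \<subseteq> X"
  hence "lookup (strip J c) (X - J) = lookup c X"
   by (subst lookup_strip) (auto simp: Un_absorb2)
  thus False using X assms(2) by (simp add: in_keys_iff)
 qed
 thus "X \<in> avoid \<Delta> J \<and> finite X \<and> card X = i" using X assms(1) by (auto simp: chains_def avoid_def)
qed

lemma strip_avoid: "c \<in> chains (avoid \<Delta> J) i ==> strip J c = 0"
proof -
 assume c: "c \<in> chains (avoid \<Delta> J) i"
 have "strip J c = lin (\<lambda>_. 0) c"
  unfolding strip_def by (rule lin_cong) (use c in \<open>auto simp: chains_def avoid_def\<close>)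
 thus ?thesis by simp
qed

lemma lk_iff: "G \<in> lk \<Delta> J \<longleftrightarrow> G \<in> \<Delta> \<and> G \<union> J \<in> \<Delta> \<and> G \<inter> J = {}"
 by (simp add: lk_def)

lemma lk_sub: "lk \<Delta> J \<subseteq> \<Delta>" by (auto simp: lk_def)

lemma down_lk: "down \<Delta> ==> down (lk \<Delta> J)"
 unfolding down_def lk_def
proof (intro ballI allI impI CollectI)
 fix X Y assume d: "\<forall>X\<in>\<Delta>. \<forall>Y\<subseteq>X. Y \<in> \<Delta>" and X: "X \<in> {G \<in> \<Delta>. G \<union> J \<in> \<Delta> \<and> G \<inter> J = {}}" and Y: "Y \<subseteq> X"
 have "Y \<union> J \<subseteq> X \<union> J" using Y by blast
 moreover have "X \<in> \<Delta>" "X \<union> J \<in> \<Delta>" "X \<inter> J = {}" using X by simp_all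
 ultimately show "Y \<in> \<Delta> \<and> Y \<union> J \<in> \<Delta> \<and> Y \<inter> J = {}" using d Y by (intro conjI) auto
qed

lemma abstract_lk:
 assumes "abstract_complex \<Delta>" "J \<in> \<Delta>"
 shows "abstract_complex (lk \<Delta> J)"
 unfolding abstract_complex_def
proof (intro conjI ballI allI impI)
 show "finite (lk \<Delta> J)" using finite_subset[OF lk_sub abstract_complexD(1)[OF assms(1)]] .
 show "{} \<in> lk \<Delta> J" using abstract_complexD(2)[OF assms(1)] assms(2) by (simp add: lk_iff)
 show "finite F" if "F \<in> lk \<Delta> J" for F using abstract_complexD(3)[OF assms(1)] that by (simp add: lk_iff)
 show "G \<in> lk \<Delta> J" if "F \<in> lk \<Delta> J" "G \<subseteq> F" for F G
  using downD[OF down_lk[OF abstract_complexD(5)[OF assms(1)]] that] .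
qed

lemma chains_strip:
 assumes \<Delta>: "abstract_complex \<Delta>" and c: "c \<in> chains \<Delta> i"
 shows "strip J c \<in> chains (lk \<Delta> J) (i - card J)"
 unfolding strip_def
proof (rule chains_lin[OF c])
 fix G assume G: "G \<in> \<Delta>" "finite G" "card G = i"
 show "(if J \<subseteq> G then single (G - J) 1 else 0) \<in> chains (lk \<Delta> J) (i - card J)"
 proof (cases "J \<subseteq> G")
  case True
  hence "G - J \<in> lk \<Delta> J" using abstract_complexD(4)[OF \<Delta> G(1)] G(1) by (auto simp: lk_iff Un_absorb2)
  moreover have "card (G - J) = i - card J" using True G finite_subset[OF True G(2)] by (simp add: card_Diff_subset)
  ultimately show ?thesis using True G(2) by (auto intro!: chains_single)
 qed simp
qed

lemma chains_join:
 assumes "finite J" "c \<in> chains (lk \<Delta> J) i"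
 shows "join J c \<in> chains \<Delta> (i + card J)"
 unfolding join_def
 by (rule chains_lin[OF assms(2)]) (use assms(1) in \<open>auto intro!: chains_single simp: lk_iff card_Un_disjoint\<close>)

lemma strip_join:
 assumes "c \<in> chains (lk \<Delta> J) i"
 shows "strip J (join J c) = c"
proof -
 have "strip J (join J c) = lin (\<lambda>H. single H 1) c"
  unfolding strip_def join_def lin_lin
 proof (rule lin_cong)
  fix H assume "H \<in> keys c"
  hence "H \<inter> J = {}" using assms by (auto simp: chains_def lk_iff)
  hence "H \<union> J - J = H" by blast
  thus "lin (\<lambda>G. if J \<subseteq> G then single (G - J) 1 else 0) (single (H \<union> J) 1)
   = single H (1::'b)" by simp
 qed
 thus ?thesis by (simp add: lin_ident)
qed

lemma join_rel_cycle:
 assumes \<Delta>: "abstract_complex \<Delta>" "J \<in> \<Delta>" and c: "c \<in> chains (lk \<Delta> J) i" "bd c = 0"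
 shows "rel_cycle \<Delta> J (i + card J) (join J c)"
proof -
 have j: "join J c \<in> chains \<Delta> (i + card J)"
  using abstract_complexD(3)[OF \<Delta>] c(1) by (rule chains_join)
 have "strip J (bd (join J c)) = 0"
  by (simp add: strip_bd[OF j] strip_join[OF c(1)] c(2))
 hence "bd (join J c) \<in> chains (avoid \<Delta> J) (i + card J - 1)"
  using chains_bd[OF abstract_complexD(5)[OF \<Delta>(1)] j] by (intro strip_eq_0_avoid)
 with j show ?thesis by (simp add: rel_cycle_def)
qed

lemma local_sphere_link:
 fixes \<Delta> :: "'a set set"
 assumes \<Delta>: "abstract_complex \<Delta>" "J \<in> \<Delta>" and dim: "\<forall>F\<in>\<Delta>. card F \<le> d"
  and S: "local_sphere TYPE('k::char_two) d \<Delta> J"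
 shows "i + card J < d ==> z \<in> chains (lk \<Delta> J) i ==> bd z = (0::('a,'k) chain) ==>
      \<exists>b\<in>chains (lk \<Delta> J) (Suc i). bd b = z"
  and "\<exists>z\<in>chains (lk \<Delta> J) (d - card J). bd z = (0::('a,'k) chain) \<and> z \<noteq> 0"
  and "z \<in> chains (lk \<Delta> J) (d - card J) ==> bd z = (0::('a,'k) chain) ==>
    z' \<in> chains (lk \<Delta> J) (d - card J) ==> bd z' = 0 ==> \<exists>a b. (a \<noteq> 0 \<or> b \<noteq> 0) \<and> sc a z + sc b z' = 0"
proof -
 note S' = local_sphereD[OF S]
 have le: "card J \<le> d" using dim \<Delta>(2) by blast
 show "\<exists>b\<in>chains (lk \<Delta> J) (Suc i). bd b = z"
  if i: "i + card J < d" and z: "z \<in> chains (lk \<Delta> J) i" "bd z = (0::('a,'k) chain)"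
 proof -
  obtain b l where bl: "b \<in> chains \<Delta> (Suc (i + card J))" "l \<in> chains (avoid \<Delta> J) (i + card J)" "join J z = bd b + l"
   using S'(1)[OF i join_rel_cycle[OF \<Delta> z]] unfolding rel_bounds_def by (elim bexE)
  have "z = strip J (bd b + l)" using strip_join[OF z(1)] bl(3) by simp
  also have "... = bd (strip J b)" by (simp add: strip_linear strip_bd[OF bl(1)] strip_avoid[OF bl(2)])
  finally have "bd (strip J b) = z" by simp
  moreover have "strip J b \<in> chains (lk \<Delta> J) (Suc i)" using chains_strip[OF \<Delta>(1) bl(1), of J] by simp
  ultimately show ?thesis by (rule bexI)
 qed
 show "\<exists>z\<in>chains (lk \<Delta> J) (d - card J). bd z = (0::('a,'k) chain) \<and> z \<noteq> 0"
 proof -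
  obtain z :: "('a,'k) chain" where z: "rel_cycle \<Delta> J d z" "\<not> rel_bounds \<Delta> J d z" using S'(2) by (elim exE conjE)
  have z1: "z \<in> chains \<Delta> d" "bd z \<in> chains (avoid \<Delta> J) (d - 1)" using z(1) unfolding rel_cycle_def by simp_all
  have "strip J z \<noteq> 0"
  proof
   assume "strip J z = 0"
   hence "z \<in> chains (avoid \<Delta> J) d" by (rule strip_eq_0_avoid[OF z1(1)])
   hence "rel_bounds \<Delta> J d z" unfolding rel_bounds_def by (intro bexI[of _ 0] bexI[of _ z]) (simp_all add: bd_linear)
   thus False using z(2) by simp
  qed
  moreover have "bd (strip J z) = 0" using strip_bd[OF z1(1), of J] strip_avoid[OF z1(2)] by simp
  ultimately show ?thesis using chains_strip[OF \<Delta>(1) z1(1), of J] by (intro bexI[of _ "strip J z"]) simp_all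
 qed
 show "\<exists>a b. (a \<noteq> 0 \<or> b \<noteq> 0) \<and> sc a z + sc b z' = 0"
  if z: "z \<in> chains (lk \<Delta> J) (d - card J)" "bd z = (0::('a,'k) chain)"
   and z': "z' \<in> chains (lk \<Delta> J) (d - card J)" "bd z' = 0"
 proof -
  have j: "rel_cycle \<Delta> J d (join J z)" "rel_cycle \<Delta> J d (join J z')"
   using join_rel_cycle[OF \<Delta> z] join_rel_cycle[OF \<Delta> z'] le by simp_all
  obtain a b where ab: "a \<noteq> 0 \<or> b \<noteq> 0" "rel_bounds \<Delta> J d (sc a (join J z) + sc b (join J z'))"
   using S'(3)[OF j] by (elim exE conjE)
  obtain \<beta> l where bl: "\<beta> \<in> chains \<Delta> (Suc d)" "l \<in> chains (avoid \<Delta> J) d"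
   "sc a (join J z) + sc b (join J z') = bd \<beta> + l" using ab(2) unfolding rel_bounds_def by (elim bexE)
  \<comment> \<open>No face has \<open>d + 1\<close> vertices, so to bound in the top index means to
    lie in \<open>avoid\<close>.\<close>
  have "\<beta> = 0"
  proof (rule ccontr)
   assume "\<beta> \<noteq> 0"
   then obtain X where "X \<in> keys \<beta>" by (metis keys_eq_empty all_not_in_conv)
   hence "X \<in> \<Delta>" "card X = Suc d" using bl(1) by (auto simp: chains_def)
   thus False using dim by force
  qed
  have "sc a z + sc b z' = strip J (sc a (join J z) + sc b (join J z'))"
   by (simp add: strip_linear strip_join[OF z(1)] strip_join[OF z'(1)])
  also have "... = 0" unfolding bl(3) by (simp add: \<open>\<beta> = 0\<close> bd_linear strip_avoid[OF bl(2)])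
  finally show ?thesis using ab(1) by (intro exI conjI)
 qed
qed

definition fund :: "nat => 'a set set => ('a, 'k::char_two) chain" where
 "fund e L = (\<Sum>F\<in>{F\<in>L. card F = e}. single F 1)"

lemma lookup_fund: "finite L ==> lookup (fund e L) X = (if X \<in> L \<and> card X = e then 1 else 0)"
 by (simp add: fund_def lookup_sum lookup_single when_def)

lemma fund_chains:
 assumes "abstract_complex L"
 shows "fund e L \<in> chains L e"
 unfolding fund_def by (rule chains_sum, rule chains_single) (use abstract_complexD[OF assms] in auto)

text \<open>With the sum of all facets as the named generator of the top cycles, later arguments can
  read off that a top cycle has the same coefficient on every facet.\<close>

definition sphere_like :: "'k::char_two itself => nat => 'a set set => bool" where
 "sphere_like (_::'k itself) e L \<longleftrightarrow>
  (\<forall>i<e. \<forall>z\<in>chains L i. bd z = (0::('a,'k) chain) --> (\<exists>b\<in>chains L (Suc i). bd b = z)) \<and>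
  bd (fund e L) = (0::('a,'k) chain) \<and>
  (\<forall>z\<in>chains L e. bd z = (0::('a,'k) chain) --> (\<exists>K. z = sc K (fund e L)))"

text \<open>The working notion: it is inherited by links and, under the link condition, by edge
  contractions.\<close>

definition hsphere :: "'k::char_two itself => nat => 'a set set => bool" where
 "hsphere K d \<Delta> \<longleftrightarrow> abstract_complex \<Delta> \<and> (\<forall>F\<in>\<Delta>. card F \<le> d) \<and>
  (\<forall>J\<in>\<Delta>. sphere_like K (d - card J) (lk \<Delta> J))"

lemma single_empty_bounds:
 assumes L: "abstract_complex L"
  and b: "b \<in> chains L (Suc 0)" "bd b = single {} (1::'k::char_two)"
 shows "\<exists>v. {v} \<in> L"
proof -
 have "b \<noteq> 0" using b(2) by (auto simp: bd_linear dest: arg_cong[of _ _ "\<lambda>c. lookup c {}"])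
 then obtain X where "X \<in> keys b" by (metis keys_eq_empty all_not_in_conv)
 hence "X \<in> L" "card X = Suc 0" using b(1) by (auto simp: chains_def)
 thus ?thesis by (auto simp: card_1_singleton_iff)
qed

text \<open>In the link of a face that is not a facet the empty simplex bounds, so the face can be
  enlarged. The link of a ridge is a set of points with one-dimensional reduced homology, hence two
  points. So each codimension-one face of a link lies in none or two of its faces of top size, and
  the sum of the latter is a cycle.\<close>

theorem homology_sphere_hsphere:
 fixes \<Delta> :: "'a set set"
 assumes H: "homology_sphere TYPE('k::char_two) d \<Delta>"
 shows "hsphere TYPE('k) d \<Delta>"
  and "F \<in> \<Delta> ==> \<exists>G\<in>\<Delta>. F \<subseteq> G \<and> card G = d"
  and "R \<in> \<Delta> ==> Suc (card R) = d ==> card {v. v \<notin> R \<and> insert v R \<in> \<Delta>} = 2"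
proof -
 have \<Delta>: "abstract_complex \<Delta>" and dim': "\<forall>F\<in>\<Delta>. card F \<le> d"
  and ls: "\<And>J. J \<in> \<Delta> ==> local_sphere TYPE('k) d \<Delta> J"
  using H by (auto simp: homology_sphere_def)
 note fin = abstract_complexD(3)[OF \<Delta>]
 note link = local_sphere_link[OF \<Delta> _ dim' ls]
 have dim: "\<And>F. F \<in> \<Delta> ==> card F \<le> d" using dim' by blast
 have lkD: "{v} \<in> lk \<Delta> J \<longleftrightarrow> v \<notin> J \<and> insert v J \<in> \<Delta>" for v J
  using abstract_complexD(4)[OF \<Delta>, of "insert v J" "{v}"] by (auto simp: lk_iff)
 have ext: "\<exists>v. v \<notin> F \<and> insert v F \<in> \<Delta>" if F: "F \<in> \<Delta>" "card F < d" for F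
 proof -
  have L: "abstract_complex (lk \<Delta> F)" using abstract_lk[OF \<Delta> F(1)] .
  have s: "single {} (1::'k) \<in> chains (lk \<Delta> F) 0"
   using abstract_complexD(2)[OF L] by (intro chains_single) auto
  have "\<exists>b\<in>chains (lk \<Delta> F) (Suc 0). bd b = single {} (1::'k)"
   by (rule link(1)[OF F(1) F(1)]) (use F s in \<open>auto simp: bd_linear bd1_def\<close>)
  thus ?thesis using single_empty_bounds[OF L] lkD by auto
 qed
 show pure: "\<exists>G\<in>\<Delta>. F \<subseteq> G \<and> card G = d" if "F \<in> \<Delta>" for F
  using that
 proof (induction "d - card F" arbitrary: F)
  case 0
  thus ?case using dim[of F] by (intro bexI[of _ F]) auto
 next
  case (Suc n)
  hence "card F < d" by simp
  then obtain v where v: "v \<notin> F" "insert v F \<in> \<Delta>" using ext[OF Suc.prems] by blast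
  have "n = d - card (insert v F)" using Suc v fin by simp
  thus ?case using Suc(1)[of "insert v F"] v by blast
 qed
 show ridge: "card {v. v \<notin> R \<and> insert v R \<in> \<Delta>} = 2" if R: "R \<in> \<Delta>" "Suc (card R) = d" for R
 proof -
  let ?S = "{v. v \<notin> R \<and> insert v R \<in> \<Delta>}"
  have L: "abstract_complex (lk \<Delta> R)" using abstract_lk[OF \<Delta> R(1)] .
  have d1: "d - card R = Suc 0" using R by simp
  have finS: "finite ?S"
   by (rule finite_subset[OF _ abstract_complexD(6)[OF \<Delta>]]) auto
  obtain z :: "('a,'k) chain" where z: "z \<in> chains (lk \<Delta> R) (Suc 0)" "bd z = 0" "z \<noteq> 0"
   using link(2)[OF R(1) R(1)] d1 by auto
  obtain X where X: "X \<in> keys z" using z(3) by (metis keys_eq_empty all_not_in_conv)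
  have kz: "\<exists>v\<in>?S. Y = {v}" if "Y \<in> keys z" for Y
   using z(1) that lkD by (fastforce simp: chains_def card_1_singleton_iff)
  then obtain u where u: "u \<in> ?S" "X = {u}" using X by auto
  have "0 = lookup (bd z) {}" using z(2) by simp
  also have "... = (\<Sum>v\<in>?S - {}. lookup z (insert v {}))"
   by (rule lookup_bd[OF finS]) (use kz in blast)
  also have "... = lookup z {u} + (\<Sum>v\<in>?S - {u}. lookup z {v})"
   using u(1) finS by (simp add: sum.remove)
  finally have "(\<Sum>v\<in>?S - {u}. lookup z {v}) \<noteq> 0" using X u by (auto simp: in_keys_iff)
  then obtain w where w: "w \<in> ?S" "w \<noteq> u" by (metis (no_types, lifting) DiffE insertI1 sum.neutral)
  have "?S = {u, w}"
  proof (rule ccontr)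
   assume "?S \<noteq> {u, w}"
   then obtain x where x: "x \<in> ?S" "x \<noteq> u" "x \<noteq> w" using u w by blast
   define c where "c p q = single {p} (1::'k) + single {q} 1" for p q :: 'a
   have c: "c p q \<in> chains (lk \<Delta> R) (d - card R)" "bd (c p q) = 0" if "p \<in> ?S" "q \<in> ?S" for p q
    using that lkD d1 by (auto simp: c_def bd_linear bd1_def intro!: chains_add chains_single)
   obtain a b where ab: "a \<noteq> 0 \<or> b \<noteq> 0" "sc a (c u w) + sc b (c u x) = 0"
    using link(3)[OF R(1) R(1) c[OF u(1) w(1)] c[OF u(1) x(1)]] by auto
   have "lookup (sc a (c u w) + sc b (c u x)) {w} = a"
     "lookup (sc a (c u w) + sc b (c u x)) {x} = b"
    using w x by (auto simp: c_def lookup_add lookup_single when_def)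
   hence "a = 0" "b = 0" unfolding ab(2) by simp_all
   thus False using ab(1) by simp
  qed
  thus ?thesis using w by simp
 qed
 show "hsphere TYPE('k) d \<Delta>"
  unfolding hsphere_def
 proof (intro conjI ballI \<Delta> dim)
  fix J assume J: "J \<in> \<Delta>"
  let ?L = "lk \<Delta> J" and ?e = "d - card J"
  have L: "abstract_complex ?L" using abstract_lk[OF \<Delta> J] .
  note finL = abstract_complexD(1)[OF L]
  have le: "card J \<le> d" using dim[OF J] .
  have cyc: "bd (fund ?e ?L) = (0::('a,'k) chain)"
  proof (rule poly_mapping_eqI)
   fix Y
   let ?V = "\<Union>\<Delta>" and ?T = "{v \<in> \<Union>\<Delta> - Y. insert v Y \<in> ?L \<and> card (insert v Y) = ?e}"
   have finV: "finite ?V" using abstract_complexD(6)[OF \<Delta>] .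
   have "lookup (bd (fund ?e ?L) :: ('a,'k) chain) Y = (\<Sum>v\<in>?V - Y. lookup (fund ?e ?L :: ('a,'k) chain) (insert v Y))"
    by (rule lookup_bd[OF finV]) (use fund_chains[OF L, of ?e] in \<open>auto simp: chains_def lk_iff\<close>)
   also have "... = (\<Sum>v\<in>?V - Y. if insert v Y \<in> ?L \<and> card (insert v Y) = ?e then 1 else 0)"
    by (simp only: lookup_fund[OF finL])
   also have "... = (\<Sum>v\<in>?T. 1)"
    using finV by (simp add: sum.If_cases Int_def)
   also have "... = 0"
   proof (cases "?T = {}")
    case False
    then obtain v where v: "v \<notin> Y" "insert v Y \<in> ?L" "card (insert v Y) = ?e" by auto
    hence vL: "insert v Y \<union> J \<in> \<Delta>" "insert v Y \<inter> J = {}" "insert v Y \<in> \<Delta>" by (auto simp: lk_iff)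
    have finY: "finite Y" "finite J" using fin[OF vL(3)] fin[OF J] by auto
    have R: "Y \<union> J \<in> \<Delta>" using abstract_complexD(4)[OF \<Delta> vL(1)] by auto
    have "card (Y \<union> J) = card Y + card J" using vL(2) finY by (intro card_Un_disjoint) auto
    moreover have cY: "Suc (card Y) = ?e" using v finY by simp
    ultimately have cR: "Suc (card (Y \<union> J)) = d" using le by linarith
    have "?T = {v. v \<notin> Y \<union> J \<and> insert v (Y \<union> J) \<in> \<Delta>}"
    proof (intro equalityI subsetI)
     fix x assume "x \<in> ?T"
     thus "x \<in> {v. v \<notin> Y \<union> J \<and> insert v (Y \<union> J) \<in> \<Delta>}" by (auto simp: lk_iff)
    next
     fix x assume x: "x \<in> {v. v \<notin> Y \<union> J \<and> insert v (Y \<union> J) \<in> \<Delta>}"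
     hence "insert x Y \<in> \<Delta>" using abstract_complexD(4)[OF \<Delta>, of "insert x (Y \<union> J)" "insert x Y"] by auto
     thus "x \<in> ?T" using x vL(2) cY finY by (auto simp: lk_iff)
    qed
    hence "card ?T = 2" using ridge[OF R cR] by simp
    thus ?thesis by simp
   qed (metis sum.empty)
   finally show "lookup (bd (fund ?e ?L) :: ('a,'k) chain) Y = lookup 0 Y" by simp
  qed
  obtain G where G: "G \<in> \<Delta>" "J \<subseteq> G" "card G = d" using pure[OF J] by auto
  have "G - J \<in> ?L" "card (G - J) = ?e"
   using G abstract_complexD(4)[OF \<Delta> G(1)] fin[OF J] by (auto simp: lk_iff Un_absorb2 card_Diff_subset)
  \<comment> \<open>Purity provides a facet of the link, so \<open>fund\<close> is nonzero and can
    serve as the generator.\<close>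
  hence top: "lookup (fund ?e ?L :: ('a,'k) chain) (G - J) = 1" by (simp add: lookup_fund[OF finL])
  show "sphere_like TYPE('k) ?e ?L"
   unfolding sphere_like_def
  proof (intro conjI allI ballI impI cyc)
   fix i and z :: "('a,'k) chain" assume "i < ?e" "z \<in> chains ?L i" "bd z = 0"
   thus "\<exists>b\<in>chains ?L (Suc i). bd b = z" by (intro link(1)[OF J J]) auto
  next
   fix z :: "('a,'k) chain" assume z: "z \<in> chains ?L ?e" "bd z = 0"
   obtain a b where ab: "a \<noteq> 0 \<or> b \<noteq> 0" "sc a z + sc b (fund ?e ?L) = 0"
    using link(3)[OF J J z fund_chains[OF L] cyc] by auto
   have "a \<noteq> 0"
   proof
    assume "a = 0"
    hence "lookup (sc b (fund ?e ?L)) (G - J) = (0::'k)" using ab(2) by simp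
    thus False using ab(1) \<open>a = 0\<close> top by simp
   qed
   have "sc a z = sc b (fund ?e ?L)" using ab(2) by (simp only: pm_eq_iff)
   hence "sc (inverse a) (sc a z) = sc (inverse a) (sc b (fund ?e ?L))" by simp
   hence "z = sc (inverse a * b) (fund ?e ?L)" using \<open>a \<noteq> 0\<close> by (simp add: sc_sc)
   thus "\<exists>K. z = sc K (fund ?e ?L)" by (intro exI)
  qed
 qed
qed

subsection \<open>Edge contraction\<close>

definition contract :: "'a => 'a => 'a set set => 'a set set" where
 "contract a b \<Delta> = (\<lambda>F. (\<lambda>x. if x = b then a else x) ` F) ` \<Delta>"

lemma contract_image:
 "(\<lambda>x. if x = b then a else x) ` F = (if b \<in> F then insert a (F - {b}) else F)"
 by auto

lemma contract_iff:
 assumes ab: "a \<noteq> b" and down: "down \<Delta>"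
 shows "G \<in> contract a b \<Delta> \<longleftrightarrow> b \<notin> G \<and> (G \<in> \<Delta> \<or> (a \<in> G \<and> insert b (G - {a}) \<in> \<Delta>))"
proof
 assume "G \<in> contract a b \<Delta>"
 then obtain F where F: "F \<in> \<Delta>" "G = (if b \<in> F then insert a (F - {b}) else F)"
  unfolding contract_def contract_image by blast
 show "b \<notin> G \<and> (G \<in> \<Delta> \<or> (a \<in> G \<and> insert b (G - {a}) \<in> \<Delta>))"
 proof (cases "b \<in> F")
  case bF: True
  show ?thesis
  proof (cases "a \<in> F")
   case True
   hence "G = F - {b}" using bF F ab by auto
   thus ?thesis using downD[OF down F(1)] by auto
  next
   case False
   hence "insert b (G - {a}) = F" using bF F ab by auto
   thus ?thesis using F bF ab by auto
  qed
 qed (use F in auto)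
next
 assume r: "b \<notin> G \<and> (G \<in> \<Delta> \<or> (a \<in> G \<and> insert b (G - {a}) \<in> \<Delta>))"
 then consider "b \<notin> G" "G \<in> \<Delta>" | "b \<notin> G" "a \<in> G" "insert b (G - {a}) \<in> \<Delta>" by blast
 thus "G \<in> contract a b \<Delta>"
 proof cases
  case 1
  thus ?thesis unfolding contract_def by (intro image_eqI[of _ _ G]) (auto simp: contract_image)
 next
  case 2
  thus ?thesis unfolding contract_def
   by (intro image_eqI[of _ _ "insert b (G - {a})"]) (auto simp: contract_image)
 qed
qed

lemma abstract_contract:
 assumes \<Delta>: "abstract_complex \<Delta>" and ab: "a \<noteq> b"
 shows "abstract_complex (contract a b \<Delta>)"
 unfolding abstract_complex_def
proof (intro conjI ballI allI impI)
 note iff = contract_iff[OF ab abstract_complexD(5)[OF \<Delta>]]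
 show "finite (contract a b \<Delta>)" using abstract_complexD(1)[OF \<Delta>] by (simp add: contract_def)
 show "{} \<in> contract a b \<Delta>" using abstract_complexD(2)[OF \<Delta>] by (simp add: iff)
 fix F assume F: "F \<in> contract a b \<Delta>"
 show "finite F" using F abstract_complexD(3)[OF \<Delta>] by (auto simp: contract_def)
 fix G assume G: "G \<subseteq> F"
 have F': "b \<notin> F" "F \<in> \<Delta> \<or> (a \<in> F \<and> insert b (F - {a}) \<in> \<Delta>)" using F by (auto simp: iff)
 have "insert b (G - {a}) \<subseteq> insert b (F - {a})" "a \<notin> G ==> G \<subseteq> insert b (F - {a})" using G by auto
 thus "G \<in> contract a b \<Delta>"
  using F' G abstract_complexD(4)[OF \<Delta>, of F G] abstract_complexD(4)[OF \<Delta>, of "insert b (F - {a})"]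
  unfolding iff by (cases "a \<in> G") blast+
qed

lemma no_big_chains:
 assumes "\<forall>F\<in>L. card F \<le> e" "c \<in> chains L i" "e < i"
 shows "c = 0"
proof (rule ccontr)
 assume "c \<noteq> 0"
 then obtain X where "X \<in> keys c" by (metis keys_eq_empty all_not_in_conv)
 hence "X \<in> L" "card X = i" using assms(2) by (auto simp: chains_def)
 thus False using assms by force
qed

text \<open>\<open>fill\<close> is the link condition for \<open>L\<close>. Two distinct surviving
  facets with the same image would differ by exchanging \<open>a\<close> and \<open>b\<close> over a
  common face, and filling would produce a face with more than \<open>e\<close> vertices. Facets
  that contain both vertices degenerate.\<close>

lemma contract_fund:
 assumes L: "abstract_complex L" and ab: "a \<noteq> b" and dim: "\<forall>F\<in>L. card F \<le> e"
  and fill: "\<And>F. a \<notin> F ==> b \<notin> F ==> insert a F \<in> L ==> insert b F \<in> L ==> insert a (insert b F) \<in> L"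
 shows "push (\<lambda>x. if x = b then a else x) (fund e L) = (fund e (contract a b L) :: ('a,'k::char_two) chain)"
proof -
 let ?\<pi> = "\<lambda>x. if x = b then a else x"
 let ?S = "{F \<in> L. card F = e}" and ?T = "{F \<in> L. card F = e \<and> \<not> (a \<in> F \<and> b \<in> F)}"
 note fin = abstract_complexD(3)[OF L]
 note iff = contract_iff[OF ab abstract_complexD(5)[OF L]]
 have inj\<pi>: "inj_on ?\<pi> F \<longleftrightarrow> \<not> (a \<in> F \<and> b \<in> F)" for F
  using ab by (auto simp: inj_on_def)
 have "push ?\<pi> (fund e L) = (\<Sum>F\<in>?S. if inj_on ?\<pi> F then single (?\<pi> ` F) (1::'k) else 0)"
  by (simp add: fund_def push_def lin_sum)
 also have "... = (\<Sum>F\<in>?T. single (?\<pi> ` F) (1::'k))"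
  by (rule sum.mono_neutral_cong_right) (use abstract_complexD(1)[OF L] inj\<pi> in auto)
 also have "... = (\<Sum>G\<in>(\<lambda>F. ?\<pi> ` F) ` ?T. single G (1::'k))"
 proof (subst sum.reindex)
  show "inj_on (\<lambda>F. ?\<pi> ` F) ?T"
  proof (rule inj_onI)
   fix F F' assume F: "F \<in> ?T" "F' \<in> ?T" and eq: "?\<pi> ` F = ?\<pi> ` F'"
   have aux: False if "F \<in> ?T" "F' \<in> ?T" "b \<in> F" "b \<notin> F'" "insert a (F - {b}) = F'" for F F'
   proof -
    let ?H = "F - {b}"
    have "a \<notin> ?H" "b \<notin> ?H" "insert a ?H \<in> L" "insert b ?H \<in> L" using that by (auto simp: insert_absorb)
    hence "insert a (insert b ?H) \<in> L" by (rule fill)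
    hence "insert a F \<in> L" using that(3) by (simp add: insert_absorb)
    moreover have "a \<notin> F" using that by auto
    moreover have "card (insert a F) = Suc e" using that(1) fin calculation by simp
    ultimately show False using dim by force
   qed
   show "F = F'"
   proof (cases "b \<in> F \<longleftrightarrow> b \<in> F'")
    case True
    show ?thesis
    proof (cases "b \<in> F")
     case bF: True
     hence "insert a (F - {b}) = insert a (F' - {b})" "a \<notin> F - {b}" "a \<notin> F' - {b}" "b \<in> F'"
      using True eq F unfolding contract_image by auto
     hence "F - {b} = F' - {b}" by (metis insert_ident)
     thus ?thesis using bF True by (metis insert_Diff)
    qed (use True eq[unfolded contract_image] in simp)
   next
    case False
    thus ?thesis using aux[OF F] aux[OF F(2,1)] eq unfolding contract_image by (cases "b \<in> F") auto
   qed
  qed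
 qed simp
 also have "(\<lambda>F. ?\<pi> ` F) ` ?T = {G \<in> contract a b L. card G = e}"
 proof (intro equalityI subsetI)
  fix G assume "G \<in> (\<lambda>F. ?\<pi> ` F) ` ?T"
  then obtain F where F: "F \<in> ?T" "G = ?\<pi> ` F" by auto
  have "inj_on ?\<pi> F" using inj\<pi> F(1) by blast
  hence "card G = card F" unfolding F(2) by (rule card_image)
  thus "G \<in> {G \<in> contract a b L. card G = e}" using F by (auto simp: contract_def)
 next
  fix G assume "G \<in> {G \<in> contract a b L. card G = e}"
  hence G: "b \<notin> G" "card G = e" "G \<in> L \<or> (a \<in> G \<and> insert b (G - {a}) \<in> L)" by (auto simp: iff)
  show "G \<in> (\<lambda>F. ?\<pi> ` F) ` ?T"
  proof (cases "G \<in> L")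
   case True
   thus ?thesis using G by (intro image_eqI[of _ _ G]) (auto simp: contract_image)
  next
   case False
   hence G2: "a \<in> G" "insert b (G - {a}) \<in> L" using G by auto
   have "finite G" using fin[OF G2(2)] by simp
   hence "card (insert b (G - {a})) = e" using G card_Suc_Diff1[OF _ G2(1)] by simp
   thus ?thesis using G G2 ab
    by (intro image_eqI[of _ _ "insert b (G - {a})"]) (auto simp: contract_image)
  qed
 qed
 finally show ?thesis by (simp add: fund_def)
qed

text \<open>The preimage of each closed face under contraction is a cone. Hence acyclic carriers
  give a chain map \<open>\<rho>\<close> backwards and a homotopy from the composite of
  \<open>\<rho>\<close> with contraction to the identity, so cycles can be moved to \<open>L\<close>
  and back.\<close>

lemma contract_sphere_like:
 assumes L: "abstract_complex L" and ab: "a \<noteq> b" and dim: "\<forall>F\<in>L. card F \<le> e"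
  and fill: "\<And>F. a \<notin> F ==> b \<notin> F ==> insert a F \<in> L ==> insert b F \<in> L ==> insert a (insert b F) \<in> L"
  and S: "sphere_like TYPE('k::char_two) e L"
 shows "sphere_like TYPE('k) e (contract a b L)"
proof -
 let ?\<pi> = "\<lambda>x. if x = b then a else x" and ?C = "contract a b L"
 note fin = abstract_complexD(3)[OF L] and dn = abstract_complexD(4)[OF L]
 have C: "abstract_complex ?C" using abstract_contract[OF L ab] .
 note iff = contract_iff[OF ab abstract_complexD(5)[OF L]]
 define Car where "Car G = {F \<in> L. ?\<pi> ` F \<subseteq> G}" for G
 have \<pi>sub: "?\<pi> ` F \<subseteq> G \<longleftrightarrow> F \<subseteq> insert b G \<and> (b \<in> F --> a \<in> G)" if "b \<notin> G" for F G
  using that by (auto split: if_splits)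
 obtain \<rho> :: "'a set => ('a,'k) chain" where \<rho>: "\<rho> {} = single {} 1"
  "\<And>X. X \<in> ?C ==> \<rho> X \<in> chains (Car X) (card X + 0)"
  "\<And>X. X \<in> ?C ==> bd (\<rho> X) = (\<lambda>X. 0) X + lin \<rho> (bd1 X)"
 proof (rule acyclic_carrier[of ?C Car "\<lambda>X. 0" 0 "single {} (1::'k)"])
  show "down ?C" by (rule abstract_complexD[OF C])
  show "Car Y \<subseteq> Car X" if "Y \<subseteq> X" for X Y using that unfolding Car_def by auto
  show "bd (single {} (1::'k)) = (\<lambda>X. 0) {}" by (simp add: bd_linear bd1_def)
  show "single {} (1::'k) \<in> chains (Car {}) 0"
   using abstract_complexD(2)[OF L] by (auto intro!: chains_single simp: Car_def)
  show "down (Car X)" for X unfolding down_def Car_def using dn by blast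
  fix G assume G: "G \<in> ?C"
  show "finite G" using abstract_complexD(3)[OF C G] .
  have G': "b \<notin> G" "G \<in> L \<or> (a \<in> G \<and> insert b (G - {a}) \<in> L)" using G by (auto simp: iff)
  assume ne: "G \<noteq> {}"
  \<comment> \<open>The apex is a vertex of \<open>G\<close> if \<open>a\<close> is missing, and
    otherwise the one of \<open>a\<close> and \<open>b\<close> with which \<open>G\<close> comes
    from a face of \<open>L\<close>. \<open>fill\<close> allows it to be added to a face that
    contains only the other one.\<close>
  consider (out) v where "a \<notin> G" "G \<in> L" "v \<in> G" | (aL) "a \<in> G" "G \<in> L" | (bL) "a \<in> G" "insert b (G - {a}) \<in> L"
   using G' ne by blast
  thus "acyclic_cx (Car G) TYPE('k)"
  proof cases
   case out
   show ?thesis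
   proof (rule cone_acyclic[of _ v])
    fix F assume "F \<in> Car G"
    hence F: "F \<subseteq> G" using G'(1) out unfolding Car_def by (auto simp: \<pi>sub)
    hence "insert v F \<subseteq> G" using out by auto
    hence "insert v F \<in> L" using dn out by auto
    thus "insert v F \<in> Car G" using \<open>insert v F \<subseteq> G\<close> G'(1) by (auto simp: Car_def \<pi>sub)
   qed
  next
   case aL
   show ?thesis
   proof (rule cone_acyclic[of _ a])
    fix F assume "F \<in> Car G"
    hence F: "F \<in> L" "F \<subseteq> insert b G" using G'(1) unfolding Car_def by (auto simp: \<pi>sub)
    have "insert a F \<in> L"
    proof (cases "b \<in> F \<and> a \<notin> F")
     case True
     have "insert a (F - {b}) \<subseteq> G" using F aL by auto
     hence "insert a (F - {b}) \<in> L" using dn aL by auto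
     hence "insert a (insert b (F - {b})) \<in> L" using True F(1) ab
      by (intro fill) (auto simp: insert_absorb)
     thus ?thesis using True by (simp add: insert_absorb)
    next
     case False
     then consider "a \<in> F" | "b \<notin> F" by blast
     thus ?thesis
     proof cases
      case 2
      hence "insert a F \<subseteq> G" using F aL by auto
      thus ?thesis using dn aL by auto
     qed (use F in \<open>simp add: insert_absorb\<close>)
    qed
    thus "insert a F \<in> Car G" using F aL G'(1) unfolding Car_def by (auto simp: \<pi>sub)
   qed
  next
   case bL
   show ?thesis
   proof (rule cone_acyclic[of _ b])
    fix F assume "F \<in> Car G"
    hence F: "F \<in> L" "F \<subseteq> insert b G" using G'(1) unfolding Car_def by (auto simp: \<pi>sub)
    have "insert b F \<in> L"
    proof (cases "a \<in> F \<and> b \<notin> F")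
     case True
     have "insert b (F - {a}) \<subseteq> insert b (G - {a})" using F by auto
     hence "insert b (F - {a}) \<in> L" using dn bL by blast
     hence "insert a (insert b (F - {a})) \<in> L" using True F(1) ab
      by (intro fill) (auto simp: insert_absorb)
     moreover have "insert a (insert b (F - {a})) = insert b F" using True by auto
     ultimately show ?thesis by simp
    next
     case False
     then consider "b \<in> F" | "a \<notin> F" by blast
     thus ?thesis
     proof cases
      case 2
      hence "insert b F \<subseteq> insert b (G - {a})" using F by auto
      thus ?thesis using dn bL by blast
     qed (use F in \<open>simp add: insert_absorb\<close>)
    qed
    thus "insert b F \<in> Car G" using F bL G'(1) unfolding Car_def by (auto simp: \<pi>sub)
   qed
  qed
 qed (auto simp: bd_linear)
 let ?r = "\<lambda>G. push ?\<pi> (\<rho> G) + single G (1::'k)"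
 obtain D where D: "D {} = 0" "\<And>X. X \<in> ?C ==> D X \<in> chains (Pow X) (card X + 1)"
  "\<And>X. X \<in> ?C ==> bd (D X) = ?r X + lin D (bd1 X)"
 proof (rule acyclic_carrier[of ?C Pow ?r 1 0])
  show "bd 0 = ?r {}" by (simp add: \<rho>(1) push_def bd_linear)
  show "Pow Y \<subseteq> Pow X" if "Y \<subseteq> X" for X Y :: "'a set" using that by auto
  show "down ?C" by (rule abstract_complexD[OF C])
  show "down (Pow X)" for X :: "'a set" by (auto simp: down_def)
  fix X assume X: "X \<in> ?C"
  show fX: "finite X" using abstract_complexD(3)[OF C X] .
  have c: "\<rho> X \<in> chains (Car X) (card X)" using \<rho>(2)[OF X] by simp
  hence "push ?\<pi> (\<rho> X) \<in> chains (Pow X) (card X)" by (rule chains_push) (simp add: Car_def)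
  thus "?r X \<in> chains (Pow X) (card X + 1 - 1)" using fX by (auto intro!: chains_add chains_single)
  have "bd (?r X) = push ?\<pi> (bd (\<rho> X)) + bd1 X" by (simp add: bd_linear push_bd[OF c])
  also have "... = lin ?r (bd1 X)"
   by (simp add: \<rho>(3)[OF X] lin_fun_add lin_ident) (simp add: push_def lin_lin)
  finally show "bd (?r X) = lin ?r (bd1 X)" .
  assume "X \<noteq> {}"
  then obtain v where "v \<in> X" by auto
  thus "acyclic_cx (Pow X) TYPE('k)" by (intro cone_acyclic[of _ v]) auto
 qed auto
 have cycle: "lin \<rho> z \<in> chains L i" "bd (lin \<rho> z) = 0" "lin D z \<in> chains ?C (Suc i)" "z = push ?\<pi> (lin \<rho> z) + bd (lin D z)"
  if z: "z \<in> chains ?C i" "bd z = 0" for z i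
 proof -
  have Lc: "Car X \<subseteq> L" for X unfolding Car_def by auto
  show "lin \<rho> z \<in> chains L i" using z(1)
   by (rule chains_lin) (use \<rho>(2) Lc in \<open>auto intro: chains_mono\<close>)
  show "bd (lin \<rho> z) = 0" using homotopy_chain[of ?C \<rho> "\<lambda>_. 0" z i, OF \<rho>(3) z(1)] z(2) by simp
  show "lin D z \<in> chains ?C (Suc i)"
   using z(1)
  proof (rule chains_lin)
   fix X assume X: "X \<in> ?C" "card X = i"
   have "Pow X \<subseteq> ?C" using abstract_complexD(4)[OF C X(1)] by auto
   thus "D X \<in> chains ?C (Suc i)" using D(2)[OF X(1)] X(2) by (auto intro: chains_mono)
  qed
  have "bd (lin D z) = push ?\<pi> (lin \<rho> z) + z"
   using homotopy_chain[OF D(3) z(1)] z(2) by (simp add: lin_fun_add lin_ident) (simp add: push_def lin_lin)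
  thus "z = push ?\<pi> (lin \<rho> z) + bd (lin D z)" by simp
 qed
 have S1: "\<exists>b\<in>chains L (Suc i). bd b = z" if "i < e" "z \<in> chains L i" "bd z = 0" for i and z :: "('a,'k) chain"
  using S that unfolding sphere_like_def by simp
 have S2: "bd (fund e L) = (0::('a,'k) chain)" using S unfolding sphere_like_def by simp
 have S3: "\<exists>K. z = sc K (fund e L)" if "z \<in> chains L e" "bd z = 0" for z :: "('a,'k) chain"
  using S that unfolding sphere_like_def by simp
 have pf: "push ?\<pi> (fund e L) = (fund e ?C :: ('a,'k) chain)" using contract_fund[OF L ab dim fill] .
 show ?thesis
  unfolding sphere_like_def
 proof (intro conjI allI ballI impI)
  fix i and z :: "('a,'k) chain" assume i: "i < e" and z: "z \<in> chains ?C i" "bd z = 0"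
  note c = cycle[OF z]
  obtain \<beta> where \<beta>: "\<beta> \<in> chains L (Suc i)" "bd \<beta> = lin \<rho> z" using S1[OF i c(1,2)] by blast
  have "bd (push ?\<pi> \<beta> + lin D z) = z"
   using c(4) by (simp add: bd_linear push_bd[OF \<beta>(1), symmetric] \<beta>(2))
  moreover have "push ?\<pi> \<beta> \<in> chains ?C (Suc i)" using \<beta>(1) by (rule chains_push) (auto simp: contract_def)
  ultimately show "\<exists>b\<in>chains ?C (Suc i). bd b = z" using chains_add[OF _ c(3)] by blast
 next
  show "bd (fund e ?C) = (0::('a,'k) chain)"
   unfolding pf[symmetric] push_bd[OF fund_chains[OF L], symmetric] S2 by (simp add: push_linear)
 next
  fix z :: "('a,'k) chain" assume z: "z \<in> chains ?C e" "bd z = 0"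
  note c = cycle[OF z]
  obtain K where K: "lin \<rho> z = sc K (fund e L)" using S3[OF c(1,2)] by blast
  have "\<forall>G\<in>?C. card G \<le> e"
  proof
   fix G assume "G \<in> ?C"
   then obtain F where "F \<in> L" "G = ?\<pi> ` F" by (auto simp: contract_def)
   thus "card G \<le> e" using dim card_image_le[OF fin[of F], of ?\<pi>] by force
  qed
  hence "lin D z = 0" using no_big_chains c(3) by blast
  hence "z = sc K (fund e ?C)" using c(4) by (simp add: K push_linear pf bd_linear)
  thus "\<exists>K. z = sc K (fund e ?C)" by (intro exI)
 qed
qed

section \<open>Deleting a vertex and gluing along a link\<close>

lemma lookup_cone:
 assumes "\<And>X. X \<in> keys c ==> b \<notin> X"
 shows "lookup (cone b c) H = (if b \<in> H then lookup c (H - {b}) else 0)"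
proof -
 have "lookup (cone b c) H =
  (\<Sum>X\<in>keys c. if b \<in> H \<and> X = H - {b} then lookup c X else 0)"
  unfolding cone_def lookup_lin
 proof (rule sum.cong)
  fix X assume "X \<in> keys c"
  hence "b \<notin> X" by (rule assms)
  hence "insert b X = H \<longleftrightarrow> b \<in> H \<and> X = H - {b}" by blast
  thus "lookup c X * lookup (if b \<in> X then 0 else single (insert b X) 1) H
   = (if b \<in> H \<and> X = H - {b} then lookup c X else 0)"
   using \<open>b \<notin> X\<close> by (simp add: lookup_single when_def)
 qed simp
 also have "... = (if b \<in> H then lookup c (H - {b}) else 0)"
  by (cases "b \<in> H") (auto simp: in_keys_iff)
 finally show ?thesis .
qed

definition del :: "'a set set => 'a => 'a set set" where
 "del X b = {H \<in> X. b \<notin> H}"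

lemma mem_del: "H \<in> del X b \<longleftrightarrow> H \<in> X \<and> b \<notin> H"
 by (auto simp: del_def)

text \<open>A chain is the cone from \<open>b\<close> over its link part plus a chain that misses
  \<open>b\<close>. Splitting the boundary accordingly does the work of a Mayer-Vietoris
  sequence.\<close>

lemma vertex_split:
 assumes X: "abstract_complex X" and w: "w \<in> chains X (Suc i)"
 shows "strip {b} w \<in> chains (lk X {b}) i" "w + cone b (strip {b} w) \<in> chains (del X b) (Suc i)"
  "bd w = bd (w + cone b (strip {b} w)) + strip {b} w + cone b (bd (strip {b} w))"
proof -
 show s: "strip {b} w \<in> chains (lk X {b}) i" using chains_strip[OF X w, of "{b}"] by simp
 have nb: "b \<notin> Y" if "Y \<in> keys (strip {b} w)" for Y using s that by (auto simp: chains_def lk_iff)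
 have c: "cone b (strip {b} w) \<in> chains X (Suc i)"
  by (rule chains_cone[OF s]) (auto simp: lk_iff)
 show "w + cone b (strip {b} w) \<in> chains (del X b) (Suc i)"
  unfolding chains_def
 proof (intro CollectI ballI)
  fix H assume H: "H \<in> keys (w + cone b (strip {b} w))"
  hence "H \<in> X \<and> finite H \<and> card H = Suc i" using chains_add[OF w c] by (auto simp: chains_def)
  moreover have "b \<notin> H"
  proof
   assume b: "b \<in> H"
   have "lookup (cone b (strip {b} w)) H = lookup w (H - {b} \<union> {b})"
    using b by (simp only: lookup_cone[OF nb] if_True) (rule lookup_strip, auto)
   also have "H - {b} \<union> {b} = H" using b by auto
   finally show False using H by (simp add: in_keys_iff lookup_add)
  qed
  ultimately show "H \<in> del X b \<and> finite H \<and> card H = Suc i" by (simp add: del_def)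
 qed
 have bc: "bd (cone b (strip {b} w)) = strip {b} w + cone b (bd (strip {b} w))" using bd_cone[OF s] .
 show "bd w = bd (w + cone b (strip {b} w)) + strip {b} w + cone b (bd (strip {b} w))"
  by (simp add: bd_linear bc add.assoc) (simp add: add.left_commute)
qed

lemma vertex_split_del:
 assumes "z \<in> chains (del X b) i"
 shows "strip {b} z = 0"
proof (rule strip_avoid)
 show "z \<in> chains (avoid X {b}) i" using assms by (rule chains_mono) (auto simp: del_def avoid_def)
qed

lemma sphere_likeD:
 assumes "sphere_like TYPE('k::char_two) e L"
 shows "i < e ==> z \<in> chains L i ==> bd z = (0::('a,'k) chain) ==> \<exists>b\<in>chains L (Suc i). bd b = z"
  and "bd (fund e L) = (0::('a,'k) chain)"
  and "z \<in> chains L e ==> bd z = (0::('a,'k) chain) ==> \<exists>K. z = sc K (fund e L)"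
 using assms unfolding sphere_like_def by simp_all

lemma down_del: "down X ==> down (del X b)"
 unfolding down_def del_def by blast

lemma abstract_del:
 assumes "abstract_complex X"
 shows "abstract_complex (del X b)"
 unfolding abstract_complex_def
proof (intro conjI ballI allI impI)
 show "finite (del X b)" by (rule finite_subset[OF _ abstract_complexD(1)[OF assms]]) (auto simp: mem_del)
 show "{} \<in> del X b" using abstract_complexD(2)[OF assms] by (simp add: mem_del)
 show "finite F" if "F \<in> del X b" for F using abstract_complexD(3)[OF assms] that by (simp add: mem_del)
 show "G \<in> del X b" if "F \<in> del X b" "G \<subseteq> F" for F G
  using downD[OF down_del[OF abstract_complexD(5)[OF assms]] that] .
qed

text \<open>A sphere minus an open vertex star is a ball bounded by the link. A cycle of the ball
  bounds in the sphere; the part of the bounding chain through \<open>b\<close> leaves a cycle in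
  the link, which is filled inside the link or, in its top index, by the fundamental chain of the
  ball.\<close>

lemma vertex_deletion_acyclic:
 fixes X :: "'a set set"
 assumes X: "abstract_complex X" and b: "{b} \<in> X" and dim: "\<forall>F\<in>X. card F \<le> Suc e"
  and SX: "sphere_like TYPE('k::char_two) (Suc e) X" and SE: "sphere_like TYPE('k) e (lk X {b})"
  and F: "F \<in> lk X {b}" "card F = e"
 shows "bd (fund (Suc e) (del X b)) = (fund e (lk X {b}) :: ('a,'k) chain)"
  and "z \<in> chains (del X b) i ==> bd z = (0::('a,'k) chain) ==> \<exists>p\<in>chains (del X b) (Suc i). bd p = z"
proof -
 let ?P = "del X b" and ?E = "lk X {b}"
 note dX = abstract_complexD(5)[OF X]
 have E: "abstract_complex ?E" using abstract_lk[OF X b] .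
 have finX: "finite X" "finite ?E" "finite ?P" using abstract_complexD(1)[OF X] abstract_complexD(1)[OF E] by (auto simp: del_def)
 have fX: "(fund (Suc e) X :: ('a,'k) chain) \<in> chains X (Suc e)" using fund_chains[OF X] .
 have finF: "finite Y" if "Y \<in> X" for Y using abstract_complexD(3)[OF X that] .
 have sX: "strip {b} (fund (Suc e) X) = (fund e ?E :: ('a,'k) chain)"
 proof (rule poly_mapping_eqI)
  fix H
  show "lookup (strip {b} (fund (Suc e) X) :: ('a,'k) chain) H = lookup (fund e ?E) H"
  proof (cases "b \<in> H")
   case True
   hence "H \<notin> keys (strip {b} (fund (Suc e) X) :: ('a,'k) chain)"
    using vertex_split(1)[OF X fX, of b] by (auto simp: chains_def lk_iff)
   thus ?thesis using True by (auto simp: in_keys_iff lookup_fund[OF finX(2)] lk_iff)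
  next
   case False
   have iff: "insert b H \<in> X \<and> card (insert b H) = Suc e \<longleftrightarrow> H \<in> ?E \<and> card H = e"
   proof (cases "insert b H \<in> X")
    case True
    hence "finite H" "H \<in> X" using finF[OF True] downD[OF dX True] by auto
    thus ?thesis using True False by (auto simp: lk_iff)
   qed (auto simp: lk_iff)
   have "lookup (strip {b} (fund (Suc e) X) :: ('a,'k) chain) H = lookup (fund (Suc e) X) (insert b H)"
    using False by (subst lookup_strip) auto
   also have "... = lookup (fund e ?E) H"
    by (simp only: lookup_fund[OF finX(1)] lookup_fund[OF finX(2)] iff)
   finally show ?thesis .
  qed
 qed
 have rX: "fund (Suc e) X + cone b (fund e ?E) = (fund (Suc e) ?P :: ('a,'k) chain)"
 proof (rule poly_mapping_eqI)
  fix H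
  have "lookup (cone b (fund e ?E)) H = (if b \<in> H then lookup (fund e ?E :: ('a,'k) chain) (H - {b}) else 0)"
   by (rule lookup_cone) (use fund_chains[OF E, of e] in \<open>auto simp: chains_def lk_iff\<close>)
  moreover have "H - {b} \<in> ?E \<and> card (H - {b}) = e \<longleftrightarrow> H \<in> X \<and> card H = Suc e" if "b \<in> H"
  proof (cases "H \<in> X")
   case True
   hence "H - {b} \<in> X" "finite H" using downD[OF dX True] finF[OF True] by auto
   thus ?thesis using that True card_Suc_Diff1[OF \<open>finite H\<close> that] by (auto simp: lk_iff insert_absorb)
  qed (use that in \<open>auto simp: lk_iff insert_absorb\<close>)
  ultimately show "lookup (fund (Suc e) X + cone b (fund e ?E)) H = lookup (fund (Suc e) ?P :: ('a,'k) chain) H"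
   using lookup_fund[OF finX(3), of "Suc e" H, where 'b = 'k]
   by (cases "b \<in> H") (simp_all add: lookup_add lookup_fund[OF finX(1)] lookup_fund[OF finX(2)] mem_del)
 qed
 show bP: "bd (fund (Suc e) ?P) = (fund e ?E :: ('a,'k) chain)"
 proof -
  have "0 = bd (fund (Suc e) ?P) + (fund e ?E :: ('a,'k) chain) + cone b (bd (fund e ?E))"
   using vertex_split(3)[OF X fX, of b] unfolding sX rX sphere_likeD(2)[OF SX] .
  also have "cone b (bd (fund e ?E)) = (0 :: ('a,'k) chain)" unfolding sphere_likeD(2)[OF SE] by (simp add: cone_def)
  finally show ?thesis by (simp add: pm_eq_iff)
 qed
 show "\<exists>p\<in>chains ?P (Suc i). bd p = z" if z: "z \<in> chains ?P i" "bd z = (0::('a,'k) chain)" for z i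
 proof -
  have zX: "z \<in> chains X i" using z(1) by (rule chains_mono) (auto simp: del_def)
  consider "i < Suc e" | "i = Suc e" | "Suc e < i" by linarith
  thus ?thesis
  proof cases
   case 1
   obtain w where w: "w \<in> chains X (Suc i)" "bd w = z" using sphere_likeD(1)[OF SX 1 zX z(2)] by blast
   note sp = vertex_split[OF X w(1), of b]
   let ?w0 = "w + cone b (strip {b} w)" and ?w1 = "strip {b} w"
   have b1: "bd ?w1 = 0" using strip_bd[OF w(1), of "{b}"] vertex_split_del[OF z(1)] w(2) by simp
   have zz: "z = bd ?w0 + ?w1" using sp(3) unfolding b1 w(2) by (simp add: cone_def)
   show ?thesis
   proof (cases "i < e")
    case True
    obtain v where v: "v \<in> chains ?E (Suc i)" "bd v = ?w1" using sphere_likeD(1)[OF SE True sp(1) b1] by blast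
    have "v \<in> chains ?P (Suc i)" using v(1) by (rule chains_mono) (auto simp: del_def lk_iff)
    moreover have "bd (?w0 + v) = z" using zz v(2) by (simp only: bd_linear)
    ultimately show ?thesis using chains_add[OF sp(2)] by blast
   next
    case False
    hence ie: "i = e" using 1 by simp
    obtain K where K: "?w1 = sc K (fund e ?E)" using sphere_likeD(3)[OF SE sp(1)[unfolded ie] b1] by blast
    have P: "abstract_complex ?P" using abstract_del[OF X] .
    have "bd (?w0 + sc K (fund (Suc e) ?P)) = bd ?w0 + ?w1" by (simp only: bd_linear bP K)
    hence "bd (?w0 + sc K (fund (Suc e) ?P)) = z" using zz by simp
    moreover have "?w0 + sc K (fund (Suc e) ?P) \<in> chains ?P (Suc i)"
     using chains_add[OF sp(2) chains_sc[OF fund_chains[OF P]]] unfolding ie .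
    ultimately show ?thesis by blast
   qed
  next
   case 2
   obtain K where K: "z = sc K (fund (Suc e) X)" using sphere_likeD(3)[OF SX zX[unfolded 2] z(2)] by blast
   have "strip {b} z = sc K (fund e ?E)" by (simp only: K strip_linear sX)
   hence "sc K (fund e ?E) = (0::('a,'k) chain)" using vertex_split_del[OF z(1)] by simp
   \<comment> \<open>The facet \<open>F\<close> makes the fundamental cycle of the link nonzero, so
     no nonzero multiple of the fundamental cycle of the sphere avoids \<open>b\<close>.\<close>
   hence "lookup (sc K (fund e ?E)) F = (0::'k)" by simp
   hence "K = 0" using F by (simp add: lookup_fund[OF finX(2)])
   hence "z = 0" by (simp add: K)
   thus ?thesis by (intro bexI[of _ 0]) (simp_all add: bd_linear)
  next
   case 3
   hence "z = 0" using no_big_chains[OF dim zX] by simp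
   thus ?thesis by (intro bexI[of _ 0]) (simp_all add: bd_linear)
  qed
 qed
qed

lemma restrict_chain:
 assumes "z \<in> chains (P \<union> Q) i"
 obtains p q where "p \<in> chains P i" "q \<in> chains Q i" "z = p + q"
proof
 let ?p = "lin (\<lambda>H. if H \<in> P then single H 1 else 0) z"
 let ?q = "lin (\<lambda>H. if H \<in> P then 0 else single H 1) z"
 show "?p \<in> chains P i" using assms by (rule chains_lin) (auto intro!: chains_single)
 show "?q \<in> chains Q i" using assms by (rule chains_lin) (auto intro!: chains_single)
 have "?p + ?q = lin (\<lambda>H. single H 1) z"
  unfolding lin_fun_add[symmetric] by (rule lin_cong) simp
 thus "z = ?p + ?q" by (simp add: lin_ident)
qed

lemma chains_Int: "c \<in> chains P i ==> c \<in> chains Q i ==> c \<in> chains (P \<inter> Q) i"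
 by (auto simp: chains_def)

text \<open>Two balls glued along their common boundary sphere. The two halves of a cycle have the
  same boundary, which lies in the intersection; filling it there closes both halves, and each ball
  is acyclic. The intersection has smaller dimension, so the fundamental chains add.\<close>

lemma union_sphere_like:
 fixes P Q :: "'a set set"
 assumes P: "abstract_complex P" and Q: "abstract_complex Q"
  and dim: "\<forall>F\<in>P \<union> Q. card F \<le> Suc e" "\<forall>F\<in>P \<inter> Q. card F \<le> e"
  and SE: "sphere_like TYPE('k::char_two) e (P \<inter> Q)"
  and bP: "bd (fund (Suc e) P) = (fund e (P \<inter> Q) :: ('a,'k) chain)" and bQ: "bd (fund (Suc e) Q) = (fund e (P \<inter> Q) :: ('a,'k) chain)"
  and aP: "\<And>z i. z \<in> chains P i ==> bd z = (0::('a,'k) chain) ==> \<exists>p\<in>chains P (Suc i). bd p = z"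
  and aQ: "\<And>z i. z \<in> chains Q i ==> bd z = (0::('a,'k) chain) ==> \<exists>p\<in>chains Q (Suc i). bd p = z"
 shows "sphere_like TYPE('k) (Suc e) (P \<union> Q)"
proof -
 let ?M = "P \<union> Q" and ?E = "P \<inter> Q"
 have finP: "finite P" "finite Q" using abstract_complexD(1)[OF P] abstract_complexD(1)[OF Q] by auto
 have PM: "c \<in> chains ?M j" if "c \<in> chains P j" for c :: "('a,'k) chain" and j using that by (rule chains_mono) auto
 have QM: "c \<in> chains ?M j" if "c \<in> chains Q j" for c :: "('a,'k) chain" and j using that by (rule chains_mono) auto
 have fM: "fund (Suc e) ?M = (fund (Suc e) P + fund (Suc e) Q :: ('a,'k) chain)"
 proof (rule poly_mapping_eqI)
  fix H
  have "\<not> (H \<in> P \<and> H \<in> Q \<and> card H = Suc e)" using dim(2) by force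
  thus "lookup (fund (Suc e) ?M :: ('a,'k) chain) H = lookup (fund (Suc e) P + fund (Suc e) Q) H"
   using finP by (auto simp: lookup_add lookup_fund)
 qed
 have split: "\<exists>p q. p \<in> chains P i \<and> q \<in> chains Q i \<and> z = p + q \<and> bd p = bd q \<and> bd p \<in> chains ?E (i - 1)"
  if z: "z \<in> chains ?M i" "bd z = 0" for z :: "('a,'k) chain" and i
 proof -
  obtain p q where pq: "p \<in> chains P i" "q \<in> chains Q i" "z = p + q" using restrict_chain[OF z(1)] .
  have eq: "bd p = bd q" using z(2) unfolding pq(3) bd_linear(1) by (simp only: pm_eq_iff)
  have "bd p \<in> chains P (i - 1)" using chains_bd[OF abstract_complexD(5)[OF P] pq(1)] .
  moreover have "bd p \<in> chains Q (i - 1)" unfolding eq using chains_bd[OF abstract_complexD(5)[OF Q] pq(2)] .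
  ultimately show ?thesis using chains_Int pq eq by blast
 qed
 show ?thesis
  unfolding sphere_like_def
 proof (intro conjI allI ballI impI)
  fix i and z :: "('a,'k) chain" assume i: "i < Suc e" and z: "z \<in> chains ?M i" "bd z = 0"
  obtain p q where pq: "p \<in> chains P i" "q \<in> chains Q i" "z = p + q" "bd p = bd q" "bd p \<in> chains ?E (i - 1)"
   using split[OF z] by (elim exE conjE)
  have "\<exists>y\<in>chains ?E i. bd y = bd p"
  proof (cases "i = 0")
   case True
   hence "bd p = 0" using bd_chains_0[of p] pq(1) by simp
   thus ?thesis by (intro bexI[of _ 0]) (simp_all add: bd_linear)
  next
   case False
   thus ?thesis using sphere_likeD(1)[OF SE _ pq(5)] i by simp
  qed
  then obtain y where y: "y \<in> chains ?E i" "bd y = bd p" by blast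
  have y': "y \<in> chains P i" "y \<in> chains Q i" using y(1) by (auto intro: chains_mono)
  obtain p' where p': "p' \<in> chains P (Suc i)" "bd p' = p + y"
   using aP[OF chains_add[OF pq(1) y'(1)]] by (auto simp: bd_linear y(2))
  obtain q' where q': "q' \<in> chains Q (Suc i)" "bd q' = q + y"
   using aQ[OF chains_add[OF pq(2) y'(2)]] by (auto simp: bd_linear y(2) pq(4))
  have "bd (p' + q') = (p + y) + (y + q)" unfolding bd_linear p'(2) q'(2) by (simp only: add.commute[of q])
  also have "... = z" unfolding pq(3) by (rule pm_cancel_mid)
  finally show "\<exists>b\<in>chains ?M (Suc i). bd b = z" using chains_add[OF PM[OF p'(1)] QM[OF q'(1)]] by blast
 next
  show "bd (fund (Suc e) ?M) = (0::('a,'k) chain)" unfolding fM bd_linear bP bQ by simp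
 next
  fix z :: "('a,'k) chain" assume z: "z \<in> chains ?M (Suc e)" "bd z = 0"
  obtain p q where pq: "p \<in> chains P (Suc e)" "q \<in> chains Q (Suc e)" "z = p + q" "bd p = bd q" "bd p \<in> chains ?E e"
   using split[OF z] by auto
  obtain K where K: "bd p = sc K (fund e ?E)" using sphere_likeD(3)[OF SE pq(5)] by auto
  have "\<forall>F\<in>P. card F \<le> Suc e" "\<forall>F\<in>Q. card F \<le> Suc e" using dim(1) by auto
  note big = no_big_chains[OF this(1)] no_big_chains[OF this(2)]
  have "p + sc K (fund (Suc e) P) = 0"
  proof -
   have "bd (p + sc K (fund (Suc e) P)) = 0" by (simp add: bd_linear bP K)
   then obtain r where r: "r \<in> chains P (Suc (Suc e))" "bd r = p + sc K (fund (Suc e) P)"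
    using aP[OF chains_add[OF pq(1) chains_sc[OF fund_chains[OF P]]]] by blast
   hence "r = 0" using big(1)[OF r(1)] by simp
   thus ?thesis using r(2) by (simp add: bd_linear)
  qed
  hence p: "p = sc K (fund (Suc e) P)" by (simp only: pm_eq_iff)
  have "q + sc K (fund (Suc e) Q) = 0"
  proof -
   have "bd (q + sc K (fund (Suc e) Q)) = 0" using K pq(4) by (simp add: bd_linear bQ)
   then obtain r where r: "r \<in> chains Q (Suc (Suc e))" "bd r = q + sc K (fund (Suc e) Q)"
    using aQ[OF chains_add[OF pq(2) chains_sc[OF fund_chains[OF Q]]]] by blast
   hence "r = 0" using big(2)[OF r(1)] by simp
   thus ?thesis using r(2) by (simp add: bd_linear)
  qed
  hence q: "q = sc K (fund (Suc e) Q)" by (simp only: pm_eq_iff)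
  show "\<exists>K. z = sc K (fund (Suc e) ?M)" unfolding pq(3) p q fM sc_add(1)[symmetric] by (rule exI[of _ K]) (rule refl)
 qed
qed

lemma link_condition_fill:
 assumes lc: "link_condition \<Delta>" and \<Delta>: "abstract_complex \<Delta>" and e: "a \<noteq> b" "{a, b} \<in> \<Delta>"
  and F: "a \<notin> F" "b \<notin> F" "insert a F \<in> \<Delta>" "insert b F \<in> \<Delta>"
 shows "insert a (insert b F) \<in> \<Delta>"
proof -
 have "F \<in> \<Delta>" using abstract_complexD(4)[OF \<Delta> F(3)] by auto
 hence "F \<in> lk \<Delta> {a} \<inter> lk \<Delta> {b}" using F by (auto simp: lk_iff)
 also have "... = lk \<Delta> {a, b}" using lc e by (auto simp: link_condition_def)
 finally show ?thesis by (simp add: lk_iff insert_commute)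
qed

lemma hsphere_facet:
 assumes H: "hsphere TYPE('k::char_two) d \<Delta>" and F: "F \<in> \<Delta>"
 obtains G where "G \<in> \<Delta>" "F \<subseteq> G" "card G = d"
proof -
 have \<Delta>: "abstract_complex \<Delta>" and dim: "\<forall>F\<in>\<Delta>. card F \<le> d"
  and sl: "\<And>J. J \<in> \<Delta> ==> sphere_like TYPE('k) (d - card J) (lk \<Delta> J)"
  using H by (auto simp: hsphere_def)
 have "\<exists>G\<in>\<Delta>. F \<subseteq> G \<and> card G = d" using F
 proof (induction "d - card F" arbitrary: F)
  case 0
  thus ?case using dim by (intro bexI[of _ F]) (auto simp: order_antisym)
 next
  case (Suc n)
  hence lt: "0 < d - card F" by simp
  have L: "abstract_complex (lk \<Delta> F)" using abstract_lk[OF \<Delta> Suc.prems] .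
  have s: "single {} (1::'k) \<in> chains (lk \<Delta> F) 0"
   using abstract_complexD(2)[OF L] by (intro chains_single) auto
  obtain b where b: "b \<in> chains (lk \<Delta> F) (Suc 0)" "bd b = single {} (1::'k)"
   using sphere_likeD(1)[OF sl[OF Suc.prems] lt s] by (auto simp: bd_linear bd1_def)
  obtain v where "{v} \<in> lk \<Delta> F" using single_empty_bounds[OF L b] by blast
  hence v: "v \<notin> F" "insert v F \<in> \<Delta>" by (auto simp: lk_iff)
  have "n = d - card (insert v F)" using Suc(2) v(1) abstract_complexD(3)[OF \<Delta> Suc.prems] by simp
  thus ?case using Suc(1)[OF _ v(2)] by blast
 qed
 thus thesis using that by blast
qed

lemma lk_lk:
 assumes "down \<Delta>" "J \<inter> t = {}"
 shows "lk (lk \<Delta> J) t = lk \<Delta> (J \<union> t)"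
proof (intro equalityI subsetI)
 fix G assume "G \<in> lk (lk \<Delta> J) t"
 hence "G \<in> \<Delta>" "G \<inter> J = {}" "(G \<union> t) \<union> J \<in> \<Delta>" "G \<inter> t = {}" by (auto simp: lk_iff)
 moreover have "(G \<union> t) \<union> J = G \<union> (J \<union> t)" by blast
 ultimately show "G \<in> lk \<Delta> (J \<union> t)" by (simp add: lk_iff Int_Un_distrib)
next
 fix G assume "G \<in> lk \<Delta> (J \<union> t)"
 hence G: "G \<in> \<Delta>" "G \<union> (J \<union> t) \<in> \<Delta>" "G \<inter> J = {}" "G \<inter> t = {}" by (auto simp: lk_iff)
 have "G \<union> J \<in> \<Delta>" "G \<union> t \<in> \<Delta>" "G \<union> t \<union> J \<in> \<Delta>"
  by (rule downD[OF assms(1) G(2)], blast)+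
 thus "G \<in> lk (lk \<Delta> J) t" using G assms(2) by (auto simp: lk_iff)
qed

lemma hsphere_link:
 assumes H: "hsphere TYPE('k::char_two) d \<Delta>" and J: "J \<in> \<Delta>"
 shows "hsphere TYPE('k) (d - card J) (lk \<Delta> J)"
proof -
 have \<Delta>: "abstract_complex \<Delta>" and dim: "\<forall>F\<in>\<Delta>. card F \<le> d"
  and sl: "\<And>J. J \<in> \<Delta> ==> sphere_like TYPE('k) (d - card J) (lk \<Delta> J)"
  using H by (auto simp: hsphere_def)
 note fin = abstract_complexD(3)[OF \<Delta>]
 have c: "card (J \<union> t) = card J + card t" if "t \<in> lk \<Delta> J" for t
  using that fin[OF J] fin[of t] by (intro card_Un_disjoint) (auto simp: lk_iff)
 show ?thesis
  unfolding hsphere_def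
 proof (intro conjI ballI)
  show "abstract_complex (lk \<Delta> J)" using abstract_lk[OF \<Delta> J] .
  fix t assume t: "t \<in> lk \<Delta> J"
  hence st: "J \<union> t \<in> \<Delta>" "J \<inter> t = {}" by (auto simp: lk_iff Un_commute)
  have "card J + card t \<le> d" using dim st(1) c[OF t] by auto
  thus "card t \<le> d - card J" by simp
  show "sphere_like TYPE('k) (d - card J - card t) (lk (lk \<Delta> J) t)"
   using sl[OF st(1)] unfolding c[OF t] lk_lk[OF abstract_complexD(5)[OF \<Delta>] st(2)] by simp
 qed
qed

text \<open>If \<open>t\<close> misses \<open>a\<close>, its link in the contraction is the
  contraction of its link. For \<open>t = insert a \<rho>\<close> it is the link of whichever of
  \<open>insert a \<rho>\<close> and \<open>insert b \<rho>\<close> is a face; if both are, it is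
  the union of their links with the other vertex deleted, two balls that by the link condition meet
  exactly in the link of \<open>insert a (insert b \<rho>)\<close>.\<close>

theorem hsphere_contract:
 fixes \<Delta> :: "'a set set"
 assumes H: "hsphere TYPE('k::char_two) d \<Delta>" and lc: "link_condition \<Delta>"
  and e: "a \<noteq> b" "{a, b} \<in> \<Delta>"
 shows "hsphere TYPE('k) d (contract a b \<Delta>)"
proof -
 have \<Delta>: "abstract_complex \<Delta>" and dim: "\<forall>F\<in>\<Delta>. card F \<le> d"
  and sl: "\<And>J. J \<in> \<Delta> ==> sphere_like TYPE('k) (d - card J) (lk \<Delta> J)"
  using H by (auto simp: hsphere_def)
 let ?C = "contract a b \<Delta>" and ?\<pi> = "\<lambda>x. if x = b then a else x"
 note dn = abstract_complexD(4)[OF \<Delta>] and fin = abstract_complexD(3)[OF \<Delta>] and dD = abstract_complexD(5)[OF \<Delta>]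
 note iff = contract_iff[OF e(1) dD]
 note fill = link_condition_fill[OF lc \<Delta> e]
 have linkdim: "\<forall>F\<in>lk \<Delta> J. card F \<le> d - card J" if "J \<in> \<Delta>" for J
  using hsphere_link[OF H that] by (simp add: hsphere_def)
 show ?thesis
  unfolding hsphere_def
 proof (intro conjI ballI)
  show G: "abstract_complex ?C" using abstract_contract[OF \<Delta> e(1)] .
  show "card G \<le> d" if GC: "G \<in> ?C" for G
  proof -
   obtain F where "F \<in> \<Delta>" "G = ?\<pi> ` F" using GC unfolding contract_def by blast
   thus ?thesis using dim card_image_le[OF fin[of F], of ?\<pi>] by force
  qed
  fix t assume t: "t \<in> ?C"
  have bt: "b \<notin> t" using t iff by blast
  show "sphere_like TYPE('k) (d - card t) (lk ?C t)"
  proof (cases "a \<in> t")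
   case False
   hence tD: "t \<in> \<Delta>" using t iff by blast
   have "lk ?C t = contract a b (lk \<Delta> t)"
   proof (intro equalityI subsetI)
    fix G assume "G \<in> lk ?C t"
    hence G: "G \<inter> t = {}" "b \<notin> G" "G \<union> t \<in> \<Delta> \<or> (a \<in> G \<and> insert b (G \<union> t - {a}) \<in> \<Delta>)"
     using False by (auto simp: lk_iff iff)
    have "G \<in> lk \<Delta> t \<or> (a \<in> G \<and> insert b (G - {a}) \<in> lk \<Delta> t)"
     using G(3)
    proof
     assume "G \<union> t \<in> \<Delta>"
     thus ?thesis using dn[of "G \<union> t" G] G(1) by (auto simp: lk_iff)
    next
     assume r: "a \<in> G \<and> insert b (G \<union> t - {a}) \<in> \<Delta>"
     have eq: "insert b (G \<union> t - {a}) = insert b (G - {a}) \<union> t" using False by blast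
     hence "insert b (G - {a}) \<in> \<Delta>" using r dn[of "insert b (G \<union> t - {a})" "insert b (G - {a})"] by auto
     thus ?thesis using r eq G(1) bt by (auto simp: lk_iff)
    qed
    thus "G \<in> contract a b (lk \<Delta> t)" using G(2) by (simp add: contract_iff[OF e(1) down_lk[OF dD]])
   next
    fix G assume "G \<in> contract a b (lk \<Delta> t)"
    hence G: "b \<notin> G" "G \<in> lk \<Delta> t \<or> (a \<in> G \<and> insert b (G - {a}) \<in> lk \<Delta> t)"
     by (simp_all add: contract_iff[OF e(1) down_lk[OF dD]])
    show "G \<in> lk ?C t"
     using G(2)
    proof
     assume "G \<in> lk \<Delta> t"
     thus ?thesis using G(1) bt by (auto simp: lk_iff iff)
    next
     assume r: "a \<in> G \<and> insert b (G - {a}) \<in> lk \<Delta> t"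
     have eq: "insert b (G \<union> t - {a}) = insert b (G - {a}) \<union> t" using False by blast
     thus ?thesis using r G(1) bt False by (auto simp: lk_iff iff)
    qed
   qed
   moreover have "sphere_like TYPE('k) (d - card t) (contract a b (lk \<Delta> t))"
   proof (rule contract_sphere_like[OF abstract_lk[OF \<Delta> tD] e(1) linkdim[OF tD] _ sl[OF tD]])
    fix F assume F: "a \<notin> F" "b \<notin> F" "insert a F \<in> lk \<Delta> t" "insert b F \<in> lk \<Delta> t"
    hence "insert a (insert b (F \<union> t)) \<in> \<Delta>"
     using False bt by (intro fill) (auto simp: lk_iff)
    moreover hence "insert a (insert b F) \<in> \<Delta>" by (rule dn) auto
    ultimately show "insert a (insert b F) \<in> lk \<Delta> t" using F by (auto simp: lk_iff)
   qed
   ultimately show ?thesis by simp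
  next
   case True
   define \<rho> where "\<rho> = t - {a}"
   have t\<rho>: "t = insert a \<rho>" "a \<notin> \<rho>" "b \<notin> \<rho>" using True bt by (auto simp: \<rho>_def)
   have fin\<rho>: "finite \<rho>" using abstract_complexD(3)[OF G t] by (simp add: \<rho>_def)
   have or: "insert a \<rho> \<in> \<Delta> \<or> insert b \<rho> \<in> \<Delta>" using t t\<rho> by (auto simp: iff)
   have cardab: "card (insert b \<rho>) = card t" using t\<rho> fin\<rho> by simp
   have mem: "H \<in> lk ?C t \<longleftrightarrow> a \<notin> H \<and> b \<notin> H \<and> H \<inter> \<rho> = {} \<and> (H \<union> insert a \<rho> \<in> \<Delta> \<or> H \<union> insert b \<rho> \<in> \<Delta>)" for H
   proof -
    have "H \<in> lk ?C t \<longleftrightarrow> H \<union> t \<in> ?C \<and> H \<inter> t = {}"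
     using abstract_complexD(4)[OF G, of "H \<union> t" H] by (auto simp: lk_iff)
    moreover have "a \<notin> H ==> insert b (H \<union> t - {a}) = H \<union> insert b \<rho>" using t\<rho> by blast
    ultimately show ?thesis using t\<rho> e(1) by (auto simp: iff)
   qed
   have lkmem: "H \<in> lk \<Delta> (insert c \<rho>) \<longleftrightarrow> c \<notin> H \<and> H \<inter> \<rho> = {} \<and> H \<union> insert c \<rho> \<in> \<Delta>" for H c
    using dn[of "H \<union> insert c \<rho>" H] by (auto simp: lk_iff)
   have fillH: "insert a (insert b (H \<union> \<rho>)) \<in> \<Delta>"
    if "a \<notin> H" "b \<notin> H" "H \<union> insert a \<rho> \<in> \<Delta>" "H \<union> insert b \<rho> \<in> \<Delta>" for H
    using that t\<rho> by (intro fill) simp_all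
   show ?thesis
   proof (cases "insert a \<rho> \<in> \<Delta> \<and> insert b \<rho> \<in> \<Delta>")
    case False
    have one: "lk ?C t = lk \<Delta> (insert c \<rho>)"
     if c: "insert c \<rho> \<in> \<Delta>" "insert c' \<rho> \<notin> \<Delta>" "{c, c'} = {a, b}" for c c'
    proof (intro equalityI subsetI)
     have no: "H \<union> insert c' \<rho> \<notin> \<Delta>" for H using dn[of "H \<union> insert c' \<rho>" "insert c' \<rho>"] c(2) by blast
     fix H assume "H \<in> lk ?C t"
     thus "H \<in> lk \<Delta> (insert c \<rho>)" using mem[of H] lkmem[of H c] no[of H] c(3) e(1) by (auto simp: doubleton_eq_iff)
    next
     fix H assume "H \<in> lk \<Delta> (insert c \<rho>)"
     hence H: "c \<notin> H" "H \<inter> \<rho> = {}" "H \<union> insert c \<rho> \<in> \<Delta>" by (simp_all add: lkmem)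
     have "c' \<notin> H"
     proof
      assume "c' \<in> H"
      hence "insert c' \<rho> \<in> \<Delta>" by (intro dn[OF H(3)]) auto
      thus False using c(2) by simp
     qed
     thus "H \<in> lk ?C t" using H c(3) e(1) mem[of H] by (auto simp: doubleton_eq_iff)
    qed
    from or show ?thesis
    proof
     assume *: "insert a \<rho> \<in> \<Delta>"
     thus ?thesis using one[of a b] sl[OF * ] False t\<rho>(1) by simp
    next
     assume *: "insert b \<rho> \<in> \<Delta>"
     thus ?thesis using one[of b a] sl[OF * ] False cardab by (simp add: insert_commute)
    qed
   next
    case True
    let ?X = "lk \<Delta> (insert a \<rho>)" and ?Y = "lk \<Delta> (insert b \<rho>)" and ?E = "lk \<Delta> (insert a (insert b \<rho>))"
    let ?P = "del ?X b" and ?Q = "del ?Y a"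
    have eD: "insert a (insert b \<rho>) \<in> \<Delta>" using fill[of \<rho>] t\<rho> True by simp
    have ct: "card t = Suc (card \<rho>)" using t\<rho> fin\<rho> by simp
    have ce: "card (insert a (insert b \<rho>)) = Suc (Suc (card \<rho>))" using t\<rho> fin\<rho> e by simp
    hence le: "Suc (Suc (card \<rho>)) \<le> d" using dim eD by force
    define k where "k = d - Suc (Suc (card \<rho>))"
    have k: "d - card t = Suc k" "d - card (insert a (insert b \<rho>)) = k" "d - card (insert b \<rho>) = Suc k" "d - card (insert a \<rho>) = Suc k"
     using le ct ce cardab t\<rho>(1) by (auto simp: k_def)
    have EX: "lk ?X {b} = ?E" and EY: "lk ?Y {a} = ?E"
     using lk_lk[OF dD, of "insert a \<rho>" "{b}"] lk_lk[OF dD, of "insert b \<rho>" "{a}"] t\<rho> e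
     by (auto simp: insert_commute)
    have bX: "{b} \<in> ?X" and aY: "{a} \<in> ?Y" using eD t\<rho> e by (auto simp: lkmem insert_commute)
    obtain Fa where Fa: "Fa \<in> \<Delta>" "insert a (insert b \<rho>) \<subseteq> Fa" "card Fa = d" using hsphere_facet[OF H eD] .
    define F where "F = Fa - insert a (insert b \<rho>)"
    have F: "F \<in> ?E" "card F = k"
    proof -
     have "F \<union> insert a (insert b \<rho>) = Fa" using Fa(2) by (auto simp: F_def)
     thus "F \<in> ?E" using Fa(1) dn[OF Fa(1), of F] by (auto simp: lk_iff F_def)
     show "card F = k" unfolding F_def using Fa fin\<rho> ce by (subst card_Diff_subset) (auto simp: k_def)
    qed
    have X: "abstract_complex ?X" "abstract_complex ?Y" using abstract_lk[OF \<Delta>] True by auto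
    have slX: "sphere_like TYPE('k) (Suc k) ?X" "sphere_like TYPE('k) (Suc k) ?Y" "sphere_like TYPE('k) k ?E"
     using sl[of "insert a \<rho>"] sl[of "insert b \<rho>"] sl[OF eD] True k by simp_all
    have dX: "\<forall>F\<in>?X. card F \<le> Suc k" "\<forall>F\<in>?Y. card F \<le> Suc k" "\<forall>F\<in>?E. card F \<le> k"
     using linkdim[of "insert a \<rho>"] linkdim[of "insert b \<rho>"] linkdim[OF eD] True k by simp_all
    note vX = vertex_deletion_acyclic[OF X(1) bX dX(1) slX(1), unfolded EX, OF slX(3) F]
    note vY = vertex_deletion_acyclic[OF X(2) aY dX(2) slX(2), unfolded EY, OF slX(3) F]
    have PQ: "?P \<inter> ?Q = ?E"
    proof (intro equalityI subsetI)
     fix H assume "H \<in> ?P \<inter> ?Q"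
     hence H: "a \<notin> H" "b \<notin> H" "H \<inter> \<rho> = {}" "H \<union> insert a \<rho> \<in> \<Delta>" "H \<union> insert b \<rho> \<in> \<Delta>"
      by (auto simp: mem_del lkmem)
     hence "H \<in> \<Delta>" using dn[OF H(4), of H] by blast
     thus "H \<in> ?E" using H fillH[OF H(1,2,4,5)] by (auto simp: lk_iff)
    next
     fix H assume "H \<in> ?E"
     hence H: "a \<notin> H" "b \<notin> H" "H \<inter> \<rho> = {}" "H \<union> insert a (insert b \<rho>) \<in> \<Delta>" by (auto simp: lk_iff)
     have "H \<union> insert a \<rho> \<in> \<Delta>" "H \<union> insert b \<rho> \<in> \<Delta>" by (rule dn[OF H(4)], blast)+
     thus "H \<in> ?P \<inter> ?Q" using H by (simp add: mem_del lkmem)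
    qed
    have PQU: "?P \<union> ?Q = lk ?C t"
     by (rule set_eqI) (simp only: Un_iff mem_del lkmem mem, blast)
    have "sphere_like TYPE('k) (Suc k) (?P \<union> ?Q)"
    proof (rule union_sphere_like[OF abstract_del[OF X(1)] abstract_del[OF X(2)]], unfold PQ)
     show "\<forall>F\<in>?P \<union> ?Q. card F \<le> Suc k" using dX by (auto simp: mem_del)
    qed (use dX(3) slX(3) vX vY in simp_all)
    thus ?thesis unfolding PQU k(1) .
   qed
  qed
 qed
qed

subsection \<open>Dual polynomials and linear systems of parameters\<close>

text \<open>A linear functional on polynomials is given by its values on monomials; this is the
  transpose of multiplication by the linear form with coefficients \<open>c x\<close>.\<close>

definition lower :: "('x => 'y => 'k::char_two) => 'y set => 'x => ('y multiset => 'k) => 'y multiset => 'k" where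
 "lower c Y x f n = (\<Sum>y\<in>Y. c x y * f (add_mset y n))"

lemma lower_commute: "lower c Y x (lower c' Y x' f) = lower c' Y x' (lower c Y x f)"
proof
 fix n
 have "lower c Y x (lower c' Y x' f) n = (\<Sum>y\<in>Y. \<Sum>z\<in>Y. c x y * (c' x' z * f (add_mset z (add_mset y n))))"
  by (simp add: lower_def sum_distrib_left)
 also have "... = (\<Sum>z\<in>Y. \<Sum>y\<in>Y. c x y * (c' x' z * f (add_mset z (add_mset y n))))" by (rule sum.swap)
 also have "... = lower c' Y x' (lower c Y x f) n"
  by (simp add: lower_def sum_distrib_left add_mset_commute mult.left_commute)
 finally show "lower c Y x (lower c' Y x' f) n = lower c' Y x' (lower c Y x f) n" .
qed

lemma lower_sum: "lower c Y x (\<lambda>n. \<Sum>i\<in>I. k i * f i n) = (\<lambda>n. \<Sum>i\<in>I. k i * lower c Y x (f i) n)"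
proof
 fix n
 have "lower c Y x (\<lambda>n. \<Sum>i\<in>I. k i * f i n) n = (\<Sum>y\<in>Y. \<Sum>i\<in>I. k i * (c x y * f i (add_mset y n)))"
  unfolding lower_def sum_distrib_left by (intro sum.cong refl mult.left_commute)
 also have "... = (\<Sum>i\<in>I. \<Sum>y\<in>Y. k i * (c x y * f i (add_mset y n)))" by (rule sum.swap)
 also have "... = (\<Sum>i\<in>I. k i * lower c Y x (f i) n)" by (simp add: lower_def sum_distrib_left)
 finally show "lower c Y x (\<lambda>n. \<Sum>i\<in>I. k i * f i n) n = (\<Sum>i\<in>I. k i * lower c Y x (f i) n)" .
qed

lemma lower_zero [simp]: "lower c Y x (\<lambda>n. 0) = (\<lambda>n. 0)"
 by (simp add: lower_def fun_eq_iff)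

text \<open>\<open>tr c Y f\<close> is the functional \<open>f\<close> on polynomials in the variables \<open>Y\<close>, pulled back along the linear
 substitution \<open>x \<mapsto> \<Sum>y\<in>Y. c x y * y\<close>.\<close>

definition tr :: "('x => 'y => 'k::char_two) => 'y set => ('y multiset => 'k) => 'x multiset => 'k" where
 "tr c Y f m = fold_mset (lower c Y) f m {#}"

lemma comp_fun_commute_lower: "comp_fun_commute (lower c Y)"
 by (standard, rule ext) (unfold comp_def, rule lower_commute)

lemma tr_empty [simp]: "tr c Y f {#} = f {#}"
 by (simp add: tr_def)

lemma tr_add: "tr c Y f (add_mset x m) = tr c Y (lower c Y x f) m"
proof -
 interpret comp_fun_commute "lower c Y" by (rule comp_fun_commute_lower)
 show ?thesis unfolding tr_def fold_mset_add_mset by (simp only: fold_mset_fun_left_comm)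
qed

lemma tr_sum: "tr c Y (\<lambda>n. \<Sum>i\<in>I. k i * f i n) m = (\<Sum>i\<in>I. k i * tr c Y (f i) m)"
 by (induction m arbitrary: f) (simp_all add: tr_add lower_sum)

lemma tr_zero [simp]: "tr c Y (\<lambda>n. 0) m = 0"
 by (induction m) (simp_all add: tr_add)

lemma lower_tr:
 "lower c' X z (tr c Y f) = tr c Y (lower (\<lambda>z y. \<Sum>x\<in>X. c' z x * c x y) Y z f)"
proof
 fix m
 have "lower c' X z (tr c Y f) m = (\<Sum>x\<in>X. c' z x * tr c Y (lower c Y x f) m)"
  by (simp add: lower_def[of c'] tr_add)
 also have "... = tr c Y (\<lambda>n. \<Sum>x\<in>X. c' z x * lower c Y x f n) m" by (simp add: tr_sum)
 also have "(\<lambda>n. \<Sum>x\<in>X. c' z x * lower c Y x f n) = lower (\<lambda>z y. \<Sum>x\<in>X. c' z x * c x y) Y z f"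
 proof
  fix n
  have "(\<Sum>x\<in>X. c' z x * lower c Y x f n) = (\<Sum>x\<in>X. \<Sum>y\<in>Y. c' z x * (c x y * f (add_mset y n)))"
   by (simp add: lower_def sum_distrib_left)
  also have "... = (\<Sum>y\<in>Y. \<Sum>x\<in>X. c' z x * (c x y * f (add_mset y n)))" by (rule sum.swap)
  also have "... = lower (\<lambda>z y. \<Sum>x\<in>X. c' z x * c x y) Y z f n"
   by (simp add: lower_def sum_distrib_right mult.assoc)
  finally show "(\<Sum>x\<in>X. c' z x * lower c Y x f n) = lower (\<lambda>z y. \<Sum>x\<in>X. c' z x * c x y) Y z f n" .
 qed
 finally show "lower c' X z (tr c Y f) m = tr c Y (lower (\<lambda>z y. \<Sum>x\<in>X. c' z x * c x y) Y z f) m" .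
qed

lemma tr_tr: "tr c X (tr c' Y f) m = tr (\<lambda>z y. \<Sum>x\<in>X. c z x * c' x y) Y f m"
 by (induction m arbitrary: f) (simp_all add: tr_add lower_tr)

lemma lower_delta:
 assumes "finite Y" "x \<in> Y" "\<And>y. y \<in> Y ==> c x y = (if x = y then 1 else 0)"
 shows "lower c Y x f = (\<lambda>n. f (add_mset x n))"
proof
 fix n
 have "lower c Y x f n = (\<Sum>y\<in>Y. if x = y then f (add_mset y n) else 0)"
  unfolding lower_def by (rule sum.cong) (simp_all add: assms(3))
 thus "lower c Y x f n = f (add_mset x n)" using assms(1,2) by simp
qed

lemma tr_delta:
 assumes Y: "finite Y" and c: "\<And>x y. x \<in> Y ==> y \<in> Y ==> c x y = (if x = y then 1 else 0)"
  and m: "set_mset m \<subseteq> Y"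
 shows "tr c Y f m = f m"
 using m
proof (induction m arbitrary: f)
 case (add x m)
 have "tr c Y f (add_mset x m) = tr c Y (\<lambda>n. f (add_mset x n)) m"
  using add.prems by (simp add: tr_add lower_delta[where c = c, OF Y _ c])
 also have "... = f (add_mset x m)" using add by simp
 finally show ?case .
qed simp

lemma tr_size:
 assumes "\<And>n. f n \<noteq> 0 ==> size n = j" "tr c Y f m \<noteq> 0"
 shows "size m = j"
 using assms
proof (induction m arbitrary: f j)
 case empty
 thus ?case by fastforce
next
 case (add x m)
 have z: "lower c Y x f n = 0" if "Suc (size n) \<noteq> j" for n
 proof -
  have "f (add_mset y n) = 0" for y using add.prems(1)[of "add_mset y n"] that by fastforce
  thus ?thesis by (simp add: lower_def)
 qed
 show ?case
 proof (cases j)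
  case 0
  hence "lower c Y x f = (\<lambda>n. 0)" using z by auto
  thus ?thesis using add.prems(2) by (simp add: tr_add)
 next
  case (Suc i)
  have "size m = i" using add.IH[of "lower c Y x f" i] z Suc add.prems(2) by (auto simp: tr_add)
  thus ?thesis using Suc by simp
 qed
qed

lemma tr_lower_zero:
 assumes "x \<in># m" "\<And>f. lower c Y x f = (\<lambda>n. 0)"
 shows "tr c Y f m = 0"
proof -
 obtain m' where "m = add_mset x m'" using assms(1) by (metis mset_add)
 thus ?thesis using assms(2) by (simp add: tr_add)
qed

text \<open>The first \<open>card J\<close> forms restrict to linear coordinates on the face
  \<open>J\<close>, and \<open>b\<close> is the inverse matrix. One relation serves to substitute
  the coordinates, the other to substitute back.\<close>

definition nondeg :: "(nat => 'a => 'k::char_two) => 'a set => ('a => nat => 'k) => bool" where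
 "nondeg a J b \<longleftrightarrow>
  (\<forall>r<card J. \<forall>q<card J. (\<Sum>v\<in>J. a r v * b v q) = (if r = q then 1 else 0)) \<and>
  (\<forall>v\<in>J. \<forall>u\<in>J. (\<Sum>r<card J. b v r * a r u) = (if v = u then 1 else 0))"

definition mons :: "'a set => nat => ('a multiset => 'k::char_two) => bool" where
 "mons J j f \<longleftrightarrow> (\<forall>m. f m \<noteq> 0 --> set_mset m \<subseteq> J \<and> size m = j)"

lemma simplex_inverse:
 fixes a :: "nat => 'a => 'k::char_two"
 assumes fin: "finite J" and nd: "nondeg a J b" and f: "mons J j f"
 shows "tr (\<lambda>v q. if v \<in> J then b v q else 0) {..<card J} (tr a J f) = f"
proof
 fix m
 let ?b = "\<lambda>v q. if v \<in> J then b v q else 0" and ?s = "card J"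
 show "tr ?b {..<?s} (tr a J f) m = f m"
 proof (cases "set_mset m \<subseteq> J")
  case True
  have "tr ?b {..<?s} (tr a J f) m = tr (\<lambda>v u. \<Sum>r<?s. ?b v r * a r u) J f m" by (rule tr_tr)
  also have "... = f m" by (rule tr_delta[OF fin _ True]) (use nd in \<open>simp add: nondeg_def\<close>)
  finally show ?thesis .
 next
  case False
  then obtain v where v: "v \<in># m" "v \<notin> J" by auto
  have "tr ?b {..<?s} (tr a J f) m = 0"
   by (rule tr_lower_zero[OF v(1)]) (use v(2) in \<open>simp add: lower_def fun_eq_iff\<close>)
  moreover have "f m = 0" using f False by (auto simp: mons_def)
  ultimately show ?thesis by simp
 qed
qed

text \<open>Dual to the regularity of coordinates. After the change of variables the forms are the
  variables themselves, and a preimage under lowering by the variable \<open>r\<close> is found by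
  shifting values to the monomials with one more factor \<open>r\<close>.\<close>

lemma simplex_coregular:
 fixes a :: "nat => 'a => 'k::char_two"
 assumes fin: "finite J" and nd: "nondeg a J b" and f: "mons J j f"
  and ker: "\<And>q. q < r ==> lower a J q f = (\<lambda>_. 0)" and r: "r < card J"
 shows "\<exists>g. mons J (Suc j) g \<and> (\<forall>q<r. lower a J q g = (\<lambda>_. 0)) \<and> lower a J r g = f"
proof -
 let ?b = "\<lambda>v q. if v \<in> J then b v q else 0" and ?s = "card J"
 define F where "F = tr a J f"
 have FD: "F (add_mset q n) = 0" if "q < r" for q n
  using ker[OF that] by (simp add: F_def tr_add)
 define G where "G n = (if r \<in># n then F (n - {#r#}) else 0)" for n
 define g where "g = tr ?b {..<?s} G"
 have low: "lower a J q g = tr ?b {..<?s} (\<lambda>n. G (add_mset q n))" if q: "q < ?s" for q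
 proof -
  have "lower a J q g = tr ?b {..<?s} (lower (\<lambda>z y. \<Sum>x\<in>J. a z x * ?b x y) {..<?s} q G)"
   unfolding g_def by (rule lower_tr)
  also have "lower (\<lambda>z y. \<Sum>x\<in>J. a z x * ?b x y) {..<?s} q G = (\<lambda>n. G (add_mset q n))"
   by (rule lower_delta) (use q nd in \<open>auto simp: nondeg_def cong: sum.cong\<close>)
  finally show ?thesis .
 qed
 have Gsize: "size n = Suc j" if "G n \<noteq> 0" for n
 proof -
  have n: "r \<in># n" "F (n - {#r#}) \<noteq> 0" using that by (auto simp: G_def split: if_splits)
  have "size (n - {#r#}) = j" using n(2) unfolding F_def by (rule tr_size[rotated]) (use f in \<open>auto simp: mons_def\<close>)
  thus ?thesis using n(1) by (metis size_Suc_Diff1)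
 qed
 have "mons J (Suc j) g"
  unfolding mons_def
 proof (intro allI impI conjI)
  fix m assume m: "g m \<noteq> 0"
  show "size m = Suc j" using m unfolding g_def by (rule tr_size[rotated]) (rule Gsize)
  show "set_mset m \<subseteq> J"
  proof (rule ccontr)
   assume "\<not> set_mset m \<subseteq> J"
   then obtain v where v: "v \<in># m" "v \<notin> J" by auto
   have "g m = 0" unfolding g_def
    by (rule tr_lower_zero[OF v(1)]) (use v(2) in \<open>simp add: lower_def fun_eq_iff\<close>)
   thus False using m by simp
  qed
 qed
 moreover have "lower a J q g = (\<lambda>_. 0)" if q: "q < r" for q
 proof -
  have "G (add_mset q n) = 0" for n
  proof (cases "r \<in># n")
   case True
   hence "add_mset q n - {#r#} = add_mset q (n - {#r#})" using q by simp
   thus ?thesis using True FD[OF q] by (simp add: G_def)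
  qed (use q in \<open>simp add: G_def\<close>)
  thus ?thesis using low[of q] q r by (simp add: fun_eq_iff)
 qed
 moreover have "lower a J r g = f"
 proof -
  have "(\<lambda>n. G (add_mset r n)) = F" by (simp add: G_def fun_eq_iff)
  hence "lower a J r g = tr ?b {..<?s} F" using low[OF r] by simp
  thus ?thesis unfolding F_def using simplex_inverse[OF fin nd f] by simp
 qed
 ultimately show ?thesis by blast
qed

text \<open>Each vertex of \<open>J\<close> is a combination of the forms, so \<open>f\<close>
  vanishes on every monomial that has a factor at all.\<close>

lemma simplex_kernel:
 fixes a :: "nat => 'a => 'k::char_two"
 assumes fin: "finite J" and nd: "nondeg a J b" and f: "mons J j f"
  and ker: "\<And>q. q < card J ==> lower a J q f = (\<lambda>_. 0)" and j: "j \<noteq> 0"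
 shows "f = (\<lambda>_. 0)"
proof
 fix m
 let ?b = "\<lambda>v q. if v \<in> J then b v q else 0" and ?s = "card J"
 show "f m = 0"
 proof (cases m)
  case empty
  thus ?thesis using f j by (auto simp: mons_def)
 next
  case (add v m')
  have FD: "tr a J f (add_mset q n) = 0" if "q < ?s" for q n
   using ker[OF that] by (simp add: tr_add)
  have "f m = tr ?b {..<?s} (tr a J f) m" using simplex_inverse[OF fin nd f] by simp
  also have "... = tr ?b {..<?s} (lower ?b {..<?s} v (tr a J f)) m'" by (simp add: add tr_add)
  also have "lower ?b {..<?s} v (tr a J f) = (\<lambda>_. 0)" by (simp add: lower_def FD fun_eq_iff)
  finally show ?thesis by simp
 qed
qed

section \<open>Coregularity of the parameters on stars of faces\<close>

locale lsop =
 fixes \<Delta> :: "'a set set" and d :: nat and a :: "nat => 'a => 'k::char_two" and b :: "'a set => 'a => nat => 'k"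
 assumes H: "hsphere TYPE('k) d \<Delta>" and nd: "\<And>J. J \<in> \<Delta> ==> nondeg a J (b J)"
begin

lemma \<Delta>: "abstract_complex \<Delta>" and dim: "\<And>F. F \<in> \<Delta> ==> card F \<le> d"
 and sl: "\<And>J. J \<in> \<Delta> ==> sphere_like TYPE('k) (d - card J) (lk \<Delta> J)"
 using H by (auto simp: hsphere_def)

lemmas fin = abstract_complexD(3)[OF \<Delta>] and dn = abstract_complexD(4)[OF \<Delta>] and down = abstract_complexD(5)[OF \<Delta>]

abbreviation "V \<equiv> \<Union>\<Delta>"

lemma finV: "finite V" using abstract_complexD(6)[OF \<Delta>] .

abbreviation \<theta> :: "nat => ('a multiset => 'k) => 'a multiset => 'k" where
 "\<theta> \<equiv> lower a V"

text \<open>Degree \<open>j\<close> of the dual of the face ring of the closed star of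
  \<open>J\<close>.\<close>

definition L :: "'a set => nat => ('a multiset => 'k) set" where
 "L J j = {f. \<forall>m. f m \<noteq> 0 --> set_mset m \<union> J \<in> \<Delta> \<and> size m = j}"

text \<open>Chains on the faces \<open>G\<close> that contain \<open>J\<close>, with coefficients in
  the dual face ring of the star of \<open>G\<close>, and with boundary \<open>dN\<close>: the
  partition complex in dual form.\<close>

definition N :: "'a set => nat => nat => ('a set => 'a multiset => 'k) set" where
 "N J i j = {c. \<forall>G m. c G m \<noteq> 0 --> G \<in> \<Delta> \<and> J \<subseteq> G \<and> card G = i \<and> set_mset m \<union> G \<in> \<Delta> \<and> size m = j}"

definition dN :: "'a set => ('a set => 'a multiset => 'k) => 'a set => 'a multiset => 'k" where
 "dN J c G m = (if J \<subseteq> G then \<Sum>v\<in>V - G. c (insert v G) m else 0)"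

definition kerl :: "nat => ('a multiset => 'k) => bool" where
 "kerl r f \<longleftrightarrow> (\<forall>q<r. \<theta> q f = (\<lambda>_. 0))"

definition kerN :: "nat => ('a set => 'a multiset => 'k) => bool" where
 "kerN r c \<longleftrightarrow> (\<forall>G. kerl r (c G))"

definition Z :: "'a set => nat => nat => ('a set => 'a multiset => 'k) set" where
 "Z J i j = {c \<in> N J i j. dN J c = (\<lambda>_ _. 0)}"

text \<open>This and \<open>EE\<close> alternate in the induction: exactness gives surjectivity in
  the same place, and surjectivity one place higher lets exactness survive the passage to the kernel
  of one more form.\<close>

definition TT :: "'a set => nat => nat => nat => bool" where
 "TT J i r j \<longleftrightarrow> (\<forall>z\<in>Z J i j. kerN r z --> (\<exists>z'\<in>Z J i (Suc j). kerN r z' \<and> (\<forall>G. \<theta> r (z' G) = z G)))"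

definition EE :: "'a set => nat => nat => nat => bool" where
 "EE J i r j \<longleftrightarrow> (\<forall>z\<in>Z J i j. kerN r z --> (\<exists>n\<in>N J (Suc i) j. kerN r n \<and> dN J n = z))"

definition coreg :: "'a set => bool" where
 "coreg J \<longleftrightarrow> (\<forall>r<d. \<forall>j. \<forall>f\<in>L J j. kerl r f --> (\<exists>g\<in>L J (Suc j). kerl r g \<and> \<theta> r g = f))"

lemma \<theta>_add: "\<theta> r (\<lambda>m. f m + g m) = (\<lambda>m. \<theta> r f m + \<theta> r g m)"
 by (simp add: lower_def fun_eq_iff distrib_left sum.distrib)

lemma \<theta>_dN: "\<theta> r (dN J c G) = dN J (\<lambda>G. \<theta> r (c G)) G"
proof
 fix m
 show "\<theta> r (dN J c G) m = dN J (\<lambda>G. \<theta> r (c G)) G m"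
 proof (cases "J \<subseteq> G")
  case True
  have "\<theta> r (dN J c G) m = (\<Sum>u\<in>V. \<Sum>v\<in>V - G. a r u * c (insert v G) (add_mset u m))"
   using True by (simp add: lower_def dN_def sum_distrib_left)
  also have "... = (\<Sum>v\<in>V - G. \<Sum>u\<in>V. a r u * c (insert v G) (add_mset u m))" by (rule sum.swap)
  also have "... = dN J (\<lambda>G. \<theta> r (c G)) G m" using True by (simp add: lower_def dN_def)
  finally show ?thesis .
 qed (simp add: lower_def dN_def)
qed

lemma dN_add: "dN J (\<lambda>G m. c G m + c' G m) = (\<lambda>G m. dN J c G m + dN J c' G m)"
 by (simp add: dN_def fun_eq_iff sum.distrib)

lemma dN_dN: "dN J (dN J c) = (\<lambda>_ _. 0)"
proof (intro ext)
 fix G m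
 show "dN J (dN J c) G m = 0"
 proof (cases "J \<subseteq> G")
  case True
  have "dN J (dN J c) G m = (\<Sum>v\<in>V - G. \<Sum>u\<in>V - G - {v}. c (insert u (insert v G)) m)"
  proof -
   have "J \<subseteq> insert v G" "V - insert v G = V - G - {v}" for v using True by blast+
   thus ?thesis using True by (simp add: dN_def)
  qed
  also have "... = 0"
   by (rule sum_symmetric_offdiag) (use finV in \<open>auto simp: insert_commute\<close>)
  finally show ?thesis .
 qed (simp add: dN_def)
qed

lemma N_D:
 assumes "c \<in> N J i j" "c G m \<noteq> 0"
 shows "G \<in> \<Delta>" "J \<subseteq> G" "card G = i" "set_mset m \<union> G \<in> \<Delta>" "size m = j"
 using assms unfolding N_def by blast+

lemma N_I:
 assumes "\<And>G m. c G m \<noteq> 0 ==> G \<in> \<Delta> \<and> J \<subseteq> G \<and> card G = i \<and> set_mset m \<union> G \<in> \<Delta> \<and> size m = j"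
 shows "c \<in> N J i j"
 using assms unfolding N_def by blast

lemma L_D:
 assumes "f \<in> L J j" "f m \<noteq> 0"
 shows "set_mset m \<union> J \<in> \<Delta>" "size m = j"
 using assms unfolding L_def by blast+

lemma dN_N:
 assumes "c \<in> N J (Suc i) j"
 shows "dN J c \<in> N J i j"
proof (rule N_I)
 fix G m assume "dN J c G m \<noteq> 0"
 hence s: "J \<subseteq> G" and "(\<Sum>v\<in>V - G. c (insert v G) m) \<noteq> 0" by (auto simp: dN_def split: if_splits)
 then obtain v where v: "v \<in> V - G" "c (insert v G) m \<noteq> 0" by (meson sum.not_neutral_contains_not_neutral)
 note c = N_D[OF assms v(2)]
 have "G \<in> \<Delta>" by (rule dn[OF c(1)]) blast
 moreover have "set_mset m \<union> G \<in> \<Delta>" by (rule dn[OF c(4)]) blast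
 moreover have "card G = i" using c(3) v(1) fin[OF calculation(1)] by simp
 ultimately show "G \<in> \<Delta> \<and> J \<subseteq> G \<and> card G = i \<and> set_mset m \<union> G \<in> \<Delta> \<and> size m = j" using s c(5) by blast
qed

lemma \<theta>_nonzero: "\<theta> r f m \<noteq> 0 ==> \<exists>v\<in>V. f (add_mset v m) \<noteq> 0"
 unfolding lower_def using sum.not_neutral_contains_not_neutral by fastforce

lemma \<theta>_N:
 assumes "c \<in> N J i (Suc j)"
 shows "(\<lambda>G. \<theta> r (c G)) \<in> N J i j"
proof (rule N_I)
 fix G m assume "\<theta> r (c G) m \<noteq> 0"
 then obtain v where v: "c G (add_mset v m) \<noteq> 0" using \<theta>_nonzero by blast
 note c = N_D[OF assms v]
 have "set_mset m \<union> G \<in> \<Delta>" by (rule dn[OF c(4)]) auto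
 thus "G \<in> \<Delta> \<and> J \<subseteq> G \<and> card G = i \<and> set_mset m \<union> G \<in> \<Delta> \<and> size m = j" using c by simp
qed

lemma \<theta>_N_0:
 assumes "c \<in> N J i 0"
 shows "\<theta> r (c G) = (\<lambda>_. 0)"
proof
 fix m
 show "\<theta> r (c G) m = 0"
 proof (rule ccontr)
  assume "\<theta> r (c G) m \<noteq> 0"
  then obtain v where "c G (add_mset v m) \<noteq> 0" using \<theta>_nonzero by blast
  from N_D(5)[OF assms this] show False by simp
 qed
qed

lemma N_add: "c \<in> N J i j ==> c' \<in> N J i j ==> (\<lambda>G m. c G m + c' G m) \<in> N J i j"
proof (rule N_I)
 fix G m assume c: "c \<in> N J i j" "c' \<in> N J i j" and "c G m + c' G m \<noteq> 0"
 hence "c G m \<noteq> 0 \<or> c' G m \<noteq> 0" by auto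
 thus "G \<in> \<Delta> \<and> J \<subseteq> G \<and> card G = i \<and> set_mset m \<union> G \<in> \<Delta> \<and> size m = j"
  using N_D[OF c(1), of G m] N_D[OF c(2), of G m] by blast
qed

text \<open>Write the cycle as a boundary, lift each coefficient through form \<open>r\<close> by
  coregularity on the larger face, and take the boundary of the lift.\<close>

lemma TT_if_EE:
 assumes E: "EE J i r j" and cor: "\<And>G. G \<in> \<Delta> ==> J \<subset> G ==> coreg G" and i: "card J \<le> i" and r: "r < d"
 shows "TT J i r j"
 unfolding TT_def
proof (intro ballI impI)
 fix z assume z: "z \<in> Z J i j" "kerN r z"
 obtain n where n: "n \<in> N J (Suc i) j" "kerN r n" "dN J n = z" using E z unfolding EE_def by blast
 have "\<exists>g. (\<forall>m. g m \<noteq> 0 --> G \<in> \<Delta> \<and> J \<subseteq> G \<and> card G = Suc i \<and> set_mset m \<union> G \<in> \<Delta> \<and> size m = Suc j) \<and> kerl r g \<and> \<theta> r g = n G" for G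
 proof (cases "G \<in> \<Delta> \<and> J \<subseteq> G \<and> card G = Suc i")
  case True
  hence "J \<subset> G" using i by auto
  hence "coreg G" using cor True by blast
  moreover have "n G \<in> L G j" using N_D[OF n(1)] unfolding L_def by blast
  moreover have "kerl r (n G)" using n(2) by (simp add: kerN_def)
  ultimately obtain g where "g \<in> L G (Suc j)" "kerl r g" "\<theta> r g = n G" using r unfolding coreg_def by blast
  thus ?thesis using True L_D by blast
 next
  case False
  hence "n G = (\<lambda>_. 0)" using N_D[OF n(1), of G] by blast
  thus ?thesis by (intro exI[of _ "\<lambda>_. 0"]) (simp add: kerl_def)
 qed
 then obtain n' where n': "\<And>G m. n' G m \<noteq> 0 ==> G \<in> \<Delta> \<and> J \<subseteq> G \<and> card G = Suc i \<and> set_mset m \<union> G \<in> \<Delta> \<and> size m = Suc j"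
  "\<And>G. kerl r (n' G)" "\<And>G. \<theta> r (n' G) = n G" by metis
 have n'N: "n' \<in> N J (Suc i) (Suc j)" using n'(1) by (rule N_I)
 have "dN J n' \<in> Z J i (Suc j)" using dN_N[OF n'N] dN_dN by (simp add: Z_def)
 moreover have "kerN r (dN J n')"
  unfolding kerN_def kerl_def
 proof (intro allI impI)
  fix G q assume "q < r"
  hence "(\<lambda>G. \<theta> q (n' G)) = (\<lambda>_ _. 0)" using n'(2) by (simp add: kerl_def)
  thus "\<theta> q (dN J n' G) = (\<lambda>_. 0)" unfolding \<theta>_dN by (simp add: dN_def fun_eq_iff)
 qed
 moreover have "\<theta> r (dN J n' G) = z G" for G unfolding \<theta>_dN n'(3) by (simp add: n(3))
 ultimately show "\<exists>z'\<in>Z J i (Suc j). kerN r z' \<and> (\<forall>G. \<theta> r (z' G) = z G)" by blast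
qed

text \<open>A primitive \<open>n\<close> of \<open>z\<close> may not be killed by form
  \<open>r\<close>, but its image is a cycle one place higher. A preimage of that image among the
  cycles corrects \<open>n\<close> without changing its boundary. The image has degree
  \<open>j - 1\<close>, so in degree 0 there is nothing to correct.\<close>

lemma EE_Suc:
 assumes E: "EE J i r j" and T: "j \<noteq> 0 ==> TT J (Suc i) r (j - 1)"
 shows "EE J i (Suc r) j"
 unfolding EE_def
proof (intro ballI impI)
 fix z assume z: "z \<in> Z J i j" "kerN (Suc r) z"
 have zr: "kerN r z" "\<And>G. \<theta> r (z G) = (\<lambda>_. 0)" using z(2) by (auto simp: kerN_def kerl_def)
 obtain n where n: "n \<in> N J (Suc i) j" "kerN r n" "dN J n = z" using E z(1) zr(1) unfolding EE_def by blast
 show "\<exists>n\<in>N J (Suc i) j. kerN (Suc r) n \<and> dN J n = z"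
 proof (cases "j = 0")
  case True
  have "kerN (Suc r) n" using n(2) \<theta>_N_0[of n J "Suc i"] n(1) True
   by (auto simp: kerN_def kerl_def less_Suc_eq)
  thus ?thesis using n by blast
 next
  case False
  then obtain j' where j': "j = Suc j'" by (cases j) auto
  let ?y = "\<lambda>G. \<theta> r (n G)"
  have "?y \<in> N J (Suc i) j'" using \<theta>_N n(1) unfolding j' by blast
  moreover have "dN J ?y = (\<lambda>_ _. 0)"
  proof -
   have "dN J ?y = (\<lambda>G. \<theta> r (dN J n G))" unfolding \<theta>_dN ..
   thus ?thesis unfolding n(3) zr(2) .
  qed
  ultimately have y: "?y \<in> Z J (Suc i) j'" by (simp add: Z_def)
  have "kerN r ?y"
   unfolding kerN_def kerl_def
  proof (intro allI impI)
   fix G q assume "q < r"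
   hence "\<theta> q (n G) = (\<lambda>_. 0)" using n(2) by (simp add: kerN_def kerl_def)
   thus "\<theta> q (\<theta> r (n G)) = (\<lambda>_. 0)" unfolding lower_commute[of a V q a r] by simp
  qed
  then obtain z' where z': "z' \<in> Z J (Suc i) j" "kerN r z'" "\<And>G. \<theta> r (z' G) = ?y G"
   using T[OF False] y unfolding TT_def j' by auto
  let ?n = "\<lambda>G m. n G m + z' G m"
  have "?n \<in> N J (Suc i) j" using N_add[OF n(1)] z'(1) by (simp add: Z_def)
  moreover have "kerN (Suc r) ?n"
   using n(2) z'(2,3) by (auto simp: kerN_def kerl_def less_Suc_eq \<theta>_add)
  moreover have "dN J ?n = z" using n(3) z'(1) by (simp add: dN_add Z_def)
  ultimately show ?thesis by blast
 qed
qed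

text \<open>For a monomial supported in \<open>J\<close> the support condition holds on every face
  \<open>G\<close>, so the summand belonging to \<open>m\<close> is the chain complex of the link of
  \<open>J\<close>.\<close>

lemma link_chain:
 assumes c: "c \<in> N J i j" "dN J c = (\<lambda>_ _. 0)" and J: "J \<in> \<Delta>" "card J \<le> i" and m: "set_mset m \<subseteq> J"
 obtains \<zeta> :: "('a,'k) chain" where "\<zeta> \<in> chains (lk \<Delta> J) (i - card J)" "bd \<zeta> = 0"
  "\<forall>G. J \<subseteq> G --> lookup \<zeta> (G - J) = c G m"
proof -
 let ?Lk = "lk \<Delta> J" and ?l = lookup
 have Lk: "abstract_complex ?Lk" using abstract_lk[OF \<Delta> J(1)] .
 have finJ: "finite J" using fin[OF J(1)] .
 define S where "S = {H \<in> ?Lk. card H = i - card J}"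
 have finS: "finite S" using abstract_complexD(1)[OF Lk] by (simp add: S_def)
 define \<zeta> where "\<zeta> = (\<Sum>H\<in>S. single H (c (H \<union> J) m))"
 have \<zeta>1: "\<zeta> \<in> chains ?Lk (i - card J)"
  unfolding \<zeta>_def by (rule chains_sum, rule chains_single) (use abstract_complexD(3)[OF Lk] in \<open>auto simp: S_def\<close>)
 have look: "?l \<zeta> H = (if H \<in> S then c (H \<union> J) m else 0)" for H
  unfolding \<zeta>_def using finS by (simp add: lookup_sum lookup_single when_def)
 have mem: "G - J \<in> S" if "J \<subseteq> G" "c G m \<noteq> 0" for G
 proof -
  note g = N_D[OF c(1) that(2)]
  have "G - J \<union> J = G" using that by blast
  moreover have "card (G - J) = i - card J" using g(3) that(1) finJ by (simp add: card_Diff_subset)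
  ultimately show ?thesis using g(1) dn[OF g(1), of "G - J"] by (auto simp: S_def lk_iff)
 qed
 have val: "?l \<zeta> (G - J) = c G m" if "J \<subseteq> G" for G
 proof -
  have "G - J \<union> J = G" using that by blast
  thus ?thesis using mem[OF that] by (auto simp: look)
 qed
 have "bd \<zeta> = 0"
 proof (rule poly_mapping_eqI)
  fix Y
  have 1: "?l (bd \<zeta>) Y = (\<Sum>v\<in>V - Y. ?l \<zeta> (insert v Y))"
   by (rule lookup_bd[OF finV]) (use \<zeta>1 in \<open>auto simp: chains_def lk_iff\<close>)
  show "?l (bd \<zeta>) Y = ?l 0 Y"
  proof (cases "Y \<inter> J = {}")
   case False
   hence "insert v Y \<notin> S" for v by (auto simp: S_def lk_iff)
   thus ?thesis unfolding 1 by (simp add: look)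
  next
   case True
   have "(\<Sum>v\<in>V - Y. ?l \<zeta> (insert v Y)) = (\<Sum>v\<in>V - (Y \<union> J). c (insert v (Y \<union> J)) m)"
   proof (rule sum.mono_neutral_cong_right)
    show "\<forall>v\<in>V - Y - (V - (Y \<union> J)). ?l \<zeta> (insert v Y) = 0"
     by (auto simp: look S_def lk_iff)
    fix v assume v: "v \<in> V - (Y \<union> J)"
    have "insert v (Y \<union> J) - J = insert v Y" using v True by blast
    thus "?l \<zeta> (insert v Y) = c (insert v (Y \<union> J)) m" using val[of "insert v (Y \<union> J)"] by auto
   qed (use finV in auto)
   also have "... = dN J c (Y \<union> J) m" by (simp add: dN_def)
   finally show ?thesis unfolding 1 c(2) by simp
  qed
 qed
 thus thesis using that \<zeta>1 val by blast
qed

lemma cone_term: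
 assumes "v \<in> V" "finite V"
  and "\<And>u. u \<noteq> v ==> u \<in> V - G ==> f u = (0::'k)" "v \<notin> G"
 shows "(\<Sum>u\<in>V - G. f u) = f v"
proof -
 have "(\<Sum>u\<in>V - G. f u) = (\<Sum>u\<in>{v}. f u)"
  by (rule sum.mono_neutral_right) (use assms in auto)
 thus ?thesis by simp
qed

text \<open>The complex splits by monomials. If \<open>m\<close> contains a vertex \<open>v\<close>
  outside \<open>J\<close>, coning with \<open>v\<close> is a contraction, because \<open>v\<close>
  can be added to every face that occurs with \<open>m\<close>. Otherwise the summand is the chain
  complex of the link of \<open>J\<close>, which is exact below the top.\<close>

lemma EE_0:
 assumes J: "J \<in> \<Delta>" "card J \<le> i" "i < d"
 shows "EE J i 0 j"
 unfolding EE_def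
proof (intro ballI impI)
 fix c assume "c \<in> Z J i j"
 hence c: "c \<in> N J i j" "dN J c = (\<lambda>_ _. 0)" by (auto simp: Z_def)
 have c0: "(\<Sum>v\<in>V - G. c (insert v G) m) = 0" if "J \<subseteq> G" for G m
  using fun_cong[OF fun_cong[OF c(2), of G], of m] that by (simp add: dN_def)
 have "\<exists>\<beta>. (\<forall>G. \<beta> G \<noteq> 0 --> G \<in> \<Delta> \<and> J \<subseteq> G \<and> card G = Suc i \<and> set_mset m \<union> G \<in> \<Delta> \<and> size m = j) \<and>
     (\<forall>G. J \<subseteq> G --> (\<Sum>v\<in>V - G. \<beta> (insert v G)) = c G m)" for m
 proof (cases "size m = j")
  case False
  hence "c G m = 0" for G using N_D(5)[OF c(1)] by blast
  thus ?thesis by (intro exI[of _ "\<lambda>_. 0"]) simp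
 next
  case sz: True
  show ?thesis
  proof (cases "set_mset m \<subseteq> J")
   case False
   then obtain v where v: "v \<in># m" "v \<notin> J" by blast
   let ?\<beta> = "\<lambda>G. if J \<subseteq> G \<and> v \<in> G then c (G - {v}) m else 0"
   have "G \<in> \<Delta> \<and> J \<subseteq> G \<and> card G = Suc i \<and> set_mset m \<union> G \<in> \<Delta> \<and> size m = j" if nz: "?\<beta> G \<noteq> 0" for G
   proof -
    have g: "J \<subseteq> G" "v \<in> G" "c (G - {v}) m \<noteq> 0" using nz by (auto split: if_splits)
    note cg = N_D[OF c(1) g(3)]
    have "set_mset m \<union> (G - {v}) = set_mset m \<union> G" using v by blast
    hence mG: "set_mset m \<union> G \<in> \<Delta>" using cg(4) by simp
    have GD: "G \<in> \<Delta>" by (rule dn[OF mG]) blast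
    have "card G = Suc i" using cg(3) g(2) fin[OF GD] card_Suc_Diff1[OF fin[OF GD] g(2)] by simp
    thus ?thesis using GD g(1) mG sz by blast
   qed
   moreover have "(\<Sum>u\<in>V - G. ?\<beta> (insert u G)) = c G m" if G: "J \<subseteq> G" for G
   proof (cases "v \<in> G")
    case False
    show ?thesis
    proof (cases "v \<in> V")
     case True
     have "(\<Sum>u\<in>V - G. ?\<beta> (insert u G)) = ?\<beta> (insert v G)"
      by (rule cone_term[OF True finV]) (use False in auto)
     also have "... = c G m" using G False by auto
     finally show ?thesis .
    next
     case vV: False
     hence "c G m = 0" using N_D(4)[OF c(1)] v(1) by blast
     moreover have "?\<beta> (insert u G) = 0" if "u \<in> V - G" for u using that vV False by auto
     ultimately show ?thesis by simp
    qed
   next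
    case True
    have s: "J \<subseteq> G - {v}" using G v by blast
    show ?thesis
    proof (cases "v \<in> V")
     case vV: True
     have "(\<Sum>u\<in>V - G. ?\<beta> (insert u G)) = (\<Sum>u\<in>V - G. c (insert u (G - {v})) m)"
     proof (rule sum.cong)
      fix u assume u: "u \<in> V - G"
      have "insert u G - {v} = insert u (G - {v})" using u True by blast
      thus "?\<beta> (insert u G) = c (insert u (G - {v})) m" using G True by auto
     qed simp
     moreover have "0 = (\<Sum>u\<in>V - (G - {v}). c (insert u (G - {v})) m)" using c0[OF s] by simp
     moreover have "V - (G - {v}) = insert v (V - G)" using vV by blast
     moreover have "insert v (G - {v}) = G" using True by blast
     ultimately show ?thesis using True finV by (simp add: char_two_eq_iff)
    next
     case False
     have "c G m = 0" using N_D(1)[OF c(1), of G m] False True by blast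
     moreover have "?\<beta> (insert u G) = 0" for u
     proof (rule ccontr)
      assume "?\<beta> (insert u G) \<noteq> 0"
      hence "c (insert u G - {v}) m \<noteq> 0" by (auto split: if_splits)
      from N_D(4)[OF c(1) this] show False using v False by blast
     qed
     ultimately show ?thesis by simp
    qed
   qed
   ultimately show ?thesis by (intro exI[of _ ?\<beta>]) blast
  next
   case mS: True
   obtain \<zeta> where \<zeta>: "\<zeta> \<in> chains (lk \<Delta> J) (i - card J)" "bd \<zeta> = 0"
    "\<forall>G. J \<subseteq> G --> lookup \<zeta> (G - J) = c G m"
    using link_chain[OF c J(1,2) mS] .
   have "i - card J < d - card J" using J by simp
   then obtain \<xi> where \<xi>: "\<xi> \<in> chains (lk \<Delta> J) (Suc (i - card J))" "bd \<xi> = \<zeta>"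
    using sphere_likeD(1)[OF sl[OF J(1)] _ \<zeta>(1,2)] by blast
   let ?\<beta> = "\<lambda>G. if J \<subseteq> G then lookup \<xi> (G - J) else 0"
   have nz: "H \<in> lk \<Delta> J \<and> card H = Suc (i - card J)" if "lookup \<xi> H \<noteq> 0" for H
    using \<xi>(1) that by (auto simp: chains_def in_keys_iff)
   have "G \<in> \<Delta> \<and> J \<subseteq> G \<and> card G = Suc i \<and> set_mset m \<union> G \<in> \<Delta> \<and> size m = j" if n: "?\<beta> G \<noteq> 0" for G
   proof -
    have g: "J \<subseteq> G" "lookup \<xi> (G - J) \<noteq> 0" using n by (auto split: if_splits)
    note h = nz[OF g(2)]
    have "G - J \<union> J = G" using g(1) by blast
    hence GD: "G \<in> \<Delta>" using h by (auto simp: lk_iff)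
    have "card (G - J) = card G - card J" using g(1) fin[OF J(1)] by (simp add: card_Diff_subset)
    moreover have "card J \<le> card G" using g(1) fin[OF GD] by (rule card_mono[rotated])
    ultimately have "card G = Suc i" using h J(2) by simp
    moreover have "set_mset m \<union> G = G" using mS g(1) by blast
    ultimately show ?thesis using GD g(1) sz by simp
   qed
   moreover have "(\<Sum>v\<in>V - G. ?\<beta> (insert v G)) = c G m" if G: "J \<subseteq> G" for G
   proof -
    have "c G m = lookup (bd \<xi>) (G - J)" using \<zeta>(3) G \<xi>(2) by simp
    also have "... = (\<Sum>v\<in>V - (G - J). lookup \<xi> (insert v (G - J)))"
     by (rule lookup_bd[OF finV]) (use \<xi>(1) in \<open>auto simp: chains_def lk_iff\<close>)
    also have "... = (\<Sum>v\<in>V - G. ?\<beta> (insert v G))"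
    proof (rule sum.mono_neutral_cong_right)
     show "\<forall>v\<in>V - (G - J) - (V - G). lookup \<xi> (insert v (G - J)) = 0"
     proof
      fix v assume v: "v \<in> V - (G - J) - (V - G)"
      hence "v \<in> J" by blast
      hence "insert v (G - J) \<notin> lk \<Delta> J" by (auto simp: lk_iff)
      thus "lookup \<xi> (insert v (G - J)) = 0" using nz by blast
     qed
     fix v assume v: "v \<in> V - G"
     have "insert v G - J = insert v (G - J)" "J \<subseteq> insert v G" using v G by blast+
     thus "lookup \<xi> (insert v (G - J)) = ?\<beta> (insert v G)" by simp
    qed (use finV in auto)
    finally show ?thesis by simp
   qed
   ultimately show ?thesis by (intro exI[of _ ?\<beta>]) blast
  qed
 qed
 then obtain \<beta> where \<beta>: "\<And>m G. \<beta> m G \<noteq> 0 ==> G \<in> \<Delta> \<and> J \<subseteq> G \<and> card G = Suc i \<and> set_mset m \<union> G \<in> \<Delta> \<and> size m = j"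
  "\<And>m G. J \<subseteq> G ==> (\<Sum>v\<in>V - G. \<beta> m (insert v G)) = c G m" by metis
 have "(\<lambda>G m. \<beta> m G) \<in> N J (Suc i) j" using \<beta>(1) by (rule N_I)
 moreover have "dN J (\<lambda>G m. \<beta> m G) = c"
 proof (intro ext)
  fix G m
  show "dN J (\<lambda>G m. \<beta> m G) G m = c G m"
   using \<beta>(2)[of G m] N_D(2)[OF c(1), of G m] by (auto simp: dN_def)
 qed
 ultimately show "\<exists>n\<in>N J (Suc i) j. kerN 0 n \<and> dN J n = c" by (intro bexI[of _ "\<lambda>G m. \<beta> m G"]) (simp_all add: kerN_def kerl_def)
qed

end

context lsop
begin

definition const :: "'a set => ('a multiset => 'k) => 'a set => 'a multiset => 'k" where
 "const J K G m = (if G \<in> \<Delta> \<and> J \<subseteq> G \<and> card G = d then K m else 0)"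

lemma facet_link:
 assumes "J \<in> \<Delta>" "J \<subseteq> G"
 shows "G - J \<in> lk \<Delta> J \<and> card (G - J) = d - card J \<longleftrightarrow> G \<in> \<Delta> \<and> card G = d"
proof -
 have eq: "G - J \<union> J = G" using assms by blast
 have "card (G - J) = d - card J \<longleftrightarrow> card G = d" if G: "G \<in> \<Delta>"
 proof -
  have "card (G - J) = card G - card J" using assms fin by (simp add: card_Diff_subset)
  moreover have "card J \<le> card G" using assms fin[OF G] by (simp add: card_mono)
  ultimately show ?thesis using dim[OF assms(1)] by linarith
 qed
 moreover have "G \<in> \<Delta> ==> G - J \<in> \<Delta>" by (rule dn) auto
 moreover have "(G - J) \<inter> J = {}" by blast
 ultimately show ?thesis unfolding lk_iff eq by blast
qed

text \<open>A monomial that occurs at a facet \<open>G\<close> is supported in \<open>G\<close>. If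
  it used a vertex \<open>v\<close> outside \<open>J\<close>, only \<open>G\<close> would contribute
  over the ridge \<open>G - {v}\<close>, and the boundary could not vanish. So the monomials live on
  \<open>J\<close>, and their coefficients are multiples of the fundamental cycle of the
  link.\<close>

lemma top_form:
 assumes J: "J \<in> \<Delta>" and c: "c \<in> Z J d j"
 obtains K where "mons J j K" "c = const J K"
proof -
 have cN: "c \<in> N J d j" "dN J c = (\<lambda>_ _. 0)" using c by (auto simp: Z_def)
 have Lk: "abstract_complex (lk \<Delta> J)" using abstract_lk[OF \<Delta> J] .
 have big: "set_mset m \<subseteq> G" if "c G m \<noteq> 0" for G m
 proof -
  note g = N_D[OF cN(1) that]
  have "card (set_mset m \<union> G) \<le> card G" using dim[OF g(4)] g(3) by simp
  hence "G = set_mset m \<union> G" using fin[OF g(4)] by (intro card_seteq) auto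
  thus ?thesis by blast
 qed
 have sub: "set_mset m \<subseteq> J" if nz: "c G m \<noteq> 0" for G m
 proof (rule ccontr)
  assume "\<not> set_mset m \<subseteq> J"
  then obtain v where v: "v \<in># m" "v \<notin> J" by blast
  note g = N_D[OF cN(1) nz]
  have vG: "v \<in> G" using big[OF nz] v by blast
  have "0 = dN J c (G - {v}) m" unfolding cN(2) by simp
  also have "... = (\<Sum>u\<in>V - (G - {v}). c (insert u (G - {v})) m)" using g(2) v by (auto simp: dN_def)
  also have "... = c (insert v (G - {v})) m"
  proof (rule cone_term[OF _ finV])
   show "v \<in> V" using vG g(1) by blast
   fix u assume "u \<noteq> v" "u \<in> V - (G - {v})"
   hence "\<not> set_mset m \<subseteq> insert u (G - {v})" using v by blast
   thus "c (insert u (G - {v})) m = 0" using big by blast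
  qed simp
  also have "insert v (G - {v}) = G" using vG by blast
  finally show False using nz by simp
 qed
 have "\<exists>k. (\<not> (set_mset m \<subseteq> J \<and> size m = j) --> k = 0) \<and> (\<forall>G. c G m = (if G \<in> \<Delta> \<and> J \<subseteq> G \<and> card G = d then k else 0))" for m
 proof (cases "set_mset m \<subseteq> J \<and> size m = j")
  case False
  hence "c G m = 0" for G using sub N_D(5)[OF cN(1)] by blast
  thus ?thesis by (intro exI[of _ 0]) simp
 next
  case True
  then obtain \<zeta> where \<zeta>: "\<zeta> \<in> chains (lk \<Delta> J) (d - card J)" "bd \<zeta> = 0"
    "\<forall>G. J \<subseteq> G --> lookup \<zeta> (G - J) = c G m"
   using link_chain[OF cN J dim[OF J]] by blast
  obtain k where k: "\<zeta> = sc k (fund (d - card J) (lk \<Delta> J))" using sphere_likeD(3)[OF sl[OF J] \<zeta>(1,2)] by blast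
  have "c G m = (if G \<in> \<Delta> \<and> J \<subseteq> G \<and> card G = d then k else 0)" for G
  proof (cases "J \<subseteq> G")
   case s: True
   have "c G m = lookup \<zeta> (G - J)" using \<zeta>(3) s by simp
   also have "... = (if G - J \<in> lk \<Delta> J \<and> card (G - J) = d - card J then k else 0)"
    unfolding k by (simp add: lookup_fund[OF abstract_complexD(1)[OF Lk]])
   finally show ?thesis using s unfolding facet_link[OF J s] by simp
  next
   case False
   thus ?thesis using N_D(2)[OF cN(1), of G m] by auto
  qed
  thus ?thesis using True by blast
 qed
 then obtain K where K: "\<And>m. \<not> (set_mset m \<subseteq> J \<and> size m = j) ==> K m = 0"
  "\<And>m G. c G m = (if G \<in> \<Delta> \<and> J \<subseteq> G \<and> card G = d then K m else 0)" by metis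
 show thesis
 proof
  show "mons J j K" using K(1) unfolding mons_def by blast
  show "c = const J K" by (intro ext) (simp only: const_def K(2))
 qed
qed

lemma const_Z:
 assumes J: "J \<in> \<Delta>" and K: "mons J j K"
 shows "const J K \<in> Z J d j"
proof -
 have Lk: "abstract_complex (lk \<Delta> J)" using abstract_lk[OF \<Delta> J] .
 have N: "const J K \<in> N J d j"
 proof (rule N_I)
  fix G m assume "const J K G m \<noteq> 0"
  hence g: "G \<in> \<Delta>" "J \<subseteq> G" "card G = d" "K m \<noteq> 0" by (auto simp: const_def split: if_splits)
  hence "set_mset m \<subseteq> J" "size m = j" using K by (auto simp: mons_def)
  moreover hence "set_mset m \<union> G = G" using g(2) by blast
  ultimately show "G \<in> \<Delta> \<and> J \<subseteq> G \<and> card G = d \<and> set_mset m \<union> G \<in> \<Delta> \<and> size m = j" using g by simp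
 qed
 have "dN J (const J K) G m = 0" for G m
 proof (cases "J \<subseteq> G")
  case s: True
  let ?f = "fund (d - card J) (lk \<Delta> J) :: ('a,'k) chain"
  have fc: "?f \<in> chains (lk \<Delta> J) (d - card J)" using fund_chains[OF Lk] .
  have "0 = lookup (bd ?f) (G - J)" using sphere_likeD(2)[OF sl[OF J]] by simp
  also have "... = (\<Sum>v\<in>V - (G - J). lookup ?f (insert v (G - J)))"
  proof (rule lookup_bd[OF finV])
   fix X assume "X \<in> keys ?f"
   hence "X \<in> lk \<Delta> J" using fc unfolding chains_def by blast
   thus "X \<subseteq> V" using lk_sub by blast
  qed
  also have "... = (\<Sum>v\<in>V - G. if insert v G \<in> \<Delta> \<and> card (insert v G) = d then 1 else 0)"
  proof (rule sum.mono_neutral_cong_right)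
   show "\<forall>v\<in>V - (G - J) - (V - G). lookup ?f (insert v (G - J)) = 0"
   proof
    fix v assume "v \<in> V - (G - J) - (V - G)"
    hence "v \<in> J" by blast
    hence "insert v (G - J) \<notin> lk \<Delta> J" by (auto simp: lk_iff)
    thus "lookup ?f (insert v (G - J)) = 0" by (simp add: lookup_fund[OF abstract_complexD(1)[OF Lk]])
   qed
   fix v assume "v \<in> V - G"
   hence e: "insert v (G - J) = insert v G - J" and s': "J \<subseteq> insert v G" using s by blast+
   show "lookup ?f (insert v (G - J)) = (if insert v G \<in> \<Delta> \<and> card (insert v G) = d then 1 else 0)"
    unfolding e lookup_fund[OF abstract_complexD(1)[OF Lk]] facet_link[OF J s'] ..
  qed (use finV in auto)
  finally have z: "(\<Sum>v\<in>V - G. if insert v G \<in> \<Delta> \<and> card (insert v G) = d then 1 else 0) = (0::'k)" by simp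
  have "dN J (const J K) G m = (\<Sum>v\<in>V - G. K m * (if insert v G \<in> \<Delta> \<and> card (insert v G) = d then 1 else 0))"
   unfolding dN_def if_P[OF s]
  proof (rule sum.cong)
   fix v
   have "J \<subseteq> insert v G" using s by blast
   thus "const J K (insert v G) m = K m * (if insert v G \<in> \<Delta> \<and> card (insert v G) = d then 1 else 0)"
    by (simp add: const_def)
  qed simp
  also have "... = 0" unfolding sum_distrib_left[symmetric] z by simp
  finally show ?thesis .
 qed (simp add: dN_def)
 thus ?thesis using N by (simp add: Z_def fun_eq_iff)
qed

lemma \<theta>_mons:
 assumes "J \<in> \<Delta>" "mons J j K"
 shows "\<theta> r K = lower a J r K"
proof
 fix m
 show "\<theta> r K m = lower a J r K m"
  unfolding lower_def by (rule sum.mono_neutral_right[OF finV]) (use assms in \<open>auto simp: mons_def\<close>)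
qed

lemma \<theta>_const: "\<theta> r (const J K G) = const J (\<theta> r K) G"
proof (cases "G \<in> \<Delta> \<and> J \<subseteq> G \<and> card G = d")
 case True
 thus ?thesis by (simp add: const_def lower_def fun_eq_iff)
next
 case False
 thus ?thesis unfolding const_def lower_def fun_eq_iff if_not_P[OF False] by simp
qed

text \<open>In top position the cycles are functionals on the single simplex \<open>J\<close>, where
  the first \<open>card J\<close> forms are coordinates. Each of these is onto, and once all are
  used only degree 0 is left.\<close>

lemma TT_top:
 assumes J: "J \<in> \<Delta>"
 shows "r < card J ==> TT J d r j" "j \<noteq> 0 ==> TT J d (card J) j"
proof -
 obtain G where G: "G \<in> \<Delta>" "J \<subseteq> G" "card G = d" using hsphere_facet[OF H J] .
 have ker: "lower a J q K = (\<lambda>_. 0)" if "kerN r (const J K)" "q < r" "mons J j K" for q r K j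
 proof -
  have "\<theta> q (const J K G) = (\<lambda>_. 0)" using that by (simp add: kerN_def kerl_def)
  hence "const J (\<theta> q K) G m = 0" for m unfolding \<theta>_const by (simp add: fun_eq_iff)
  hence "\<theta> q K = (\<lambda>_. 0)" using G by (simp add: const_def fun_eq_iff)
  thus ?thesis using \<theta>_mons[OF J that(3)] by simp
 qed
 show "TT J d r j" if r: "r < card J"
  unfolding TT_def
 proof (intro ballI impI)
  fix z assume z: "z \<in> Z J d j" "kerN r z"
  obtain K where K: "mons J j K" "z = const J K" using top_form[OF J z(1)] .
  obtain g where g: "mons J (Suc j) g" "\<forall>q<r. lower a J q g = (\<lambda>_. 0)" "lower a J r g = K"
   using simplex_coregular[OF fin[OF J] nd[OF J] K(1) ker[OF z(2)[unfolded K(2)] _ K(1)] r] by blast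
  have "kerN r (const J g)"
   unfolding kerN_def kerl_def \<theta>_const using g(2) by (simp add: \<theta>_mons[OF J g(1)] const_def fun_eq_iff)
  moreover have "\<forall>G. \<theta> r (const J g G) = z G"
   unfolding \<theta>_const \<theta>_mons[OF J g(1)] g(3) K(2) by simp
  ultimately show "\<exists>z'\<in>Z J d (Suc j). kerN r z' \<and> (\<forall>G. \<theta> r (z' G) = z G)"
   using const_Z[OF J g(1)] by blast
 qed
 show "TT J d (card J) j" if j: "j \<noteq> 0"
  unfolding TT_def
 proof (intro ballI impI)
  fix z assume z: "z \<in> Z J d j" "kerN (card J) z"
  obtain K where K: "mons J j K" "z = const J K" using top_form[OF J z(1)] .
  have "K = (\<lambda>_. 0)"
   using simplex_kernel[OF fin[OF J] nd[OF J] K(1) ker[OF z(2)[unfolded K(2)] _ K(1)] j] .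
  hence z0: "z = (\<lambda>_ _. 0)" using K(2) by (simp add: const_def fun_eq_iff)
  have "z \<in> Z J d (Suc j)" unfolding z0 by (simp add: Z_def N_def dN_def fun_eq_iff)
  moreover have "\<theta> (card J) (z G) = z G" for G unfolding z0 by simp
  ultimately show "\<exists>z'\<in>Z J d (Suc j). kerN (card J) z' \<and> (\<forall>G. \<theta> (card J) (z' G) = z G)"
   using z(2) by blast
 qed
qed

text \<open>Each step down from \<open>i = d\<close> gains one more form. The borderline form may
  fail only in degree \<open>d - i\<close>, the trace of degree 0 at the top. At
  \<open>i = card J\<close> the bound on \<open>r\<close> reaches \<open>d\<close>.\<close>

definition QQ :: "'a set => nat => bool" where
 "QQ J i \<longleftrightarrow> (\<forall>r j. r < card J + (d - i) --> TT J i r j) \<and>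
  (\<forall>j. card J < i --> j \<noteq> d - i --> TT J i (card J + (d - i)) j)"

lemma EE_if_QQ:
 assumes J: "J \<in> \<Delta>" "card J \<le> i" "i < d" and Q: "QQ J (Suc i)"
 shows "r \<le> card J + (d - Suc i) ==> EE J i r j"
  and "j \<noteq> d - i ==> EE J i (card J + (d - i)) j"
proof -
 show 1: "EE J i r j" if "r \<le> card J + (d - Suc i)" for r j
  using that
 proof (induction r arbitrary: j)
  case 0
  thus ?case using EE_0[OF J] by simp
 next
  case (Suc r)
  thus ?case using Q by (intro EE_Suc) (auto simp: QQ_def)
 qed
 show "EE J i (card J + (d - i)) j" if j: "j \<noteq> d - i"
 proof -
  have eq: "card J + (d - i) = Suc (card J + (d - Suc i))" using J by simp
  show ?thesis
   unfolding eq
  proof (rule EE_Suc[OF 1[OF order_refl]])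
   assume "j \<noteq> 0"
   thus "TT J (Suc i) (card J + (d - Suc i)) (j - 1)"
    using Q J j unfolding QQ_def by auto
  qed
 qed
qed

lemma QQ_step:
 assumes J: "J \<in> \<Delta>" "card J \<le> i" "i < d" and Q: "QQ J (Suc i)"
  and cor: "\<And>G. G \<in> \<Delta> ==> J \<subset> G ==> coreg G"
 shows "QQ J i"
 unfolding QQ_def
proof (intro conjI allI impI)
 fix r j assume r: "r < card J + (d - i)"
 have "EE J i r j" by (rule EE_if_QQ(1)[OF J Q]) (use r in linarith)
 thus "TT J i r j" using J r by (intro TT_if_EE cor) auto
next
 fix j assume s: "card J < i" and j: "j \<noteq> d - i"
 have "EE J i (card J + (d - i)) j" using EE_if_QQ(2)[OF J Q j] .
 thus "TT J i (card J + (d - i)) j" using J s by (intro TT_if_EE cor) auto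
qed

lemma Z_bottom:
 assumes J: "J \<in> \<Delta>"
 shows "f \<in> L J j ==> (\<lambda>G. if G = J then f else (\<lambda>_. 0)) \<in> Z J (card J) j"
  and "c \<in> Z J (card J) j ==> c J \<in> L J j"
proof -
 show "(\<lambda>G. if G = J then f else (\<lambda>_. 0)) \<in> Z J (card J) j" if f: "f \<in> L J j"
 proof -
  have "(\<lambda>G. if G = J then f else (\<lambda>_. 0)) \<in> N J (card J) j"
   by (rule N_I) (use f J L_D in \<open>auto split: if_splits\<close>)
  moreover have "dN J (\<lambda>G. if G = J then f else (\<lambda>_. 0)) G m = 0" for G m
  proof (cases "J \<subseteq> G")
   case True
   hence "insert v G \<noteq> J" if "v \<in> V - G" for v using that by blast
   thus ?thesis by (simp add: dN_def)
  qed (simp add: dN_def)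
  ultimately show ?thesis by (simp add: Z_def fun_eq_iff)
 qed
 show "c J \<in> L J j" if "c \<in> Z J (card J) j"
  using that N_D[of c J "card J" j] unfolding Z_def L_def by blast
qed

text \<open>The outer induction goes from the facets to smaller faces and supplies coregularity on
  larger faces; the inner one lowers \<open>i\<close> from \<open>d\<close> to
  \<open>card J\<close>, where the complex reduces to \<open>L J\<close> itself.\<close>

lemma coreg_QQ:
 assumes "J \<in> \<Delta>"
 shows "coreg J \<and> (\<forall>i. card J \<le> i --> i \<le> d --> QQ J i)"
 using assms
proof (induction "d - card J" arbitrary: J rule: less_induct)
 case less
 note J = less.prems
 have cor: "coreg G" if G: "G \<in> \<Delta>" "J \<subset> G" for G
 proof -
  have "card J < card G" using G fin by (intro psubset_card_mono) auto
  hence "d - card G < d - card J" using dim[OF G(1)] by linarith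
  thus ?thesis using less.hyps G(1) by blast
 qed
 have QQ: "QQ J i" if i: "card J \<le> i" "i \<le> d" for i
  using i(2,1)
 proof (induction i rule: inc_induct)
  case base
  show ?case using TT_top[OF J] by (simp add: QQ_def)
 next
  case (step n)
  thus ?case using QQ_step[OF J _ _ _ cor, of n] by simp
 qed
 have "coreg J"
  unfolding coreg_def
 proof (intro allI impI ballI)
  fix r j f assume r: "r < d" and f: "f \<in> L J j" "kerl r f"
  let ?z = "\<lambda>G. if G = J then f else (\<lambda>_. 0)"
  have "TT J (card J) r j" using QQ[OF order_refl dim[OF J]] r dim[OF J] unfolding QQ_def by auto
  moreover have "kerN r ?z" using f(2) by (auto simp: kerN_def kerl_def)
  ultimately obtain z' where z': "z' \<in> Z J (card J) (Suc j)" "kerN r z'" "\<And>G. \<theta> r (z' G) = ?z G"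
   using Z_bottom(1)[OF J f(1)] unfolding TT_def by blast
  have "\<theta> r (z' J) = f" using z'(3)[of J] by simp
  moreover have "kerl r (z' J)" using z'(2) unfolding kerN_def by blast
  ultimately show "\<exists>g\<in>L J (Suc j). kerl r g \<and> \<theta> r g = f" using Z_bottom(2)[OF J z'(1)] by blast
 qed
 thus ?case using QQ by blast
qed

text \<open>Exactness at the bottom of the complex with all \<open>d\<close> forms. The excluded
  degree is the top degree for \<open>J\<close>, which is treated by uniqueness of the volume
  form.\<close>

lemma star_cover:
 assumes J: "J \<in> \<Delta>" "card J < d" and j: "j \<noteq> d - card J" and f: "f \<in> L J j" "kerl d f"
 obtains g where "\<And>v. v \<in> V - J ==> insert v J \<in> \<Delta> ==> g v \<in> L (insert v J) j \<and> kerl d (g v)"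
  "\<And>m. f m = (\<Sum>v\<in>{v \<in> V - J. insert v J \<in> \<Delta>}. g v m)"
proof -
 let ?z = "\<lambda>G. if G = J then f else (\<lambda>_. 0)"
 have "QQ J (Suc (card J))" using coreg_QQ[OF J(1)] J(2) by simp
 hence "EE J (card J) (card J + (d - card J)) j" using EE_if_QQ(2)[OF J(1) order_refl J(2)] j by blast
 hence "EE J (card J) d j" using J(2) by simp
 moreover have "kerN d ?z" using f(2) by (auto simp: kerN_def kerl_def)
 ultimately obtain n where n: "n \<in> N J (Suc (card J)) j" "kerN d n" "dN J n = ?z"
  using Z_bottom(1)[OF J(1) f(1)] unfolding EE_def by blast
 show thesis
 proof (rule that[of "\<lambda>v. n (insert v J)"])
  fix v
  show "n (insert v J) \<in> L (insert v J) j \<and> kerl d (n (insert v J))"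
   using n(2) N_D[OF n(1), of "insert v J"] unfolding kerN_def L_def by blast
 next
  fix m
  have "f m = dN J n J m" unfolding n(3) by simp
  also have "... = (\<Sum>v\<in>V - J. n (insert v J) m)" by (simp add: dN_def)
  also have "... = (\<Sum>v\<in>{v \<in> V - J. insert v J \<in> \<Delta>}. n (insert v J) m)"
   by (rule sum.mono_neutral_right) (use finV N_D(1)[OF n(1)] in auto)
  finally show "f m = (\<Sum>v\<in>{v \<in> V - J. insert v J \<in> \<Delta>}. n (insert v J) m)" .
 qed
qed

text \<open>A combination of the forms that equals \<open>u\<close> plus vertices outside
  \<open>t\<close>. It lets a factor \<open>u\<close> be traded for vertices that enlarge the
  support.\<close>

lemma dual_form:
 assumes t: "t \<in> \<Delta>" "u \<in> t"
 obtains l where "l u = 1" "\<And>v. v \<in> t ==> v \<noteq> u ==> l v = (0::'k)"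
  "\<And>f m. kerl d f ==> (\<Sum>v\<in>V. l v * f (add_mset v m)) = 0"
proof -
 let ?l = "\<lambda>v. \<Sum>r<card t. b t u r * a r v"
 have l: "?l v = (if u = v then 1 else 0)" if "v \<in> t" for v using nd[OF t(1)] t(2) that by (simp add: nondeg_def)
 have "(\<Sum>v\<in>V. ?l v * f (add_mset v m)) = 0" if f: "kerl d f" for f m
 proof -
  have "(\<Sum>v\<in>V. ?l v * f (add_mset v m)) = (\<Sum>v\<in>V. \<Sum>r<card t. b t u r * (a r v * f (add_mset v m)))"
   by (simp add: sum_distrib_right mult.assoc)
  also have "... = (\<Sum>r<card t. \<Sum>v\<in>V. b t u r * (a r v * f (add_mset v m)))" by (rule sum.swap)
  also have "... = (\<Sum>r<card t. b t u r * \<theta> r f m)" by (simp add: lower_def sum_distrib_left)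
  also have "... = 0" using f dim[OF t(1)] by (intro sum.neutral) (simp add: kerl_def fun_eq_iff)
  finally show ?thesis .
 qed
 thus thesis using l t(2) by (intro that[of ?l]) auto
qed

text \<open>A factor that is repeated or lies in \<open>J\<close> is traded by
  \<open>dual_form\<close>. The monomials that arise have, together with \<open>J\<close>, a
  strictly larger support, so only the squarefree monomials disjoint from \<open>J\<close>
  matter.\<close>

lemma eliminate:
 assumes J: "J \<in> \<Delta>" and f: "f \<in> L J j" "kerl d f"
  and sq: "\<And>S. S \<inter> J = {} ==> S \<union> J \<in> \<Delta> ==> card S = j ==> f (mset_set S) = 0"
 shows "f m = 0"
proof (induction "d - card (set_mset m \<union> J)" arbitrary: m rule: less_induct)
 case less
 show ?case
 proof (rule ccontr)
  assume nz: "f m \<noteq> 0"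
  let ?t = "set_mset m \<union> J"
  have t: "?t \<in> \<Delta>" "size m = j" using L_D[OF f(1) nz] by auto
  obtain u where u: "u \<in># m" "u \<in> set_mset (m - {#u#}) \<union> J"
  proof (rule ccontr)
   assume "\<not> thesis"
   hence n: "\<And>u. u \<in># m ==> u \<notin># m - {#u#} \<and> u \<notin> J" using that by blast
   have "count m u \<le> 1" for u
   proof (cases "u \<in># m")
    case True
    hence "count (m - {#u#}) u = 0" using n by (simp add: not_in_iff)
    thus ?thesis by simp
   qed (simp add: not_in_iff)
   hence mm: "m = mset_set (set_mset m)"
    by (intro multiset_eqI) (metis count_mset_set(1) count_mset_set(3) finite_set_mset le_SucE le_zero_eq not_in_iff One_nat_def count_greater_zero_iff neq0_conv)
   have "card (set_mset m) = j" using t(2) by (subst (asm) mm) simp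
   moreover have "set_mset m \<inter> J = {}" using n by blast
   ultimately have "f (mset_set (set_mset m)) = 0" using t(1) by (intro sq)
   thus False using nz mm by simp
  qed
  let ?m' = "m - {#u#}"
  have m: "m = add_mset u ?m'" using u(1) by simp
  have un: "set_mset ?m' \<union> J = ?t" by (subst m) (use u(2) in auto)
  have uV: "u \<in> V" and ut: "u \<in> ?t" using t(1) u(1) by auto
  obtain l where l: "l u = 1" "\<And>v. v \<in> ?t ==> v \<noteq> u ==> l v = (0::'k)"
   "\<And>f m. kerl d f ==> (\<Sum>v\<in>V. l v * f (add_mset v m)) = 0"
   using dual_form[OF t(1) ut] by metis
  have "l v * f (add_mset v ?m') = 0" if "v \<in> V - {u}" for v
  proof (cases "v \<in> ?t")
   case True
   thus ?thesis using l(2) that by simp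
  next
   case False
   show ?thesis
   proof (rule ccontr)
    assume n: "l v * f (add_mset v ?m') \<noteq> 0"
    hence "f (add_mset v ?m') \<noteq> 0" by auto
    from L_D(1)[OF f(1) this] have vt: "insert v ?t \<in> \<Delta>" using un by simp
    have "card (insert v ?t) = Suc (card ?t)" using False fin[OF t(1)] by simp
    hence "d - card (set_mset (add_mset v ?m') \<union> J) < d - card ?t" using dim[OF vt] un by simp
    hence "f (add_mset v ?m') = 0" by (rule less)
    thus False using n by simp
   qed
  qed
  hence "(\<Sum>v\<in>V. l v * f (add_mset v ?m')) = f m"
   using finV uV l(1) by (subst sum.remove[of _ u]) (simp_all add: sum.neutral flip: m)
  thus False using l(3)[OF f(2)] nz by simp
 qed
qed

end

section \<open>The top degree and generation by a volume form\<close>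

context lsop
begin

text \<open>The fundamental cycle makes the number of facets over \<open>G\<close> even, and purity
  makes it positive. With more than two, any two of them would form a cycle that is not constant on
  the facets over \<open>G\<close>.\<close>

lemma ridge_two:
 assumes G: "G \<in> \<Delta>" "Suc (card G) = d"
 obtains u w where "u \<noteq> w" "{v \<in> V - G. insert v G \<in> \<Delta>} = {u, w}"
proof -
 let ?T = "{v \<in> V - G. insert v G \<in> \<Delta>}"
 have finT: "finite ?T" by (rule finite_subset[OF _ finV]) blast
 have cardI: "card (insert v G) = d" if "v \<in> ?T" for v using that G fin[OF G(1)] by simp
 let ?K = "\<lambda>m::'a multiset. if m = {#} then 1 else (0::'k)"
 have K: "mons G 0 ?K" by (simp add: mons_def)
 have "dN G (const G ?K) G {#} = 0" using const_Z[OF G(1) K] by (simp add: Z_def)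
 moreover have "dN G (const G ?K) G {#} = (\<Sum>v\<in>?T. 1)"
  unfolding dN_def if_P[OF order_refl]
  by (rule sum.mono_neutral_cong_right) (use finV cardI in \<open>auto simp: const_def\<close>)
 ultimately have even: "(of_nat (card ?T) :: 'k) = 0" by simp
 obtain F where F: "F \<in> \<Delta>" "G \<subseteq> F" "card F = d" using hsphere_facet[OF H G(1)] .
 have "G \<noteq> F" using F(3) G(2) by auto
 then obtain u where u: "u \<in> F" "u \<notin> G" using F(2) by blast
 have "insert u G \<in> \<Delta>" by (rule dn[OF F(1)]) (use u F in auto)
 hence uT: "u \<in> ?T" using u F by auto
 have "?T \<noteq> {u}" using even by auto
 then obtain w where w: "w \<in> ?T" "w \<noteq> u" using uT by blast
 let ?C = "\<lambda>F (m::'a multiset). if (F = insert u G \<or> F = insert w G) \<and> m = {#} then 1 else (0::'k)"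
 have CN: "?C \<in> N G d 0"
  by (rule N_I) (use uT w cardI in \<open>auto split: if_splits\<close>)
 have "dN G ?C G' m = 0" for G' m
 proof (cases "G \<subseteq> G' \<and> m = {#}")
  case sub: True
  show ?thesis
  proof (cases "G' = G")
   case True
   have "dN G ?C G' m = (\<Sum>v\<in>V - G. if v = u \<or> v = w then 1 else 0)"
    unfolding dN_def if_P[OF conjunct1[OF sub]] unfolding True
    by (rule sum.cong) (use uT w sub in \<open>auto simp: insert_ident\<close>)
   also have "... = (\<Sum>v\<in>{u, w}. 1)"
    by (rule sum.mono_neutral_cong_right) (use finV uT w in auto)
   also have "... = 0" using w by simp
   finally show ?thesis .
  next
   case False
   have "?C (insert v G') m = 0" if v: "v \<in> V - G'" for v
   proof -
    have no: "insert v G' \<noteq> insert x G" if x: "x \<in> ?T" for x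
    proof
     assume e: "insert v G' = insert x G"
     have "G' \<subseteq> insert x G" "v \<in> insert x G" using e by blast+
     hence "v = x" using v sub by blast
     hence "G' \<subseteq> G" using \<open>G' \<subseteq> insert x G\<close> v by blast
     thus False using sub False by blast
    qed
    show ?thesis using no[OF uT] no[OF w(1)] by simp
   qed
   thus ?thesis by (simp add: dN_def)
  qed
 qed (auto simp: dN_def)
 hence CZ: "?C \<in> Z G d 0" using CN by (simp add: Z_def fun_eq_iff)
 obtain K where "mons G 0 K" and k: "?C = const G K" using top_form[OF G(1) CZ] .
 have val: "?C (insert x G) {#} = K {#}" if "x \<in> ?T" for x
 proof -
  have "?C (insert x G) {#} = const G K (insert x G) {#}" using fun_cong[OF fun_cong[OF k, of "insert x G"], of "{#}"] .
  also have "... = K {#}" using that cardI[OF that] unfolding const_def by auto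
  finally show ?thesis .
 qed
 have "?T = {u, w}"
 proof (rule ccontr)
  assume "?T \<noteq> {u, w}"
  then obtain x where x: "x \<in> ?T" "x \<noteq> u" "x \<noteq> w" using uT w by blast
  hence "insert x G \<noteq> insert u G" "insert x G \<noteq> insert w G" using uT w by blast+
  hence "K {#} = 0" using val[OF x(1)] by simp
  thus False using val[OF uT] by simp
 qed
 thus thesis using that w by blast
qed

end

text \<open>\<open>\<Omega>\<close> plays the role of the degree map of the Artinian
  quotient.\<close>

locale lsop_vol = lsop \<Delta> d a b
 for \<Delta> :: "'a set set" and d :: nat and a :: "nat => 'a => 'k::char_two" and b :: "'a set => 'a => nat => 'k" +
 fixes \<Omega> :: "'a multiset => 'k"
 assumes \<Omega>L: "\<Omega> \<in> L {} d" and \<Omega>ker: "kerl d \<Omega>"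
  and \<Omega>nz: "\<And>F. F \<in> \<Delta> ==> card F = d ==> \<Omega> (mset_set F) \<noteq> 0"
begin

text \<open>The form dual to \<open>u\<close> leaves only the terms of the two facets over the
  ridge, so their values have a ratio that does not depend on \<open>f\<close>.\<close>

lemma ridge_relation:
 assumes G: "G \<in> \<Delta>" "J \<subseteq> G" and T: "{v \<in> V - G. insert v G \<in> \<Delta>} = {u, w}" "u \<noteq> w"
  and l: "l u = 1" "\<And>v. v \<in> insert u G ==> v \<noteq> u ==> l v = (0::'k)"
   "\<And>f m. kerl d f ==> (\<Sum>v\<in>V. l v * f (add_mset v m)) = 0"
  and f: "f \<in> L J j" "kerl d f"
 shows "f (mset_set (insert u G - J)) = l w * f (mset_set (insert w G - J))"
proof -
 have "u \<in> {v \<in> V - G. insert v G \<in> \<Delta>}" "w \<in> {v \<in> V - G. insert v G \<in> \<Delta>}" unfolding T(1) by simp_all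
 hence uw: "u \<in> V - G" "w \<in> V - G" by simp_all
 have ms: "mset_set (insert v G - J) = add_mset v (mset_set (G - J))" if "v \<in> V - G" for v
 proof -
  have "insert v G - J = insert v (G - J)" "v \<notin> G - J" using that G(2) by blast+
  thus ?thesis using fin[OF G(1)] by simp
 qed
 let ?t = "\<lambda>v. l v * f (add_mset v (mset_set (G - J)))"
 have "0 = (\<Sum>v\<in>V. ?t v)" using l(3)[OF f(2)] by simp
 also have "... = (\<Sum>v\<in>{u, w}. ?t v)"
 proof (rule sum.mono_neutral_right[OF finV])
  show "{u, w} \<subseteq> V" using uw by blast
  show "\<forall>v\<in>V - {u, w}. ?t v = 0"
  proof
   fix v assume v: "v \<in> V - {u, w}"
   show "?t v = 0"
   proof (cases "v \<in> G")
    case True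
    thus ?thesis using l(2)[of v] v by simp
   next
    case False
    hence n: "insert v G \<notin> \<Delta>" using v T(1) by blast
    have "f (add_mset v (mset_set (G - J))) = 0"
    proof (rule ccontr)
     assume "f (add_mset v (mset_set (G - J))) \<noteq> 0"
     from L_D(1)[OF f(1) this] have "insert v (G - J) \<union> J \<in> \<Delta>" using fin[OF G(1)] by simp
     moreover have "insert v (G - J) \<union> J = insert v G" using G(2) by blast
     ultimately show False using n by simp
    qed
    thus ?thesis by simp
   qed
  qed
 qed
 also have "... = f (mset_set (insert u G - J)) + l w * f (mset_set (insert w G - J))"
  using T(2) l(1) ms[OF uw(1)] ms[OF uw(2)] by simp
 finally show ?thesis by (metis char_two_eq_iff)
qed

definition \<Omega>at :: "'a set => 'a multiset => 'k" where
 "\<Omega>at J m = \<Omega> (m + mset_set J)"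

lemma \<Omega>at_L:
 assumes "J \<in> \<Delta>"
 shows "\<Omega>at J \<in> L J (d - card J)" "kerl d (\<Omega>at J)"
proof -
 show "\<Omega>at J \<in> L J (d - card J)"
  unfolding L_def
 proof (intro CollectI allI impI)
  fix m assume "\<Omega>at J m \<noteq> 0"
  hence "\<Omega> (m + mset_set J) \<noteq> 0" by (simp add: \<Omega>at_def)
  from L_D[OF \<Omega>L this] show "set_mset m \<union> J \<in> \<Delta> \<and> size m = d - card J" using fin[OF assms] by simp
 qed
 have "\<theta> q (\<Omega>at J) m = \<theta> q \<Omega> (m + mset_set J)" for q m by (simp add: lower_def \<Omega>at_def)
 thus "kerl d (\<Omega>at J)" using \<Omega>ker by (simp add: kerl_def fun_eq_iff)
qed

text \<open>By \<open>ridge_relation\<close> the quotient of \<open>f\<close> by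
  \<open>\<Omega>\<close> agrees on adjacent facets, so it is a top cycle and hence constant. The
  difference then vanishes on the squarefree monomials, and \<open>eliminate\<close>
  applies.\<close>

lemma top_unique:
 assumes J: "J \<in> \<Delta>" and f: "f \<in> L J (d - card J)" "kerl d f"
 obtains K where "\<And>m. f m = K * \<Omega>at J m"
proof -
 let ?q = "\<lambda>F. f (mset_set (F - J)) / \<Omega> (mset_set F)"
 let ?C = "\<lambda>F (m::'a multiset). if F \<in> \<Delta> \<and> J \<subseteq> F \<and> card F = d \<and> m = {#} then ?q F else 0"
 have CN: "?C \<in> N J d 0" by (rule N_I) (auto split: if_splits)
 have "dN J ?C G m = 0" for G m
 proof (cases "J \<subseteq> G \<and> m = {#} \<and> G \<in> \<Delta> \<and> Suc (card G) = d")
  case True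
  hence G: "J \<subseteq> G" "m = {#}" "G \<in> \<Delta>" "Suc (card G) = d" by auto
  obtain u w where T: "u \<noteq> w" "{v \<in> V - G. insert v G \<in> \<Delta>} = {u, w}" using ridge_two[OF G(3,4)] .
  have "u \<in> {v \<in> V - G. insert v G \<in> \<Delta>}" "w \<in> {v \<in> V - G. insert v G \<in> \<Delta>}" unfolding T(2) by simp_all
  hence uw: "u \<in> V - G" "w \<in> V - G" "insert u G \<in> \<Delta>" "insert w G \<in> \<Delta>" by simp_all
  have card: "card (insert v G) = d" if "v \<in> V - G" for v using that G fin[OF G(3)] by simp
  have "dN J ?C G m = (\<Sum>v\<in>{u, w}. ?q (insert v G))"
   unfolding dN_def if_P[OF G(1)]
  proof (rule sum.mono_neutral_cong_right)
   show "{u, w} \<subseteq> V - G" using uw by blast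
   show "\<forall>v\<in>V - G - {u, w}. ?C (insert v G) m = 0"
   proof
    fix v assume "v \<in> V - G - {u, w}"
    hence "insert v G \<notin> \<Delta>" using T(2) by blast
    thus "?C (insert v G) m = 0" by simp
   qed
   fix v assume "v \<in> {u, w}"
   hence "insert v G \<in> \<Delta>" "J \<subseteq> insert v G" "card (insert v G) = d" using uw card G(1) by blast+
   thus "?C (insert v G) m = ?q (insert v G)" using G(2) by simp
  qed (use finV in simp)
  also have "... = ?q (insert u G) + ?q (insert w G)" using T(1) by simp
  also have "?q (insert u G) = ?q (insert w G)"
  proof -
   obtain l where l: "l u = 1" "\<And>v. v \<in> insert u G ==> v \<noteq> u ==> l v = (0::'k)"
    "\<And>f m. kerl d f ==> (\<Sum>v\<in>V. l v * f (add_mset v m)) = 0"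
    using dual_form[OF uw(3), of u] by (metis insertI1)
   have 1: "f (mset_set (insert u G - J)) = l w * f (mset_set (insert w G - J))"
    by (rule ridge_relation[OF G(3,1) T(2,1) l f])
   have "\<Omega> (mset_set (insert u G - {})) = l w * \<Omega> (mset_set (insert w G - {}))"
    by (rule ridge_relation[OF G(3) _ T(2,1) l \<Omega>L \<Omega>ker]) simp
   hence 2: "\<Omega> (mset_set (insert u G)) = l w * \<Omega> (mset_set (insert w G))" by simp
   moreover have "\<Omega> (mset_set (insert u G)) \<noteq> 0" using \<Omega>nz[OF uw(3) card[OF uw(1)]] .
   ultimately have "l w \<noteq> 0" by auto
   thus ?thesis unfolding 1 2 by simp
  qed
  finally show ?thesis by simp
 next
  case False
  show ?thesis
  proof (rule ccontr)
   assume nz: "dN J ?C G m \<noteq> 0"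
   hence s: "J \<subseteq> G" by (auto simp: dN_def split: if_splits)
   hence h: "(\<Sum>v\<in>V - G. ?C (insert v G) m) \<noteq> 0" using nz unfolding dN_def by simp
   obtain v where v: "v \<in> V - G" "?C (insert v G) m \<noteq> 0"
    using sum.not_neutral_contains_not_neutral[OF h] .
   hence c: "insert v G \<in> \<Delta>" "card (insert v G) = d" "m = {#}" by (auto split: if_splits)
   have GD: "G \<in> \<Delta>" by (rule dn[OF c(1)]) blast
   hence "Suc (card G) = d" using c(2) v(1) fin[OF GD] by simp
   thus False using False s c GD by blast
  qed
 qed
 hence CZ: "?C \<in> Z J d 0" using CN by (simp add: Z_def fun_eq_iff)
 obtain K where "mons J 0 K" and k: "?C = const J K" using top_form[OF J CZ] .
 let ?k = "K {#}"
 have val: "f (mset_set (F - J)) = ?k * \<Omega> (mset_set F)" if F: "F \<in> \<Delta>" "J \<subseteq> F" "card F = d" for F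
 proof -
  have "?C F {#} = const J K F {#}" using fun_cong[OF fun_cong[OF k, of F], of "{#}"] .
  hence "?q F = ?k" using F by (simp add: const_def)
  thus ?thesis using \<Omega>nz[OF F(1,3)] by (simp add: field_simps)
 qed
 let ?f = "\<lambda>m. f m + ?k * \<Omega>at J m"
 have "?f m = 0" for m
 proof (rule eliminate[OF J, of ?f "d - card J"])
  show "?f \<in> L J (d - card J)"
   unfolding L_def
  proof (intro CollectI allI impI)
   fix m assume "?f m \<noteq> 0"
   hence "f m \<noteq> 0 \<or> \<Omega>at J m \<noteq> 0" by auto
   thus "set_mset m \<union> J \<in> \<Delta> \<and> size m = d - card J"
    using L_D[OF f(1), of m] L_D[OF \<Omega>at_L(1)[OF J], of m] by blast
  qed
  have "\<theta> q (\<lambda>m. ?k * \<Omega>at J m) = (\<lambda>_. 0)" if "q < d" for q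
  proof -
   have "\<theta> q (\<lambda>m. ?k * \<Omega>at J m) = (\<lambda>m. ?k * \<theta> q (\<Omega>at J) m)"
    by (intro ext, unfold lower_def sum_distrib_left, intro sum.cong refl mult.left_commute)
   thus ?thesis using \<Omega>at_L(2)[OF J] that by (simp add: kerl_def fun_eq_iff)
  qed
  thus "kerl d ?f" using f(2) by (simp add: kerl_def \<theta>_add)
  fix S assume S: "S \<inter> J = {}" "S \<union> J \<in> \<Delta>" "card S = d - card J"
  have finS: "finite S" "finite J" using fin[OF S(2)] by auto
  have "card (S \<union> J) = d" using S dim[OF J] finS by (simp add: card_Un_disjoint)
  moreover have "S \<union> J - J = S" using S by blast
  ultimately have "f (mset_set S) = ?k * \<Omega> (mset_set (S \<union> J))" using val[OF S(2)] by auto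
  moreover have "mset_set (S \<union> J) = mset_set S + mset_set J" using S finS by (simp add: mset_set_Union)
  ultimately show "?f (mset_set S) = 0" by (simp add: \<Omega>at_def)
 qed
 thus thesis using that[of ?k] by (simp add: char_two_eq_iff)
qed

text \<open>In degree \<open>j\<close> the functional is a combination of shifts of the volume form.
  That all kernel elements are of this kind is the Gorenstein property of the quotient ring.\<close>

definition sp :: "'a set => nat => ('a multiset => 'k) => bool" where
 "sp J j f \<longleftrightarrow> (\<exists>M c. finite M \<and> (\<forall>m\<in>M. size m + card J + j = d) \<and>
  (\<forall>n. size n = j --> f n = (\<Sum>m\<in>M. c m * \<Omega>at J (m + n))))"

lemma sp_add:
 assumes "sp J j f" "sp J j g"
 shows "sp J j (\<lambda>n. f n + g n)"
proof -
 obtain M c where M: "finite M" "\<forall>m\<in>M. size m + card J + j = d" "\<forall>n. size n = j --> f n = (\<Sum>m\<in>M. c m * \<Omega>at J (m + n))"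
  using assms(1) unfolding sp_def by blast
 obtain M' c' where M': "finite M'" "\<forall>m\<in>M'. size m + card J + j = d" "\<forall>n. size n = j --> g n = (\<Sum>m\<in>M'. c' m * \<Omega>at J (m + n))"
  using assms(2) unfolding sp_def by blast
 let ?e = "\<lambda>m. (if m \<in> M then c m else 0) + (if m \<in> M' then c' m else 0)"
 have "f n + g n = (\<Sum>m\<in>M \<union> M'. ?e m * \<Omega>at J (m + n))" if n: "size n = j" for n
 proof -
  have "f n = (\<Sum>m\<in>M \<union> M'. (if m \<in> M then c m else 0) * \<Omega>at J (m + n))"
   using M n by (intro trans[OF M(3)[rule_format, OF n]] sum.mono_neutral_cong_left) (use M' in auto)
  moreover have "g n = (\<Sum>m\<in>M \<union> M'. (if m \<in> M' then c' m else 0) * \<Omega>at J (m + n))"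
   using M' n by (intro trans[OF M'(3)[rule_format, OF n]] sum.mono_neutral_cong_left) (use M in auto)
  ultimately show ?thesis by (simp add: distrib_right sum.distrib)
 qed
 thus ?thesis unfolding sp_def using M M' by (intro exI[of _ "M \<union> M'"] exI[of _ ?e]) blast
qed

lemma sp_sum:
 assumes "finite T" "\<And>v. v \<in> T ==> sp J j (g v)"
 shows "sp J j (\<lambda>n. \<Sum>v\<in>T. g v n)"
 using assms
proof (induction T)
 case empty
 show ?case unfolding sp_def by (intro exI[of _ "{}"]) simp
next
 case (insert v T)
 thus ?case using sp_add[of J j "g v"] by simp
qed

lemma sp_insert:
 assumes v: "v \<notin> J" "finite J" and f: "sp (insert v J) j f"
 shows "sp J j f"
proof -
 obtain M c where M: "finite M" "\<forall>m\<in>M. size m + card (insert v J) + j = d"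
  "\<forall>n. size n = j --> f n = (\<Sum>m\<in>M. c m * \<Omega>at (insert v J) (m + n))"
  using f unfolding sp_def by blast
 let ?c = "\<lambda>m. c (m - {#v#})"
 have "\<Omega>at (insert v J) (m + n) = \<Omega>at J (add_mset v m + n)" for m n
  using v by (simp add: \<Omega>at_def)
 hence "f n = (\<Sum>m\<in>add_mset v ` M. ?c m * \<Omega>at J (m + n))" if "size n = j" for n
  using M(3) that by (subst sum.reindex) (simp_all add: inj_on_def)
 thus ?thesis unfolding sp_def using M(1,2) v by (intro exI[of _ "add_mset v ` M"] exI[of _ ?c]) auto
qed

text \<open>\<open>star_cover\<close> passes to larger faces until \<open>j\<close> is the top
  degree there, where the kernel is one-dimensional. The volume form at a larger face is a shift of
  the one at \<open>J\<close>.\<close>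

theorem span_volume:
 assumes "J \<in> \<Delta>" "card J + j \<le> d" "f \<in> L J j" "kerl d f"
 shows "sp J j f"
 using assms
proof (induction "d - card J" arbitrary: J f rule: less_induct)
 case less
 note J = less.prems(1) and f = less.prems(3,4)
 show ?case
 proof (cases "j = d - card J")
  case True
  obtain K where "\<And>m. f m = K * \<Omega>at J m" using top_unique[OF J f[unfolded True]] by blast
  thus ?thesis unfolding sp_def using True less.prems(2)
   by (intro exI[of _ "{{#}}"] exI[of _ "\<lambda>_. K"]) simp
 next
  case False
  hence lt: "card J < d" using less.prems(2) by simp
  let ?T = "{v \<in> V - J. insert v J \<in> \<Delta>}"
  obtain g where g: "\<And>v. v \<in> V - J ==> insert v J \<in> \<Delta> ==> g v \<in> L (insert v J) j \<and> kerl d (g v)"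
   "\<And>m. f m = (\<Sum>v\<in>?T. g v m)"
  proof (rule star_cover[OF J lt False f], goal_cases)
   case (1 g)
   show thesis by (rule that[of g]) (use 1 in simp_all)
  qed
  have "sp J j (g v)" if v: "v \<in> ?T" for v
  proof (rule sp_insert)
   have c: "card (insert v J) = Suc (card J)" using v fin[OF J] by simp
   show "sp (insert v J) j (g v)"
    by (rule less.hyps) (use v g(1)[of v] c lt False less.prems(2) in auto)
  qed (use v fin[OF J] in auto)
  hence "sp J j (\<lambda>m. \<Sum>v\<in>?T. g v m)" by (intro sp_sum finite_subset[OF _ finV]) auto
  thus ?thesis using g(2) by (simp add: sp_def)
 qed
qed

end

subsection \<open>Determinants in characteristic two\<close>

text \<open>Laplace expansion along the row \<open>r\<close>, as an operator on functions of column
  sets. Without signs these operators commute and square to zero.\<close>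

definition dop :: "('a => 'k::char_two) => ('a set => 'k) => 'a set => 'k" where
 "dop r f S = (if finite S then \<Sum>v\<in>S. r v * f (S - {v}) else 0)"

lemma sum_offdiag_swap:
 assumes "finite S"
 shows "(\<Sum>v\<in>S. \<Sum>u\<in>S - {v}. g v u) = (\<Sum>u\<in>S. \<Sum>v\<in>S - {u}. g v u :: 'c::comm_monoid_add)"
proof -
 have "(\<Sum>v\<in>S. \<Sum>u\<in>S - {v}. g v u) = (\<Sum>v\<in>S. \<Sum>u\<in>S. if u \<noteq> v then g v u else 0)"
  by (intro sum.cong refl sum.mono_neutral_cong_left) (use assms in auto)
 also have "... = (\<Sum>u\<in>S. \<Sum>v\<in>S. if u \<noteq> v then g v u else 0)" by (rule sum.swap)
 also have "... = (\<Sum>u\<in>S. \<Sum>v\<in>S - {u}. g v u)"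
  by (intro sum.cong refl sum.mono_neutral_cong_right) (use assms in auto)
 finally show ?thesis .
qed

lemma dop_dop:
 "dop r (dop r' f) S = (if finite S then \<Sum>v\<in>S. \<Sum>u\<in>S - {v}. r v * r' u * f (S - {v} - {u}) else 0)"
 by (simp add: dop_def sum_distrib_left mult.assoc)

lemma dop_commute: "dop r (dop r' f) = dop r' (dop r f)"
proof
 fix S
 show "dop r (dop r' f) S = dop r' (dop r f) S"
 proof (cases "finite S")
  case True
  have "(\<Sum>v\<in>S. \<Sum>u\<in>S - {v}. r v * r' u * f (S - {v} - {u})) = (\<Sum>u\<in>S. \<Sum>v\<in>S - {u}. r v * r' u * f (S - {v} - {u}))"
   by (rule sum_offdiag_swap[OF True])
  also have "... = (\<Sum>u\<in>S. \<Sum>v\<in>S - {u}. r' u * r v * f (S - {u} - {v}))"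
  proof (intro sum.cong refl)
   fix u v
   have "S - {v} - {u} = S - {u} - {v}" by blast
   thus "r v * r' u * f (S - {v} - {u}) = r' u * r v * f (S - {u} - {v})" by (simp only: mult.commute[of "r v"])
  qed
  finally show ?thesis using True unfolding dop_dop by simp
 qed (simp add: dop_def)
qed

lemma dop_same: "dop r (dop r f) = (\<lambda>_. 0)"
proof
 fix S
 show "dop r (dop r f) S = 0"
 proof (cases "finite S")
  case True
  have "(\<Sum>v\<in>S. \<Sum>u\<in>S - {v}. r v * r u * f (S - {v} - {u})) = 0"
  proof (rule sum_symmetric_offdiag[OF True])
   fix u v
   have "S - {v} - {u} = S - {u} - {v}" by blast
   thus "r v * r u * f (S - {v} - {u}) = r u * r v * f (S - {u} - {v})" by (simp only: mult.commute[of "r v"])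
  qed (rule add_self)
  thus ?thesis using True unfolding dop_dop by simp
 qed (simp add: dop_def)
qed

text \<open>The determinant of a square matrix over a field of characteristic two, given by the multiset of its
 rows and the set of its columns.\<close>

definition dt :: "('a => 'k::char_two) multiset => 'a set => 'k" where
 "dt R = fold_mset dop (\<lambda>S. if S = {} then 1 else 0) R"

lemma comp_fun_commute_dop: "comp_fun_commute dop"
 by (standard, rule ext) (unfold comp_def, rule dop_commute)

lemma dt_empty: "dt {#} S = (if S = {} then 1 else 0)"
 by (simp add: dt_def)

lemma dt_add_fun: "dt (add_mset r R) = dop r (dt R)"
proof -
 interpret comp_fun_commute dop by (rule comp_fun_commute_dop)
 show ?thesis unfolding dt_def by (rule fold_mset_add_mset)
qed

lemma dt_add: "finite S ==> dt (add_mset r R) S = (\<Sum>v\<in>S. r v * dt R (S - {v}))"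
 by (simp add: dt_add_fun dop_def)

lemma dt_dup: "r \<in># R ==> dt (add_mset r R) S = 0"
 by (metis dt_add_fun dop_same mset_add)

lemma dt_row_add:
 assumes "finite S"
 shows "dt (add_mset (\<lambda>v. r v + c * r' v) R) S = dt (add_mset r R) S + c * dt (add_mset r' R) S"
 using assms by (simp add: dt_add distrib_right sum.distrib sum_distrib_left mult.assoc)

lemma dt_row_op:
 assumes "finite S" "r' \<in># R"
 shows "dt (add_mset (\<lambda>v. r v + c * r' v) R) S = dt (add_mset r R) S"
 using dt_row_add[OF assms(1), of r c r' R] dt_dup[OF assms(2), of S] by simp

lemma dt_zero_column:
 "finite S ==> z \<in> S ==> (\<And>r. r \<in># R ==> r z = 0) ==> dt R S = 0"
proof (induction R arbitrary: S)
 case empty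
 thus ?case by (auto simp: dt_empty)
next
 case (add r R)
 have "r v * dt R (S - {v}) = 0" if "v \<in> S" for v
  using add.IH[of "S - {v}"] add.prems by (cases "v = z") auto
 thus ?case using add.prems by (simp add: dt_add sum.neutral)
qed

lemma sum_mset_sum_swap:
 "(\<Sum>q\<in>#R. \<Sum>v\<in>S. f q v) = (\<Sum>v\<in>S. \<Sum>q\<in>#R. f q v :: 'c::comm_monoid_add)"
 by (induction R) (simp_all add: sum.distrib)

lemma sum_mset_cong: "(\<And>q. q \<in># R ==> f q = g q) ==> (\<Sum>q\<in>#R. f q) = (\<Sum>q\<in>#R. g q)"
 by (intro arg_cong[of _ _ sum_mset] image_mset_cong)

lemma dt_column_expand:
 "finite S ==> z \<in> S ==> dt R S = (\<Sum>r\<in>#R. r z * dt (R - {#r#}) (S - {z}))"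
proof (induction R arbitrary: S)
 case empty
 thus ?case by (auto simp: dt_empty)
next
 case (add r R)
 have rem: "add_mset r R - {#q#} = add_mset r (R - {#q#})" if "q \<in># R" for q
  using that by (metis add_mset_remove_trivial diff_union_swap2 diff_add_mset_swap insert_DiffM)
 have "dt (add_mset r R) S = r z * dt R (S - {z}) + (\<Sum>v\<in>S - {z}. r v * dt R (S - {v}))"
  using add.prems by (simp add: dt_add sum.remove)
 also have "(\<Sum>v\<in>S - {z}. r v * dt R (S - {v})) = (\<Sum>v\<in>S - {z}. \<Sum>q\<in>#R. q z * (r v * dt (R - {#q#}) (S - {z} - {v})))"
 proof (rule sum.cong)
  fix v assume v: "v \<in> S - {z}"
  have "S - {v} - {z} = S - {z} - {v}" by blast
  moreover have "dt R (S - {v}) = (\<Sum>q\<in>#R. q z * dt (R - {#q#}) (S - {v} - {z}))"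
   by (rule add.IH) (use add.prems v in auto)
  ultimately have "dt R (S - {v}) = (\<Sum>q\<in>#R. q z * dt (R - {#q#}) (S - {z} - {v}))"
   by simp
  hence "r v * dt R (S - {v}) = (\<Sum>q\<in>#R. r v * (q z * dt (R - {#q#}) (S - {z} - {v})))"
   by (simp only: sum_mset_distrib_left)
  also have "... = (\<Sum>q\<in>#R. q z * (r v * dt (R - {#q#}) (S - {z} - {v})))"
   by (rule sum_mset_cong) (rule mult.left_commute)
  finally show "r v * dt R (S - {v}) = (\<Sum>q\<in>#R. q z * (r v * dt (R - {#q#}) (S - {z} - {v})))" .
 qed simp
 also have "... = (\<Sum>q\<in>#R. \<Sum>v\<in>S - {z}. q z * (r v * dt (R - {#q#}) (S - {z} - {v})))"
  by (rule sum_mset_sum_swap[symmetric])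
 also have "... = (\<Sum>q\<in>#R. q z * dt (add_mset r R - {#q#}) (S - {z}))"
  by (rule sum_mset_cong) (use add.prems in \<open>simp add: rem dt_add sum_distrib_left\<close>)
 finally show ?case by simp
qed

text \<open>This is the column expansion of a matrix in which column \<open>w\<close> occurs
  twice.\<close>

lemma dt_equal_columns:
 "finite S ==> w \<in> S ==> (\<Sum>r\<in>#R. r w * dt (R - {#r#}) S) = 0"
proof (induction R arbitrary: S)
 case (add r R)
 have rem: "add_mset r R - {#q#} = add_mset r (R - {#q#})" if "q \<in># R" for q
  using that by (metis add_mset_remove_trivial diff_union_swap2 diff_add_mset_swap insert_DiffM)
 have "(\<Sum>q\<in>#R. q w * dt (add_mset r R - {#q#}) S) = (\<Sum>q\<in>#R. \<Sum>v\<in>S. r v * (q w * dt (R - {#q#}) (S - {v})))"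
  by (rule sum_mset_cong) (use add.prems in \<open>simp add: rem dt_add sum_distrib_left mult.left_commute\<close>)
 also have "... = (\<Sum>v\<in>S. \<Sum>q\<in>#R. r v * (q w * dt (R - {#q#}) (S - {v})))"
  by (rule sum_mset_sum_swap)
 also have "... = (\<Sum>v\<in>S. r v * (\<Sum>q\<in>#R. q w * dt (R - {#q#}) (S - {v})))"
  by (simp add: sum_mset_distrib_left)
 also have "... = r w * (\<Sum>q\<in>#R. q w * dt (R - {#q#}) (S - {w})) + (\<Sum>v\<in>S - {w}. r v * (\<Sum>q\<in>#R. q w * dt (R - {#q#}) (S - {v})))"
  using add.prems by (simp add: sum.remove)
 also have "(\<Sum>v\<in>S - {w}. r v * (\<Sum>q\<in>#R. q w * dt (R - {#q#}) (S - {v}))) = 0"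
 proof (rule sum.neutral, rule ballI)
  fix v assume "v \<in> S - {w}"
  hence "(\<Sum>q\<in>#R. q w * dt (R - {#q#}) (S - {v})) = 0" by (intro add.IH) (use add.prems in auto)
  thus "r v * (\<Sum>q\<in>#R. q w * dt (R - {#q#}) (S - {v})) = 0" by (simp only: mult_zero_right)
 qed
 also have "(\<Sum>q\<in>#R. q w * dt (R - {#q#}) (S - {w})) = dt R S"
  by (rule dt_column_expand[symmetric]) (use add.prems in auto)
 finally show ?case by simp
qed simp

text \<open>Cramer's rule: the adjugate times the matrix is the determinant times the
  identity.\<close>

lemma dt_kernel:
 assumes S: "finite S" "s \<in> S" and y: "\<And>r. r \<in># R ==> (\<Sum>w\<in>S. r w * y w) = 0"
 shows "dt R S * y s = 0"
proof -
 let ?c = "\<lambda>w. \<Sum>r\<in>#R. r w * dt (R - {#r#}) (S - {s})"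
 have c: "?c w = (if w = s then dt R S else 0)" if "w \<in> S" for w
  using that dt_column_expand[OF S, of R] dt_equal_columns[of "S - {s}" w R] S by auto
 have "dt R S * y s = (\<Sum>w\<in>S. (if w = s then dt R S else 0) * y w)"
  using S by (simp add: if_distrib[of "\<lambda>x. x * _"] cong: if_cong)
 also have "... = (\<Sum>w\<in>S. ?c w * y w)" by (rule sum.cong) (simp_all add: c)
 also have "... = (\<Sum>w\<in>S. \<Sum>r\<in>#R. dt (R - {#r#}) (S - {s}) * (r w * y w))"
  unfolding sum_mset_distrib_right by (intro sum.cong sum_mset_cong refl) (simp only: ac_simps)
 also have "... = (\<Sum>r\<in>#R. \<Sum>w\<in>S. dt (R - {#r#}) (S - {s}) * (r w * y w))"
  by (rule sum_mset_sum_swap[symmetric])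
 also have "... = (\<Sum>r\<in>#R. dt (R - {#r#}) (S - {s}) * 0)"
  by (rule sum_mset_cong) (simp add: y flip: sum_distrib_left)
 finally show ?thesis by simp
qed

definition cof :: "('a => 'k::char_two) multiset => 'a set => 'a => 'k" where
 "cof R T v = dt R (T - {v})"

lemma cof_orthogonal:
 assumes "finite T" "r \<in># R"
 shows "(\<Sum>v\<in>T. r v * cof R T v) = 0"
 using dt_dup[OF assms(2), of T] by (simp add: dt_add assms(1) cof_def)

definition minor :: "('a => 'k::char_two) multiset => 'a set => 'a => 'a => 'k" where
 "minor R T v u = (if v = u then 0 else dt R (T - {v} - {u}))"

lemma minor_sym: "minor R T v u = minor R T u v"
 by (simp add: minor_def Diff_insert2[symmetric] insert_commute)

lemma minor_orthogonal:
 assumes "finite T" "r \<in># R"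
 shows "(\<Sum>w\<in>T. r w * minor R T w y) = 0"
proof -
 have "(\<Sum>w\<in>T. r w * minor R T w y) = (\<Sum>w\<in>T - {y}. r w * cof R (T - {y}) w)"
 proof (rule sum.mono_neutral_cong_right)
  fix w assume "w \<in> T - {y}"
  hence "w \<noteq> y" "T - {w} - {y} = T - {y} - {w}" by blast+
  thus "r w * minor R T w y = r w * cof R (T - {y}) w" by (simp add: minor_def cof_def)
 qed (use assms in \<open>auto simp: minor_def\<close>)
 thus ?thesis using cof_orthogonal[OF _ assms(2), of "T - {y}"] assms(1) by simp
qed

text \<open>As a function of \<open>w\<close> the left side is orthogonal to all rows of
  \<open>R\<close> and vanishes at \<open>x\<close> and \<open>y\<close>. So it is a kernel vector
  of the matrix on the remaining columns, whose determinant is the nonzero minor.\<close>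

lemma pluecker:
 assumes T: "finite T" "x \<in> T" "y \<in> T" "w \<in> T" and nz: "minor R T x y \<noteq> 0"
 shows "minor R T x y * cof (add_mset r R) T w + minor R T w y * cof (add_mset r R) T x
   + minor R T w x * cof (add_mset r R) T y = 0"
proof -
 let ?X = "cof (add_mset r R) T" and ?M = "minor R T"
 let ?Y = "\<lambda>w. ?M x y * ?X w + ?M w y * ?X x + ?M w x * ?X y"
 have xy: "x \<noteq> y" using nz by (auto simp: minor_def)
 have Yx: "?Y x = 0" and Yy: "?Y y = 0" using minor_sym[of R T x y] by (simp_all add: minor_def)
 have orth: "(\<Sum>w\<in>T - {x} - {y}. q w * ?Y w) = 0" if q: "q \<in># R" for q
 proof -
  have "(\<Sum>w\<in>T - {x} - {y}. q w * ?Y w) = (\<Sum>w\<in>T. q w * ?Y w)"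
   by (rule sum.mono_neutral_left) (use T Yx Yy in auto)
  also have "... = ?M x y * (\<Sum>w\<in>T. q w * ?X w) + ?X x * (\<Sum>w\<in>T. q w * ?M w y) + ?X y * (\<Sum>w\<in>T. q w * ?M w x)"
   by (simp add: sum_distrib_left sum.distrib algebra_simps)
  also have "... = 0" using q by (simp add: cof_orthogonal[OF T(1)] minor_orthogonal[OF T(1)])
  finally show ?thesis .
 qed
 show ?thesis
 proof (cases "w = x \<or> w = y")
  case True
  thus ?thesis using Yx Yy by auto
 next
  case False
  have "dt R (T - {x} - {y}) * ?Y w = 0"
   by (rule dt_kernel) (use T False orth in auto)
  thus ?thesis using nz xy by (simp add: minor_def)
 qed
qed

text \<open>The relation is symmetric in \<open>x\<close>, \<open>y\<close> and \<open>w\<close>, so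
  any nonzero minor among the three may be used.\<close>

lemma pluecker':
 assumes T: "finite T" "x \<in> T" "y \<in> T" "w \<in> T"
 shows "minor R T x y * cof (add_mset r R) T w + minor R T w y * cof (add_mset r R) T x
   + minor R T w x * cof (add_mset r R) T y = 0"
proof -
 consider "minor R T x y \<noteq> 0" | "minor R T w y \<noteq> 0" | "minor R T w x \<noteq> 0"
  | "minor R T x y = 0" "minor R T w y = 0" "minor R T w x = 0" by blast
 thus ?thesis
 proof cases
  case 1
  thus ?thesis by (rule pluecker[OF T])
 next
  case 2
  from pluecker[OF T(1,4,3,2) 2, of r] show ?thesis
   by (simp only: minor_sym[of R T x w] minor_sym[of R T x y] ac_simps)
 next
  case 3
  from pluecker[OF T(1,4,2,3) 3, of r] show ?thesis
   by (simp only: minor_sym[of R T y w] minor_sym[of R T y x] ac_simps)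
 qed simp
qed

lemma sum_square: "finite E ==> (\<Sum>v\<in>E. n v) * (\<Sum>v\<in>E. n v) = (\<Sum>v\<in>E. n v * n v :: 'k::char_two)"
proof (induction E rule: finite_induct)
 case (insert v E)
 let ?s = "sum n E"
 have "(n v + ?s) * (n v + ?s) = n v * n v + ?s * ?s + (n v * ?s + n v * ?s)"
  by (simp only: algebra_simps)
 thus ?case using insert by simp
qed simp

lemma sum_const_odd: "finite E ==> odd (card E) ==> (\<Sum>v\<in>E. c) = (c :: 'k::char_two)"
proof -
 have "of_nat (2 * n + 1) * c = c" for n
  by (induction n) (simp_all add: algebra_simps)
 thus "finite E ==> odd (card E) ==> (\<Sum>v\<in>E. c) = c" by (auto elim!: oddE)
qed

text \<open>By the Pluecker relation the normalised minors \<open>N v u\<close> have the form \<open>N v x + N u x\<close>, and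
 then the off-diagonal sum of products vanishes because \<open>E\<close> is odd.\<close>

lemma pair_vanish:
 fixes R :: "('a => 'k::char_two) multiset"
 assumes T: "finite T" "E \<subseteq> T" "odd (card E)" "u \<in> T" "u' \<in> T"
  and X: "\<And>v. v \<in> T ==> cof (add_mset r R) T v \<noteq> 0"
 shows "(\<Sum>v\<in>E. \<Sum>v'\<in>E - {v}. minor R T v u * minor R T v' u' * (\<Prod>w\<in>E - {v} - {v'}. cof (add_mset r R) T w)) = 0"
proof -
 define X where "X = cof (add_mset r R) T"
 define N where "N v u = minor R T v u / (X v * X u)" for v u
 have X0: "X v \<noteq> 0" if "v \<in> T" for v using X[OF that] by (simp add: X_def)
 have fE: "finite E" using T finite_subset by blast
 obtain x where x: "x \<in> T" using T by blast
 have N: "N v u = N v x + N u x" if "v \<in> T" "u \<in> T" for v u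
 proof -
  have "minor R T v u * X x + minor R T x u * X v + minor R T x v * X u = 0"
   using pluecker'[OF T(1) that x, of R r] by (simp add: X_def)
  hence "(minor R T v u * X x + minor R T u x * X v + minor R T v x * X u) / (X v * X u * X x) = 0"
   by (simp only: minor_sym[of R T x] div_0)
  moreover have "N v u = minor R T v u * X x / (X v * X u * X x)" "N u x = minor R T u x * X v / (X v * X u * X x)"
   "N v x = minor R T v x * X u / (X v * X u * X x)"
   using X0[OF that(1)] X0[OF that(2)] X0[OF x] by (simp_all add: N_def)
  ultimately have "N v u + N u x + N v x = 0" by (simp only: add_divide_distrib)
  hence "N v u + (N v x + N u x) = 0" by (simp only: ac_simps)
  thus ?thesis by (simp only: char_two_eq_iff)
 qed
 let ?n = "\<lambda>v. N v x"
 let ?s = "\<Sum>v\<in>E. ?n v"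
 have sumN: "(\<Sum>v\<in>E. N v u) = ?s + ?n u" if "u \<in> T" for u
 proof -
  have "(\<Sum>v\<in>E. N v u) = (\<Sum>v\<in>E. ?n v + ?n u)" by (rule sum.cong) (use N that T in auto)
  thus ?thesis using sum_const_odd[OF fE T(3)] by (simp add: sum.distrib del: sum_constant)
 qed
 have "(\<Sum>v\<in>E. N v u * N v u') = (\<Sum>v\<in>E. ?n v * ?n v + (?n u + ?n u') * ?n v + ?n u * ?n u')"
  by (rule sum.cong) (use N T in \<open>auto simp: algebra_simps\<close>)
 also have "... = ?s * ?s + (?n u + ?n u') * ?s + ?n u * ?n u'"
  by (simp add: sum.distrib sum_square[OF fE] sum_const_odd[OF fE T(3)] del: sum_constant flip: sum_distrib_left)
 also have "... = (\<Sum>v\<in>E. N v u) * (\<Sum>v\<in>E. N v u')"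
  unfolding sumN[OF T(4)] sumN[OF T(5)] by (simp only: algebra_simps)
 also have "... = (\<Sum>v\<in>E. \<Sum>v'\<in>E. N v u * N v' u')" by (rule sum_product)
 also have "... = (\<Sum>v\<in>E. N v u * N v u' + (\<Sum>v'\<in>E - {v}. N v u * N v' u'))"
  by (intro sum.cong refl sum.remove fE)
 finally have z: "(\<Sum>v\<in>E. \<Sum>v'\<in>E - {v}. N v u * N v' u') = 0"
  by (simp add: sum.distrib)
 have "(\<Sum>v\<in>E. \<Sum>v'\<in>E - {v}. minor R T v u * minor R T v' u' * (\<Prod>w\<in>E - {v} - {v'}. X w))
   = (\<Sum>v\<in>E. \<Sum>v'\<in>E - {v}. (X u * X u' * (\<Prod>w\<in>E. X w)) * (N v u * N v' u'))"
 proof (intro sum.cong refl)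
  fix v v' assume v: "v \<in> E" "v' \<in> E - {v}"
  have "(\<Prod>w\<in>E. X w) = X v * (X v' * (\<Prod>w\<in>E - {v} - {v'}. X w))"
   using v fE by (simp add: prod.remove)
  thus "minor R T v u * minor R T v' u' * (\<Prod>w\<in>E - {v} - {v'}. X w)
    = (X u * X u' * (\<Prod>w\<in>E. X w)) * (N v u * N v' u')"
   using X0[of v] X0[of v'] X0[of u] X0[of u'] v T by (auto simp: N_def)
 qed
 also have "... = (X u * X u' * (\<Prod>w\<in>E. X w)) * (\<Sum>v\<in>E. \<Sum>v'\<in>E - {v}. N v u * N v' u')"
  by (simp only: sum_distrib_left)
 also have "... = 0" by (simp only: z mult_zero_right)
 finally show ?thesis unfolding X_def .
qed

subsection \<open>Derivations and maximal minors\<close>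

definition rows :: "(nat => 'a => 'k::char_two) => nat set => ('a => 'k::char_two) multiset" where
 "rows r I = image_mset r (mset_set I)"

lemma rows_insert: "finite I ==> i \<notin> I ==> rows r (insert i I) = add_mset (r i) (rows r I)"
 by (simp add: rows_def)

lemma rows_remove: "finite I ==> i \<in> I ==> rows r I = add_mset (r i) (rows r (I - {i}))"
 using rows_insert[of "I - {i}" i r] by (simp add: insert_absorb)

locale derivations =
 fixes D :: "nat => 'k::char_two => 'k"
 assumes D_add: "D i (x + y) = D i x + D i y"
  and D_mult: "D i (x * y) = D i x * y + x * D i y"
  and D_commute: "D i (D j x) = D j (D i x)"
begin

lemma D_0 [simp]: "D i 0 = 0"
 using D_add[of i 0 0] by simp

lemma D_1 [simp]: "D i 1 = 0"
 using D_mult[of i 1 1] by simp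

lemma D_square [simp]: "D i (x * x) = 0"
 by (simp add: D_mult mult.commute)

lemma D_const_mult: "D i c = 0 ==> D i (c * x) = c * D i x"
 by (simp add: D_mult)

lemma D_inverse: "D i c = 0 ==> D i (inverse c) = 0"
proof (cases "c = 0")
 case False
 assume "D i c = 0"
 hence "c * D i (inverse c) = D i (c * inverse c)" by (simp only: D_const_mult)
 also have "... = 0" using False by simp
 finally show ?thesis using False by simp
qed simp

lemma D_divide: "D i x = 0 ==> D i y = 0 ==> D i (x / y) = 0"
 by (simp add: divide_inverse D_mult D_inverse)

lemma D_sum: "D i (sum f A) = (\<Sum>x\<in>A. D i (f x))"
 by (induction A rule: infinite_finite_induct) (simp_all add: D_add)

lemma D_prod: "finite A ==> D i (prod f A) = (\<Sum>x\<in>A. D i (f x) * prod f (A - {x}))"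
proof (induction A rule: finite_induct)
 case (insert y A)
 have "(\<Sum>x\<in>A. D i (f x) * prod f (insert y A - {x})) = (\<Sum>x\<in>A. f y * (D i (f x) * prod f (A - {x})))"
 proof (rule sum.cong)
  fix x assume x: "x \<in> A"
  hence "insert y A - {x} = insert y (A - {x})" using insert by auto
  thus "D i (f x) * prod f (insert y A - {x}) = f y * (D i (f x) * prod f (A - {x}))"
   using insert by simp
 qed simp
 moreover have "insert y A - {y} = A" using insert by auto
 ultimately show ?case using insert by (simp add: D_mult add.commute flip: sum_distrib_left)
qed simp

lemma D_pow: "D i c = 0 ==> D i (c ^ n) = 0"
 by (induction n) (simp_all add: D_mult)

definition Dm :: "nat set => 'k => 'k" where
 "Dm I x = Finite_Set.fold D x I"

lemma comp_fun_commute_D: "comp_fun_commute D"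
 by standard (simp add: fun_eq_iff D_commute)

lemma Dm_empty [simp]: "Dm {} x = x"
 by (simp add: Dm_def)

lemma Dm_insert: "finite I ==> i \<notin> I ==> Dm (insert i I) x = D i (Dm I x)"
proof -
 interpret comp_fun_commute D by (rule comp_fun_commute_D)
 show "finite I ==> i \<notin> I ==> Dm (insert i I) x = D i (Dm I x)" unfolding Dm_def by (simp add: fold_insert)
qed

lemma Dm_insert2: "finite I ==> i \<notin> I ==> Dm (insert i I) x = Dm I (D i x)"
proof -
 interpret comp_fun_commute D by (rule comp_fun_commute_D)
 show "finite I ==> i \<notin> I ==> Dm (insert i I) x = Dm I (D i x)" unfolding Dm_def by (simp add: fold_insert2 del: fold_insert)
qed

lemma Dm_remove: "finite I ==> i \<in> I ==> Dm I x = Dm (I - {i}) (D i x)"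
 using Dm_insert2[of "I - {i}" i x] by (simp add: insert_absorb)

lemma Dm_0 [simp]: "finite I ==> Dm I 0 = 0"
 by (induction I rule: finite_induct) (simp_all add: Dm_insert)

lemma Dm_add: "finite I ==> Dm I (x + y) = Dm I x + Dm I y"
 by (induction I rule: finite_induct) (simp_all add: Dm_insert D_add)

lemma Dm_sum: "finite I ==> Dm I (sum f A) = (\<Sum>x\<in>A. Dm I (f x))"
 by (induction A rule: infinite_finite_induct) (simp_all add: Dm_add)

lemma Dm_const_mult: "finite I ==> (\<And>i. i \<in> I ==> D i c = 0) ==> Dm I (c * x) = c * Dm I x"
 by (induction I rule: finite_induct) (simp_all add: Dm_insert D_const_mult)

text \<open>The derivation moves only column \<open>j\<close>, with speed \<open>\<gamma> i\<close>
  in row \<open>i\<close>, so the result is the expansion along the column of speeds.\<close>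

lemma D_dt:
 assumes "finite I" "finite S" "\<And>i w. i \<in> I ==> w \<in> S ==> D k (r i w) = (if w = j then \<gamma> i else 0)"
 shows "D k (dt (rows r I) S) = (if j \<in> S then \<Sum>i\<in>I. \<gamma> i * dt (rows r (I - {i})) (S - {j}) else 0)"
 using assms
proof (induction I arbitrary: S rule: finite_induct)
 case empty
 thus ?case by (simp add: rows_def dt_empty)
next
 case (insert q I)
 have IH: "D k (dt (rows r I) (S - {v})) = (if j \<in> S - {v} then \<Sum>i\<in>I. \<gamma> i * dt (rows r (I - {i})) (S - {v} - {j}) else 0)" for v
  by (rule insert.IH) (use insert.prems in auto)
 have "D k (dt (rows r (insert q I)) S)
   = (\<Sum>v\<in>S. D k (r q v) * dt (rows r I) (S - {v})) + (\<Sum>v\<in>S. r q v * D k (dt (rows r I) (S - {v})))"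
  using insert by (simp add: rows_insert dt_add D_sum D_mult sum.distrib)
 also have "(\<Sum>v\<in>S. D k (r q v) * dt (rows r I) (S - {v})) = (\<Sum>v\<in>S. if v = j then \<gamma> q * dt (rows r I) (S - {j}) else 0)"
  by (rule sum.cong) (use insert.prems in auto)
 also have "... = (if j \<in> S then \<gamma> q * dt (rows r I) (S - {j}) else 0)"
  using insert.prems(1) by simp
 also have "(\<Sum>v\<in>S. r q v * D k (dt (rows r I) (S - {v})))
   = (if j \<in> S then \<Sum>i\<in>I. \<gamma> i * dt (rows r (insert q I - {i})) (S - {j}) else 0)"
 proof (cases "j \<in> S")
  case True
  have "(\<Sum>v\<in>S. r q v * D k (dt (rows r I) (S - {v})))
    = (\<Sum>v\<in>S - {j}. r q v * (\<Sum>i\<in>I. \<gamma> i * dt (rows r (I - {i})) (S - {j} - {v})))"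
  proof (rule sum.mono_neutral_cong_right)
   fix v assume v: "v \<in> S - {j}"
   have "S - {v} - {j} = S - {j} - {v}" by blast
   thus "r q v * D k (dt (rows r I) (S - {v})) = r q v * (\<Sum>i\<in>I. \<gamma> i * dt (rows r (I - {i})) (S - {j} - {v}))"
    using v True unfolding IH by auto
  qed (use insert.prems in \<open>auto simp: IH\<close>)
  also have "... = (\<Sum>v\<in>S - {j}. \<Sum>i\<in>I. \<gamma> i * (r q v * dt (rows r (I - {i})) (S - {j} - {v})))"
   by (simp add: sum_distrib_left mult.left_commute)
  also have "... = (\<Sum>i\<in>I. \<Sum>v\<in>S - {j}. \<gamma> i * (r q v * dt (rows r (I - {i})) (S - {j} - {v})))"
   by (rule sum.swap)
  also have "... = (\<Sum>i\<in>I. \<gamma> i * dt (rows r (insert q I - {i})) (S - {j}))"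
  proof (rule sum.cong)
   fix i assume i: "i \<in> I"
   hence "insert q I - {i} = insert q (I - {i})" using insert by auto
   thus "(\<Sum>v\<in>S - {j}. \<gamma> i * (r q v * dt (rows r (I - {i})) (S - {j} - {v}))) = \<gamma> i * dt (rows r (insert q I - {i})) (S - {j})"
    using insert by (simp add: rows_insert dt_add sum_distrib_left)
  qed simp
  finally show ?thesis using True by simp
 qed (simp add: IH)
 also have "(if j \<in> S then \<gamma> q * dt (rows r I) (S - {j}) else 0)
   + (if j \<in> S then \<Sum>i\<in>I. \<gamma> i * dt (rows r (insert q I - {i})) (S - {j}) else 0)
   = (if j \<in> S then \<Sum>i\<in>insert q I. \<gamma> i * dt (rows r (insert q I - {i})) (S - {j}) else 0)"
  using insert by simp
 finally show ?case .
qed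

lemma D_cof:
 assumes "finite I" "finite T" "j \<in> T" "\<And>i w. i \<in> I ==> w \<in> T ==> D k (r i w) = (if w = j then \<gamma> i else 0)"
 shows "D k (cof (rows r I) T v) = (\<Sum>i\<in>I. \<gamma> i * minor (rows r (I - {i})) T v j)"
proof -
 have "D k (cof (rows r I) T v) = (if j \<in> T - {v} then \<Sum>i\<in>I. \<gamma> i * dt (rows r (I - {i})) (T - {v} - {j}) else 0)"
  unfolding cof_def by (rule D_dt) (use assms in auto)
 thus ?thesis using assms(3) by (simp add: minor_def)
qed

text \<open>Applying \<open>D p\<close> gives one term for each row \<open>i\<close>, weighted by
  the constant \<open>\<beta> i\<close>, in which one cofactor has become a minor without row
  \<open>i\<close>. Applying \<open>D i\<close> turns a second cofactor into such a minor, and the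
  sum over the pairs vanishes by \<open>pair_vanish\<close>.\<close>

lemma Dm_kill:
 fixes r :: "nat => 'a => 'k"
 assumes I: "finite I" and T: "finite T" and J: "\<And>i. i \<in> I ==> J i \<in> T"
  and r: "\<And>k i w. k \<in> I ==> i \<in> I ==> w \<in> T ==> D k (r i w) = (if i = k \<and> w = J k then 1 else 0)"
  and X: "\<And>v. v \<in> T ==> cof (rows r I) T v \<noteq> 0"
  and E: "E \<subseteq> T" "odd (card E)"
  and p: "j \<in> T" "\<And>i w. i \<in> I ==> w \<in> T ==> D p (r i w) = (if w = j then \<beta> i else 0)"
  and \<beta>: "\<And>i k. i \<in> I ==> k \<in> I ==> D k (\<beta> i) = 0"
 shows "Dm I (D p (\<Prod>v\<in>E. cof (rows r I) T v)) = 0"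
proof -
 let ?X = "cof (rows r I) T"
 let ?M = "\<lambda>i. minor (rows r (I - {i})) T"
 let ?F = "\<lambda>i. \<Sum>v\<in>E. ?M i v j * prod ?X (E - {v})"
 have fE: "finite E" using E T finite_subset by blast
 have "D p (prod ?X E) = (\<Sum>v\<in>E. (\<Sum>i\<in>I. \<beta> i * ?M i v j) * prod ?X (E - {v}))"
  unfolding D_prod[OF fE] by (intro sum.cong refl arg_cong2[of _ _ _ _ "(*)"] D_cof I T p)
 also have "... = (\<Sum>v\<in>E. \<Sum>i\<in>I. \<beta> i * (?M i v j * prod ?X (E - {v})))"
  by (simp add: sum_distrib_right mult.assoc)
 also have "... = (\<Sum>i\<in>I. \<beta> i * ?F i)"
  unfolding sum_distrib_left by (rule sum.swap)
 finally have DP: "D p (prod ?X E) = (\<Sum>i\<in>I. \<beta> i * ?F i)" .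
 have "Dm I (\<beta> i * ?F i) = 0" if i: "i \<in> I" for i
 proof -
  have DX: "D i (?X v) = ?M i v (J i)" for v
  proof -
   have "D i (?X v) = (\<Sum>q\<in>I. (if q = i then 1 else 0) * minor (rows r (I - {q})) T v (J i))"
    by (rule D_cof) (use I T J i r in auto)
   also have "... = (\<Sum>q\<in>I. if q = i then ?M i v (J i) else 0)" by (rule sum.cong) auto
   finally show ?thesis using i I by simp
  qed
  have DM: "D i (?M i v u) = 0" for v u
  proof (cases "v = u")
   case False
   have "D i (dt (rows r (I - {i})) (T - {v} - {u}))
     = (if J i \<in> T - {v} - {u} then \<Sum>q\<in>I - {i}. 0 * dt (rows r (I - {i} - {q})) (T - {v} - {u} - {J i}) else 0)"
    by (rule D_dt) (use I T r i in auto)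
   thus ?thesis using False by (simp add: minor_def)
  qed (simp add: minor_def)
  have X': "cof (add_mset (r i) (rows r (I - {i}))) T = ?X"
   by (simp only: rows_remove[OF I i, symmetric])
  have "D i (?F i) = (\<Sum>v\<in>E. ?M i v j * D i (prod ?X (E - {v})))"
   by (simp only: D_sum D_const_mult[OF DM])
  also have "... = (\<Sum>v\<in>E. \<Sum>v'\<in>E - {v}. ?M i v j * ?M i v' (J i) * prod ?X (E - {v} - {v'}))"
  proof (rule sum.cong)
   fix v
   have "D i (prod ?X (E - {v})) = (\<Sum>v'\<in>E - {v}. ?M i v' (J i) * prod ?X (E - {v} - {v'}))"
    using fE by (simp only: D_prod[of "E - {v}"] finite_Diff DX)
   thus "?M i v j * D i (prod ?X (E - {v})) = (\<Sum>v'\<in>E - {v}. ?M i v j * ?M i v' (J i) * prod ?X (E - {v} - {v'}))"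
    by (simp only: sum_distrib_left mult.assoc)
  qed simp
  also have "... = 0"
   using pair_vanish[OF T E p(1) J[OF i], of "r i" "rows r (I - {i})"] X unfolding X' by blast
  finally have z: "D i (?F i) = 0" .
  have "Dm I (\<beta> i * ?F i) = \<beta> i * Dm I (?F i)"
   by (rule Dm_const_mult[OF I]) (use \<beta> i in auto)
  also have "Dm I (?F i) = Dm (I - {i}) (D i (?F i))" by (rule Dm_remove[OF I i])
  finally show ?thesis using I z by simp
 qed
 thus ?thesis unfolding DP Dm_sum[OF I] by (simp add: sum.neutral)
qed

end

lemma dt_row_ops:
 assumes "finite S"
 shows "dt (add_mset p (image_mset (\<lambda>q v. q v + c q * p v) R + R')) S = dt (add_mset p (R + R')) S"
proof (induction R arbitrary: R')
 case (add q R)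
 let ?f = "\<lambda>q v. q v + c q * p v"
 have "dt (add_mset p (image_mset ?f (add_mset q R) + R')) S = dt (add_mset (?f q) (add_mset p (image_mset ?f R + R'))) S"
  by (simp add: add_mset_commute)
 also have "... = dt (add_mset q (add_mset p (image_mset ?f R + R'))) S"
  by (rule dt_row_op[OF assms]) simp
 also have "... = dt (add_mset p (image_mset ?f R + add_mset q R')) S"
  by (simp add: add_mset_commute)
 also have "... = dt (add_mset p (R + add_mset q R')) S" by (rule add)
 finally show ?case by simp
qed simp

definition fib :: "(nat => 'a) => nat set => 'a => nat" where
 "fib J I v = card {i \<in> I. J i = v}"

lemma fib_remove:
 assumes "finite I" "i \<in> I"
 shows "fib J I v = fib J (I - {i}) v + (if v = J i then 1 else 0)"
proof -
 have "{q \<in> I. J q = v} = (if v = J i then insert i {q \<in> I - {i}. J q = v} else {q \<in> I - {i}. J q = v})"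
  using assms(2) by auto
 thus ?thesis using assms(1) by (simp add: fib_def)
qed

lemma sum_fib: "finite I ==> finite T ==> J ` I \<subseteq> T ==> (\<Sum>v\<in>T. fib J I v) = card I"
 using sum_fun_comp[of I T J "\<lambda>_. 1 :: nat"] by (simp add: fib_def)

text \<open>Parity bookkeeping for the power of the pivot in
  \<open>simplex_identity\<close>.\<close>

lemma sum_half_fib:
 assumes "finite I" "finite T" "J ` I \<subseteq> T" "E = {v \<in> T. even (fib J I v)}"
 shows "2 * (\<Sum>v\<in>T. fib J I v div 2) + card T = card I + card E"
proof -
 have "fib J I v + (if even (fib J I v) then 1 else 0) = 2 * (fib J I v div 2) + 1" for v by auto
 hence "(\<Sum>v\<in>T. fib J I v + (if even (fib J I v) then 1 else 0)) = (\<Sum>v\<in>T. 2 * (fib J I v div 2) + 1)" by simp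
 hence "(\<Sum>v\<in>T. fib J I v) + (\<Sum>v\<in>T. if even (fib J I v) then 1 else 0) = 2 * (\<Sum>v\<in>T. fib J I v div 2) + card T"
  by (simp only: sum.distrib sum_distrib_left) simp
 moreover have "(\<Sum>v\<in>T. if even (fib J I v) then 1 else 0) = card E"
  using assms by (simp add: sum.If_cases Int_def)
 ultimately show ?thesis using sum_fib[OF assms(1-3)] by simp
qed

context derivations
begin

lemma Dm_square: "finite I ==> Dm I (c * c * x) = c * c * Dm I x"
 by (rule Dm_const_mult) simp_all

text \<open>Gaussian elimination of column \<open>z\<close> with the pivot
  \<open>r p z\<close>.\<close>

lemma cof_pivot:
 fixes r :: "nat => 'a => 'k"
 assumes I: "finite I" "p \<in> I" and T: "finite T" "z \<in> T" and nz: "r p z \<noteq> 0"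
 defines "r' \<equiv> \<lambda>i v. r i v + r i z / r p z * r p v"
 shows "v \<in> T - {z} ==> cof (rows r I) T v = r p z * cof (rows r' (I - {p})) (T - {z}) v"
  and "cof (rows r I) T z = (\<Sum>u\<in>T - {z}. r p u * cof (rows r' (I - {p})) (T - {z}) u)"
proof -
 have ops: "dt (rows r I) S = dt (add_mset (r p) (rows r' (I - {p}))) S" if "finite S" for S
  using dt_row_ops[OF that, of "r p" "\<lambda>q. q z / r p z" "rows r (I - {p})" "{#}"]
  unfolding rows_remove[OF I] by (simp add: rows_def r'_def multiset.map_comp comp_def)
 have z0: "r' i z = 0" for i using nz by (simp add: r'_def)
 show "cof (rows r I) T v = r p z * cof (rows r' (I - {p})) (T - {z}) v" if v: "v \<in> T - {z}"
 proof -
  have "dt (rows r' (I - {p})) (T - {v} - {u}) = 0" if "u \<in> T - {v} - {z}" for u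
   by (rule dt_zero_column[where z = z]) (use T v that z0 in \<open>auto simp: rows_def\<close>)
  hence zz: "(\<Sum>u\<in>T - {v} - {z}. r p u * dt (rows r' (I - {p})) (T - {v} - {u})) = 0"
   by (intro sum.neutral) simp
  have "cof (rows r I) T v = (\<Sum>u\<in>T - {v}. r p u * dt (rows r' (I - {p})) (T - {v} - {u}))"
   using T by (simp add: cof_def ops dt_add)
  also have "... = r p z * dt (rows r' (I - {p})) (T - {v} - {z})
    + (\<Sum>u\<in>T - {v} - {z}. r p u * dt (rows r' (I - {p})) (T - {v} - {u}))"
   by (rule sum.remove) (use T v in auto)
  also have "T - {v} - {z} = T - {z} - {v}" by blast
  finally show ?thesis unfolding cof_def using zz by (simp add: Diff_insert2[symmetric] insert_commute)
 qed
 show "cof (rows r I) T z = (\<Sum>u\<in>T - {z}. r p u * cof (rows r' (I - {p})) (T - {z}) u)"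
  using T by (simp add: cof_def ops dt_add)
qed

text \<open>\<open>J\<close> prescribes one column for each row, and differentiating by these
  entries turns a product of an odd number of maximal minors into a square or into zero, depending
  on the parities of the fibres of \<open>J\<close>. The induction eliminates a column that
  \<open>J\<close> misses together with a pivot row.\<close>

lemma simplex_identity:
 fixes r :: "nat => 'a => 'k"
 assumes I: "finite I" and T: "finite T" "card T = card I + 1" and J: "\<And>i. i \<in> I ==> J i \<in> T"
  and r: "\<And>k i w. k \<in> I ==> i \<in> I ==> w \<in> T ==> D k (r i w) = (if i = k \<and> w = J k then 1 else 0)"
  and X: "\<And>v. v \<in> T ==> cof (rows r I) T v \<noteq> 0"
  and E: "E \<subseteq> T" "odd (card E)"
 shows "Dm I (\<Prod>v\<in>E. cof (rows r I) T v)
  = (if E = {v \<in> T. even (fib J I v)} then (\<Prod>v\<in>T. cof (rows r I) T v ^ (fib J I v div 2))\<^sup>2 else 0)"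
 using assms
proof (induction "card I" arbitrary: I T r E)
 case 0
 hence [simp]: "I = {}" by simp
 obtain x where T: "T = {x}" using "0.prems"(3) by (auto simp: card_Suc_eq)
 hence "E = T" using "0.prems"(7,8) by (auto simp: subset_singleton_iff)
 thus ?case using T by (simp add: fib_def cof_def rows_def dt_empty)
next
 case (Suc n)
 note I = Suc.prems(1) and T = Suc.prems(2,3) and J = Suc.prems(4) and r = Suc.prems(5) and X = Suc.prems(6) and E = Suc.prems(7,8)
 have JI: "J ` I \<subseteq> T" using J by auto
 \<comment> \<open>There is one more column than rows, so \<open>J\<close> misses a column; its
   entries are constants for all derivations involved.\<close>
 obtain z where z: "z \<in> T" "fib J I z = 0"
 proof (rule ccontr)
  assume "\<not> thesis"
  hence "1 \<le> fib J I v" if "v \<in> T" for v using that \<open>\<And>z. z \<in> T ==> fib J I z = 0 ==> thesis\<close> by (meson not_less_eq_eq le_zero_eq One_nat_def not_le less_one)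
  hence "(\<Sum>v\<in>T. 1) \<le> (\<Sum>v\<in>T. fib J I v)" by (intro sum_mono) auto
  thus False using sum_fib[OF I T(1) JI] T by simp
 qed
 have Jz: "J i \<noteq> z" if "i \<in> I" for i
  using z(2) that I by (auto simp: fib_def)
 obtain v0 where v0: "v0 \<in> T - {z}"
 proof -
  have "card (T - {z}) \<noteq> 0" using T z Suc.hyps(2) by simp
  thus ?thesis using that by (metis card.empty all_not_in_conv)
 qed
 obtain p where p: "p \<in> I" "r p z \<noteq> 0"
 proof (rule ccontr)
  assume np: "\<not> thesis"
  have "r i z = 0" if "i \<in> I" for i using np that \<open>\<And>p. p \<in> I ==> r p z \<noteq> 0 ==> thesis\<close> by blast
  hence "dt (rows r I) (T - {v0}) = 0"
   by (intro dt_zero_column[where z = z]) (use I T v0 z in \<open>auto simp: rows_def\<close>)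
  thus False using X[of v0] v0 by (simp add: cof_def)
 qed
 define \<alpha> where "\<alpha> = r p z"
 define I' where "I' = I - {p}"
 define T' where "T' = T - {z}"
 define r' where "r' = (\<lambda>i v. r i v + r i z / r p z * r p v)"
 define X' where "X' = cof (rows r' I') T'"
 define E1 where "E1 = E - {z}"
 have I': "finite I'" "n = card I'" "I = insert p I'" "p \<notin> I'" using I p Suc.hyps(2) by (auto simp: I'_def)
 have T': "finite T'" "card T' = card I' + 1" using T z I' by (auto simp: T'_def)
 have J': "J i \<in> T'" if "i \<in> I" for i using J[OF that] Jz[OF that] by (simp add: T'_def)
 have \<alpha>: "\<alpha> \<noteq> 0" "D k \<alpha> = 0" if "k \<in> I" for k
  using p r[OF that p(1) z(1)] Jz[OF that] by (auto simp: \<alpha>_def)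
 have \<beta>: "D k (r i z / \<alpha>) = 0" if "k \<in> I" "i \<in> I" for k i
  using \<alpha>(2)[OF that(1)] r[OF that z(1)] Jz[OF that(1)] by (intro D_divide) auto
 have Dr': "D k (r' i w) = D k (r i w) + r i z / \<alpha> * D k (r p w)" if "k \<in> I" "i \<in> I" for k i w
  unfolding r'_def \<alpha>_def[symmetric] by (simp only: D_add D_const_mult[OF \<beta>[OF that]])
 have r': "D k (r' i w) = (if i = k \<and> w = J k then 1 else 0)" if "k \<in> I'" "i \<in> I'" "w \<in> T'" for k i w
 proof -
  have "k \<in> I" "i \<in> I" "w \<in> T" "p \<noteq> k" using that I' by (auto simp: T'_def)
  thus ?thesis using r p by (simp add: Dr')
 qed
 have r'p: "D p (r' i w) = (if w = J p then r i z / \<alpha> else 0)" if "i \<in> I'" "w \<in> T'" for i w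
 proof -
  have "i \<in> I" "w \<in> T" "i \<noteq> p" using that I' by (auto simp: T'_def)
  thus ?thesis using r p by (simp add: Dr')
 qed
 have Xv: "cof (rows r I) T v = \<alpha> * X' v" if "v \<in> T'" for v
  unfolding \<alpha>_def X'_def I'_def T'_def r'_def
  by (rule cof_pivot(1)[of I p T z r, OF I p(1) T(1) z(1) p(2)]) (use that in \<open>simp add: T'_def\<close>)
 have Xz: "cof (rows r I) T z = (\<Sum>u\<in>T'. r p u * X' u)"
  unfolding \<alpha>_def X'_def I'_def T'_def r'_def by (rule cof_pivot(2)[of I p T z r, OF I p(1) T(1) z(1) p(2)])
 have X'0: "X' v \<noteq> 0" if "v \<in> T'" for v
  using X[of v] Xv[OF that] that by (auto simp: T'_def)
 have kill: "Dm I' (D p (prod X' A)) = 0" if "A \<subseteq> T'" "odd (card A)" for A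
  unfolding X'_def
 proof (rule Dm_kill[where J = J and j = "J p" and \<beta> = "\<lambda>i. r i z / \<alpha>"])
  show "J p \<in> T'" by (rule J'[OF p(1)])
  show "D k (r i z / \<alpha>) = 0" if "i \<in> I'" "k \<in> I'" for i k using \<beta> that I' by simp
  show "cof (rows r' I') T' v \<noteq> 0" if "v \<in> T'" for v using X'0[OF that] by (simp add: X'_def)
 qed (use I' T' J' r' r'p that in simp_all)
 have E1: "E1 \<subseteq> T'" "finite E1" using E T finite_subset[of E T] by (auto simp: E1_def T'_def)
 have scale: "Dm I (\<alpha> ^ m * x) = \<alpha> ^ m * Dm I x" for m x
  by (rule Dm_const_mult[OF I]) (use \<alpha> in \<open>auto intro: D_pow\<close>)
 have DmI: "Dm I x = Dm I' (D p x)" for x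
  unfolding I'(3) by (rule Dm_insert2[OF I'(1,4)])
 have scale': "Dm I' (D p (\<alpha> ^ m * x)) = \<alpha> ^ m * Dm I' (D p x)" for m x
  using scale[of m x] by (simp only: DmI)
 have PE: "(\<Prod>v\<in>E1. cof (rows r I) T v) = \<alpha> ^ card E1 * prod X' E1"
  using E1 by (simp add: Xv subset_iff prod.distrib)
 show ?case
 proof (cases "z \<in> E")
  \<comment> \<open>Without \<open>z\<close> the product is a power of the pivot times reduced
    minors over an odd set, so \<open>kill\<close> applies.\<close>
  case False
  hence [simp]: "E1 = E" by (auto simp: E1_def)
  have "Dm I (\<Prod>v\<in>E. cof (rows r I) T v) = \<alpha> ^ card E * Dm I' (D p (prod X' E))"
   using PE by (simp add: scale' DmI)
  also have "... = 0" using kill[of E] E E1 by simp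
  finally show ?thesis using False z by auto
 next
  case True
  have cE: "card E = Suc (card E1)" "even (card E1)" using True E E1 finite_subset[OF E(1) T(1)]
   by (auto simp: E1_def)
  have E1z: "z \<notin> E1" "E = insert z E1" using True by (auto simp: E1_def)
  let ?j = "J p"
  have j: "?j \<in> T'" by (rule J'[OF p(1)])
  \<comment> \<open>Whether or not \<open>u\<close> lies in \<open>E1\<close>, what remains after
    removing a square is a product over an odd set. So only the derivative of the coefficient
    \<open>r p u\<close> can survive.\<close>
  have term0: "Dm I' (D p (X' u * prod X' E1)) = 0" if u: "u \<in> T'" for u
  proof (cases "u \<in> E1")
   case True
   have "X' u * prod X' E1 = X' u * X' u * prod X' (E1 - {u})"
    unfolding mult.assoc using True E1 by (subst prod.remove[of E1 u]) simp_all
   hence "Dm I' (D p (X' u * prod X' E1)) = X' u * X' u * Dm I' (D p (prod X' (E1 - {u})))"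
    by (simp only: Dm_square[OF I'(1)] D_const_mult[OF D_square])
   also have "... = 0" using kill[of "E1 - {u}"] E1 True cE(2) card_gt_0_iff[of E1] by auto
   finally show ?thesis .
  next
   case False
   hence "X' u * prod X' E1 = prod X' (insert u E1)" using E1 by simp
   thus ?thesis using kill[of "insert u E1"] False E1 u cE(2) by simp
  qed
  have "(\<Prod>v\<in>E. cof (rows r I) T v) = \<alpha> ^ card E1 * (\<Sum>u\<in>T'. r p u * (X' u * prod X' E1))"
   using E1z E1 PE Xz by (simp add: sum_distrib_left sum_distrib_right mult_ac)
  hence "Dm I (\<Prod>v\<in>E. cof (rows r I) T v)
    = \<alpha> ^ card E1 * (\<Sum>u\<in>T'. Dm I' (D p (r p u * (X' u * prod X' E1))))"
   by (simp only: scale' DmI D_sum Dm_sum[OF I'(1)])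
  also have "(\<Sum>u\<in>T'. Dm I' (D p (r p u * (X' u * prod X' E1)))) = (\<Sum>u\<in>T'. if u = ?j then Dm I' (X' u * prod X' E1) else 0)"
  proof (rule sum.cong)
   fix u assume u: "u \<in> T'"
   hence uT: "u \<in> T" by (simp add: T'_def)
   have "Dm I' (r p u * D p (X' u * prod X' E1)) = r p u * Dm I' (D p (X' u * prod X' E1))"
    by (rule Dm_const_mult[OF I'(1)]) (use r[OF _ p(1) uT] I' in auto)
   hence "Dm I' (D p (r p u * (X' u * prod X' E1))) = Dm I' (D p (r p u) * (X' u * prod X' E1))"
    using term0[OF u] by (simp only: D_mult Dm_add[OF I'(1)] mult_zero_right add_0_right)
   thus "Dm I' (D p (r p u * (X' u * prod X' E1))) = (if u = ?j then Dm I' (X' u * prod X' E1) else 0)"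
    using r[OF p(1) p(1) uT] I' by simp
  qed simp
  also have "... = Dm I' (X' ?j * prod X' E1)" using j T' by simp
  finally have red: "Dm I (\<Prod>v\<in>E. cof (rows r I) T v) = \<alpha> ^ card E1 * Dm I' (X' ?j * prod X' E1)" .
  \<comment> \<open>The surviving term carries the extra minor at \<open>J p\<close>; it adds
    \<open>J p\<close> to \<open>E1\<close> or removes it, up to the square of
    \<open>c\<close>.\<close>
  define E' where "E' = (if ?j \<in> E1 then E1 - {?j} else insert ?j E1)"
  define c where "c = (if ?j \<in> E1 then X' ?j else 1)"
  have "X' ?j * prod X' E1 = c * c * prod X' E'"
   using E1 prod.remove[of E1 ?j X'] by (simp add: c_def E'_def mult.assoc)
  hence red2: "Dm I' (X' ?j * prod X' E1) = c * c * Dm I' (prod X' E')"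
   by (simp only: Dm_square[OF I'(1)])
  have E': "E' \<subseteq> T'" "odd (card E')"
   using E1 j cE(2) card_gt_0_iff[of E1] by (auto simp: E'_def)
  have IH: "Dm I' (prod X' E')
   = (if E' = {v \<in> T'. even (fib J I' v)} then (\<Prod>v\<in>T'. X' v ^ (fib J I' v div 2))\<^sup>2 else 0)"
   unfolding X'_def
   by (rule Suc.hyps(1)) (use I' T' J' r' X'0 E' in \<open>simp_all add: X'_def\<close>)
  have fib: "fib J I v = fib J I' v + (if v = ?j then 1 else 0)" for v
   unfolding I'_def by (rule fib_remove[OF I p(1)])
  have iff: "E' = {v \<in> T'. even (fib J I' v)} \<longleftrightarrow> E = {v \<in> T. even (fib J I v)}"
  proof -
   have mE': "v \<in> E' \<longleftrightarrow> (v \<in> E \<longleftrightarrow> v \<noteq> ?j)" if "v \<in> T'" for v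
    using that by (auto simp: E'_def E1_def T'_def)
   have mE: "(v \<in> E \<longleftrightarrow> even (fib J I v)) \<longleftrightarrow> (v \<in> E' \<longleftrightarrow> even (fib J I' v))" if "v \<in> T'" for v
    using mE'[OF that] by (auto simp: fib)
   have "E' = {v \<in> T'. even (fib J I' v)} \<longleftrightarrow> (\<forall>v\<in>T'. v \<in> E' \<longleftrightarrow> even (fib J I' v))"
    using E'(1) by blast
   also have "... \<longleftrightarrow> (\<forall>v\<in>T'. v \<in> E \<longleftrightarrow> even (fib J I v))" using mE by blast
   also have "... \<longleftrightarrow> (\<forall>v\<in>T. v \<in> E \<longleftrightarrow> even (fib J I v))"
    using True z unfolding T'_def by (metis DiffI singletonD DiffD1 even_zero)
   also have "... \<longleftrightarrow> E = {v \<in> T. even (fib J I v)}"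
    using E(1) by blast
   finally show ?thesis .
  qed
  show ?thesis
  proof (cases "E = {v \<in> T. even (fib J I v)}")
   case F: False
   thus ?thesis using red red2 IH iff by simp
  next
   case T1: True
   let ?P = "\<lambda>v. X' v ^ (fib J I v div 2)"
   have cP: "c * (\<Prod>v\<in>T'. X' v ^ (fib J I' v div 2)) = (\<Prod>v\<in>T'. ?P v)"
   proof -
    have "(\<Prod>v\<in>T'. X' v ^ (fib J I' v div 2)) = X' ?j ^ (fib J I' ?j div 2) * (\<Prod>v\<in>T' - {?j}. ?P v)"
     unfolding prod.remove[OF T'(1) j] by (intro arg_cong2[of _ _ _ _ "(*)"] prod.cong refl) (simp add: fib)
    moreover have "c * X' ?j ^ (fib J I' ?j div 2) = ?P ?j"
    proof (cases "?j \<in> E1")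
     case True
     hence "even (fib J I ?j)" using T1 by (simp add: E1_def)
     hence "fib J I ?j div 2 = Suc (fib J I' ?j div 2)" by (simp add: fib)
     thus ?thesis using True by (simp add: c_def)
    next
     case False
     hence "odd (fib J I ?j)" using T1 j by (auto simp: E1_def T'_def)
     hence "fib J I ?j div 2 = fib J I' ?j div 2" by (simp add: fib)
     thus ?thesis using False by (simp add: c_def)
    qed
    ultimately show ?thesis
     unfolding prod.remove[OF T'(1) j, of "\<lambda>v. ?P v"] by (simp only: mult.assoc[symmetric])
   qed
   let ?s = "\<Sum>v\<in>T. fib J I v div 2"
   \<comment> \<open>This count makes the exponent of the pivot on the left exactly twice the
     exponent inside the square on the right.\<close>
   have "2 * ?s + card T = card I + card E" by (rule sum_half_fib[OF I T(1) JI T1])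
   hence s: "card E1 = 2 * ?s" using T cE by simp
   have s': "(\<Sum>v\<in>T'. fib J I v div 2) = ?s"
    unfolding T'_def using T z by (simp add: sum.remove)
   have "(\<Prod>v\<in>T. cof (rows r I) T v ^ (fib J I v div 2)) = (\<Prod>v\<in>T'. cof (rows r I) T v ^ (fib J I v div 2))"
    unfolding T'_def using T z by (simp add: prod.remove)
   also have "... = (\<Prod>v\<in>T'. \<alpha> ^ (fib J I v div 2) * ?P v)"
    by (rule prod.cong) (simp_all add: Xv power_mult_distrib)
   also have "... = \<alpha> ^ ?s * (\<Prod>v\<in>T'. ?P v)"
    by (simp add: prod.distrib power_sum s'[symmetric])
   finally have R: "(\<Prod>v\<in>T. cof (rows r I) T v ^ (fib J I v div 2)) = \<alpha> ^ ?s * (\<Prod>v\<in>T'. ?P v)" .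
   have "Dm I (\<Prod>v\<in>E. cof (rows r I) T v) = \<alpha> ^ card E1 * (c * c * (\<Prod>v\<in>T'. X' v ^ (fib J I' v div 2))\<^sup>2)"
    using red red2 IH iff T1 by simp
   also have "... = (\<alpha> ^ ?s)\<^sup>2 * (c * (\<Prod>v\<in>T'. X' v ^ (fib J I' v div 2)))\<^sup>2"
    by (simp add: s power_mult[symmetric] mult.commute[of 2] power_mult_distrib power2_eq_square[of c])
   finally show ?thesis unfolding cP R using T1 by (simp add: power_mult_distrib)
  qed
 qed
qed

end

subsection \<open>The volume form\<close>

lemma sum_mset_rows:
 assumes "finite I"
 shows "(\<Sum>q\<in>#rows r I. q z * dt (rows r I - {#q#}) S) = (\<Sum>i\<in>I. r i z * dt (rows r (I - {i})) S)"
proof -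
 have "(\<Sum>q\<in>#rows r I. q z * dt (rows r I - {#q#}) S) = (\<Sum>i\<in>I. r i z * dt (rows r I - {#r i#}) S)"
  by (simp add: rows_def sum_unfold_sum_mset multiset.map_comp comp_def)
 also have "... = (\<Sum>i\<in>I. r i z * dt (rows r (I - {i})) S)"
  by (rule sum.cong) (simp_all add: rows_remove[OF assms])
 finally show ?thesis .
qed

lemma nondeg_dt:
 assumes S: "finite S" "card S = s" and nz: "dt (rows a {..<s}) S \<noteq> 0"
 shows "nondeg a S (\<lambda>v q. dt (rows a ({..<s} - {q})) (S - {v}) / dt (rows a {..<s}) S)"
 unfolding nondeg_def S(2)
proof (intro conjI allI ballI impI)
 let ?R = "rows a {..<s}" and ?d = "\<lambda>v q. dt (rows a ({..<s} - {q})) (S - {v})"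
 fix r q assume rq: "r < s" "q < s"
 have "(\<Sum>v\<in>S. a r v * (?d v q / dt ?R S)) = (\<Sum>v\<in>S. a r v * ?d v q) / dt ?R S"
  by (simp add: sum_divide_distrib)
 also have "(\<Sum>v\<in>S. a r v * ?d v q) = dt (add_mset (a r) (rows a ({..<s} - {q}))) S"
  by (simp add: dt_add S)
 also have "... = (if r = q then dt ?R S else 0)"
 proof (cases "r = q")
  case True
  thus ?thesis using rows_remove[of "{..<s}" q a] rq by simp
 next
  case False
  hence "a r \<in># rows a ({..<s} - {q})" using rq by (simp add: rows_def)
  from dt_dup[OF this] show ?thesis using False by simp
 qed
 finally show "(\<Sum>v\<in>S. a r v * (?d v q / dt ?R S)) = (if r = q then 1 else 0)" using nz by simp
next
 let ?R = "rows a {..<s}" and ?d = "\<lambda>v q. dt (rows a ({..<s} - {q})) (S - {v})"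
 fix v u assume vu: "v \<in> S" "u \<in> S"
 have "(\<Sum>q<s. ?d v q / dt ?R S * a q u) = (\<Sum>q<s. a q u * ?d v q) / dt ?R S"
  by (simp add: sum_divide_distrib mult.commute)
 also have "(\<Sum>q<s. a q u * ?d v q) = (if v = u then dt ?R S else 0)"
 proof (cases "v = u")
  case True
  thus ?thesis using dt_column_expand[OF S(1) vu(2), of ?R] by (simp add: sum_mset_rows)
 next
  case False
  thus ?thesis using dt_equal_columns[of "S - {v}" u ?R] S vu by (simp add: sum_mset_rows)
 qed
 finally show "(\<Sum>q<s. ?d v q / dt ?R S * a q u) = (if v = u then 1 else 0)" using nz by simp
qed

text \<open>The degree map of the boundary of the simplex on \<open>T\<close>. With \<open>d\<close>
  rows and \<open>d + 1\<close> columns the cofactors form a kernel vector; a monomial is evaluated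
  there and normalised so that the facet without \<open>v\<close> gets the reciprocal of the
  cofactor at \<open>v\<close>.\<close>

definition simplex_vol :: "('b => 'k::char_two) multiset => 'b set => 'b multiset => 'k" where
 "simplex_vol R T m =
  (if set_mset m \<subseteq> T \<and> size m = size R
   then (\<Prod>v\<in>T. cof R T v ^ count m v) / (\<Prod>v\<in>T. cof R T v) else 0)"

text \<open>Up to a constant, \<open>simplex_vol\<close> evaluates monomials at the cofactor vector,
  which every row annihilates.\<close>

lemma simplex_vol_relation:
 assumes T: "finite T" "T \<subseteq> U" "finite U" and q: "q \<in># R"
 shows "(\<Sum>w\<in>U. q w * simplex_vol R T (add_mset w n)) = 0"
proof (cases "set_mset n \<subseteq> T \<and> Suc (size n) = size R")
 case False
 thus ?thesis by (intro sum.neutral) (auto simp: simplex_vol_def)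
next
 case True
 let ?X = "cof R T" and ?c = "(\<Prod>v\<in>T. cof R T v ^ count n v) / (\<Prod>v\<in>T. cof R T v)"
 have "(\<Sum>w\<in>U. q w * simplex_vol R T (add_mset w n)) = (\<Sum>w\<in>T. ?c * (q w * ?X w))"
 proof (rule sum.mono_neutral_cong_right)
  fix w assume w: "w \<in> T"
  have "(\<Prod>v\<in>T. ?X v ^ count (add_mset w n) v) = (\<Prod>v\<in>T. (if v = w then ?X w else 1) * ?X v ^ count n v)"
   by (rule prod.cong) auto
  also have "... = ?X w * (\<Prod>v\<in>T. ?X v ^ count n v)"
   using T w by (simp add: prod.distrib)
  finally show "q w * simplex_vol R T (add_mset w n) = ?c * (q w * ?X w)"
   using w True by (simp add: simplex_vol_def)
 qed (use T in \<open>auto simp: simplex_vol_def\<close>)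
 also have "... = 0"
  by (simp only: sum_distrib_left[symmetric] cof_orthogonal[OF T(1) q] mult_zero_right)
 finally show ?thesis .
qed

text \<open>The entries behave like independent variables: each has its own partial
  derivative.\<close>

locale generic_matrix =
 fixes d :: nat and r :: "nat => 'b => 'k::char_two" and U :: "'b set" and del :: "nat => 'b => 'k => 'k"
 assumes del_add: "del i w (x + y) = del i w x + del i w y"
  and del_mult: "del i w (x * y) = del i w x * y + x * del i w y"
  and del_commute: "del i w (del j u x) = del j u (del i w x)"
  and del_r: "i < d ==> j < d ==> w \<in> U ==> u \<in> U ==> del i w (r j u) = (if j = i \<and> u = w then 1 else 0)"
begin

lemma derivations_del: "derivations (\<lambda>i. del (f i) (J i))"
 by standard (simp_all add: del_add del_mult del_commute)

text \<open>The derivative by an entry of the new row is a smaller minor, nonzero by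
  induction.\<close>

lemma dt_nonzero:
 "finite I ==> I \<subseteq> {..<d} ==> finite S ==> S \<subseteq> U ==> card S = card I ==> dt (rows r I) S \<noteq> 0"
proof (induction I arbitrary: S rule: finite_induct)
 case empty
 thus ?case by (simp add: rows_def dt_empty)
next
 case (insert i I)
 then obtain w where w: "w \<in> S" by fastforce
 interpret derivations "\<lambda>_. del i w" by (rule derivations_del)
 have "del i w (dt (rows r (insert i I)) S)
   = (if w \<in> S then \<Sum>q\<in>insert i I. (if q = i then 1 else 0) * dt (rows r (insert i I - {q})) (S - {w}) else 0)"
  by (rule D_dt) (use insert.prems insert.hyps w in \<open>auto simp: del_r subset_iff\<close>)
 also have "... = (\<Sum>q\<in>insert i I. if q = i then dt (rows r (insert i I - {i})) (S - {w}) else 0)"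
  unfolding if_P[OF w] by (rule sum.cong) auto
 also have "... = dt (rows r I) (S - {w})" using insert.hyps by simp
 finally have D: "del i w (dt (rows r (insert i I)) S) = dt (rows r I) (S - {w})" .
 have "dt (rows r I) (S - {w}) \<noteq> 0" by (rule insert.IH) (use insert.prems insert.hyps w in auto)
 thus ?case using D D_0 by metis
qed

abbreviation "R \<equiv> rows r {..<d}"

abbreviation DJ :: "(nat => 'b) => 'k => 'k" where
 "DJ J \<equiv> derivations.Dm (\<lambda>i. del i (J i)) {..<d}"

lemma cof_nonzero: "finite T ==> T \<subseteq> U ==> card T = d + 1 ==> v \<in> T ==> cof R T v \<noteq> 0"
 unfolding cof_def by (rule dt_nonzero) auto

lemma size_R [simp]: "size R = d"
 by (simp add: rows_def)

text \<open>Up to the square of \<open>Q\<close> the value is the product of the cofactors of even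
  multiplicity. Their number is odd, since the multiplicities sum to \<open>d\<close> over
  \<open>d + 1\<close> columns, so \<open>simplex_identity\<close> applies.\<close>

lemma simplex_vol_identity:
 assumes T: "finite T" "T \<subseteq> U" "card T = d + 1" and J: "J ` {..<d} \<subseteq> U"
  and m: "size m = d" "set_mset m \<subseteq> T" "J ` {..<d} \<subseteq> T"
 shows "DJ J (simplex_vol R T m)
  = (if \<forall>v\<in>T. even (count m v) \<longleftrightarrow> even (fib J {..<d} v)
   then ((\<Prod>v\<in>T. cof R T v ^ ((count m v + fib J {..<d} v) div 2)) / (\<Prod>v\<in>T. cof R T v))\<^sup>2 else 0)"
proof -
 interpret D: derivations "\<lambda>i. del i (J i)" by (rule derivations_del)
 let ?X = "cof R T" and ?f = "fib J {..<d}"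
 define E where "E = {v \<in> T. even (count m v)}"
 define Q where "Q = (\<Prod>v\<in>T. ?X v ^ (count m v div 2) / (if even (count m v) then ?X v else 1))"
 have X: "?X v \<noteq> 0" if "v \<in> T" for v by (rule cof_nonzero[OF T that])
 have "simplex_vol R T m = (\<Prod>v\<in>T. ?X v ^ count m v / ?X v)"
  using m by (simp add: simplex_vol_def prod_dividef)
 also have "... = (\<Prod>v\<in>T. (?X v ^ (count m v div 2) / (if even (count m v) then ?X v else 1))\<^sup>2 * (if v \<in> E then ?X v else 1))"
 proof (rule prod.cong)
  fix v assume v: "v \<in> T"
  show "?X v ^ count m v / ?X v = (?X v ^ (count m v div 2) / (if even (count m v) then ?X v else 1))\<^sup>2 * (if v \<in> E then ?X v else 1)"
   using X[OF v] v by (auto simp: E_def power_divide power2_eq_square power_add[symmetric] mult_2 elim!: evenE oddE)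
 qed simp
 also have "... = Q\<^sup>2 * prod ?X E"
 proof -
  have "(\<Prod>v\<in>T. if v \<in> E then ?X v else 1) = prod ?X E"
   using T by (simp add: prod.If_cases E_def Int_def)
  thus ?thesis by (simp add: prod.distrib Q_def prod_power_distrib)
 qed
 finally have vol: "simplex_vol R T m = Q * Q * prod ?X E" by (simp add: power2_eq_square)
 have cardE: "odd (card E)"
 proof -
  have "(\<Sum>v\<in>T. count m v) = d"
   using m(1) size_multiset_overloaded_eq[of m] sum.mono_neutral_left[OF T(1) m(2), of "count m"] by (auto simp: not_in_iff)
  moreover have "(\<Sum>v\<in>T. count m v) + card E = 2 * (\<Sum>v\<in>T. count m v div 2) + card T"
  proof -
   have "(\<Sum>v\<in>T. count m v + (if even (count m v) then 1 else 0)) = (\<Sum>v\<in>T. 2 * (count m v div 2) + 1)"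
    by (rule sum.cong) auto
   hence "(\<Sum>v\<in>T. count m v) + (\<Sum>v\<in>T. if even (count m v) then 1 else 0) = 2 * (\<Sum>v\<in>T. count m v div 2) + card T"
    by (simp only: sum.distrib sum_distrib_left) simp
   thus ?thesis using T by (simp add: sum.If_cases Int_def E_def)
  qed
  ultimately have "d + card E = 2 * (\<Sum>v\<in>T. count m v div 2) + d + 1" using T by simp
  hence "card E = 2 * (\<Sum>v\<in>T. count m v div 2) + 1" by simp
  thus ?thesis by simp
 qed
 have id: "D.Dm {..<d} (prod ?X E) = (if E = {v \<in> T. even (?f v)} then (\<Prod>v\<in>T. ?X v ^ (?f v div 2))\<^sup>2 else 0)"
  by (rule D.simplex_identity) (use T J m X cardE in \<open>auto simp: del_r subset_iff E_def\<close>)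
 have iff: "E = {v \<in> T. even (?f v)} \<longleftrightarrow> (\<forall>v\<in>T. even (count m v) \<longleftrightarrow> even (?f v))"
  by (auto simp: E_def)
 have "Q * (\<Prod>v\<in>T. ?X v ^ (?f v div 2)) = (\<Prod>v\<in>T. ?X v ^ ((count m v + ?f v) div 2)) / (\<Prod>v\<in>T. ?X v)"
  if par: "\<forall>v\<in>T. even (count m v) \<longleftrightarrow> even (?f v)"
  unfolding Q_def prod.distrib[symmetric] prod_dividef[symmetric]
 proof (rule prod.cong)
  fix v assume v: "v \<in> T"
  show "?X v ^ (count m v div 2) / (if even (count m v) then ?X v else 1) * ?X v ^ (?f v div 2) = ?X v ^ ((count m v + ?f v) div 2) / ?X v"
  proof (cases "even (count m v)")
   case True
   hence "even (?f v)" using par v by blast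
   hence "(count m v + ?f v) div 2 = count m v div 2 + ?f v div 2" using True by auto
   thus ?thesis using True by (simp add: power_add)
  next
   case False
   hence "odd (?f v)" using par v by blast
   hence "(count m v + ?f v) div 2 = Suc (count m v div 2 + ?f v div 2)" using False by (auto elim!: oddE)
   thus ?thesis using False X[OF v] by (simp add: power_add)
  qed
 qed simp
 moreover have "Q * Q * P\<^sup>2 = (Q * P)\<^sup>2" for P
  by (simp add: power_mult_distrib power2_eq_square[of Q])
 ultimately show ?thesis
  unfolding vol D.Dm_square[OF finite_lessThan] id iff by simp
qed

end

lemma half_multiset:
 assumes "\<And>v. even (count M v)"
 obtains n where "n + n = M"
proof -
 let ?n = "\<Sum>v\<in>set_mset M. replicate_mset (count M v div 2) v"
 have c: "count ?n v = count M v div 2" for v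
 proof -
  have "count ?n v = (\<Sum>u\<in>set_mset M. if u = v then count M v div 2 else 0)"
   unfolding count_sum by (rule sum.cong) auto
  thus ?thesis by (simp add: not_in_iff)
 qed
 have "?n + ?n = M"
 proof (rule multiset_eqI)
  fix v
  have "count (?n + ?n) v = count M v div 2 + count M v div 2" by (simp only: count_union c)
  thus "count (?n + ?n) v = count M v" using assms[of v] by presburger
 qed
 thus ?thesis by (rule that)
qed

lemma mset_set_if_card:
 assumes "card (set_mset m) = size m"
 shows "m = mset_set (set_mset m)"
proof (rule multiset_eqI)
 have "(\<Sum>v\<in>set_mset m. count m v - 1) = size m - card (set_mset m)"
  by (subst sum_subtractf_nat) (auto simp: size_multiset_overloaded_eq Suc_le_eq)
 hence "\<forall>v\<in>set_mset m. count m v - 1 = 0" using assms by simp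
 thus "count m v = count (mset_set (set_mset m)) v" for v
  by (cases "v \<in># m") (auto simp: not_in_iff count_mset_set' count_greater_zero_iff[symmetric] simp del: count_greater_zero_iff intro: le_antisym)
qed

text \<open>\<open>None\<close> is the apex of a cone over \<open>\<Delta>\<close> and has a generic
  column of its own. It turns each facet into a simplex with \<open>d + 1\<close> vertices.\<close>

locale generic_complex =
 generic_matrix d r "insert None (Some ` \<Union>\<Delta>)" del
 for \<Delta> :: "'a set set" and d :: nat and r :: "nat => 'a option => 'k::char_two" and del :: "nat => 'a option => 'k => 'k" +
 assumes hsph: "hsphere TYPE('k) d \<Delta>"
begin

abbreviation "a \<equiv> \<lambda>i v. r i (Some v)"

lemma generic_matrix_base: "generic_matrix d a (\<Union>\<Delta>) (\<lambda>i w. del i (Some w))"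
 by standard (use del_add del_mult del_commute del_r in auto)

sublocale lsop \<Delta> d a "\<lambda>S v q. dt (rows a ({..<card S} - {q})) (S - {v}) / dt (rows a {..<card S}) S"
proof
 show "hsphere TYPE('k) d \<Delta>" by (rule hsph)
 fix J assume J: "J \<in> \<Delta>"
 have "finite J" "card J \<le> d" using J hsph by (auto simp: hsphere_def abstract_complex_def)
 moreover have "dt (rows a {..<card J}) J \<noteq> 0"
  by (rule generic_matrix.dt_nonzero[OF generic_matrix_base]) (use calculation J in auto)
 ultimately show "nondeg a J (\<lambda>v q. dt (rows a ({..<card J} - {q})) (J - {v}) / dt (rows a {..<card J}) J)"
  by (intro nondeg_dt) auto
qed

abbreviation "U \<equiv> insert None (Some ` V)"

definition T :: "'a set => 'a option set" where "T F = insert None (Some ` F)"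

text \<open>The boundaries of the simplices of the cone add up to \<open>\<Delta>\<close>: by
  \<open>vol_None\<close> the contributions through the apex cancel.\<close>

definition vol :: "'a option multiset => 'k" where
 "vol m = (\<Sum>F\<in>{F \<in> \<Delta>. card F = d}. simplex_vol R (T F) m)"

lemma finU: "finite U"
 using finV by simp

lemma finT: "F \<in> \<Delta> ==> finite (T F)" and TU: "F \<in> \<Delta> ==> T F \<subseteq> U" and cardT: "F \<in> \<Delta> ==> card (T F) = card F + 1"
 using fin by (auto simp: T_def card_image)

lemma vol_relation: "q < d ==> (\<Sum>w\<in>U. r q w * vol (add_mset w n)) = 0"
proof -
 assume q: "q < d"
 have "(\<Sum>w\<in>U. r q w * vol (add_mset w n)) = (\<Sum>w\<in>U. \<Sum>F\<in>{F \<in> \<Delta>. card F = d}. r q w * simplex_vol R (T F) (add_mset w n))"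
  by (simp only: vol_def sum_distrib_left)
 also have "... = (\<Sum>F\<in>{F \<in> \<Delta>. card F = d}. \<Sum>w\<in>U. r q w * simplex_vol R (T F) (add_mset w n))"
  by (rule sum.swap)
 also have "... = 0"
 proof (rule sum.neutral, rule ballI)
  fix F assume "F \<in> {F \<in> \<Delta>. card F = d}"
  hence "finite (T F)" "T F \<subseteq> U" using finT TU by blast+
  thus "(\<Sum>w\<in>U. r q w * simplex_vol R (T F) (add_mset w n)) = 0"
   by (rule simplex_vol_relation[OF _ _ finU]) (use q in \<open>simp add: rows_def\<close>)
 qed
 finally show ?thesis .
qed

lemma vol_support:
 assumes "vol m \<noteq> 0"
 obtains F where "F \<in> \<Delta>" "card F = d" "set_mset m \<subseteq> T F" "size m = d"
proof -
 obtain F where F: "F \<in> {F \<in> \<Delta>. card F = d}" "simplex_vol R (T F) m \<noteq> 0"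
  using assms unfolding vol_def by (meson sum.not_neutral_contains_not_neutral)
 thus ?thesis using that by (auto simp: simplex_vol_def split: if_splits)
qed

text \<open>The two facets over a ridge contribute the same value.\<close>

lemma vol_ridge:
 assumes J: "J \<in> \<Delta>" "Suc (card J) = d"
 shows "vol (mset_set (T J)) = 0"
proof -
 obtain u w where uw: "u \<noteq> w" "{v \<in> V - J. insert v J \<in> \<Delta>} = {u, w}"
  using ridge_two[OF J] .
 have val: "simplex_vol R (T (insert x J)) (mset_set (T J)) = 1 / dt R (T J)" if x: "x \<in> {v \<in> V - J. insert v J \<in> \<Delta>}" for x
 proof -
  let ?X = "cof R (T (insert x J))"
  have Tx: "T (insert x J) = insert (Some x) (T J)" "Some x \<notin> T J" using x by (auto simp: T_def)
  have c: "card (T (insert x J)) = d + 1" using x cardT fin[OF J(1)] J(2) by auto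
  have "?X v \<noteq> 0" if "v \<in> T (insert x J)" for v
   using x that c by (intro cof_nonzero finT TU) auto
  hence nz: "prod ?X (T J) \<noteq> 0" using finT[OF J(1)] Tx by simp
  have "(\<Prod>v\<in>T (insert x J). ?X v ^ count (mset_set (T J)) v) = prod ?X (T J)"
   unfolding Tx(1) using finT[OF J(1)] Tx by (simp add: count_mset_set')
  moreover have "prod ?X (T (insert x J)) = dt R (T J) * prod ?X (T J)"
  proof -
   have "?X (Some x) = dt R (T J)" unfolding cof_def using Tx by simp
   thus ?thesis unfolding Tx(1) using finT[OF J(1)] Tx by simp
  qed
  ultimately show ?thesis
   using nz finT[OF J(1)] cardT[OF J(1)] J(2) Tx(1) by (auto simp: simplex_vol_def)
 qed
 have "vol (mset_set (T J)) = (\<Sum>F\<in>{insert u J, insert w J}. simplex_vol R (T F) (mset_set (T J)))"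
  unfolding vol_def
 proof (rule sum.mono_neutral_right)
  show "finite {F \<in> \<Delta>. card F = d}" using abstract_complexD(1)[OF \<Delta>] by simp
  show "{insert u J, insert w J} \<subseteq> {F \<in> \<Delta>. card F = d}"
  proof -
   have "u \<in> {v \<in> V - J. insert v J \<in> \<Delta>}" "w \<in> {v \<in> V - J. insert v J \<in> \<Delta>}" using uw(2) by simp_all
   thus ?thesis using fin[OF J(1)] J(2) by simp
  qed
  show "\<forall>F\<in>{F \<in> \<Delta>. card F = d} - {insert u J, insert w J}. simplex_vol R (T F) (mset_set (T J)) = 0"
  proof (rule ballI, rule ccontr)
   fix F assume F: "F \<in> {F \<in> \<Delta>. card F = d} - {insert u J, insert w J}" and nz: "simplex_vol R (T F) (mset_set (T J)) \<noteq> 0"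
   have "T J \<subseteq> T F" using nz finT[OF J(1)] by (auto simp: simplex_vol_def split: if_splits)
   hence sub: "J \<subseteq> F" by (auto simp: T_def)
   have "card (F - J) = 1" using F J sub fin by (simp add: card_Diff_subset)
   then obtain x where "F - J = {x}" by (auto simp: card_1_singleton_iff)
   hence "F = insert x J" "x \<in> V - J" using sub F by auto
   hence "x \<in> {u, w}" using F uw(2) by blast
   thus False using F \<open>F = insert x J\<close> by blast
  qed
 qed
 also have "... = 0"
 proof -
  have "insert u J \<noteq> insert w J" using uw by (metis (lifting) DiffD2 insertI1 insert_iff mem_Collect_eq insertCI)
  moreover have "u \<in> {v \<in> V - J. insert v J \<in> \<Delta>}" "w \<in> {v \<in> V - J. insert v J \<in> \<Delta>}" using uw(2) by simp_all
  ultimately show ?thesis using val by simp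
 qed
 finally show ?thesis .
qed

text \<open>A monomial with a repeated factor is exchanged through the row relations for monomials
  of larger support, which vanish by induction, and nondegeneracy on its own support then kills it.
  A squarefree one is a ridge joined with the apex, where the two facets cancel.\<close>

lemma vol_None: "None \<in># m ==> vol m = 0"
proof (induction "d - card (set_mset m)" arbitrary: m rule: less_induct)
 case less
 show ?case
 proof (rule ccontr)
  assume nz: "vol m \<noteq> 0"
  obtain F where F: "F \<in> \<Delta>" "card F = d" "set_mset m \<subseteq> T F" "size m = d" using vol_support[OF nz] .
  define J where "J = {v. Some v \<in># m}"
  have set: "set_mset m = T J"
  proof (rule set_eqI)
   fix x show "x \<in># m \<longleftrightarrow> x \<in> T J" using less.prems by (cases x) (auto simp: T_def J_def)
  qed
  have J: "J \<in> \<Delta>" by (rule dn[OF F(1)]) (use F(3) in \<open>auto simp: J_def T_def\<close>)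
  have "card (set_mset m) \<le> d" using F(4) by (metis size_multiset_overloaded_eq card_eq_sum sum_mono count_greater_zero_iff One_nat_def Suc_leI)
  then consider "card (set_mset m) = d" | "card (set_mset m) < d" by linarith
  thus False
  proof cases
   case 1
   hence "m = mset_set (T J)" using mset_set_if_card[of m] F(4) set by simp
   moreover have "Suc (card J) = d" using 1 set cardT[OF J] by simp
   ultimately show False using vol_ridge[OF J] nz by simp
  next
   case 2
   obtain x where x: "x \<in># m" "count m x \<noteq> 1"
   proof (rule ccontr)
    assume "\<not> thesis"
    hence "\<forall>x\<in>#m. count m x = 1" using that by blast
    hence "size m = card (set_mset m)" by (simp add: size_multiset_overloaded_eq)
    thus False using 2 F(4) by simp
   qed
   define n where "n = m - {#x#}"
   have m: "m = add_mset x n" using x(1) by (simp add: n_def)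
   hence "x \<in># n" using x(2) by (metis One_nat_def count_add_mset not_in_iff)
   hence setn: "set_mset n = T J" using set m by (metis insert_absorb set_mset_add_mset_insert)
   have zero: "vol (add_mset w n) = 0" if "w \<in> U - T J" for w
   proof (rule less.hyps)
    have "card (set_mset (add_mset w n)) = Suc (card (set_mset m))"
     using that setn set finT[OF J] by simp
    thus "d - card (set_mset (add_mset w n)) < d - card (set_mset m)" using 2 by simp
    show "None \<in># add_mset w n" using setn by (simp add: T_def)
   qed
   have "dt (rows r {..<card (T J)}) (T J) * vol (add_mset x n) = 0"
   proof (rule dt_kernel[OF finT[OF J]])
    show "x \<in> T J" using x set by simp
    fix q assume "q \<in># rows r {..<card (T J)}"
    then obtain i where "i < card (T J)" and qi: "q = r i" by (auto simp: rows_def)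
    hence i: "i < d" "q = r i" using 2 set by simp_all
    have "(\<Sum>w\<in>T J. q w * vol (add_mset w n)) = (\<Sum>w\<in>U. q w * vol (add_mset w n))"
     by (rule sum.mono_neutral_left) (use finU TU[OF J] zero in auto)
    thus "(\<Sum>w\<in>T J. q w * vol (add_mset w n)) = 0" using vol_relation[OF i(1)] i(2) by simp
   qed
   moreover have "dt (rows r {..<card (T J)}) (T J) \<noteq> 0"
    by (rule dt_nonzero) (use finT TU J 2 set in auto)
   ultimately show False using nz m by simp
  qed
 qed
qed

definition \<Omega> :: "'a multiset => 'k" where "\<Omega> m = vol (image_mset Some m)"

lemma Some_in_T [simp]: "Some ` A \<subseteq> T F \<longleftrightarrow> A \<subseteq> F"
 by (auto simp: T_def)

sublocale lsop_vol \<Delta> d a "\<lambda>S v q. dt (rows a ({..<card S} - {q})) (S - {v}) / dt (rows a {..<card S}) S" \<Omega>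
proof
 show "\<Omega> \<in> L {} d"
  unfolding L_def
 proof (intro CollectI allI impI)
  fix m assume "\<Omega> m \<noteq> 0"
  then obtain F where "F \<in> \<Delta>" "set_mset (image_mset Some m) \<subseteq> T F" "size (image_mset Some m) = d"
   unfolding \<Omega>_def by (rule vol_support) blast
  thus "set_mset m \<union> {} \<in> \<Delta> \<and> size m = d" using dn[of F "set_mset m"] by simp
 qed
 show "kerl d \<Omega>"
  unfolding kerl_def
 proof (intro allI impI ext)
  fix q n assume q: "q < d"
  have "\<theta> q \<Omega> n = (\<Sum>w\<in>Some ` V. r q w * vol (add_mset w (image_mset Some n)))"
   by (simp add: lower_def \<Omega>_def sum.reindex)
  also have "... = (\<Sum>w\<in>U. r q w * vol (add_mset w (image_mset Some n)))"
   by (rule sum.mono_neutral_left) (use finU vol_None in auto)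
  finally show "\<theta> q \<Omega> n = 0" using vol_relation[OF q] by simp
 qed
 fix F assume F: "F \<in> \<Delta>" "card F = d"
 let ?m = "image_mset Some (mset_set F)"
 have m: "?m = mset_set (Some ` F)" by (simp add: image_mset_mset_set)
 have other: "simplex_vol R (T G) ?m = 0" if "G \<in> {F \<in> \<Delta>. card F = d} - {F}" for G
 proof -
  have "\<not> F \<subseteq> G" using that F card_subset_eq[of G F] fin by auto
  thus ?thesis using fin[OF F(1)] by (simp add: simplex_vol_def)
 qed
 have "\<Omega> (mset_set F) = simplex_vol R (T F) ?m"
  unfolding \<Omega>_def vol_def using other F abstract_complexD(1)[OF \<Delta>]
  by (subst sum.remove[of _ F]) (simp_all add: sum.neutral)
 moreover have "cof R (T F) v \<noteq> 0" if "v \<in> T F" for v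
  using F that cardT by (intro cof_nonzero finT TU) auto
 hence "simplex_vol R (T F) ?m \<noteq> 0"
  using F fin finT[OF F(1)] by (simp add: simplex_vol_def)
 ultimately show "\<Omega> (mset_set F) \<noteq> 0" by simp
qed

text \<open>Extends \<open>simplex_vol_identity\<close> beyond \<open>F\<close>. If
  \<open>J i\<close> lies outside \<open>F\<close>, the derivation number \<open>i\<close> sees only
  constants, and a multiset \<open>n\<close> with double \<open>M\<close> is not supported in
  \<open>F\<close> either, so both sides vanish.\<close>

lemma DJ_simplex_vol:
 fixes m :: "'a multiset"
 assumes F: "F \<in> \<Delta>" "card F = d" and J: "J ` {..<d} \<subseteq> V"
 defines "e \<equiv> DJ (Some \<circ> J) (simplex_vol R (T F) (image_mset Some m))" and "M \<equiv> m + image_mset J (mset_set {..<d})"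
 shows "n + n = M ==> e = simplex_vol R (T F) (image_mset Some n) * simplex_vol R (T F) (image_mset Some n)"
  and "\<nexists>n. n + n = M ==> e = 0"
proof -
 interpret D: derivations "\<lambda>i. del i ((Some \<circ> J) i)" by (rule derivations_del)
 let ?JJ = "image_mset J (mset_set {..<d})" and ?S = "\<lambda>n. simplex_vol R (T F) (image_mset Some n)"
 have setn: "set_mset n = set_mset m \<union> J ` {..<d}" if "n + n = M" for n
  using arg_cong[OF that, of set_mset] by (simp add: M_def)
 have sizen: "2 * size n = size m + d" if "n + n = M" for n
  using arg_cong[OF that, of size] by (simp add: M_def)
 have "(\<forall>n. n + n = M --> e = ?S n * ?S n) \<and> ((\<nexists>n. n + n = M) --> e = 0)"
 proof (cases "size m = d \<and> set_mset m \<subseteq> F \<and> J ` {..<d} \<subseteq> F")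
  case True
  have cnt: "count (image_mset Some k) (Some v) = count k v" for k :: "'a multiset" and v
   by (induction k) auto
  have cntN: "count (image_mset Some k) None = 0" for k :: "'a multiset"
   by (simp add: not_in_iff[symmetric])
  have fib: "fib (Some \<circ> J) {..<d} (Some v) = count ?JJ v" for v
   by (simp add: fib_def count_image_mset vimage_def Int_def conj_commute)
  have fibN: "fib (Some \<circ> J) {..<d} None = 0" by (simp add: fib_def)
  let ?par = "\<forall>v\<in>T F. even (count (image_mset Some m) v) \<longleftrightarrow> even (fib (Some \<circ> J) {..<d} v)"
  have id: "e = (if ?par
   then ((\<Prod>v\<in>T F. cof R (T F) v ^ ((count (image_mset Some m) v + fib (Some \<circ> J) {..<d} v) div 2)) / (\<Prod>v\<in>T F. cof R (T F) v))\<^sup>2 else 0)"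
   unfolding e_def by (rule simplex_vol_identity) (use F True J finT TU cardT in \<open>auto simp: T_def image_subset_iff\<close>)
  show ?thesis
  proof (cases "\<exists>n. n + n = M")
   case ex: True
   have c: "count m v + count ?JJ v = 2 * count n v" if "n + n = M" for n v
    using arg_cong[OF that, of "\<lambda>k. count k v"] by (simp add: M_def)
   obtain n0 where n0: "n0 + n0 = M" using ex by blast
   have par: "?par"
   proof
    fix v assume "v \<in> T F"
    show "even (count (image_mset Some m) v) \<longleftrightarrow> even (fib (Some \<circ> J) {..<d} v)"
    proof (cases v)
     case (Some u)
     have "even (count m u + count ?JJ u)" using c[OF n0] by simp
     thus ?thesis unfolding Some cnt fib by simp
    qed (simp add: cntN fibN)
   qed
   have "e = ?S n * ?S n" if n: "n + n = M" for n
   proof -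
    have "(count (image_mset Some m) v + fib (Some \<circ> J) {..<d} v) div 2 = count (image_mset Some n) v" for v
    proof (cases v)
     case (Some u)
     show ?thesis unfolding Some cnt fib c[OF n] by simp
    qed (simp add: cntN fibN)
    thus ?thesis unfolding id if_P[OF par]
     using True setn[OF n] sizen[OF n] by (simp add: simplex_vol_def power2_eq_square)
   qed
   thus ?thesis using ex by blast
  next
   case False
   have np: "\<not> ?par"
   proof
    assume par: "?par"
    have "even (count M v)" for v
    proof (cases "v \<in> F")
     case True
     hence "even (count m v) \<longleftrightarrow> even (count ?JJ v)"
      using par[rule_format, of "Some v"] unfolding cnt fib by (simp add: T_def)
     thus ?thesis by (simp add: M_def)
    next
     case False
     hence "v \<notin># M" using True by (auto simp: M_def)
     hence "count M v = 0" by (simp only: not_in_iff)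
     thus ?thesis by (simp only: even_zero)
    qed
    thus False using half_multiset[of M] False by metis
   qed
   show ?thesis unfolding id if_not_P[OF np] using False by blast
  qed
 next
  case False
  have L: "e = 0"
  proof (cases "size m = d \<and> set_mset m \<subseteq> F")
   case True
   then obtain i where i: "i < d" "J i \<notin> F" using False by auto
   have X: "del i ((Some \<circ> J) i) (cof R (T F) v) = 0" for v
   proof -
    have "del i ((Some \<circ> J) i) (dt R (T F - {v}))
     = (if (Some \<circ> J) i \<in> T F - {v} then \<Sum>q<d. 0 * dt (rows r ({..<d} - {q})) (T F - {v} - {(Some \<circ> J) i}) else 0)"
    proof (rule D.D_dt)
     fix q w assume "q \<in> {..<d}" "w \<in> T F - {v}"
     moreover have "w \<noteq> Some (J i)" using calculation i by (auto simp: T_def)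
     moreover have "w \<in> U" using calculation TU[OF F(1)] by blast
     ultimately show "del i ((Some \<circ> J) i) (r q w) = (if w = (Some \<circ> J) i then 0 else 0)"
      using i J by (simp add: del_r image_subset_iff)
    qed (use finT[OF F(1)] in auto)
    thus ?thesis by (simp add: cof_def)
   qed
   have P: "del i ((Some \<circ> J) i) (prod f A) = 0" if "\<And>x. x \<in> A ==> del i ((Some \<circ> J) i) (f x) = 0" for f :: "'a option => 'k" and A
    using that by (cases "finite A") (simp_all add: D.D_prod del: o_apply)
   have "del i ((Some \<circ> J) i) (simplex_vol R (T F) (image_mset Some m)) = 0"
    using X by (auto simp: simplex_vol_def simp del: o_apply intro!: D.D_divide P D.D_pow)
   thus ?thesis unfolding e_def using D.Dm_remove[of "{..<d}" i] i(1) by (simp del: o_apply)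
  next
   case False
   hence "simplex_vol R (T F) (image_mset Some m) = 0" by (auto simp: simplex_vol_def)
   thus ?thesis unfolding e_def by (simp del: o_apply)
  qed
  have "?S n = 0" if "n + n = M" for n
   using False setn[OF that] sizen[OF that] by (auto simp: simplex_vol_def)
  thus ?thesis using L by auto
 qed
 thus "n + n = M ==> e = ?S n * ?S n" "\<nexists>n. n + n = M ==> e = 0" by blast+
qed

text \<open>The identity holds facet by facet, and in characteristic two a sum of squares is the
  square of the sum.\<close>

theorem DJ_\<Omega>:
 assumes J: "J ` {..<d} \<subseteq> V"
 shows "n + n = m + image_mset J (mset_set {..<d}) ==> DJ (Some \<circ> J) (\<Omega> m) = \<Omega> n * \<Omega> n"
  and "\<nexists>n. n + n = m + image_mset J (mset_set {..<d}) ==> DJ (Some \<circ> J) (\<Omega> m) = 0"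
proof -
 interpret D: derivations "\<lambda>i. del i ((Some \<circ> J) i)" by (rule derivations_del)
 let ?M = "m + image_mset J (mset_set {..<d})" and ?S = "\<lambda>F n. simplex_vol R (T F) (image_mset Some n)"
 have sum: "DJ (Some \<circ> J) (\<Omega> m) = (\<Sum>F\<in>{F \<in> \<Delta>. card F = d}. DJ (Some \<circ> J) (?S F m))"
  unfolding \<Omega>_def vol_def by (rule D.Dm_sum) simp
 show "DJ (Some \<circ> J) (\<Omega> m) = 0" if "\<nexists>n. n + n = ?M"
  unfolding sum by (rule sum.neutral) (use DJ_simplex_vol(2)[OF _ _ J that] in blast)
 show "DJ (Some \<circ> J) (\<Omega> m) = \<Omega> n * \<Omega> n" if n: "n + n = ?M"
 proof -
  have "DJ (Some \<circ> J) (\<Omega> m) = (\<Sum>F\<in>{F \<in> \<Delta>. card F = d}. ?S F n * ?S F n)"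
   unfolding sum by (rule sum.cong) (use DJ_simplex_vol(1)[OF _ _ J n] in blast)+
  also have "... = \<Omega> n * \<Omega> n"
   unfolding \<Omega>_def vol_def by (rule sum_square[symmetric]) (use abstract_complexD(1)[OF \<Delta>] in simp)
  finally show ?thesis .
 qed
qed

end

subsection \<open>The Lefschetz property\<close>

definition subsp :: "('b => 'k::field) set => bool" where
 "subsp W \<longleftrightarrow> (\<lambda>_. 0) \<in> W \<and> (\<forall>f\<in>W. \<forall>g\<in>W. (\<lambda>x. f x + g x) \<in> W) \<and> (\<forall>c. \<forall>f\<in>W. (\<lambda>x. c * f x) \<in> W)"

lemma subspD:
 assumes "subsp W"
 shows "(\<lambda>_. 0) \<in> W" "f \<in> W ==> g \<in> W ==> (\<lambda>x. f x + g x) \<in> W" "f \<in> W ==> (\<lambda>x. c * f x) \<in> W"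
  "f \<in> W ==> g \<in> W ==> (\<lambda>x. f x - g x) \<in> W"
proof -
 show "(\<lambda>_. 0) \<in> W" "f \<in> W ==> g \<in> W ==> (\<lambda>x. f x + g x) \<in> W" "f \<in> W ==> (\<lambda>x. c * f x) \<in> W"
  using assms by (simp_all add: subsp_def)
 assume f: "f \<in> W" and g: "g \<in> W"
 have "(\<lambda>x. -1 * g x) \<in> W" using assms g by (simp only: subsp_def)
 from bspec[OF bspec[OF conjunct1[OF conjunct2[OF assms[unfolded subsp_def]]] f] this]
 show "(\<lambda>x. f x - g x) \<in> W" by simp
qed

text \<open>A vector outside a finite-dimensional subspace is detected by an annihilator of the
  subspace, found by eliminating one coordinate at a time.\<close>

lemma separation:
 fixes W :: "('b => 'k::field) set"
 assumes "finite P" "subsp W" "\<And>w x. w \<in> W ==> w x \<noteq> 0 ==> x \<in> P" "\<And>x. f x \<noteq> 0 ==> x \<in> P" "f \<notin> W"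
 obtains c where "\<And>w. w \<in> W ==> (\<Sum>x\<in>P. c x * w x) = 0" "(\<Sum>x\<in>P. c x * f x) \<noteq> 0"
proof -
 have "\<exists>c. (\<forall>w\<in>W. (\<Sum>x\<in>P. c x * w x) = 0) \<and> (\<Sum>x\<in>P. c x * f x) \<noteq> 0"
  using assms
 proof (induction P arbitrary: W f rule: finite_induct)
  case empty
  hence "f = (\<lambda>_. 0)" by auto
  thus ?case using empty.prems subspD(1) by metis
 next
  case (insert p P)
  note W = subspD[OF insert.prems(1)]
  show ?case
  proof (cases "\<exists>w\<in>W. w p \<noteq> 0")
   case True
   then obtain w1 where w1: "w1 \<in> W" "w1 p \<noteq> 0" by blast
   define w0 where "w0 = (\<lambda>x. inverse (w1 p) * w1 x)"
   have w0: "w0 \<in> W" "w0 p = 1" using w1 W(3) by (auto simp: w0_def)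
   let ?W = "{w \<in> W. w p = 0}" and ?f = "\<lambda>x. f x - f p * w0 x"
   have "\<exists>c. (\<forall>w\<in>?W. (\<Sum>x\<in>P. c x * w x) = 0) \<and> (\<Sum>x\<in>P. c x * ?f x) \<noteq> 0"
   proof (rule insert.IH)
    show "subsp ?W" using W by (auto simp: subsp_def)
    show "x \<in> P" if "w \<in> ?W" "w x \<noteq> 0" for w x using that insert.prems(2)[of w x] by auto
    show "x \<in> P" if "?f x \<noteq> 0" for x
    proof -
     have "x \<noteq> p" using that w0 by auto
     moreover have "f x \<noteq> 0 \<or> w0 x \<noteq> 0" using that by auto
     ultimately show ?thesis using insert.prems(2)[OF w0(1), of x] insert.prems(3)[of x] by auto
    qed
    show "?f \<notin> ?W"
    proof
     assume "?f \<in> ?W"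
     hence "(\<lambda>x. ?f x + f p * w0 x) \<in> W" using W(2)[of ?f "\<lambda>x. f p * w0 x"] W(3)[OF w0(1)] by simp
     thus False using insert.prems(4) by simp
    qed
   qed
   then obtain c where c: "\<And>w. w \<in> W ==> w p = 0 ==> (\<Sum>x\<in>P. c x * w x) = 0" "(\<Sum>x\<in>P. c x * ?f x) \<noteq> 0"
    by blast
   define c' where "c' = c(p := - (\<Sum>x\<in>P. c x * w0 x))"
   have c': "(\<Sum>x\<in>insert p P. c' x * g x) = (\<Sum>x\<in>P. c x * (g x - g p * w0 x))" for g
   proof -
    have "(\<Sum>x\<in>P. c' x * g x) = (\<Sum>x\<in>P. c x * g x)"
     by (rule sum.cong) (use insert.hyps in \<open>auto simp: c'_def\<close>)
    moreover have "(\<Sum>x\<in>P. c x * (g x - g p * w0 x)) = (\<Sum>x\<in>P. c x * g x) - (\<Sum>x\<in>P. c x * w0 x) * g p"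
     unfolding sum_distrib_right by (simp add: right_diff_distrib sum_subtractf mult_ac)
    ultimately show ?thesis using insert.hyps by (simp add: c'_def)
   qed
   have "(\<Sum>x\<in>insert p P. c' x * w x) = 0" if "w \<in> W" for w
    unfolding c' by (rule c(1)) (use that W w0 in auto)
   thus ?thesis using c(2) c'[of f] by metis
  next
   case False
   show ?thesis
   proof (cases "f p = 0")
    case True
    have "\<exists>c. (\<forall>w\<in>W. (\<Sum>x\<in>P. c x * w x) = 0) \<and> (\<Sum>x\<in>P. c x * f x) \<noteq> 0"
     by (rule insert.IH) (use insert.prems False True in \<open>blast+\<close>)
    then obtain c where c: "\<And>w. w \<in> W ==> (\<Sum>x\<in>P. c x * w x) = 0" "(\<Sum>x\<in>P. c x * f x) \<noteq> 0" by blast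
    thus ?thesis using False True insert.hyps by (intro exI[of _ c]) auto
   next
    case f: False
    have "(\<Sum>x\<in>insert p P. (if x = p then 1 else 0) * g x) = g p" for g :: "'b => 'k"
     using insert.hyps by (simp add: if_distrib[of "\<lambda>x. x * _"] cong: if_cong)
    thus ?thesis using False f by (intro exI[of _ "\<lambda>x. if x = p then 1 else 0"]) simp
   qed
  qed
 qed
 thus ?thesis using that by blast
qed

lemma sum_sum_symmetric:
 fixes f :: "'b => 'b => 'k::char_two"
 assumes "finite P" "\<And>x y. f x y = f y x"
 shows "(\<Sum>x\<in>P. \<Sum>y\<in>P. f x y) = (\<Sum>x\<in>P. f x x)"
proof -
 have "(\<Sum>x\<in>P. \<Sum>y\<in>P. f x y) = (\<Sum>x\<in>P. f x x + (\<Sum>y\<in>P - {x}. f x y))"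
  using assms(1) by (intro sum.cong refl sum.remove)
 also have "... = (\<Sum>x\<in>P. f x x)"
  using sum_symmetric_offdiag[OF assms(1), of f] assms(2) by (simp add: sum.distrib)
 finally show ?thesis .
qed

lemma finite_multisets: "finite A ==> finite {m. set_mset m \<subseteq> A \<and> size m = n}"
proof (induction n)
 case (Suc n)
 have "{m. set_mset m \<subseteq> A \<and> size m = Suc n} \<subseteq> (\<Union>a\<in>A. add_mset a ` {m. set_mset m \<subseteq> A \<and> size m = n})"
 proof
  fix m assume m: "m \<in> {m. set_mset m \<subseteq> A \<and> size m = Suc n}"
  then obtain a N where "m = add_mset a N" by (auto dest!: size_eq_Suc_imp_eq_union)
  thus "m \<in> (\<Union>a\<in>A. add_mset a ` {m. set_mset m \<subseteq> A \<and> size m = n})" using m by auto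
 qed
 moreover have "finite (\<Union>a\<in>A. add_mset a ` {m. set_mset m \<subseteq> A \<and> size m = n})" using Suc by simp
 ultimately show ?case by (rule finite_subset)
qed simp

lemma multiset_index:
 assumes "size M = d"
 obtains J where "image_mset J (mset_set {..<d}) = M" "J ` {..<d} = set_mset M"
proof -
 obtain xs where xs: "mset xs = M" using ex_mset by blast
 have "map (\<lambda>i. xs ! i) [0..<d] = xs" using xs assms by (auto simp: map_nth)
 hence "image_mset (\<lambda>i. xs ! i) (mset [0..<d]) = M" using xs by (metis mset_map)
 hence "image_mset (\<lambda>i. xs ! i) (mset_set {..<d}) = M" by (simp add: mset_upt lessThan_atLeast0)
 moreover from this have "(\<lambda>i. xs ! i) ` {..<d} = set_mset M" by (metis finite_lessThan finite_set_mset_mset_set set_image_mset)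
 ultimately show ?thesis by (rule that)
qed

lemma multiset_split:
 fixes M :: "'b multiset"
 assumes "size M = x + y"
 obtains A B where "M = A + B" "size A = x" "size B = y"
proof -
 obtain xs where xs: "mset xs = M" using ex_mset by blast
 have "M = mset (take x xs) + mset (drop x xs)" using xs by (metis append_take_drop_id mset_append)
 moreover have "size (mset (take x xs)) = x" "size (mset (drop x xs)) = y" using xs assms by auto
 ultimately show ?thesis by (rule that)
qed

context lsop
begin

text \<open>Transpose of multiplication by the sum of all vertices, the Lefschetz element.\<close>

definition ell :: "('a multiset => 'k) => 'a multiset => 'k" where
 "ell f n = (\<Sum>v\<in>V. f (add_mset v n))"

definition KK :: "nat => nat => ('a multiset => 'k) set" where
 "KK q j = {f \<in> L {} j. kerl q f}"

lemma subsp_KK: "subsp (KK q j)"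
 unfolding subsp_def
proof (intro conjI ballI allI)
 show "(\<lambda>_. 0) \<in> KK q j" by (simp add: KK_def L_def kerl_def lower_def fun_eq_iff)
next
 fix f g assume fg: "f \<in> KK q j" "g \<in> KK q j"
 have "(\<lambda>x. f x + g x) \<in> L {} j" unfolding L_def
 proof (intro CollectI allI impI)
  fix m assume "f m + g m \<noteq> 0"
  hence "f m \<noteq> 0 \<or> g m \<noteq> 0" by auto
  thus "set_mset m \<union> {} \<in> \<Delta> \<and> size m = j" using fg by (auto simp: KK_def L_def)
 qed
 thus "(\<lambda>x. f x + g x) \<in> KK q j" using fg by (simp add: KK_def kerl_def \<theta>_add)
next
 fix c f assume "f \<in> KK q j"
 thus "(\<lambda>x. c * f x) \<in> KK q j"
  by (auto simp: KK_def L_def kerl_def lower_def fun_eq_iff mult.left_commute sum_distrib_left[symmetric])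
qed

lemma KK_support: "f \<in> KK q j ==> f m \<noteq> 0 ==> set_mset m \<in> \<Delta> \<and> size m = j"
 by (auto simp: KK_def L_def)

lemma lower_KK:
 assumes f: "f \<in> KK q (Suc j)"
 shows "lower c V x f \<in> KK q j"
proof -
 have "\<theta> i (lower c V x f) = (\<lambda>_. 0)" if "i < q" for i
 proof -
  have "\<theta> i (lower c V x f) = lower c V x (\<theta> i f)" by (rule lower_commute)
  also have "\<theta> i f = (\<lambda>_. 0)" using f that by (simp add: KK_def kerl_def)
  finally show ?thesis by (simp add: lower_def fun_eq_iff)
 qed
 moreover have "lower c V x f \<in> L {} j" unfolding L_def
 proof (intro CollectI allI impI)
  fix m assume "lower c V x f m \<noteq> 0"
  then obtain v where "v \<in> V" "f (add_mset v m) \<noteq> 0"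
   unfolding lower_def by (metis (no_types, lifting) mult_zero_right sum.not_neutral_contains_not_neutral)
  hence "insert v (set_mset m) \<in> \<Delta>" "size m = j" using KK_support[OF f] by fastforce+
  thus "set_mset m \<union> {} \<in> \<Delta> \<and> size m = j" using dn[of "insert v (set_mset m)" "set_mset m"] by auto
 qed
 ultimately show ?thesis by (simp add: KK_def kerl_def)
qed

lemma ell_KK: "f \<in> KK q (Suc j) ==> ell f \<in> KK q j"
proof -
 have "ell f = lower (\<lambda>_ _. 1) V () f" by (simp add: ell_def lower_def fun_eq_iff)
 thus "f \<in> KK q (Suc j) ==> ell f \<in> KK q j" by (simp only: lower_KK)
qed

lemma shift_KK:
 assumes "f \<in> KK q (size m + j)"
 shows "(\<lambda>n. f (m + n)) \<in> KK q j"
 unfolding KK_def L_def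
proof (intro CollectI conjI allI impI)
 fix n assume "f (m + n) \<noteq> 0"
 from KK_support[OF assms this] show "set_mset n \<union> {} \<in> \<Delta>" "size n = j"
  using dn[of "set_mset (m + n)" "set_mset n"] by auto
next
 have "\<theta> i (\<lambda>n. f (m + n)) = (\<lambda>n. \<theta> i f (m + n))" for i by (simp add: lower_def fun_eq_iff)
 thus "kerl q (\<lambda>n. f (m + n))" using assms by (simp add: KK_def kerl_def)
qed

lemma ell_add: "ell (\<lambda>x. f x + g x) = (\<lambda>x. ell f x + ell g x)"
 by (simp add: ell_def sum.distrib fun_eq_iff)

lemma ell_scale: "ell (\<lambda>x. c * f x) = (\<lambda>x. c * ell f x)"
 by (simp add: ell_def sum_distrib_left fun_eq_iff)

lemma empty_face: "{} \<in> \<Delta>"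
 using \<Delta> by (simp add: abstract_complex_def)

end

context generic_complex
begin

lemma \<Omega>_outside: "\<not> set_mset m \<subseteq> V ==> \<Omega> m = 0"
 using L_D[OF \<Omega>L, of m] by auto

text \<open>A functional \<open>c\<close> vanishing on the image of \<open>ell\<close> gives a linear relation between values of
 \<open>\<Omega>\<close>. Multiplying by \<open>c\<close> once more leaves only squares of the coefficients, which are constants for
 all derivations, and the derivations turn the values of \<open>\<Omega>\<close> into squares as well. Taking
 square roots, \<open>c\<close> vanishes on all shifts of \<open>\<Omega>\<close>.\<close>

theorem ell_surjective:
 assumes j: "2 * j + 1 \<le> d" and f: "f \<in> KK d j"
 obtains g where "g \<in> KK d (Suc j)" "ell g = f"
proof (rule ccontr)
 assume no: "\<not> thesis"
 let ?P = "{n. set_mset n \<subseteq> V \<and> size n = j}"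
 have finP: "finite ?P" by (rule finite_multisets[OF finV])
 have inP: "n \<in> ?P" if "g \<in> KK d j" "g n \<noteq> 0" for g n
  using KK_support[OF that] by auto
 have nof: "f \<notin> ell ` KK d (Suc j)" using no that by blast
 obtain c where c: "\<And>w. w \<in> ell ` KK d (Suc j) ==> (\<Sum>n\<in>?P. c n * w n) = 0" and cf: "(\<Sum>n\<in>?P. c n * f n) \<noteq> 0"
 proof (rule separation[OF finP, of "ell ` KK d (Suc j)" f])
  note K = subspD[OF subsp_KK[of d "Suc j"]]
  show "subsp (ell ` KK d (Suc j))"
   unfolding subsp_def
  proof (intro conjI ballI allI)
   have "ell (\<lambda>_. 0) = (\<lambda>_. 0)" by (simp add: ell_def fun_eq_iff)
   thus "(\<lambda>_. 0) \<in> ell ` KK d (Suc j)" using K(1) by (metis image_eqI)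
  next
   fix f g assume "f \<in> ell ` KK d (Suc j)" "g \<in> ell ` KK d (Suc j)"
   then obtain f' g' where "f = ell f'" "g = ell g'" "f' \<in> KK d (Suc j)" "g' \<in> KK d (Suc j)" by blast
   thus "(\<lambda>x. f x + g x) \<in> ell ` KK d (Suc j)" using imageI[OF K(2)[of f' g'], of ell] by (simp add: ell_add)
  next
   fix c f assume "f \<in> ell ` KK d (Suc j)"
   then obtain f' where "f = ell f'" "f' \<in> KK d (Suc j)" by blast
   thus "(\<lambda>x. c * f x) \<in> ell ` KK d (Suc j)" using imageI[OF K(3)[of f' c], of ell] by (simp add: ell_scale)
  qed
  show "n \<in> ?P" if "w \<in> ell ` KK d (Suc j)" "w n \<noteq> 0" for w n
   using that inP ell_KK by blast
  show "n \<in> ?P" if "f n \<noteq> 0" for n using inP[OF f that] .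
  show "f \<notin> ell ` KK d (Suc j)" by (rule nof)
 qed (rule that)
 have \<Omega>K: "\<Omega> \<in> KK d d" using \<Omega>L \<Omega>ker by (simp add: KK_def)
 \<comment> \<open>Shifts of \<open>\<Omega>\<close> lie in the kernel of the parameters, so
   \<open>c\<close> can be tested on their images.\<close>
 have rel: "(\<Sum>n\<in>?P. c n * (\<Sum>v\<in>V. \<Omega> (m + add_mset v n))) = 0" if "size m + Suc j = d" for m
 proof -
  have "(\<lambda>n. \<Omega> (m + n)) \<in> KK d (Suc j)" using shift_KK[of \<Omega> d m "Suc j"] that \<Omega>K by simp
  from c[OF imageI[OF this]] show ?thesis by (simp add: ell_def)
 qed
 \<comment> \<open>The relation at \<open>q + n\<close> is multiplied by \<open>c n\<close> and
   summed over \<open>n\<close>. The double sum is symmetric, so only its diagonal remains.\<close>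
 have quad: "(\<Sum>n\<in>?P. (c n * c n) * (\<Sum>v\<in>V. \<Omega> (q + n + n + {#v#}))) = 0" if q: "size q + 2 * j + 1 = d" for q
 proof -
  have "(\<Sum>n\<in>?P. \<Sum>n'\<in>?P. c n * (c n' * (\<Sum>v\<in>V. \<Omega> (q + n + n' + {#v#})))) = 0"
  proof (rule sum.neutral, rule ballI)
   fix n assume "n \<in> ?P"
   hence "(\<Sum>n'\<in>?P. c n' * (\<Sum>v\<in>V. \<Omega> (q + n + add_mset v n'))) = 0" by (intro rel) (use q in auto)
   hence "(\<Sum>n'\<in>?P. c n' * (\<Sum>v\<in>V. \<Omega> (q + n + n' + {#v#}))) = 0" by simp
   thus "(\<Sum>n'\<in>?P. c n * (c n' * (\<Sum>v\<in>V. \<Omega> (q + n + n' + {#v#})))) = 0"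
    by (simp only: sum_distrib_left[symmetric] mult_zero_right)
  qed
  moreover have "(\<Sum>n\<in>?P. \<Sum>n'\<in>?P. c n * (c n' * (\<Sum>v\<in>V. \<Omega> (q + n + n' + {#v#}))))
    = (\<Sum>n\<in>?P. c n * (c n * (\<Sum>v\<in>V. \<Omega> (q + n + n + {#v#}))))"
  proof (rule sum_sum_symmetric[OF finP])
   fix n n' :: "'a multiset"
   have e: "q + n + n' = q + n' + n" by (simp only: ac_simps)
   show "c n * (c n' * (\<Sum>v\<in>V. \<Omega> (q + n + n' + {#v#}))) = c n' * (c n * (\<Sum>v\<in>V. \<Omega> (q + n' + n + {#v#})))"
    unfolding e by (rule mult.left_commute)
  qed
  ultimately show ?thesis by (simp add: mult.assoc)
 qed
 have van: "(\<Sum>n\<in>?P. c n * \<Omega> (m + n)) = 0" if m: "size m + j = d" for m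
 proof (cases "set_mset m \<subseteq> V")
  case False
  have "\<Omega> (m + n) = 0" for n by (rule \<Omega>_outside) (use False in auto)
  thus ?thesis by simp
 next
  case mV: True
  have "size m = (d - 2 * j - 1) + Suc j" using m j by simp
  then obtain q m1 where q: "m = q + m1" "size q = d - 2 * j - 1" "size m1 = Suc j"
   by (rule multiset_split)
  obtain v0 w where vw: "m1 = add_mset v0 w"
   using size_eq_Suc_imp_eq_union[OF q(3)] by blast
  have w: "size w = j" using q(3) vw by simp
  \<comment> \<open>Chosen so that \<open>q + n + n + {#v0#} + ?M\<close> is twice
    \<open>m + n\<close>, while for any other \<open>v\<close> the multiplicity of \<open>v\<close>
    becomes odd and the derivative vanishes.\<close>
  let ?M = "q + {#v0#} + w + w"
  have "size ?M = d" using q vw w j by simp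
  then obtain J where J: "image_mset J (mset_set {..<d}) = ?M" "J ` {..<d} = set_mset ?M" by (rule multiset_index)
  have JV: "J ` {..<d} \<subseteq> V" unfolding J(2) using mV q vw by auto
  interpret D: derivations "\<lambda>i. del i ((Some \<circ> J) i)" by (rule derivations_del)
  have der: "DJ (Some \<circ> J) (\<Omega> (q + n + n + {#v#})) = (if v = v0 then \<Omega> (m + n) * \<Omega> (m + n) else 0)" for n v
  proof (cases "v = v0")
   case True
   have "(m + n) + (m + n) = q + n + n + {#v#} + ?M" unfolding q(1) vw True by simp
   thus ?thesis using DJ_\<Omega>(1)[OF JV] J(1) True by simp
  next
   case False
   have "\<nexists>k. k + k = q + n + n + {#v#} + ?M"
   proof
    assume "\<exists>k. k + k = q + n + n + {#v#} + ?M"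
    then obtain k where "k + k = q + n + n + {#v#} + ?M" by blast
    from arg_cong[OF this, of "\<lambda>x. count x v"]
    have "2 * count k v = 2 * (count q v + count n v + count w v) + 1" using False by simp
    thus False by presburger
   qed
   thus ?thesis using DJ_\<Omega>(2)[OF JV] J(1) False by simp
  qed
  have v0: "v0 \<in> V" using mV q vw by auto
  have "0 = DJ (Some \<circ> J) (\<Sum>n\<in>?P. (c n * c n) * (\<Sum>v\<in>V. \<Omega> (q + n + n + {#v#})))"
   using quad[of q] q(2) j D.Dm_0[of "{..<d}"] by (simp del: o_apply)
  also have "... = (\<Sum>n\<in>?P. (c n * c n) * (\<Sum>v\<in>V. DJ (Some \<circ> J) (\<Omega> (q + n + n + {#v#}))))"
   by (simp only: D.Dm_sum[OF finite_lessThan] D.Dm_square[OF finite_lessThan])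
  also have "... = (\<Sum>n\<in>?P. (c n * \<Omega> (m + n)) * (c n * \<Omega> (m + n)))"
   unfolding der using finV v0 by (simp add: mult_ac)
  also have "... = (\<Sum>n\<in>?P. c n * \<Omega> (m + n)) * (\<Sum>n\<in>?P. c n * \<Omega> (m + n))"
   by (rule sum_square[OF finP, symmetric])
  finally show ?thesis by simp
 qed
 \<comment> \<open>The shifts of \<open>\<Omega>\<close> generate degree \<open>j\<close> of the
   kernel, so a functional that kills them kills \<open>f\<close>.\<close>
 have "sp {} j f" by (rule span_volume) (use f j empty_face in \<open>auto simp: KK_def\<close>)
 then obtain M e where Me: "finite M" "\<And>m. m \<in> M ==> size m + j = d"
  "\<And>n. size n = j ==> f n = (\<Sum>m\<in>M. e m * \<Omega> (m + n))"
  by (auto simp: sp_def \<Omega>at_def)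
 have "(\<Sum>n\<in>?P. c n * f n) = (\<Sum>n\<in>?P. \<Sum>m\<in>M. e m * (c n * \<Omega> (m + n)))"
  by (rule sum.cong) (simp_all add: Me(3) sum_distrib_left mult.left_commute)
 also have "... = (\<Sum>m\<in>M. \<Sum>n\<in>?P. e m * (c n * \<Omega> (m + n)))" by (rule sum.swap)
 also have "... = 0"
  using van Me(2) by (simp add: sum_distrib_left[symmetric])
 finally show False using cf by simp
qed

end

subsection \<open>A field with enough derivations\<close>

text \<open>The polynomials over the two-element field form only a domain; the class passes
  characteristic two on to the fraction field.\<close>

class char_two_idom = idom +
 assumes one_plus_one_idom: "1 + 1 = 0"

lemma idom_add_self [simp]: "x + x = (0::'r::char_two_idom)"
proof -
 have "x + x = x * (1 + 1)" by (simp only: distrib_left mult_1_right)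
 thus ?thesis by (simp only: one_plus_one_idom mult_zero_right)
qed

instance bit :: char_two
 by standard simp

instance poly_mapping :: ("{ordered_cancel_comm_monoid_add, linorder}", char_two) char_two_idom
 by standard (rule pm_add_self)

instance fract :: (char_two_idom) char_two
 by standard (simp add: One_fract_def Zero_fract_def one_plus_one_idom)

lemma pm_induct [case_names zero add single]:
 fixes c :: "'b \<Rightarrow>\<^sub>0 'k::char_two"
 assumes "P 0" "\<And>c d. P c ==> P d ==> P (c + d)" "\<And>X a. P (single X a)"
 shows "P c"
proof -
 have "sc a (single X b) = single X (a * b)" for a b :: 'k and X :: 'b
  by (rule poly_mapping_eqI) (simp add: lookup_single when_def)
 hence "c = (\<Sum>X\<in>keys c. single X (lookup c X))"
  using lin_ident[of c] by (simp add: lin_def)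
 moreover have "P (\<Sum>X\<in>S. single X (lookup c X))" for S
  by (induction S rule: infinite_finite_induct) (use assms in auto)
 ultimately show ?thesis by metis
qed

type_synonym polys = "(nat \<Rightarrow>\<^sub>0 nat) \<Rightarrow>\<^sub>0 bit"

definition pdiff :: "nat => polys => polys" where
 "pdiff i = lin (\<lambda>m. single (m - single i 1) (of_nat (lookup m i)))"

lemma pdiff_add: "pdiff i (p + q) = pdiff i p + pdiff i q"
 by (simp add: pdiff_def lin_add)

lemma pdiff_0 [simp]: "pdiff i 0 = 0"
 by (simp add: pdiff_def)

lemma pdiff_single:
 "pdiff i (single m c)
  = single (m - single i 1) (c * of_nat (lookup m i))"
 unfolding pdiff_def lin_single by (rule poly_mapping_eqI) (simp add: lookup_single when_def)

lemma monomial_diff_add: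
 "0 < lookup a i ==> a - single i 1 + b = a + b - single i (1::nat)"
 by (rule poly_mapping_eqI) (auto simp: lookup_add lookup_minus lookup_single when_def)

lemma pdiff_mult: "pdiff i (p * q) = pdiff i p * q + p * pdiff i q"
proof (induction p rule: pm_induct)
 case (single a x)
 show ?case
 proof (induction q rule: pm_induct)
  case (single b y)
  let ?e = "single i (1::nat)"
  have A: "single (a - ?e + b) (x * of_nat (lookup a i) * y)
    = single (a + b - ?e) (x * of_nat (lookup a i) * y)"
   by (cases "0 < lookup a i") (simp_all add: monomial_diff_add[simplified])
  have B: "single (a + (b - ?e)) (x * (y * of_nat (lookup b i)))
    = single (a + b - ?e) (x * (y * of_nat (lookup b i)))"
   using monomial_diff_add[of b i a, simplified] by (cases "0 < lookup b i") (simp_all add: add.commute)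
  show ?case
   unfolding mult_single pdiff_single A B single_add[symmetric] lookup_add of_nat_add
   by (simp only: distrib_left mult_ac)
 qed (simp_all add: pdiff_add algebra_simps)
qed (simp_all add: pdiff_add algebra_simps)

lemma pdiff_commute: "pdiff i (pdiff j p) = pdiff j (pdiff i p)"
proof (induction p rule: pm_induct)
 case (single m c)
 show ?case
 proof (cases "i = j")
  case False
  have "m - single j 1 - single i (1::nat) = m - single i 1 - single j 1"
   by (rule poly_mapping_eqI) (simp add: lookup_minus)
  thus ?thesis using False by (simp add: pdiff_single lookup_minus lookup_single mult_ac)
 qed simp
qed (simp_all add: pdiff_add)

text \<open>Since squares are constants in characteristic two, the quotient rule takes the form
 \<open>D (x / y) = D (x y) / y\<^sup>2\<close>.\<close>

definition fder :: "('r => 'r) => 'r::char_two_idom fract => 'r fract" where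
 "fder D x = (THE y. \<forall>a b. b \<noteq> 0 --> x = Fract a b --> y = Fract (D (a * b)) (b * b))"

lemma deriv_square:
 fixes D :: "'r::char_two_idom => 'r"
 assumes "\<And>x y. D (x * y) = D x * y + x * D y"
 shows "D (x * (y * y)) = D x * (y * y)"
proof -
 have "D (y * y) = 0" unfolding assms by (simp add: mult.commute)
 thus ?thesis by (simp add: assms[of x "y * y"])
qed

text \<open>Well-definedness: comparing two representations involves only the squares of the
  denominators, which pass through \<open>D\<close>.\<close>

lemma fder_Fract:
 fixes D :: "'r::char_two_idom => 'r"
 assumes mult: "\<And>x y. D (x * y) = D x * y + x * D y" and b: "b \<noteq> 0"
 shows "fder D (Fract a b) = Fract (D (a * b)) (b * b)"
 unfolding fder_def
proof (rule the_equality)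
 show "\<forall>a' b'. b' \<noteq> 0 --> Fract a b = Fract a' b' --> Fract (D (a * b)) (b * b) = Fract (D (a' * b')) (b' * b')"
 proof (intro allI impI)
  fix a' b' assume b': "b' \<noteq> 0" and e: "Fract a b = Fract a' b'"
  have ab: "a * b' = a' * b" using e b b' by (simp add: eq_fract)
  have "a * b * (b' * b') = (a * b') * (b * b')" by (simp only: mult_ac)
  also have "... = a' * b' * (b * b)" unfolding ab by (simp only: mult_ac)
  finally have "D (a * b) * (b' * b') = D (a' * b') * (b * b)"
   by (simp only: deriv_square[of D, OF mult, symmetric])
  thus "Fract (D (a * b)) (b * b) = Fract (D (a' * b')) (b' * b')"
   using b b' by (simp add: eq_fract)
 qed
qed (use b in blast)

lemma Fract_product_rule:
 assumes "b \<noteq> 0" "d \<noteq> 0"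
 shows "Fract (P * (c * d) + (a * b) * Q) (b * d * (b * d))
  = Fract (P * c) (b * b * d) + Fract (a * Q) (b * (d * d) :: 'r::idom)"
proof -
 have "(P * (c * d) + (a * b) * Q) * (b * b * d * (b * (d * d)))
   = (P * c * (b * (d * d)) + a * Q * (b * b * d)) * (b * d * (b * d))"
  by (simp only: distrib_right distrib_left mult_ac)
 thus ?thesis using assms by (simp add: eq_fract)
qed

lemma fder_props:
 fixes D :: "'r::char_two_idom => 'r"
 assumes add: "\<And>x y. D (x + y) = D x + D y" and mult: "\<And>x y. D (x * y) = D x * y + x * D y"
 shows "fder D (x + y) = fder D x + fder D y" and "fder D (x * y) = fder D x * y + x * fder D y"
proof -
 note sq = deriv_square[of D, OF mult]
 obtain a b where x: "x = Fract a b" "b \<noteq> 0" by (cases x)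
 obtain c d where y: "y = Fract c d" "d \<noteq> 0" by (cases y)
 have "(a * d + c * b) * (b * d) = a * b * (d * d) + c * d * (b * b)" by (simp add: algebra_simps)
 hence "D ((a * d + c * b) * (b * d)) = D (a * b) * (d * d) + D (c * d) * (b * b)"
  by (simp only: add sq)
 thus "fder D (x + y) = fder D x + fder D y"
  using x y by (simp add: fder_Fract[of D, OF mult] mult_ac)
 have "(a * c) * (b * d) = (a * b) * (c * d)" by (simp only: mult_ac)
 hence "D ((a * c) * (b * d)) = D (a * b) * (c * d) + (a * b) * D (c * d)"
  by (simp only: mult)
 note e = this
 have "fder D (x * y) = Fract (D ((a * c) * (b * d))) (b * d * (b * d))"
  unfolding x(1) y(1) mult_fract by (rule fder_Fract[of D, OF mult]) (use x y in simp)
 also have "... = Fract (D (a * b) * c) (b * b * d) + Fract (a * D (c * d)) (b * (d * d))"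
  unfolding e by (rule Fract_product_rule[OF x(2) y(2)])
 also have "... = fder D x * y + x * fder D y"
  unfolding x(1) y(1) fder_Fract[of D, OF mult x(2)] fder_Fract[of D, OF mult y(2)] mult_fract ..
 finally show "fder D (x * y) = fder D x * y + x * fder D y" .
qed

lemma fder_commute:
 fixes D :: "'r::char_two_idom => 'r"
 assumes D: "\<And>x y. D (x * y) = D x * y + x * D y" and E: "\<And>x y. E (x * y) = E x * y + x * E y"
  and c: "\<And>x. D (E x) = E (D x)"
 shows "fder D (fder E x) = fder E (fder D x)"
proof -
 obtain a b where x: "x = Fract a b" "b \<noteq> 0" by (cases x)
 have "D (E (a * b) * (b * b)) = E (D (a * b) * (b * b))"
  by (simp only: deriv_square[of D, OF D] deriv_square[of E, OF E] c)
 thus ?thesis using x by (simp add: fder_Fract[of D, OF D] fder_Fract[of E, OF E])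
qed

definition var :: "nat => polys fract" where
 "var n = Fract (single (single n 1) 1) 1"

lemma pdiff_var: "pdiff i (single (single n 1) 1) = (if n = i then 1 else 0)"
proof (cases "n = i")
 case True
 thus ?thesis by (simp only: pdiff_single lookup_single_eq cancel_comm_monoid_add_class.diff_cancel simp_thms if_True mult_1 of_nat_1 single_one)
next
 case False
 hence "lookup (single n (1::nat)) i = 0" by (simp add: lookup_single when_def)
 thus ?thesis using False by (simp only: pdiff_single of_nat_0 mult_zero_right single_zero if_False)
qed

lemma fder_var: "fder (pdiff i) (var n) = (if n = i then 1 else 0)"
proof -
 have "fder (pdiff i) (var n) = Fract (pdiff i (single (single n 1) 1 * 1)) (1 * 1)"
  unfolding var_def by (rule fder_Fract[of "pdiff i", OF pdiff_mult]) (rule one_neq_zero)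
 thus ?thesis unfolding mult_1_right pdiff_var by (simp only: One_fract_def Zero_fract_def if_distrib[of "\<lambda>x. Fract x 1"])
qed

text \<open>The entries are distinct variables, numbered by pairs of a row and a number for the
  vertex.\<close>

lemma generic_complex_exists:
 fixes \<Delta> :: "'a set set"
 assumes H: "hsphere TYPE(polys fract) d \<Delta>"
 obtains r del where "generic_complex \<Delta> d (r :: nat => 'a option => polys fract) del"
proof -
 let ?U = "insert None (Some ` \<Union>\<Delta>)"
 have "abstract_complex \<Delta>" using H by (simp only: hsphere_def)
 hence "finite ?U" using abstract_complexD(6) by blast
 then obtain \<iota> :: "'a option => nat" where \<iota>: "inj_on \<iota> ?U"
  using finite_imp_inj_to_nat_seg[OF \<open>finite ?U\<close>] by (elim exE conjE) meson
 have "generic_complex \<Delta> d (\<lambda>i w. var (prod_encode (i, \<iota> w))) (\<lambda>i w. fder (pdiff (prod_encode (i, \<iota> w))))"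
 proof (unfold_locales, goal_cases)
  case (1 i w x y)
  show ?case by (rule fder_props(1)) (simp_all add: pdiff_add pdiff_mult)
 next
  case (2 i w x y)
  show ?case by (rule fder_props(2)) (simp_all add: pdiff_add pdiff_mult)
 next
  case (3 i w j u x)
  show ?case by (rule fder_commute) (simp_all add: pdiff_mult pdiff_commute)
 next
  case (4 i j w u)
  have "\<iota> u = \<iota> w \<longleftrightarrow> u = w" by (rule inj_on_eq_iff[OF \<iota> 4(4) 4(3)])
  thus ?case by (simp add: fder_var prod_encode_eq)
 next
  case 5
  show ?case by (rule H)
 qed
 thus ?thesis by (rule that)
qed

subsection \<open>Dimensions and leading monomials\<close>

text \<open>Stated for a subspace \<open>W\<close> inside a finite span, because it will be applied
  in function spaces on infinitely many monomials.\<close>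

lemma (in vector_space_pair) rank_nullity:
 assumes f: "Vector_Spaces.linear s1 s2 f" and W: "vs1.subspace W" and A: "finite A" "W \<subseteq> vs1.span A"
 shows "vs1.dim W = vs1.dim {x \<in> W. f x = 0} + vs2.dim (f ` W)"
proof -
 interpret f: Vector_Spaces.linear s1 s2 f by (rule f)
 let ?K = "{x \<in> W. f x = 0}"
 obtain B0 where B0: "B0 \<subseteq> ?K" "vs1.independent B0" "?K \<subseteq> vs1.span B0"
  by (rule vs1.basis_exists[of ?K])
 obtain B where B: "B0 \<subseteq> B" "B \<subseteq> W" "vs1.independent B" "W \<subseteq> vs1.span B"
  using vs1.maximal_independent_subset_extend[of B0 W] B0 by blast
 have finB: "finite B" using vs1.independent_span_bound[OF A(1) B(3)] B(2) A(2) by auto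
 let ?C = "B - B0"
 have indC: "vs1.independent ?C" using B(3) by (rule vs1.independent_mono) auto
 have inj: "inj_on f (vs1.span ?C)"
  unfolding f.inj_on_iff_eq_0[OF vs1.subspace_span]
 proof (intro ballI impI)
  fix x assume x: "x \<in> vs1.span ?C" "f x = 0"
  have "vs1.span ?C \<subseteq> W" using B(2) W by (intro vs1.span_minimal) auto
  hence x0: "x \<in> vs1.span B0" using x B0(3) by auto
  have "vs1.representation B x = vs1.representation ?C x"
   by (rule vs1.representation_extend[OF B(3) x(1)]) auto
  moreover have "vs1.representation B x = vs1.representation B0 x"
   by (rule vs1.representation_extend[OF B(3) x0 B(1)])
  ultimately have "vs1.representation B x b = 0" for b
   using vs1.representation_ne_zero[of ?C x b] vs1.representation_ne_zero[of B0 x b] by auto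
  moreover have "x \<in> vs1.span B" using x0 vs1.span_mono[OF B(1)] by auto
  ultimately show "x = 0" using vs1.sum_nonzero_representation_eq[OF B(3), of x] by simp
 qed
 have injC: "inj_on f ?C" using inj vs1.span_superset by (rule inj_on_subset)
 have "vs2.independent (f ` ?C)" by (rule f.independent_injective_image[OF indC inj])
 moreover have "f ` W \<subseteq> vs2.span (f ` ?C)"
 proof -
  have "f ` B \<subseteq> vs2.span (f ` ?C)"
  proof
   fix y assume "y \<in> f ` B"
   then obtain b where b: "b \<in> B" "y = f b" by blast
   show "y \<in> vs2.span (f ` ?C)"
   proof (cases "b \<in> B0")
    case True
    hence "y = 0" using B0(1) b(2) by auto
    thus ?thesis by (simp only: vs2.span_zero)
   next
    case False
    thus ?thesis using b by (intro vs2.span_base) blast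
   qed
  qed
  hence "vs2.span (f ` B) \<subseteq> vs2.span (f ` ?C)" by (simp add: vs2.span_minimal)
  thus ?thesis using B(4) f.span_image[of B] by blast
 qed
 ultimately have "vs2.dim (f ` W) = card (f ` ?C)"
  using B(2) by (intro vs2.dim_unique[of "f ` ?C"]) auto
 moreover have "vs1.dim W = card B" using B by (intro vs1.dim_unique[of B]) auto
 moreover have "vs1.dim ?K = card B0" using B0 by (intro vs1.dim_unique[of B0]) auto
 moreover have "card ?C = card B - card B0" "card B0 \<le> card B"
  using finB B(1) by (auto simp: card_Diff_subset finite_subset card_mono)
 ultimately show ?thesis using card_image[OF injC] by simp
qed

definition scl :: "'k::field => ('b => 'k) => 'b => 'k" where
 "scl c f = (\<lambda>x. c * f x)"

interpretation fv: vector_space scl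
 by standard (auto simp: scl_def fun_eq_iff algebra_simps)

interpretation fvp: vector_space_pair scl scl
 by standard

lemma subsp_iff: "subsp W \<longleftrightarrow> fv.subspace W"
 by (auto simp: subsp_def fv.subspace_def scl_def zero_fun_def plus_fun_def)

definition fdim :: "('b => 'k::field) set => nat" where "fdim W = fv.dim W"

lemma sum_fun_apply: "(\<Sum>i\<in>S. g i) x = (\<Sum>i\<in>S. g i x :: 'k::comm_monoid_add)"
 by (induction S rule: infinite_finite_induct) simp_all

lemma supported_in_span:
 assumes "finite P" "\<And>x. f x \<noteq> 0 ==> x \<in> P"
 shows "f \<in> fv.span ((\<lambda>p x. if x = p then 1 else 0 :: 'k::field) ` P)"
proof -
 have "f = (\<Sum>p\<in>P. scl (f p) (\<lambda>x. if x = p then 1 else 0))"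
 proof
  fix x
  have "(\<Sum>p\<in>P. scl (f p) (\<lambda>x. if x = p then 1 else 0)) x = (\<Sum>p\<in>P. if p = x then f p else 0)"
   unfolding sum_fun_apply scl_def by (rule sum.cong) auto
  also have "... = f x" using assms by auto
  finally show "f x = (\<Sum>p\<in>P. scl (f p) (\<lambda>x. if x = p then 1 else 0)) x" by simp
 qed
 moreover have "(\<Sum>p\<in>P. scl (f p) (\<lambda>x. if x = p then 1 else 0)) \<in> fv.span ((\<lambda>p x. if x = p then 1 else 0 :: 'k) ` P)"
  by (intro fv.span_sum fv.span_scale fv.span_base) simp
 ultimately show ?thesis by simp
qed

lemma fdim_rank_nullity:
 fixes T :: "('b => 'k::field) => 'c => 'k"
 assumes "finite P" "\<And>f x. f \<in> W ==> f x \<noteq> 0 ==> x \<in> P" "subsp W"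
  and "\<And>f g. T (\<lambda>x. f x + g x) = (\<lambda>y. T f y + T g y)" "\<And>c f. T (\<lambda>x. c * f x) = (\<lambda>y. c * T f y)"
 shows "fdim W = fdim {f \<in> W. T f = (\<lambda>_. 0)} + fdim (T ` W)"
proof -
 have "Vector_Spaces.linear scl scl T"
  unfolding Vector_Spaces.linear_iff
 proof (intro conjI allI)
  show "T (x + y) = T x + T y" for x y by (simp add: plus_fun_def assms(4))
  show "T (scl c x) = scl c (T x)" for c x by (simp add: scl_def assms(5))
 qed (rule fv.vector_space_axioms)+
 moreover have "W \<subseteq> fv.span ((\<lambda>p x. if x = p then 1 else 0) ` P)"
  using supported_in_span[OF assms(1)] assms(2) by blast
 ultimately show ?thesis
  using fvp.rank_nullity[of T W] assms(1,3) unfolding fdim_def subsp_iff zero_fun_def by blast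
qed

lemma fdim_zero: "fdim {\<lambda>_. 0} = 0"
 using fv.dim_eq_card[of "{}" "{\<lambda>_. 0}"] by (simp add: fdim_def fv.span_empty fv.span_singleton scl_def zero_fun_def image_constant_conv fv.independent_empty)

text \<open>The leading monomials with respect to the order given by \<open>\<rho>\<close>.\<close>

definition pivots :: "('b => 'o::linorder) => ('b => 'k::field) set => 'b set" where
 "pivots \<rho> W = {p. \<exists>f\<in>W. f p \<noteq> 0 \<and> (\<forall>q. f q \<noteq> 0 --> \<rho> q \<le> \<rho> p)}"

text \<open>The vectors that vanish at the largest position \<open>p\<close> have codimension one if
  \<open>p\<close> is a pivot and zero otherwise; their pivots are the remaining ones.\<close>

lemma fdim_pivots:
 fixes W :: "('b => 'k::field) set" and \<rho> :: "'b => 'o::linorder"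
 assumes "finite P" "inj_on \<rho> P" "\<And>f x. f \<in> W ==> f x \<noteq> 0 ==> x \<in> P" "subsp W"
 shows "fdim W = card (pivots \<rho> W) \<and> finite (pivots \<rho> W)"
 using assms
proof (induction P arbitrary: W rule: finite_ranking_induct[where f = \<rho>])
 case empty
 have "f = (\<lambda>_. 0)" if "f \<in> W" for f using empty.prems(2)[OF that] by auto
 hence "W = {\<lambda>_. 0}" using subspD(1)[OF empty.prems(3)] by blast
 thus ?case by (simp add: fdim_zero pivots_def)
next
 case (insert p P)
 note W = subspD[OF insert.prems(3)]
 let ?W = "{f \<in> W. f p = 0}" and ?T = "\<lambda>f x. if x = p then f p else (0::'k)"
 have "finite (insert p P)" using insert.hyps by simp
 hence "fdim W = fdim {f \<in> W. ?T f = (\<lambda>_. 0)} + fdim (?T ` W)"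
  by (rule fdim_rank_nullity) (use insert.prems in \<open>auto simp: fun_eq_iff\<close>)
 moreover have "{f \<in> W. ?T f = (\<lambda>_. 0)} = ?W" by (auto simp: fun_eq_iff)
 ultimately have dimW: "fdim W = fdim ?W + fdim (?T ` W)" by simp
 have IH: "fdim ?W = card (pivots \<rho> ?W) \<and> finite (pivots \<rho> ?W)"
 proof (rule insert.IH)
  show "inj_on \<rho> P" using insert.prems(1) by simp
  show "x \<in> P" if "f \<in> ?W" "f x \<noteq> 0" for f x using insert.prems(2)[of f x] that by auto
  show "subsp ?W" using W by (auto simp: subsp_def)
 qed
 show ?case
 proof (cases "\<exists>f\<in>W. f p \<noteq> 0")
  case False
  hence "?W = W" by auto
  thus ?thesis using IH by simp
 next
  case True
  then obtain f0 where f0: "f0 \<in> W" "f0 p \<noteq> 0" by blast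
  let ?\<delta> = "\<lambda>x. if x = p then 1 else (0::'k)"
  have "?T ` W = range (\<lambda>c. scl c ?\<delta>)"
  proof (intro equalityI subsetI)
   fix y assume "y \<in> range (\<lambda>c. scl c ?\<delta>)"
   then obtain c where c: "y = scl c ?\<delta>" by blast
   have "?T (\<lambda>x. (c / f0 p) * f0 x) \<in> ?T ` W" by (rule imageI) (rule W(3)[OF f0(1)])
   moreover have "?T (\<lambda>x. (c / f0 p) * f0 x) = y" using f0(2) by (auto simp: c scl_def)
   ultimately show "y \<in> ?T ` W" by (rule back_subst)
  qed (auto simp: scl_def fun_eq_iff intro!: image_eqI)
  hence "?T ` W = fv.span {?\<delta>}" by (simp add: fv.span_singleton)
  moreover have "?\<delta> \<noteq> 0" by (simp add: fun_eq_iff)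
  ultimately have "fdim (?T ` W) = 1"
   using fv.dim_span_eq_card_independent[of "{?\<delta>}"] by (simp add: fdim_def)
  moreover have "pivots \<rho> W = insert p (pivots \<rho> ?W)"
  proof (intro equalityI subsetI)
   fix q assume "q \<in> pivots \<rho> W"
   then obtain f where f: "f \<in> W" "f q \<noteq> 0" "\<And>x. f x \<noteq> 0 ==> \<rho> x \<le> \<rho> q" by (auto simp: pivots_def)
   show "q \<in> insert p (pivots \<rho> ?W)"
   proof (cases "f p = 0")
    case True
    thus ?thesis using f by (auto simp: pivots_def)
   next
    case False
    have q: "q \<in> insert p P" by (rule insert.prems(2)[OF f(1,2)])
    hence "\<rho> q = \<rho> p" using f(3)[OF False] insert.hyps by (auto intro: antisym)
    hence "q = p" using q insert.prems(1) by (auto simp: inj_on_def)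
    thus ?thesis by simp
   qed
  next
   fix q assume "q \<in> insert p (pivots \<rho> ?W)"
   moreover have "p \<in> pivots \<rho> W"
    unfolding pivots_def using f0 insert.prems(2)[OF f0(1)] insert.hyps by blast
   ultimately show "q \<in> pivots \<rho> W" by (auto simp: pivots_def)
  qed
  moreover have "p \<notin> pivots \<rho> ?W" by (auto simp: pivots_def)
  ultimately show ?thesis using dimW IH by simp
 qed
qed

text \<open>The coefficient of \<open>t^j\<close> in \<open>(t / (1 - t))^i\<close>, which counts
  the monomials of degree \<open>j\<close> whose support is a given set of \<open>i\<close>
  vertices.\<close>

fun supp_count :: "nat => nat => nat" where
 "supp_count 0 0 = 1"
| "supp_count 0 (Suc j) = 0"
| "supp_count (Suc i) 0 = 0"
| "supp_count (Suc i) (Suc j) = supp_count (Suc i) j + supp_count i j"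

lemma card_supp_count: "finite F ==> card {m. set_mset m = F \<and> size m = j} = supp_count (card F) j"
proof (induction j arbitrary: F)
 case 0
 show ?case
 proof (cases "F = {}")
  case True
  hence "{m. set_mset m = F \<and> size m = 0} = {{#}}" by auto
  thus ?thesis using True by simp
 next
  case False
  hence "{m. set_mset m = F \<and> size m = 0} = {}" by auto
  moreover obtain i where "card F = Suc i" using False 0 by (metis card_eq_0_iff not0_implies_Suc)
  ultimately show ?thesis by simp
 qed
next
 case (Suc j)
 show ?case
 proof (cases "F = {}")
  case True
  hence "{m. set_mset m = F \<and> size m = Suc j} = {}" by auto
  thus ?thesis using True by simp
 next
  case False
  then obtain x where x: "x \<in> F" by blast
  have fin: "finite {m. set_mset m = G \<and> size m = j}" if "finite G" for G :: "'a set"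
   using finite_multisets[OF that, of j] by (rule rev_finite_subset) auto
  have "{m. set_mset m = F \<and> size m = Suc j}
    = add_mset x ` {m. set_mset m = F \<and> size m = j} \<union> add_mset x ` {m. set_mset m = F - {x} \<and> size m = j}" (is "?L = ?R")
  proof (intro equalityI subsetI)
   fix m assume m: "m \<in> ?L"
   then obtain n where n: "m = add_mset x n" using x by (metis (mono_tags) mem_Collect_eq multi_member_split)
   show "m \<in> ?R"
   proof (cases "x \<in># n")
    case True
    hence "set_mset n = F" using m n by auto
    thus ?thesis using m n by simp
   next
    case False
    hence "set_mset n = F - {x}" using m n by auto
    thus ?thesis using m n by simp
   qed
  next
   fix m assume "m \<in> ?R"
   then obtain n where n: "m = add_mset x n" "size n = j" "set_mset n = F \<or> set_mset n = F - {x}" by blast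
   hence "insert x (set_mset n) = F" using x by blast
   thus "m \<in> ?L" using n by simp
  qed
  moreover have "card (add_mset x ` S) = card S" for S by (rule card_image) (simp add: inj_on_def)
  moreover have "card (add_mset x ` {m. set_mset m = F \<and> size m = j} \<union> add_mset x ` {m. set_mset m = F - {x} \<and> size m = j})
   = card (add_mset x ` {m. set_mset m = F \<and> size m = j}) + card (add_mset x ` {m. set_mset m = F - {x} \<and> size m = j})"
  proof (rule card_Un_disjoint)
   show "add_mset x ` {m. set_mset m = F \<and> size m = j} \<inter> add_mset x ` {m. set_mset m = F - {x} \<and> size m = j} = {}"
   proof (rule equals0I)
    fix m assume "m \<in> add_mset x ` {m. set_mset m = F \<and> size m = j} \<inter> add_mset x ` {m. set_mset m = F - {x} \<and> size m = j}"
    then obtain n n' where "set_mset n = F" "set_mset n' = F - {x}" "add_mset x n = add_mset x n'" by blast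
    hence "x \<notin> F" by (metis DiffD2 add_mset_add_mset_same_iff singletonI)
    thus False using x by blast
   qed
  qed (simp_all add: fin Suc.prems)
  moreover obtain i where "card F = Suc i" using False Suc.prems by (metis card_eq_0_iff not0_implies_Suc)
  ultimately show ?thesis using Suc x by simp
 qed
qed

text \<open>The same coefficient after multiplication by \<open>(1 - t)^r\<close>, which is the
  effect of \<open>r\<close> coregular forms on the Hilbert series.\<close>

fun reduced_count :: "nat => nat => nat => int" where
 "reduced_count i 0 j = int (supp_count i j)"
| "reduced_count i (Suc r) 0 = reduced_count i r 0"
| "reduced_count i (Suc r) (Suc j) = reduced_count i r (Suc j) - reduced_count i r j"

lemma reduced_count_empty: "reduced_count 0 r j = (-1) ^ j * int (r choose j)"
proof (induction r arbitrary: j)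
 case 0
 thus ?case by (cases j) auto
next
 case (Suc r)
 thus ?case by (cases j) (auto simp: algebra_simps)
qed

lemma reduced_count_degree_0: "reduced_count (Suc i) r 0 = 0"
 by (induction r) auto

text \<open>One denominator \<open>1 - t\<close> cancels against the new factor and a factor
  \<open>t\<close> is left.\<close>

lemma reduced_count_Suc: "reduced_count (Suc i) (Suc r) (Suc j) = reduced_count i r j"
proof (induction r arbitrary: j)
 case (Suc r)
 show ?case
 proof (cases j)
  case 0
  thus ?thesis using Suc[of 0] reduced_count_degree_0[of i "Suc r"] by simp
 next
  case (Suc j')
  thus ?thesis using Suc.IH[of j] Suc.IH[of j'] by simp
 qed
qed simp

lemma reduced_count_eq:
 "i \<le> d ==> reduced_count i d j = (if i \<le> j then (-1) ^ (j - i) * int ((d - i) choose (j - i)) else 0)"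
proof (induction i arbitrary: d j)
 case 0
 thus ?case by (simp add: reduced_count_empty)
next
 case (Suc i)
 then obtain d' where d: "d = Suc d'" by (cases d) auto
 show ?case
 proof (cases j)
  case 0
  thus ?thesis by (simp add: reduced_count_degree_0)
 next
  case (Suc j')
  thus ?thesis using Suc.IH[of d' j'] Suc.prems d by (simp add: reduced_count_Suc del: reduced_count.simps)
 qed
qed

section \<open>Hilbert function of the dual ring and kernel of the Lefschetz map\<close>

context lsop
begin

lemma finite_mons: "finite {n. set_mset n \<subseteq> V \<and> size n = j}"
 by (rule finite_multisets[OF finV])

lemma KK_mons: "f \<in> KK q j ==> f m \<noteq> 0 ==> m \<in> {n. set_mset n \<subseteq> V \<and> size n = j}"
 using KK_support by blast

lemma \<theta>_scale: "\<theta> r (\<lambda>m. c * f m) = (\<lambda>m. c * \<theta> r f m)"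
 by (simp add: lower_def fun_eq_iff sum_distrib_left mult.left_commute)

text \<open>Coregularity makes form \<open>q\<close> map onto the next lower degree, so this is rank
  and nullity.\<close>

lemma fdim_KK_step:
 assumes q: "q < d"
 shows "fdim (KK q (Suc j)) = fdim (KK (Suc q) (Suc j)) + fdim (KK q j)"
proof -
 have "fdim (KK q (Suc j)) = fdim {f \<in> KK q (Suc j). \<theta> q f = (\<lambda>_. 0)} + fdim (\<theta> q ` KK q (Suc j))"
  by (rule fdim_rank_nullity[OF finite_mons KK_mons subsp_KK \<theta>_add \<theta>_scale])
 moreover have "{f \<in> KK q (Suc j). \<theta> q f = (\<lambda>_. 0)} = KK (Suc q) (Suc j)"
  by (auto simp: KK_def kerl_def less_Suc_eq)
 moreover have "\<theta> q ` KK q (Suc j) = KK q j"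
 proof
  show "\<theta> q ` KK q (Suc j) \<subseteq> KK q j" by (auto intro: lower_KK)
  show "KK q j \<subseteq> \<theta> q ` KK q (Suc j)"
  proof
   fix f assume "f \<in> KK q j"
   then obtain g where "g \<in> L {} (Suc j)" "kerl q g" "\<theta> q g = f"
    using coreg_QQ[OF empty_face] q unfolding coreg_def KK_def by blast
   thus "f \<in> \<theta> q ` KK q (Suc j)" by (auto simp: KK_def)
  qed
 qed
 ultimately show ?thesis by simp
qed

lemma fdim_KK_degree_0: "fdim (KK (Suc q) 0) = fdim (KK q 0)"
proof -
 have "\<theta> i f = (\<lambda>_. 0)" if "f \<in> L {} 0" for f i
 proof
  fix n
  have "f (add_mset v n) = 0" for v using L_D(2)[OF that, of "add_mset v n"] by auto
  thus "\<theta> i f n = 0" by (simp add: lower_def)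
 qed
 hence "KK (Suc q) 0 = KK q 0" by (auto simp: KK_def kerl_def)
 thus ?thesis by simp
qed

lemma fdim_KK_0: "int (fdim (KK 0 j)) = (\<Sum>F\<in>\<Delta>. reduced_count (card F) 0 j)"
proof -
 have "finite \<Delta>" using \<Delta> by (simp add: abstract_complex_def)
 obtain \<iota> :: "'a multiset => nat" where \<iota>: "inj_on \<iota> {n. set_mset n \<subseteq> V \<and> size n = j}"
  using finite_imp_inj_to_nat_seg[OF finite_mons[of j]] by (elim exE conjE) meson
 have "pivots \<iota> (KK 0 j) = {m. set_mset m \<in> \<Delta> \<and> size m = j}"
 proof (intro equalityI subsetI)
  fix m assume "m \<in> pivots \<iota> (KK 0 j)"
  thus "m \<in> {m. set_mset m \<in> \<Delta> \<and> size m = j}" using KK_support by (fastforce simp: pivots_def)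
 next
  fix m assume "m \<in> {m. set_mset m \<in> \<Delta> \<and> size m = j}"
  hence "(\<lambda>n. if n = m then 1 else 0) \<in> KK 0 j" by (simp add: KK_def L_def kerl_def)
  thus "m \<in> pivots \<iota> (KK 0 j)" unfolding pivots_def by (intro CollectI bexI) auto
 qed
 hence "fdim (KK 0 j) = card {m. set_mset m \<in> \<Delta> \<and> size m = j}"
  using fdim_pivots[OF finite_mons \<iota> KK_mons subsp_KK, of 0] by simp
 also have "{m. set_mset m \<in> \<Delta> \<and> size m = j} = (\<Union>F\<in>\<Delta>. {m. set_mset m = F \<and> size m = j})" by auto
 also have "card ... = (\<Sum>F\<in>\<Delta>. card {m. set_mset m = F \<and> size m = j})"
 proof (rule card_UN_disjoint[OF \<open>finite \<Delta>\<close>])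
  show "\<forall>F\<in>\<Delta>. finite {m. set_mset m = F \<and> size m = j}"
   using finite_mons[of j] by (auto intro: rev_finite_subset)
 qed auto
 also have "... = (\<Sum>F\<in>\<Delta>. supp_count (card F) j)"
  by (rule sum.cong) (use fin card_supp_count in auto)
 finally show ?thesis by simp
qed

lemma fdim_KK: "q \<le> d ==> int (fdim (KK q j)) = (\<Sum>F\<in>\<Delta>. reduced_count (card F) q j)"
proof (induction q arbitrary: j)
 case 0
 show ?case by (rule fdim_KK_0)
next
 case (Suc q)
 show ?case
 proof (cases j)
  case 0
  thus ?thesis using Suc fdim_KK_degree_0 by simp
 next
  case (Suc j')
  hence "int (fdim (KK (Suc q) j)) = int (fdim (KK q j)) - int (fdim (KK q j'))"
   using fdim_KK_step[of q j'] Suc.prems by simp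
  thus ?thesis using Suc.IH[of j] Suc.IH[of j'] Suc.prems Suc by (simp add: sum_subtractf)
 qed
qed

text \<open>The Hilbert series is the sum of \<open>t^i (1 - t)^(d - i)\<close> over the faces with
  \<open>i\<close> vertices, and the h-numbers are its coefficients.\<close>

lemma fdim_KK_h: "int (fdim (KK d j)) = h_num d \<Delta> j"
proof -
 have fin: "finite \<Delta>" using \<Delta> by (simp add: abstract_complex_def)
 have "int (fdim (KK d j)) = (\<Sum>F\<in>\<Delta>. if card F \<le> j then (-1) ^ (j - card F) * int ((d - card F) choose (j - card F)) else 0)"
  unfolding fdim_KK[OF order_refl] by (rule sum.cong) (use dim reduced_count_eq in auto)
 also have "... = (\<Sum>F\<in>{F \<in> \<Delta>. card F \<in> {0..j}}. (-1) ^ (j - card F) * int ((d - card F) choose (j - card F)))"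
  by (rule sum.mono_neutral_cong_right) (use fin in auto)
 also have "... = (\<Sum>i=0..j. \<Sum>F\<in>{F \<in> {F \<in> \<Delta>. card F \<in> {0..j}}. card F = i}. (-1) ^ (j - card F) * int ((d - card F) choose (j - card F)))"
  by (rule sum.group[symmetric]) (use fin in auto)
 also have "... = (\<Sum>i=0..j. (-1) ^ (j - i) * int ((d - i) choose (j - i)) * int (f_num \<Delta> (int i - 1)))"
 proof (rule sum.cong)
  fix i assume i: "i \<in> {0..j}"
  have "{F \<in> {F \<in> \<Delta>. card F \<in> {0..j}}. card F = i} = {F \<in> \<Delta>. int (card F) = int i - 1 + 1}" using i by auto
  thus "(\<Sum>F\<in>{F \<in> {F \<in> \<Delta>. card F \<in> {0..j}}. card F = i}. (-1) ^ (j - card F) * int ((d - card F) choose (j - card F)))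
    = (-1) ^ (j - i) * int ((d - i) choose (j - i)) * int (f_num \<Delta> (int i - 1))"
   by (simp add: f_num_def)
 qed simp
 finally show ?thesis by (simp add: h_num_def)
qed

text \<open>Dual of the further quotient by the Lefschetz element; up to degree
  \<open>d div 2\<close> its dimensions are the g-numbers.\<close>

definition WK :: "nat => ('a multiset => 'k) set" where
 "WK j = {f \<in> KK d j. ell f = (\<lambda>_. 0)}"

lemma subsp_WK: "subsp (WK j)"
 using subspD[OF subsp_KK[of d j]] by (auto simp: subsp_def WK_def ell_add ell_scale) (simp add: ell_def fun_eq_iff)

lemma WK_KK: "f \<in> WK j ==> f \<in> KK d j"
 by (simp add: WK_def)

text \<open>Contracting with a variable maps \<open>WK (Suc j)\<close> to \<open>WK j\<close>, and leading monomials are divided by it.\<close>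

lemma pivots_WK_order_ideal:
 assumes \<iota>: "\<And>x m n. \<rho> (add_mset x m) \<le> \<rho> (add_mset x n) \<longleftrightarrow> \<rho> m \<le> \<rho> n"
  and m: "m \<in> pivots \<rho> (WK (Suc j))" "x \<in># m"
 shows "m - {#x#} \<in> pivots (\<rho> :: 'a multiset => 'o::linorder) (WK j)"
proof -
 obtain f where f: "f \<in> WK (Suc j)" "f m \<noteq> 0" "\<And>q. f q \<noteq> 0 ==> \<rho> q \<le> \<rho> m"
  using m(1) by (auto simp: pivots_def)
 let ?g = "\<lambda>n. f ({#x#} + n)"
 have "?g \<in> KK d j" using shift_KK[of f d "{#x#}" j] f(1) by (simp add: WK_def)
 moreover have "ell ?g = (\<lambda>_. 0)"
 proof
  fix n
  have "ell ?g n = ell f (add_mset x n)" by (simp add: ell_def add_mset_commute)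
  thus "ell ?g n = 0" using f(1) by (simp add: WK_def)
 qed
 ultimately have g: "?g \<in> WK j" by (simp add: WK_def)
 have e: "add_mset x (m - {#x#}) = m" using m(2) by simp
 have gm: "?g (m - {#x#}) \<noteq> 0" using f(2) e by simp
 have le: "\<rho> q \<le> \<rho> (m - {#x#})" if "?g q \<noteq> 0" for q
  using f(3)[of "add_mset x q"] that \<iota>[of x q "m - {#x#}"] e by simp
 show ?thesis unfolding pivots_def
  by (rule CollectI, rule bexI[OF _ g]) (use gm le in simp)
qed

end

context generic_complex
begin

lemma fdim_WK:
 assumes j: "j \<le> d div 2"
 shows "int (fdim (WK j)) = g_num d \<Delta> j"
proof (cases j)
 case 0
 have "ell f = (\<lambda>_. 0)" if "f \<in> KK d 0" for f
 proof
  fix n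
  have "f (add_mset v n) = 0" for v using KK_support[OF that, of "add_mset v n"] by auto
  thus "ell f n = 0" by (simp add: ell_def)
 qed
 hence "WK 0 = KK d 0" by (auto simp: WK_def)
 moreover have "h_num d \<Delta> 0 = 1"
 proof -
  have "{F \<in> \<Delta>. int (card F) = 0} = {{}}" using fin empty_face by auto
  thus ?thesis by (simp add: h_num_def f_num_def)
 qed
 ultimately show ?thesis using fdim_KK_h[of 0] 0 by (simp add: g_num_def)
next
 case (Suc i)
 have "fdim (KK d (Suc i)) = fdim {f \<in> KK d (Suc i). ell f = (\<lambda>_. 0)} + fdim (ell ` KK d (Suc i))"
  by (rule fdim_rank_nullity[OF finite_mons KK_mons subsp_KK ell_add ell_scale])
 moreover have "ell ` KK d (Suc i) = KK d i"
 proof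
  show "ell ` KK d (Suc i) \<subseteq> KK d i" using ell_KK by blast
  show "KK d i \<subseteq> ell ` KK d (Suc i)"
  proof
   fix f assume "f \<in> KK d i"
   moreover have "2 * i + 1 \<le> d" using j Suc by simp
   ultimately obtain g where "g \<in> KK d (Suc i)" "ell g = f" using ell_surjective by blast
   thus "f \<in> ell ` KK d (Suc i)" by blast
  qed
 qed
 ultimately have "int (fdim (WK j)) = int (fdim (KK d (Suc i))) - int (fdim (KK d i))"
  by (simp add: WK_def Suc)
 thus ?thesis using j Suc by (simp add: fdim_KK_h g_num_def)
qed

end

text \<open>The vertices are numbered so that the multiset order on natural numbers becomes a linear
  monomial order compatible with multiplication.\<close>

theorem order_ideal_exists:
 fixes \<Delta> :: "'a set set"
 assumes H: "hsphere TYPE(polys fract) d \<Delta>"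
 obtains M :: "nat => nat multiset set" where
  "\<forall>j \<le> d div 2. finite (M j) \<and> int (card (M j)) = g_num d \<Delta> j"
  "\<forall>j. \<forall>m\<in>M j. size m = j"
  "\<forall>j. \<forall>m\<in>M (Suc j). \<forall>x\<in>#m. m - {#x#} \<in> M j"
proof -
 obtain r :: "nat => 'a option => polys fract" and del where "generic_complex \<Delta> d r del"
  using generic_complex_exists[OF H] by metis
 then interpret generic_complex \<Delta> d r del .
 obtain \<iota> :: "'a => nat" where \<iota>: "inj_on \<iota> V"
  using finite_imp_inj_to_nat_seg[OF finV] by (elim exE conjE) meson
 let ?\<rho> = "image_mset \<iota>"
 let ?M = "\<lambda>j. ?\<rho> ` pivots ?\<rho> (WK j)"
 have sub: "pivots ?\<rho> (WK j) \<subseteq> {n. set_mset n \<subseteq> V \<and> size n = j}" for j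
 proof
  fix m assume "m \<in> pivots ?\<rho> (WK j)"
  then obtain f where "f \<in> WK j" "f m \<noteq> 0" by (auto simp: pivots_def)
  thus "m \<in> {n. set_mset n \<subseteq> V \<and> size n = j}" by (intro KK_mons[OF WK_KK])
 qed
 have inj: "inj_on ?\<rho> {n. set_mset n \<subseteq> V \<and> size n = j}" for j
 proof (rule inj_onI)
  fix m n assume mn: "m \<in> {n. set_mset n \<subseteq> V \<and> size n = j}" "n \<in> {n. set_mset n \<subseteq> V \<and> size n = j}" "?\<rho> m = ?\<rho> n"
  have id: "image_mset (the_inv_into V \<iota>) (?\<rho> k) = k" if "set_mset k \<subseteq> V" for k
  proof -
   have "image_mset (the_inv_into V \<iota>) (?\<rho> k) = image_mset (\<lambda>x. x) k"
    unfolding multiset.map_comp by (rule image_mset_cong) (simp add: the_inv_into_f_f[OF \<iota> subsetD[OF that]])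
   thus ?thesis by simp
  qed
  have V: "set_mset m \<subseteq> V" "set_mset n \<subseteq> V" using mn(1,2) by blast+
  have "m = image_mset (the_inv_into V \<iota>) (?\<rho> m)" by (rule id[OF V(1), symmetric])
  also have "... = n" unfolding mn(3) by (rule id[OF V(2)])
  finally show "m = n" .
 qed
 show ?thesis
 proof (rule that[of ?M]; intro allI impI ballI conjI)
  fix j assume j: "j \<le> d div 2"
  have P: "fdim (WK j) = card (pivots ?\<rho> (WK j)) \<and> finite (pivots ?\<rho> (WK j))"
   by (rule fdim_pivots[OF finite_mons inj KK_mons[OF WK_KK] subsp_WK])
  thus "finite (?M j)" by simp
  have "card (?M j) = card (pivots ?\<rho> (WK j))"
   by (rule card_image) (rule inj_on_subset[OF inj sub])
  thus "int (card (?M j)) = g_num d \<Delta> j" using P fdim_WK[OF j] by simp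
 next
  fix j m assume "m \<in> ?M j"
  then obtain n where "m = ?\<rho> n" "n \<in> pivots ?\<rho> (WK j)" by blast
  thus "size m = j" using subsetD[OF sub] by simp
 next
  fix j m y assume "m \<in> ?M (Suc j)" "y \<in># m"
  then obtain n x where n: "n \<in> pivots ?\<rho> (WK (Suc j))" "m = ?\<rho> n" "x \<in># n" "y = \<iota> x" by auto
  have "n - {#x#} \<in> pivots ?\<rho> (WK j)"
   by (rule pivots_WK_order_ideal[OF _ n(1,3)]) simp
  moreover have "m - {#y#} = ?\<rho> (n - {#x#})" using n by (simp add: image_mset_Diff)
  ultimately show "m - {#y#} \<in> ?M j" by blast
 qed
qed

subsection \<open>Growth of order ideals\<close>

text \<open>A Hoelder inequality for \<open>n\<close> factors: once the sums are normalised to 1, it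
  is the inequality of the arithmetic and geometric means, summed over \<open>X\<close>.\<close>

lemma product_of_sums:
 fixes a :: "nat => 'x => real"
 assumes n: "0 < n" and a: "\<And>i x. i < n ==> x \<in> X ==> 0 \<le> a i x" and X: "finite X"
  and c: "\<And>x. x \<in> X ==> 0 \<le> c x" "\<And>x. x \<in> X ==> c x ^ n \<le> N * (\<Prod>i<n. a i x)" and N: "0 \<le> N"
 shows "(\<Sum>x\<in>X. c x) ^ n \<le> N * (\<Prod>i<n. \<Sum>x\<in>X. a i x)"
proof -
 let ?S = "\<lambda>i. \<Sum>x\<in>X. a i x"
 have S: "0 \<le> ?S i" if "i < n" for i using a that by (intro sum_nonneg) auto
 show ?thesis
 proof (cases "N = 0 \<or> (\<exists>i<n. ?S i = 0)")
  \<comment> \<open>Here normalising would divide by zero, but every \<open>c x\<close>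
    vanishes.\<close>
  case True
  have "c x = 0" if x: "x \<in> X" for x
  proof -
   have "N * (\<Prod>i<n. a i x) = 0"
   proof (cases "N = 0")
    case False
    then obtain i where i: "i < n" "?S i = 0" using True by blast
    hence "a i x = 0" using a x X sum_nonneg_eq_0_iff[OF X, of "a i"] by auto
    thus ?thesis using i(1) by (simp add: prod_zero_iff) blast
   qed simp
   hence "c x ^ n \<le> 0" using c(2)[OF x] by linarith
   thus ?thesis using c(1)[OF x] n by (metis le_less not_le zero_less_power)
  qed
  hence "(\<Sum>x\<in>X. c x) ^ n = 0" using n by simp
  moreover have "0 \<le> N * (\<Prod>i<n. ?S i)" using N S by (intro mult_nonneg_nonneg prod_nonneg) auto
  ultimately show ?thesis by linarith
 next
  case False
  have pos: "0 < ?S i" if "i < n" for i using S[OF that] False that by (auto simp: less_le)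
  have Np: "0 < N" using N False by auto
  define Q where "Q = root n (N * (\<Prod>i<n. ?S i))"
  have Pp: "0 < N * (\<Prod>i<n. ?S i)" using Np pos by (intro mult_pos_pos prod_pos) auto
  have Qp: "0 < Q" using Pp n by (simp add: Q_def)
  have Qn: "Q ^ n = N * (\<Prod>i<n. ?S i)" unfolding Q_def using Pp n by (intro real_root_pow_pos2) auto
  have bound: "c x / Q \<le> (\<Sum>i<n. a i x / ?S i) / n" if x: "x \<in> X" for x
  proof -
   let ?b = "\<lambda>i. a i x / ?S i"
   have b: "0 \<le> ?b i" if "i < n" for i using a[OF that x] pos[OF that] by simp
   have "(c x / Q) ^ n \<le> (\<Prod>i<n. ?b i)"
   proof -
    have "(c x / Q) ^ n \<le> (N * (\<Prod>i<n. a i x)) / (N * (\<Prod>i<n. ?S i))"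
     unfolding power_divide Qn using c(2)[OF x] Pp by (intro divide_right_mono) auto
    also have "... = (\<Prod>i<n. ?b i)" using Np by (simp add: prod_dividef)
    finally show ?thesis .
   qed
   also have "... \<le> ((\<Sum>i<n. ?b i) / n) ^ n"
   proof -
    have "root n p = p powr (1 / card {..<n})" if "0 \<le> p" for p :: real
     using n that by (cases "p = 0") (simp_all add: root_powr_inverse)
    moreover have P0: "0 \<le> (\<Prod>i<n. ?b i)" using b by (intro prod_nonneg) auto
    ultimately have "root n (\<Prod>i<n. ?b i) = (\<Prod>i<n. ?b i) powr (1 / card {..<n})" .
    also have "... \<le> (\<Sum>i<n. ?b i / card {..<n})"
     by (rule arith_geom_mean) (use n b in auto)
    finally have "root n (\<Prod>i<n. ?b i) \<le> (\<Sum>i<n. ?b i) / n"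
     by (simp only: sum_divide_distrib[symmetric] card_lessThan)
    hence "(root n (\<Prod>i<n. ?b i)) ^ n \<le> ((\<Sum>i<n. ?b i) / n) ^ n"
     by (rule power_mono) (use n P0 in simp)
    thus ?thesis using real_root_pow_pos2[OF n P0] by simp
   qed
   finally have "(c x / Q) ^ Suc (n - 1) \<le> ((\<Sum>i<n. ?b i) / n) ^ Suc (n - 1)" using n by simp
   moreover have "0 \<le> (\<Sum>i<n. ?b i) / n"
    by (rule divide_nonneg_nonneg[OF sum_nonneg]) (use b in \<open>simp_all only: lessThan_iff of_nat_0_le_iff\<close>)
   ultimately show ?thesis by (rule power_le_imp_le_base)
  qed
  have "(\<Sum>x\<in>X. c x) / Q = (\<Sum>x\<in>X. c x / Q)" by (rule sum_divide_distrib)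
  also have "... \<le> (\<Sum>x\<in>X. (\<Sum>i<n. a i x / ?S i) / n)" by (intro sum_mono bound)
  also have "... = (\<Sum>x\<in>X. \<Sum>i<n. a i x / ?S i) / n" by (rule sum_divide_distrib[symmetric])
  also have "(\<Sum>x\<in>X. \<Sum>i<n. a i x / ?S i) = (\<Sum>i<n. \<Sum>x\<in>X. a i x / ?S i)" by (rule sum.swap)
  also have "... = (\<Sum>i<n. 1)"
  proof (rule sum.cong)
   fix i assume "i \<in> {..<n}"
   hence "?S i \<noteq> 0" using pos[of i] by simp
   thus "(\<Sum>x\<in>X. a i x / ?S i) = 1" by (simp add: sum_divide_distrib[symmetric])
  qed simp
  finally have "(\<Sum>x\<in>X. c x) / Q \<le> 1" using n by simp
  hence "(\<Sum>x\<in>X. c x) \<le> Q" using Qp by (simp add: field_simps)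
  hence "(\<Sum>x\<in>X. c x) ^ n \<le> Q ^ n" using c(1) by (intro power_mono sum_nonneg)
  thus ?thesis unfolding Qn .
 qed
qed

definition drop_nth :: "nat => 'x list => 'x list" where
 "drop_nth i xs = take i xs @ drop (Suc i) xs"

text \<open>Slice by the first coordinate. Each slice satisfies the inequality by induction and is
  no larger than the projection that forgets the first coordinate; \<open>product_of_sums\<close>
  adds up the slices.\<close>

theorem Loomis_Whitney:
 assumes "finite A" "A \<noteq> {}" "\<And>xs. xs \<in> A ==> length xs = Suc n"
 shows "real (card A) ^ n \<le> (\<Prod>i<Suc n. real (card (drop_nth i ` A)))"
 using assms
proof (induction n arbitrary: A)
 case 0
 have "drop_nth 0 ` A \<noteq> {}" "finite (drop_nth 0 ` A)" using "0.prems" by auto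
 hence "1 \<le> card (drop_nth 0 ` A)" by (simp add: Suc_le_eq card_gt_0_iff)
 thus ?case by simp
next
 case (Suc n)
 let ?X = "hd ` A" and ?A = "\<lambda>x. {ys. x # ys \<in> A}"
 have finA: "finite (?A x)" for x
  by (rule finite_subset[of _ "tl ` A"]) (use Suc.prems(1) in \<open>auto intro: rev_image_eqI\<close>)
 have finX: "finite ?X" using Suc.prems(1) by simp
 have ne: "xs \<noteq> []" if "xs \<in> A" for xs using Suc.prems(3)[OF that] by auto
 have split: "A = (\<Union>x\<in>?X. (#) x ` ?A x)"
 proof (intro equalityI subsetI)
  fix xs assume "xs \<in> A"
  moreover from this obtain x ys where "xs = x # ys" using ne by (cases xs) auto
  ultimately show "xs \<in> (\<Union>x\<in>?X. (#) x ` ?A x)" by force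
 qed auto
 have fibres: "card (f ` A) = (\<Sum>x\<in>?X. card (g ` ?A x))" if f: "\<And>x ys. f (x # ys) = x # g ys" for f g :: "'a list => 'a list"
 proof -
  have "f ` A = (\<Union>x\<in>?X. (#) x ` (g ` ?A x))"
   by (subst split) (simp only: image_UN image_image f)
  moreover have "card (\<Union>x\<in>?X. (#) x ` (g ` ?A x)) = (\<Sum>x\<in>?X. card ((#) x ` (g ` ?A x)))"
   by (rule card_UN_disjoint) (use finX finA in auto)
  moreover have "card ((#) x ` (g ` ?A x)) = card (g ` ?A x)" for x by (rule card_image) simp
  ultimately show ?thesis by simp
 qed
 have "(\<Sum>x\<in>?X. real (card (?A x))) ^ Suc n
   \<le> real (card (drop_nth 0 ` A)) * (\<Prod>i<Suc n. \<Sum>x\<in>?X. real (card (drop_nth i ` ?A x)))"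
 proof (rule product_of_sums)
  fix x assume x: "x \<in> ?X"
  have "?A x \<noteq> {}"
  proof -
   obtain xs where "xs \<in> A" "x = hd xs" using x by blast
   hence "tl xs \<in> ?A x" using ne by simp
   thus ?thesis by blast
  qed
  hence "real (card (?A x)) ^ n \<le> (\<Prod>i<Suc n. real (card (drop_nth i ` ?A x)))"
   by (rule Suc.IH[OF finA]) (use Suc.prems(3) in force)
  moreover have "card (?A x) \<le> card (drop_nth 0 ` A)"
  proof (rule card_mono)
   show "?A x \<subseteq> drop_nth 0 ` A" by (force simp: drop_nth_def)
  qed (use Suc.prems(1) in simp)
  ultimately show "real (card (?A x)) ^ Suc n \<le> real (card (drop_nth 0 ` A)) * (\<Prod>i<Suc n. real (card (drop_nth i ` ?A x)))"
   unfolding power_Suc by (intro mult_mono) auto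
 qed (use finX in auto)
 moreover have "(\<Sum>x\<in>?X. real (card (?A x))) = real (card A)"
  using fibres[of "\<lambda>x. x" "\<lambda>x. x"] by simp
 moreover have "(\<Sum>x\<in>?X. real (card (drop_nth i ` ?A x))) = real (card (drop_nth (Suc i) ` A))" for i
  using fibres[of "drop_nth (Suc i)" "drop_nth i"] by (simp add: drop_nth_def)
 ultimately show ?case unfolding prod.lessThan_Suc_shift[of _ "Suc n"] by simp
qed

text \<open>A monomial becomes the sorted list of its factors. Deleting any entry leaves the sorted
  list of a divisor, so all \<open>k + 1\<close> projections land in the lists of
  \<open>M k\<close>.\<close>

lemma order_ideal_growth:
 fixes M :: "nat => 'o::linorder multiset set"
 assumes fin: "finite (M (Suc k))" "finite (M k)"
  and size: "\<And>m. m \<in> M (Suc k) ==> size m = Suc k"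
  and ideal: "\<And>m x. m \<in> M (Suc k) ==> x \<in># m ==> m - {#x#} \<in> M k"
  and k: "1 \<le> k"
 shows "card (M (Suc k)) ^ k \<le> card (M k) ^ Suc k"
proof (cases "M (Suc k) = {}")
 case True
 thus ?thesis using k by (simp add: power_0_left)
next
 case False
 let ?s = sorted_list_of_multiset
 let ?A = "?s ` M (Suc k)"
 have inj: "inj_on ?s S" for S :: "'o multiset set"
  by (rule inj_onI) (metis mset_sorted_list_of_multiset)
 have "real (card ?A) ^ k \<le> (\<Prod>i<Suc k. real (card (drop_nth i ` ?A)))"
 proof (rule Loomis_Whitney)
  fix xs assume "xs \<in> ?A"
  then obtain m where "m \<in> M (Suc k)" "xs = ?s m" by blast
  thus "length xs = Suc k" using size by (metis mset_sorted_list_of_multiset size_mset)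
 qed (use fin False in auto)
 also have "... \<le> (\<Prod>i<Suc k. real (card (M k)))"
 proof (rule prod_mono)
  fix i assume i: "i \<in> {..<Suc k}"
  have "drop_nth i ` ?A \<subseteq> ?s ` M k"
  proof
   fix ys assume "ys \<in> drop_nth i ` ?A"
   then obtain m where m: "m \<in> M (Suc k)" "ys = drop_nth i (?s m)" by blast
   let ?xs = "?s m"
   have len: "i < length ?xs" using size[OF m(1)] i by (metis mset_sorted_list_of_multiset size_mset lessThan_iff)
   have xs: "?xs = take i ?xs @ ?xs ! i # drop (Suc i) ?xs" using id_take_nth_drop[OF len] .
   hence "mset ?xs = mset (take i ?xs @ ?xs ! i # drop (Suc i) ?xs)" by simp
   hence e: "m = add_mset (?xs ! i) (mset ys)" using m(2) by (simp add: drop_nth_def)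
   have x: "?xs ! i \<in># m" by (subst e) simp
   have "m - {#?xs ! i#} = mset ys" by (subst e) simp
   hence in_M: "mset ys \<in> M k" using ideal[OF m(1) x] by simp
   have "sorted ys"
   proof -
    have "sorted (take i ?xs @ ?xs ! i # drop (Suc i) ?xs)" using xs by (metis sorted_sorted_list_of_multiset)
    thus ?thesis using m(2) by (auto simp: sorted_append drop_nth_def)
   qed
   hence "ys = ?s (mset ys)" by (simp add: sorted_list_of_multiset_mset sorted_sort_id)
   thus "ys \<in> ?s ` M k" using in_M by (rule image_eqI)
  qed
  hence "card (drop_nth i ` ?A) \<le> card (?s ` M k)" by (rule card_mono[rotated]) (use fin in simp)
  thus "0 \<le> real (card (drop_nth i ` ?A)) \<and> real (card (drop_nth i ` ?A)) \<le> real (card (M k))"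
   using card_image[OF inj, of "M k"] by simp
 qed
 finally have "real (card (M (Suc k)) ^ k) \<le> real (card (M k) ^ Suc k)"
  using card_image[OF inj, of "M (Suc k)"] by simp
 thus ?thesis by (simp only: of_nat_le_iff)
qed

theorem g_num_growth:
 fixes \<Delta> :: "'a set set"
 assumes H: "hsphere TYPE(polys fract) d \<Delta>"
 shows "j \<le> d div 2 ==> 0 \<le> g_num d \<Delta> j"
  and "1 \<le> k ==> Suc k \<le> d div 2 ==> g_num d \<Delta> (Suc k) ^ k \<le> g_num d \<Delta> k ^ Suc k"
proof -
 obtain M :: "nat => nat multiset set" where M:
  "\<forall>j \<le> d div 2. finite (M j) \<and> int (card (M j)) = g_num d \<Delta> j"
  "\<forall>j. \<forall>m\<in>M j. size m = j"
  "\<forall>j. \<forall>m\<in>M (Suc j). \<forall>x\<in>#m. m - {#x#} \<in> M j"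
  by (rule order_ideal_exists[OF H])
 show "0 \<le> g_num d \<Delta> j" if "j \<le> d div 2" using M(1) that by (metis of_nat_0_le_iff)
 show "g_num d \<Delta> (Suc k) ^ k \<le> g_num d \<Delta> k ^ Suc k" if k: "1 \<le> k" "Suc k \<le> d div 2"
 proof -
  have "card (M (Suc k)) ^ k \<le> card (M k) ^ Suc k"
   by (rule order_ideal_growth) (use M k in auto)
  hence "int (card (M (Suc k))) ^ k \<le> int (card (M k)) ^ Suc k"
   by (simp only: of_nat_power[symmetric] of_nat_le_iff)
  thus ?thesis using M(1) k by simp
 qed
qed

subsection \<open>Edge contraction and g-numbers\<close>

text \<open>A face is lost if it contains both ends of the edge (\<open>P\<close>), or if it
  contains only \<open>b\<close> and its image is already a face (\<open>Q\<close>). The link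
  condition identifies \<open>Q\<close> with faces of the edge link. The faces in \<open>R\<close>
  move to new faces.\<close>

lemma f_num_contract:
 assumes \<Delta>: "abstract_complex \<Delta>" and lc: "link_condition \<Delta>" and ab: "a \<noteq> b" "{a, b} \<in> \<Delta>"
 shows "f_num (contract a b \<Delta>) i + f_num (lk \<Delta> {a, b}) (i - 1) + f_num (lk \<Delta> {a, b}) (i - 2) = f_num \<Delta> i"
proof -
 note C = abstract_complexD[OF \<Delta>]
 let ?L = "lk \<Delta> {a, b}" and ?\<phi> = "\<lambda>F. insert a (F - {b})"
 define D0 where "D0 = {F \<in> \<Delta>. int (card F) = i + 1 \<and> b \<notin> F}"
 define P where "P = {F \<in> \<Delta>. int (card F) = i + 1 \<and> b \<in> F \<and> a \<in> F}"
 define Q where "Q = {F \<in> \<Delta>. int (card F) = i + 1 \<and> b \<in> F \<and> a \<notin> F \<and> ?\<phi> F \<in> \<Delta>}"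
 define R where "R = {F \<in> \<Delta>. int (card F) = i + 1 \<and> b \<in> F \<and> a \<notin> F \<and> ?\<phi> F \<notin> \<Delta>}"
 have fin: "finite D0" "finite P" "finite Q" "finite R"
  using C(1) by (simp_all add: D0_def P_def Q_def R_def)
 have "f_num \<Delta> i = card (D0 \<union> (P \<union> (Q \<union> R)))"
  unfolding f_num_def by (rule arg_cong[of _ _ card]) (auto simp: D0_def P_def Q_def R_def)
 also have "... = card D0 + card (P \<union> (Q \<union> R))"
  by (rule card_Un_disjoint) (use fin in \<open>auto simp: D0_def P_def Q_def R_def\<close>)
 also have "card (P \<union> (Q \<union> R)) = card P + card (Q \<union> R)"
  by (rule card_Un_disjoint) (use fin in \<open>auto simp: P_def Q_def R_def\<close>)
 also have "card (Q \<union> R) = card Q + card R"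
  by (rule card_Un_disjoint) (use fin in \<open>auto simp: Q_def R_def\<close>)
 finally have total: "f_num \<Delta> i = card D0 + (card P + (card Q + card R))" .
 have finF: "finite F" if "F \<in> \<Delta>" for F using C(3) that .
 have L: "G \<in> ?L \<longleftrightarrow> insert a (insert b G) \<in> \<Delta> \<and> a \<notin> G \<and> b \<notin> G" for G
 proof
  assume "G \<in> ?L"
  hence "G \<union> {a, b} \<in> \<Delta>" "G \<inter> {a, b} = {}" by (simp_all add: lk_iff)
  moreover have "G \<union> {a, b} = insert a (insert b G)" by blast
  ultimately show "insert a (insert b G) \<in> \<Delta> \<and> a \<notin> G \<and> b \<notin> G" by auto
 next
  assume g: "insert a (insert b G) \<in> \<Delta> \<and> a \<notin> G \<and> b \<notin> G"
  moreover have "G \<union> {a, b} = insert a (insert b G)" by blast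
  moreover have "G \<in> \<Delta>" by (rule C(4)[of "insert a (insert b G)"]) (use g in auto)
  ultimately show "G \<in> ?L" by (simp add: lk_iff)
 qed
 have Lfin: "finite G" if "G \<in> ?L" for G using finF[of "insert a (insert b G)"] L that by auto
 have P_eq: "P = (\<lambda>G. insert a (insert b G)) ` {G \<in> ?L. int (card G) = i - 2 + 1}"
 proof (intro equalityI subsetI)
  fix F assume F: "F \<in> P"
  let ?G = "F - {a} - {b}"
  have e: "insert a (insert b ?G) = F" using F by (auto simp: P_def)
  have "card (insert a (insert b G)) = Suc (Suc (card G))" if "finite G" "a \<notin> G" "b \<notin> G" for G
   using that ab(1) by simp
  from this[of ?G] have "card F = Suc (Suc (card ?G))"
   unfolding e using F finF[of F] by (simp add: P_def)
  hence "?G \<in> {G \<in> ?L. int (card G) = i - 2 + 1}"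
   using F e by (simp add: L P_def)
  thus "F \<in> (\<lambda>G. insert a (insert b G)) ` {G \<in> ?L. int (card G) = i - 2 + 1}"
   using e[symmetric] by (rule rev_image_eqI)
 next
  fix F assume "F \<in> (\<lambda>G. insert a (insert b G)) ` {G \<in> ?L. int (card G) = i - 2 + 1}"
  then obtain G where G: "F = insert a (insert b G)" "G \<in> ?L" "int (card G) = i - 2 + 1" by blast
  hence "card F = Suc (Suc (card G))" using L Lfin ab(1) by simp
  thus "F \<in> P" using G L by (simp add: P_def)
 qed
 have "card P = card {G \<in> ?L. int (card G) = i - 2 + 1}"
  unfolding P_eq by (rule card_image, rule inj_onI) (use L in \<open>simp add: insert_ident\<close>, metis ab(1) insert_ident insert_iff)
 hence cP: "card P = f_num ?L (i - 2)" by (simp add: f_num_def)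
 have Q_eq: "Q = insert b ` {G \<in> ?L. int (card G) = i - 1 + 1}"
 proof (intro equalityI subsetI)
  fix F assume F: "F \<in> Q"
  let ?G = "F - {b}"
  have e: "insert b ?G = F" using F by (auto simp: Q_def)
  have "card (insert b G) = Suc (card G)" if "finite G" "b \<notin> G" for G
   using that by simp
  from this[of ?G] have "card F = Suc (card ?G)"
   unfolding e using F finF[of F] by (simp add: Q_def)
  hence "int (card ?G) = i - 1 + 1" using F unfolding Q_def mem_Collect_eq by linarith
  moreover have "insert a (insert b ?G) \<in> \<Delta>"
   by (rule link_condition_fill[OF lc \<Delta> ab]) (use F e in \<open>auto simp: Q_def\<close>)
  hence "?G \<in> ?L" using F unfolding L Q_def mem_Collect_eq by blast
  ultimately have "?G \<in> {G \<in> ?L. int (card G) = i - 1 + 1}" by blast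
  thus "F \<in> insert b ` {G \<in> ?L. int (card G) = i - 1 + 1}"
   using e[symmetric] by (rule rev_image_eqI)
 next
  fix F assume "F \<in> insert b ` {G \<in> ?L. int (card G) = i - 1 + 1}"
  then obtain G where G: "F = insert b G" "G \<in> ?L" "int (card G) = i - 1 + 1" by blast
  have g: "insert a (insert b G) \<in> \<Delta>" "a \<notin> G" "b \<notin> G" using G(2) L by auto
  have "card F = Suc (card G)" using g G Lfin by simp
  moreover have "F \<in> \<Delta>" "insert a G \<in> \<Delta>" using G(1) by (auto intro!: C(4)[OF g(1)])
  moreover have "F - {b} = G" using G(1) g(3) by auto
  ultimately show "F \<in> Q" using G g ab(1) by (simp add: Q_def)
 qed
 have "card Q = card {G \<in> ?L. int (card G) = i - 1 + 1}"
  unfolding Q_eq by (rule card_image, rule inj_onI) (use L in \<open>simp add: insert_ident\<close>)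
 hence cQ: "card Q = f_num ?L (i - 1)" by (simp add: f_num_def)
 have R_card: "card (?\<phi> F) = card F" if "F \<in> R" for F
  using that finF[of F] by (simp add: R_def card_insert_if card_Diff_singleton)
   (metis One_nat_def Suc_pred card_gt_0_iff empty_iff)
 have G_eq: "{G \<in> contract a b \<Delta>. int (card G) = i + 1} = D0 \<union> ?\<phi> ` R"
 proof (intro equalityI subsetI)
  fix G assume G: "G \<in> {G \<in> contract a b \<Delta>. int (card G) = i + 1}"
  hence "b \<notin> G" and alt: "G \<in> \<Delta> \<or> (a \<in> G \<and> insert b (G - {a}) \<in> \<Delta>)"
   using contract_iff[OF ab(1) C(5)] by auto
  show "G \<in> D0 \<union> ?\<phi> ` R"
  proof (cases "G \<in> \<Delta>")
   case True
   thus ?thesis using G \<open>b \<notin> G\<close> by (simp add: D0_def)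
  next
   case False
   let ?F = "insert b (G - {a})"
   have F: "a \<in> G" "?F \<in> \<Delta>" using alt False by auto
   have e: "?\<phi> ?F = G" using F(1) \<open>b \<notin> G\<close> by auto
   have "finite G" using finF[OF F(2)] by simp
   hence "card ?F = card G" using F(1) \<open>b \<notin> G\<close>
    by (simp add: card_insert_if card_Diff_singleton) (metis One_nat_def Suc_pred card_gt_0_iff empty_iff)
   hence "?F \<in> R" using F G False e ab(1) by (simp add: R_def)
   thus ?thesis using e by (metis UnI2 image_eqI)
  qed
 next
  fix G assume "G \<in> D0 \<union> ?\<phi> ` R"
  thus "G \<in> {G \<in> contract a b \<Delta>. int (card G) = i + 1}"
  proof
   assume "G \<in> D0"
   thus ?thesis using contract_iff[OF ab(1) C(5)] by (simp add: D0_def)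
  next
   assume "G \<in> ?\<phi> ` R"
   then obtain F where F: "F \<in> R" "G = ?\<phi> F" by blast
   have "insert b (G - {a}) = F" using F by (auto simp: R_def)
   thus ?thesis using F contract_iff[OF ab(1) C(5)] R_card[OF F(1)] ab(1) by (simp add: R_def)
  qed
 qed
 have "inj_on ?\<phi> R"
 proof (rule inj_onI)
  fix F F' assume F: "F \<in> R" "F' \<in> R" "?\<phi> F = ?\<phi> F'"
  have "insert b (?\<phi> F - {a}) = F" if "F \<in> R" for F using that by (auto simp: R_def)
  from this[OF F(1)] this[OF F(2)] F(3) show "F = F'" by simp
 qed
 hence "f_num (contract a b \<Delta>) i = card D0 + card R"
  unfolding f_num_def G_eq using fin
  by (subst card_Un_disjoint) (auto simp: card_image D0_def R_def)
 thus ?thesis using total cP cQ by simp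
qed

lemma sum_shift_f_num:
 assumes "\<And>i. i < 0 ==> F i = (0::int)"
 shows "(\<Sum>i=0..Suc n. A i * F (int i - 1)) = (\<Sum>i=0..n. A (Suc i) * F (int i))"
 unfolding sum.atLeast0_atMost_Suc_shift using assms[of "-1"] by simp

text \<open>The f-numbers drop by those of the link in two adjacent degrees, and Pascal's rule
  merges the two shifted sums. Writing \<open>e + 2\<close> for \<open>d\<close> keeps the
  subtractions of natural numbers exact.\<close>

lemma h_num_contract:
 assumes \<Delta>: "abstract_complex \<Delta>" and lc: "link_condition \<Delta>" and ab: "a \<noteq> b" "{a, b} \<in> \<Delta>"
 shows "j \<le> e ==> h_num (e + 2) (contract a b \<Delta>) (Suc j) = h_num (e + 2) \<Delta> (Suc j) - h_num e (lk \<Delta> {a, b}) j"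
  and "h_num (e + 2) (contract a b \<Delta>) 0 = h_num (e + 2) \<Delta> 0"
proof -
 let ?C = "contract a b \<Delta>" and ?F = "\<lambda>i. int (f_num (lk \<Delta> {a, b}) (i - 1))"
 have fG: "int (f_num ?C i) = int (f_num \<Delta> i) - (?F i + ?F (i - 1))" for i
  using f_num_contract[OF assms, of i] by (simp add: algebra_simps flip: of_nat_add)
 have F0: "?F i = 0" if "i < 0" for i
  using that by (simp add: f_num_def)
 show "h_num (e + 2) ?C 0 = h_num (e + 2) \<Delta> 0"
  using fG[of "-1"] F0[of "-1"] F0[of "-2"] by (simp add: h_num_def)
 assume j: "j \<le> e"
 let ?A = "\<lambda>i. (-1) ^ (Suc j - i) * int ((e + 2 - i) choose (Suc j - i))"
 let ?B = "\<lambda>i. (-1) ^ (j - i) * int ((e - i) choose (j - i))"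
 have "h_num (e + 2) \<Delta> (Suc j) - h_num (e + 2) ?C (Suc j) = (\<Sum>i=0..Suc j. ?A i * (?F (int i - 1) + ?F (int i - 1 - 1)))"
  unfolding h_num_def fG sum_subtractf[symmetric] by (rule sum.cong) (simp_all add: algebra_simps)
 also have "... = (\<Sum>i=0..j. ?A (Suc i) * (?F (int i) + ?F (int i - 1)))"
 proof (rule sum_shift_f_num[of "\<lambda>i. ?F i + ?F (i - 1)"])
  fix i :: int assume "i < 0"
  thus "?F i + ?F (i - 1) = 0" using F0[of i] F0[of "i - 1"] by linarith
 qed
 also have "... = (\<Sum>i=0..j. ?A (Suc i) * ?F (int i)) + (\<Sum>i=0..j. ?A (Suc i) * ?F (int i - 1))"
  by (simp only: distrib_left sum.distrib)
 also have "... = (\<Sum>i=0..j. ?B i * ?F (int i))"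
 proof (cases j)
  case 0
  thus ?thesis using F0[of "-1"] by simp
 next
  case (Suc n)
  have 2: "(\<Sum>i=0..j. ?A (Suc i) * ?F (int i - 1)) = (\<Sum>i=0..n. ?A (Suc (Suc i)) * ?F (int i))"
   unfolding Suc by (rule sum_shift_f_num) (rule F0)
  have "?A (Suc i) + ?A (Suc (Suc i)) = ?B i" if "i \<le> n" for i
  proof -
   have 1: "Suc j - Suc i = Suc (n - i)" "j - i = Suc (n - i)" "Suc j - Suc (Suc i) = n - i" using Suc that by auto
   have "e + 2 - Suc i = Suc (e - i)" "e + 2 - Suc (Suc i) = e - i" using j Suc that by auto
   thus ?thesis unfolding 1 by (simp add: algebra_simps)
  qed
  hence "(\<Sum>i=0..n. ?A (Suc i) * ?F (int i)) + (\<Sum>i=0..n. ?A (Suc (Suc i)) * ?F (int i)) = (\<Sum>i=0..n. ?B i * ?F (int i))"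
   unfolding sum.distrib[symmetric] distrib_right[symmetric] by (intro sum.cong) auto
  moreover have "?A (Suc j) = ?B j" by simp
  moreover have "(\<Sum>i=0..j. g i) = (\<Sum>i=0..n. g i) + g j" for g :: "nat => int"
   using Suc by simp
  ultimately show ?thesis unfolding 2 by simp
 qed
 also have "... = h_num e (lk \<Delta> {a, b}) j" by (simp add: h_num_def)
 finally show "h_num (e + 2) ?C (Suc j) = h_num (e + 2) \<Delta> (Suc j) - h_num e (lk \<Delta> {a, b}) j" by simp
qed

lemma h_num_0: "abstract_complex \<Delta> ==> h_num d \<Delta> 0 = 1"
proof -
 assume \<Delta>: "abstract_complex \<Delta>"
 have "{F \<in> \<Delta>. int (card F) = 0} = {{}}" using abstract_complexD(2,3)[OF \<Delta>] by auto
 thus ?thesis by (simp add: h_num_def f_num_def)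
qed

lemma g_num_contract:
 assumes \<Delta>: "abstract_complex \<Delta>" and lc: "link_condition \<Delta>" and ab: "a \<noteq> b" "{a, b} \<in> \<Delta>"
  and j: "Suc j \<le> d div 2"
 shows "g_num d (contract a b \<Delta>) (Suc j) = g_num d \<Delta> (Suc j) - g_num (d - 2) (lk \<Delta> {a, b}) j"
proof -
 define e where "e = d - 2"
 have d: "d = e + 2" using j by (simp add: e_def)
 note h = h_num_contract[OF \<Delta> lc ab]
 have je: "j \<le> e" "j \<le> e div 2" using j d by auto
 show ?thesis
 proof (cases j)
  case 0
  thus ?thesis using j d h(1)[of 0 e] h(2)[of e] h_num_0[OF abstract_lk[OF \<Delta> ab(2)]]
   by (simp add: g_num_def)
 next
  case (Suc i)
  thus ?thesis using j d je h(1)[of j e] h(1)[of i e] by (simp add: g_num_def)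
 qed
qed

lemma link_condition_lk:
 assumes lc: "link_condition \<Delta>" and \<Delta>: "abstract_complex \<Delta>" and J: "J \<in> \<Delta>"
 shows "link_condition (lk \<Delta> J)"
 unfolding link_condition_def
proof (intro allI impI)
 fix a b assume e: "a \<noteq> b \<and> {a, b} \<in> lk \<Delta> J"
 let ?L = "lk \<Delta> J"
 have ab: "a \<noteq> b" "{a, b} \<in> \<Delta>" "a \<notin> J" "b \<notin> J" using e by (auto simp: lk_iff)
 show "lk ?L {a} \<inter> lk ?L {b} = lk ?L {a, b}"
 proof (intro equalityI subsetI)
  fix G assume G: "G \<in> lk ?L {a} \<inter> lk ?L {b}"
  have ng: "a \<notin> G" "b \<notin> G" "G \<inter> J = {}" "G \<in> ?L" using G by (auto simp: lk_iff)
  have "G \<union> {x} \<union> J = insert x (G \<union> J)" for x by blast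
  moreover have "G \<union> {a} \<union> J \<in> \<Delta>" "G \<union> {b} \<union> J \<in> \<Delta>"
  proof -
   have "G \<union> {a} \<in> ?L" "G \<union> {b} \<in> ?L" using G unfolding Int_iff lk_iff[of G ?L] by blast+
   thus "G \<union> {a} \<union> J \<in> \<Delta>" "G \<union> {b} \<union> J \<in> \<Delta>" unfolding lk_iff[of _ \<Delta>] by blast+
  qed
  ultimately have "insert a (G \<union> J) \<in> \<Delta>" "insert b (G \<union> J) \<in> \<Delta>" by simp_all
  hence f: "insert a (insert b (G \<union> J)) \<in> \<Delta>"
   by (intro link_condition_fill[OF lc \<Delta> ab(1,2)]) (use ng ab in auto)
  have "G \<union> {a, b} \<in> \<Delta>" by (rule abstract_complexD(4)[OF \<Delta> f]) auto
  moreover have "G \<union> {a, b} \<union> J = insert a (insert b (G \<union> J))" by blast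
  ultimately have "G \<union> {a, b} \<in> ?L" using f ng ab by (auto simp: lk_iff)
  thus "G \<in> lk ?L {a, b}" using ng by (simp add: lk_iff[of G ?L])
 next
  fix G assume G: "G \<in> lk ?L {a, b}"
  have L: "abstract_complex ?L" by (rule abstract_lk[OF \<Delta> J])
  have "G \<union> {a, b} \<in> ?L" "G \<in> ?L" "a \<notin> G" "b \<notin> G" using G by (auto simp: lk_iff[of G ?L])
  moreover have "G \<union> {a} \<in> ?L" "G \<union> {b} \<in> ?L"
   using abstract_complexD(4)[OF L \<open>G \<union> {a, b} \<in> ?L\<close>] by auto
  ultimately show "G \<in> lk ?L {a} \<inter> lk ?L {b}" by (simp add: lk_iff[of G ?L])
 qed
qed

text \<open>The g-numbers of the contraction are nonnegative, so by \<open>g_num_contract\<close>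
  those of \<open>\<Delta>\<close> are at least those of an edge link, which are positive by
  induction.\<close>

lemma g_num_pos:
 "hsphere TYPE(polys fract) d \<Delta> ==> link_condition \<Delta> ==> j \<le> d div 2 ==> 1 \<le> g_num d \<Delta> j"
proof (induction j arbitrary: d \<Delta>)
 case 0
 thus ?case by (simp add: g_num_def)
next
 case (Suc j)
 note H = Suc.prems(1) and lc = Suc.prems(2) and j = Suc.prems(3)
 have \<Delta>: "abstract_complex \<Delta>" using H by (simp add: hsphere_def)
 obtain F where F: "F \<in> \<Delta>" "card F = d"
  by (rule hsphere_facet[OF H abstract_complexD(2)[OF \<Delta>]])
 have "2 \<le> card F" using j F(2) by simp
 then obtain e where e: "e \<subseteq> F" "card e = 2" by (rule obtain_subset_with_card_n)
 then obtain a b where ab: "e = {a, b}" "a \<noteq> b" by (auto simp: card_2_iff)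
 have eD: "{a, b} \<in> \<Delta>" using abstract_complexD(4)[OF \<Delta> F(1) e(1)] ab by simp
 have "0 \<le> g_num d (contract a b \<Delta>) (Suc j)"
  by (rule g_num_growth(1)[OF hsphere_contract[OF H lc ab(2) eD] j])
 moreover have "1 \<le> g_num (d - 2) (lk \<Delta> {a, b}) j"
 proof (rule Suc.IH)
  have "card {a, b} = 2" using ab(2) by simp
  thus "hsphere TYPE(polys fract) (d - 2) (lk \<Delta> {a, b})" using hsphere_link[OF H eD] by simp
  show "link_condition (lk \<Delta> {a, b})" by (rule link_condition_lk[OF lc \<Delta> eD])
  show "j \<le> (d - 2) div 2" using j by simp
 qed
 ultimately show ?case using g_num_contract[OF \<Delta> lc ab(2) eD j] by simp
qed

section \<open>Inequalities for powers and the conclusion\<close>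

lemma sum_powr_le:
 fixes B :: "'x => real"
 assumes E: "finite E" and B: "\<And>e. e \<in> E ==> 0 \<le> B e" and p: "1 \<le> p"
 shows "(\<Sum>e\<in>E. B e powr p) \<le> (\<Sum>e\<in>E. B e) powr p"
proof -
 let ?S = "\<Sum>e\<in>E. B e"
 have split: "x powr p = x * x powr (p - 1)" if "0 \<le> x" for x :: real
  using that p by (cases "x = 0") (simp_all add: powr_mult_base)
 \<comment> \<open>One factor \<open>B e\<close> is kept and the remaining power is bounded by that
   of the whole sum.\<close>
 have "(\<Sum>e\<in>E. B e powr p) \<le> (\<Sum>e\<in>E. B e * ?S powr (p - 1))"
 proof (rule sum_mono)
  fix e assume e: "e \<in> E"
  have "B e \<le> ?S" using E B e by (intro member_le_sum) auto
  hence "B e powr (p - 1) \<le> ?S powr (p - 1)" using B[OF e] p by (intro powr_mono2) auto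
  thus "B e powr p \<le> B e * ?S powr (p - 1)"
   unfolding split[OF B[OF e]] using B[OF e] by (rule mult_left_mono)
 qed
 also have "... = ?S powr p"
  using split[of ?S] B by (simp add: sum_distrib_right sum_nonneg)
 finally show ?thesis .
qed

text \<open>On the unit interval a power with exponent at most 1 is at least the base.\<close>

lemma powr_complement_ge:
 assumes "0 \<le> x" "x \<le> 1" "0 < \<theta>" "\<theta> \<le> 1"
 shows "1 \<le> x powr \<theta> + (1 - x) powr (\<theta>::real)"
proof -
 have "y \<le> y powr \<theta>" if "0 \<le> y" "y \<le> 1" for y :: real
 proof (cases "y = 0")
  case False
  hence "y powr 1 \<le> y powr \<theta>" using that assms by (intro powr_mono') auto
  thus ?thesis using that False by simp
 qed simp
 from this[of x] this[of "1 - x"] show ?thesis using assms by simp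
qed

lemma real_power_le_powr:
 fixes x y :: real
 assumes "0 \<le> x" "0 \<le> y" "0 < k" "x ^ k \<le> y ^ Suc k"
 shows "x \<le> y powr (real (k + 1) / real k)"
proof -
 have "x = (x ^ k) powr (1 / real k)"
  using assms by (cases "x = 0") (simp_all add: powr_realpow[symmetric] powr_powr)
 also have "... \<le> (y ^ Suc k) powr (1 / real k)" using assms by (intro powr_mono2) auto
 also have "... = y powr (real (k + 1) / real k)"
  using assms by (cases "y = 0") (simp_all add: powr_realpow[symmetric] powr_powr del: power_Suc of_nat_Suc)
 finally show ?thesis .
qed

text \<open>\<open>A\<close> and \<open>B\<close> are the g-numbers of the contraction of
  \<open>e\<close> in degrees \<open>k + 1\<close> and \<open>k\<close>, so nonnegativity and growth
  for the contraction give the first three claims.\<close>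

lemma g_num_edge_bounds:
 fixes \<Delta> :: "'a set set"
 assumes H: "hsphere TYPE(polys fract) d \<Delta>" and lc: "link_condition \<Delta>" and e: "e \<in> edges \<Delta>"
  and k: "1 \<le> k" "Suc k \<le> d div 2"
 defines "A \<equiv> real_of_int (g_num d \<Delta> (k + 1) - g_num (d - 2) (lk \<Delta> e) k)"
  and "B \<equiv> real_of_int (g_num d \<Delta> k - g_num (d - 2) (lk \<Delta> e) (k - 1))"
 shows "0 \<le> A" "0 \<le> B" "A \<le> B powr (real (k + 1) / real k)" "1 \<le> g_num (d - 2) (lk \<Delta> e) k"
proof -
 have \<Delta>: "abstract_complex \<Delta>" using H by (simp add: hsphere_def)
 obtain a b where ab: "e = {a, b}" "a \<noteq> b" using e by (auto simp: edges_def card_2_iff)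
 have eD: "{a, b} \<in> \<Delta>" using e ab by (simp add: edges_def)
 note C = hsphere_contract[OF H lc ab(2) eD]
 note g = g_num_contract[OF \<Delta> lc ab(2) eD]
 obtain i where i: "k = Suc i" using k(1) by (cases k) auto
 have gA: "A = real_of_int (g_num d (contract a b \<Delta>) (Suc k))" using g[OF k(2)] by (simp add: A_def ab(1))
 have gB: "B = real_of_int (g_num d (contract a b \<Delta>) k)" using g[of i] k(2) i by (simp add: B_def ab(1))
 have nA: "0 \<le> g_num d (contract a b \<Delta>) (Suc k)" and nB: "0 \<le> g_num d (contract a b \<Delta>) k"
  using g_num_growth(1)[OF C] k by simp_all
 thus A: "0 \<le> A" and B: "0 \<le> B" by (simp_all only: gA gB of_int_0_le_iff)
 have "A ^ k \<le> B ^ Suc k"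
  using g_num_growth(2)[OF C k] unfolding gA gB of_int_power[symmetric] of_int_le_iff .
 thus "A \<le> B powr (real (k + 1) / real k)" using A B k by (intro real_power_le_powr) auto
 have "card {a, b} = 2" using ab(2) by simp
 hence "hsphere TYPE(polys fract) (d - 2) (lk \<Delta> {a, b})" using hsphere_link[OF H eD] by simp
 moreover have "k \<le> (d - 2) div 2" using k by simp
 ultimately show "1 \<le> g_num (d - 2) (lk \<Delta> e) k"
  unfolding ab(1) using link_condition_lk[OF lc \<Delta> eD] by (intro g_num_pos)
qed

theorem proposition2p38:
  fixes \<Delta> :: "'a set set" and d k :: nat
  assumes "PL_sphere \<Delta>"
    and "complex_dim \<Delta> = int d - 1"
    and "link_condition \<Delta>"
    and "1 \<le> k"
    and "real k \<le> real d / 2 - 1"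
  shows "1 / real (f_num \<Delta> 1) * (real_of_int (C_num d \<Delta> k) / real_of_int (g_num d \<Delta> (k + 1)))
         \<ge> pos_powr
             (1 - omega d \<Delta> k powr (real k / real (k + 1)) *
               (1 - 1 / real (f_num \<Delta> 1) *
                    (real_of_int (C_num d \<Delta> (k - 1)) / real_of_int (g_num d \<Delta> k))))
             (real (k + 1) / real k)
       \<and> pos_powr
             (1 - omega d \<Delta> k powr (real k / real (k + 1)) *
               (1 - 1 / real (f_num \<Delta> 1) *
                    (real_of_int (C_num d \<Delta> (k - 1)) / real_of_int (g_num d \<Delta> k))))
             (real (k + 1) / real k)
         = pos_powr
             (omega d \<Delta> k powr (real k / real (k + 1)) *
               (1 / real (f_num \<Delta> 1) *
                    (real_of_int (C_num d \<Delta> (k - 1)) / real_of_int (g_num d \<Delta> k)))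
              + (1 - omega d \<Delta> k powr (real k / real (k + 1))))
             (real (k + 1) / real k)"
proof -
 have H: "hsphere TYPE(polys fract) d \<Delta>"
  by (rule homology_sphere_hsphere(1)[OF PL_sphere_homology_sphere[OF assms(1,2)]])
 note lc = assms(3)
 have \<Delta>: "abstract_complex \<Delta>" using H by (simp add: hsphere_def)
 have kd: "Suc k \<le> d div 2"
 proof -
  have "real (2 * k + 2) \<le> real d" using assms(5) by simp
  hence "2 * k + 2 \<le> d" by (simp only: of_nat_le_iff)
  thus ?thesis by simp
 qed
 note bounds = g_num_edge_bounds[OF H lc _ assms(4) kd]
 define p where "p = real (k + 1) / real k"
 define \<theta> where "\<theta> = real k / real (k + 1)"
 define f where "f = real (f_num \<Delta> 1)"
 define G0 where "G0 = real_of_int (g_num d \<Delta> k)"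
 define G1 where "G1 = real_of_int (g_num d \<Delta> (k + 1))"
 define C1 where "C1 = real_of_int (C_num d \<Delta> k)"
 define C0 where "C0 = real_of_int (C_num d \<Delta> (k - 1))"
 define w where "w = omega d \<Delta> k powr \<theta>"
 have inv: "x / y * (y / x) = 1" "1 / x * (x / y) = 1 - x / y \<longleftrightarrow> y = x + 1" if "0 < x" "0 < y" for x y :: real
  using that by (auto simp: field_simps)
 have pos: "0 < real k" "0 < real (k + 1)" using assms(4) by simp_all
 have p: "1 \<le> p" "0 < \<theta>" "\<theta> \<le> 1" "p * \<theta> = 1" "\<theta> * p = 1" "1 / real k * \<theta> = 1 - \<theta>"
  unfolding p_def \<theta>_def inv(1)[OF pos] inv(1)[OF pos(2,1)] inv(2)[OF pos] using assms(4) by simp_all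
 have G: "1 \<le> G0" "1 \<le> G1"
  using g_num_pos[OF H lc, of k] g_num_pos[OF H lc, of "k + 1"] kd by (simp_all add: G0_def G1_def)
 have finE: "finite (edges \<Delta>)" using abstract_complexD(1)[OF \<Delta>] by (simp add: edges_def)
 have f_card: "f = real (card (edges \<Delta>))" by (simp add: f_def f_num_def edges_def)
 have f: "1 \<le> f"
 proof -
  obtain F where F: "F \<in> \<Delta>" "card F = d"
   by (rule hsphere_facet[OF H abstract_complexD(2)[OF \<Delta>]])
  have "2 \<le> card F" using kd F(2) by simp
  then obtain e where "e \<subseteq> F" "card e = 2" by (rule obtain_subset_with_card_n)
  hence "e \<in> edges \<Delta>" using abstract_complexD(4)[OF \<Delta> F(1)] by (simp add: edges_def)
  hence "card (edges \<Delta>) \<noteq> 0" using finE by auto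
  thus ?thesis by (simp add: f_card)
 qed
 let ?A = "\<lambda>e. real_of_int (g_num d \<Delta> (k + 1) - g_num (d - 2) (lk \<Delta> e) k)"
 let ?B = "\<lambda>e. real_of_int (g_num d \<Delta> k - g_num (d - 2) (lk \<Delta> e) (k - 1))"
 have sumA: "(\<Sum>e\<in>edges \<Delta>. ?A e) = f * G1 - C1" and sumB: "(\<Sum>e\<in>edges \<Delta>. ?B e) = f * G0 - C0"
  by (simp_all add: f_card G1_def G0_def C1_def C0_def C_num_def sum_subtractf)
 have "(\<Sum>e\<in>edges \<Delta>. ?A e) \<le> (\<Sum>e\<in>edges \<Delta>. ?B e powr p)"
  unfolding p_def by (intro sum_mono bounds(3))
 also have "... \<le> (\<Sum>e\<in>edges \<Delta>. ?B e) powr p"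
  by (rule sum_powr_le[OF finE _ p(1)]) (rule bounds(2))
 finally have main: "f * G1 - C1 \<le> (f * G0 - C0) powr p" unfolding sumA sumB .
 have A0: "0 \<le> f * G1 - C1" unfolding sumA[symmetric] by (intro sum_nonneg bounds(1))
 have B0: "0 \<le> f * G0 - C0" unfolding sumB[symmetric] by (intro sum_nonneg bounds(2))
 \<comment> \<open>This makes \<open>X\<close> at most 1 complementary to a nonnegative quantity:
   with \<open>A0\<close> it places \<open>X\<close> in the unit interval.\<close>
 have C1: "0 \<le> C1"
  unfolding C1_def C_num_def of_int_0_le_iff by (rule sum_nonneg) (use bounds(4) in force)
 define X where "X = 1 / f * (C1 / G1)"
 define Y where "Y = 1 / f * (C0 / G0)"
 have X: "0 \<le> X" "X \<le> 1" "f * G1 - C1 = f * G1 * (1 - X)"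
  using f G A0 C1 by (simp_all add: X_def field_simps)
 have Y: "f * G0 - C0 = f * G0 * (1 - Y)"
  using f G by (simp add: Y_def field_simps)
 have "omega d \<Delta> k = f powr (1 / real k) * (G0 powr p / G1)"
  by (simp only: omega_def f_def G0_def G1_def p_def)
 \<comment> \<open>The exponent \<open>\<theta>\<close> is the inverse of \<open>p\<close>, so the
   powers in \<open>omega\<close> collapse, and \<open>w\<close> becomes exactly the factor left
   when the summed inequality is divided by
   \<open>f powr \<theta> * G1 powr \<theta>\<close>.\<close>
 hence "w = (f powr (1 / real k)) powr \<theta> * ((G0 powr p) powr \<theta> / G1 powr \<theta>)"
  using f G by (simp add: w_def powr_mult powr_divide)
 hence w: "w = f powr (1 - \<theta>) * (G0 / G1 powr \<theta>)"
  using G unfolding powr_powr p(4,6) by simp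
 have "(f * G1 * (1 - X)) powr \<theta> \<le> ((f * G0 * (1 - Y)) powr p) powr \<theta>"
  using main A0 p unfolding X(3) Y by (intro powr_mono2) auto
 also have "... = f * G0 * (1 - Y)"
  using B0 p unfolding Y powr_powr by simp
 finally have "f powr \<theta> * G1 powr \<theta> * (1 - X) powr \<theta> \<le> f * G0 * (1 - Y)"
  using f G X by (simp add: powr_mult)
 moreover have "f = f powr \<theta> * f powr (1 - \<theta>)"
  using f by (simp add: powr_add[symmetric])
 ultimately have "f powr \<theta> * G1 powr \<theta> * (1 - X) powr \<theta> \<le> f powr \<theta> * G1 powr \<theta> * (w * (1 - Y))"
  using f G by (simp add: w mult_ac)
 hence "(1 - X) powr \<theta> \<le> w * (1 - Y)"
  using f G by (simp add: mult_le_cancel_left)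
 \<comment> \<open>As \<open>X\<close> lies in the unit interval,
   \<open>(1 - X) powr \<theta>\<close> is at least \<open>1 - X powr \<theta>\<close>.\<close>
 hence "1 - w * (1 - Y) \<le> X powr \<theta>"
  using powr_complement_ge[OF X(1,2) p(2,3)] by linarith
 \<comment> \<open>The base may be negative; since \<open>X powr \<theta>\<close> is nonnegative, it
   also bounds the maximum with 0, and powers are monotone there.\<close>
 hence "max 0 (1 - w * (1 - Y)) powr p \<le> (X powr \<theta>) powr p"
  using p by (intro powr_mono2) auto
 also have "... = X" using X p by (simp add: powr_powr)
 finally have "pos_powr (1 - w * (1 - Y)) p \<le> X" by (simp add: pos_powr_def)
 moreover have "1 - w * (1 - Y) = w * Y + (1 - w)" by (simp add: algebra_simps)
 ultimately have "X \<ge> pos_powr (1 - w * (1 - Y)) p \<and> pos_powr (1 - w * (1 - Y)) p = pos_powr (w * Y + (1 - w)) p"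
  by metis
 thus ?thesis
  unfolding X_def Y_def w_def p_def \<theta>_def f_def G0_def G1_def C0_def C1_def .
qed

end
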